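(* For all $c,l,s,t,w\in\mathbb{N}$, there is a constant $\gamma=\gamma(c,l,s,t,w)\in\mathbb{N}$ such that for every $t$-clean graph $G$ of treewidth more than $\gamma$, one of the following holds: (a) there exists a $t^t$-meager $(s,l)$-cluster in $G$; (b) there exists a $2w$-polypath in $G$ which is both $w$-fancy and $(l+t^ts^{t^t})$-loose.
   Context: A $t$-basic obstruction is a graph isomorphic to $K_{t+1}$, $K_{t,t}$, a subdivision of the $t$-by-$t$ wall $W_{t\times t}$ (hexagonal grid), or the line graph of such a subdivision; $G$ is $t$-clean if it has no induced subgraph isomorphic to a $t$-basic obstruction. A path in $G$ is an induced subgraph that is a path. For $w\in\mathbb{N}$, a $w$-polypath in $G$ is a set $\mathcal{W}$ of $w$ pairwise disjoint paths in $G$; $V(\mathcal{W})$ is the union of their vertex sets. $\mathcal{W}$ is $d$-loose if for every $W\in\mathcal{W}$, each vertex of $W$ has neighbors in fewer than $d$ paths of $\mathcal{W}\setminus\{W\}$. For $w'\le w$, $\mathcal{W}$ is $w'$-fancy if there is $\mathcal{W}'\subseteq\mathcal{W}$ with $|\mathcal{W}'|=w'$ such that for every $W'\in\mathcal{W}'$ and every $W\in\mathcal{W}\setminus\mathcal{W}'$, there is an edge of $G$ between $W'$ and $W$. For $s,l\in\mathbb{N}$, an $(s,l)$-cluster in $G$ is a pair $(S,\mathcal{L})$ where $S\subseteq V(G)$ with $|S|=s$ and $\mathcal{L}$ is an $l$-polypath in $G\setminus S$ such that every vertex of $S$ has at least one neighbor in every path of $\mathcal{L}$; it is $d$-meager if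 every vertex of $V(\mathcal{L})$ has fewer than $d$ neighbors in $S$. *)

theory Defs
  imports "Graph_Theory.Graph_Theory"
begin

text \<open>
  A finite simple graph is a digraph \<open>G\<close> satisfying the locale predicate \<^const>\<open>graph\<close>: every edge is a
  pair of opposite arcs. Vertices \<open>u\<close> and \<open>v\<close> are adjacent when \<open>u \<rightarrow>\<^bsub>G\<^esub> v\<close>.
\<close>

subsection \<open>Treewidth\<close>

text \<open>
  The constant \<^const>\<open>tree\<close> of the library forbids directed cycles, and in a symmetric digraph every
  edge traversed back and forth is one. Hence an undirected cycle is a \<^const>\<open>pre_digraph.cycle\<close> of
  length at least three.
\<close>
definition undirected_tree :: "'a pair_pre_digraph \<Rightarrow> bool" where
  "undirected_tree T \<longleftrightarrow> pair_graph T \<and> Digraph_Component.connected (with_proj T) \<and>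
     \<not> (\<exists>p. pre_digraph.cycle (with_proj T) p \<and> length p \<ge> 3)"

definition tree_decomposition ::
    "'n pair_pre_digraph \<Rightarrow> ('n \<Rightarrow> 'a set) \<Rightarrow> ('a,'b) pre_digraph \<Rightarrow> bool" where
  "tree_decomposition T \<beta> G \<longleftrightarrow> undirected_tree T \<and>
     (\<Union>x\<in>pverts T. \<beta> x) = verts G \<and>
     (\<forall>u v. u \<rightarrow>\<^bsub>G\<^esub> v \<longrightarrow> (\<exists>x\<in>pverts T. u \<in> \<beta> x \<and> v \<in> \<beta> x)) \<and>
     (\<forall>v\<in>verts G. Digraph_Component.connected (with_proj T \<restriction> {x \<in> pverts T. v \<in> \<beta> x}))"

definition decomposition_width :: "'n pair_pre_digraph \<Rightarrow> ('n \<Rightarrow> 'a set) \<Rightarrow> nat" where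
  "decomposition_width T \<beta> = Max ((\<lambda>x. card (\<beta> x)) ` pverts T) - 1"

text \<open>
  Every finite tree is isomorphic to one on natural numbers. Because subtraction on \<^typ>\<open>nat\<close>
  truncates, the null graph gets treewidth 0 instead of -1.
\<close>
definition treewidth :: "('a,'b) pre_digraph \<Rightarrow> nat" where
  "treewidth G = (LEAST k. \<exists>(T :: nat pair_pre_digraph) \<beta>.
     tree_decomposition T \<beta> G \<and> decomposition_width T \<beta> = k)"

subsection \<open>Basic obstructions\<close>

text \<open>
  The \<open>t\<close>-by-\<open>t\<close> wall: take \<open>t\<close> rows of \<open>2 t\<close> vertices each, of the edges between consecutive rows keep
  every second one, shifted by one from each pair of rows to the next, and delete the vertices of
  degree one (for \<open>t \<ge> 2\<close>, two corners). For \<open>t = 2\<close> this is a cycle of length six.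
\<close>
definition wall_grid :: "nat \<Rightarrow> (nat \<times> nat) pair_pre_digraph" where
  "wall_grid t =
     (let V = {..<t} \<times> {..<2 * t};
          E = {((i, j), (i, Suc j)) | i j. True} \<union> {((i, j), (Suc i, j)) | i j. even (i + j)}
      in \<lparr> pverts = V, parcs = (E \<union> E\<inverse>) \<inter> V \<times> V \<rparr>)"

definition wall :: "nat \<Rightarrow> (nat \<times> nat) pair_pre_digraph" where
  "wall t =
     (let V = {v \<in> pverts (wall_grid t). out_degree (with_proj (wall_grid t)) v \<noteq> 1}
      in \<lparr> pverts = V, parcs = parcs (wall_grid t) \<inter> V \<times> V \<rparr>)"

definition line_graph :: "'a pair_pre_digraph \<Rightarrow> 'a set pair_pre_digraph" where
  "line_graph G =
     (let E = {{u, v} | u v. (u, v) \<in> parcs G}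
      in \<lparr> pverts = E, parcs = {(e, f). e \<in> E \<and> f \<in> E \<and> e \<noteq> f \<and> e \<inter> f \<noteq> {}} \<rparr>)"

text \<open>
  The subdivisions \<open>W\<close> have vertices in \<^typ>\<open>nat \<times> nat\<close>; this type being infinite, every subdivision
  of the wall occurs up to isomorphism.
\<close>
definition basic_obstruction :: "nat \<Rightarrow> ('a,'b) pre_digraph \<Rightarrow> bool" where
  "basic_obstruction t H \<longleftrightarrow>
     K\<^bsub>t + 1\<^esub> H \<or> K\<^bsub>t, t\<^esub> H \<or>
     (\<exists>W. subdivision_pair (wall t) W \<and>
        (digraph_iso (with_proj W) H \<or> digraph_iso (with_proj (line_graph W)) H))"

definition clean :: "nat \<Rightarrow> ('a,'b) pre_digraph \<Rightarrow> bool" where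
  "clean t G \<longleftrightarrow> \<not> (\<exists>H. induced_subgraph H G \<and> basic_obstruction t H)"

subsection \<open>Polypaths and clusters\<close>

definition is_path :: "('a,'b) pre_digraph \<Rightarrow> bool" where
  "is_path P \<longleftrightarrow> graph P \<and> (\<exists>xs. vpath xs P \<and> verts P = set xs \<and>
     arcs_ends P = set (vwalk_arcs xs) \<union> (set (vwalk_arcs xs))\<inverse>)"

definition path_in :: "('a,'b) pre_digraph \<Rightarrow> ('a,'b) pre_digraph \<Rightarrow> bool" where
  "path_in G P \<longleftrightarrow> induced_subgraph P G \<and> is_path P"

definition polypath :: "nat \<Rightarrow> ('a,'b) pre_digraph \<Rightarrow> ('a,'b) pre_digraph set \<Rightarrow> bool" where
  "polypath w G \<W> \<longleftrightarrow> finite \<W> \<and> card \<W> = w \<and> (\<forall>W\<in>\<W>. path_in G W) \<and>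
     pairwise (\<lambda>W W'. verts W \<inter> verts W' = {}) \<W>"

definition loose :: "nat \<Rightarrow> ('a,'b) pre_digraph \<Rightarrow> ('a,'b) pre_digraph set \<Rightarrow> bool" where
  "loose d G \<W> \<longleftrightarrow> (\<forall>W\<in>\<W>. \<forall>v\<in>verts W.
     card {W' \<in> \<W> - {W}. \<exists>u\<in>verts W'. v \<rightarrow>\<^bsub>G\<^esub> u} < d)"

definition fancy :: "nat \<Rightarrow> ('a,'b) pre_digraph \<Rightarrow> ('a,'b) pre_digraph set \<Rightarrow> bool" where
  "fancy w' G \<W> \<longleftrightarrow> (\<exists>\<W>'\<subseteq>\<W>. card \<W>' = w' \<and>
     (\<forall>W'\<in>\<W>'. \<forall>W\<in>\<W> - \<W>'. \<exists>u\<in>verts W'. \<exists>v\<in>verts W. u \<rightarrow>\<^bsub>G\<^esub> v))"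

definition cluster ::
    "nat \<Rightarrow> nat \<Rightarrow> ('a,'b) pre_digraph \<Rightarrow> 'a set \<Rightarrow> ('a,'b) pre_digraph set \<Rightarrow> bool" where
  "cluster s l G S \<L> \<longleftrightarrow> S \<subseteq> verts G \<and> card S = s \<and>
     polypath l (G \<restriction> (verts G - S)) \<L> \<and>
     (\<forall>x\<in>S. \<forall>L\<in>\<L>. \<exists>u\<in>verts L. x \<rightarrow>\<^bsub>G\<^esub> u)"

definition meager ::
    "nat \<Rightarrow> ('a,'b) pre_digraph \<Rightarrow> 'a set \<Rightarrow> ('a,'b) pre_digraph set \<Rightarrow> bool" where
  "meager d G S \<L> \<longleftrightarrow> (\<forall>v\<in>(\<Union>L\<in>\<L>. verts L). card {x \<in> S. v \<rightarrow>\<^bsub>G\<^esub> x} < d)"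

end

theory Submission
  imports Defs "HOL-Library.Ramsey"
begin

text \<open>
  A path model of order \<open>n\<close> consists of \<open>2 n\<close> disjoint induced paths \<open>A\<^sub>i\<close>, \<open>B\<^sub>j\<close> such that every \<open>A\<^sub>i\<close> touches every
  \<open>B\<^sub>j\<close>. If a clean graph has no meager cluster, then few vertices have neighbours in many given paths of a
  large path model, and deleting these conflicts makes a part of it loose. So it suffices to show that clean
  graphs of large treewidth have large path models.

  A graph of large treewidth has a set that no small separator splits evenly. Induced paths grown into the side
  that keeps most of this set yield many hubs, which are anticomplete to each other, or else form a path model,
  and cannot be separated from each other by few vertices. By Menger's theorem any two hubs are joined by many
  disjoint paths. If these paths, chosen with as few vertices outside the other hubs and connections as possible,
  cross many of those, then the small separators through the vertices that cannot be spared order the crossings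
  along the paths, which gives a ladder: anticomplete rows that are met by anticomplete columns in the same order.
  Otherwise anticomplete connections can be selected, and a grid of hubs joined by them gives a ladder as well.
  Ladders contain, by Ramsey arguments on how the columns cross between the rows, a path model or an induced
  subdivision of a wall or its line graph.
\<close>


section \<open>Finite combinatorics\<close>

text \<open>The obstacle throughout is that all structures must be induced: Menger's theorem gives
  disjoint paths, but with uncontrolled edges between them. Wherever such edges could be dense they
  form a path model, so in its absence pigeonholing on touched sets, Ramsey's theorem and free sets
  of set mappings leave anticomplete families; the constants are chosen backwards from the last of
  these selections. Where a column meets a row, its extreme attachments may coincide, be consecutive
  or lie further apart. The first and the last case give a branch vertex with three independent
  neighbours, the second one a triangle. This is why subdivided walls and their line graphs both
  have to be excluded, and why crossings are made uniform before a wall is drawn. The constant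
  \<open>t ^ t\<close> bounds the Ramsey number of a clique on \<open>t + 1\<close> against a stable
  set on \<open>t\<close> vertices, so two sets of that size that are complete to each other contain
  an induced K_{t+1} or K_{t,t}; \<open>s ^ (t ^ t)\<close> bounds the number of
  \<open>t ^ t\<close>-subsets of a set of size \<open>s\<close>.\<close>

lemma pigeonhole_fiber_subset:
  assumes "finite I" "finite F" "F \<noteq> {}" "f ` I \<subseteq> F" "m * card F \<le> card I"
  obtains y J where "y \<in> F" "J \<subseteq> I" "card J = m" "\<And>i. i \<in> J ==> f i = y"
proof -
  obtain y where y: "y \<in> F" "card I \<le> card (f -` {y} \<inter> I) * card F"
    using pigeonhole_card[of f I F] assms(1-4) by (auto simp: image_subset_iff)
  have "f -` {y} \<inter> I = {i \<in> I. f i = y}" by auto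
  moreover have "0 < card F" using assms(2,3) by (simp add: card_gt_0_iff)
  ultimately have my: "m \<le> card {i \<in> I. f i = y}"
    using le_trans[OF assms(5) y(2)] mult_le_cancel2[of m "card F"] by simp
  obtain J where "J \<subseteq> {i \<in> I. f i = y}" "card J = m"
    by (rule obtain_subset_with_card_n[OF my])
  then show ?thesis
    using that[OF y(1), of J] by auto
qed

text \<open>By Pascal's rule, the neighbours and the non-neighbours of one element cannot both fall
  short of their bounds. The binomial form is kept because for \<open>p = t\<close> and
  \<open>q = t - 1\<close> it is at most \<open>t ^ t\<close>, the constant of the theorem.\<close>

lemma ramsey_binomial:
  fixes T :: "'b => 'b => bool"
  assumes "finite I" "(p + q) choose p \<le> card I" "\<And>x y. T x y ==> T y x"
  shows "(\<exists>J\<subseteq>I. card J = Suc p \<and> pairwise T J) \<or> (\<exists>J\<subseteq>I. card J = Suc q \<and> pairwise (\<lambda>x y. \<not> T x y) J)"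
  using assms(1,2)
proof (induction "p + q" arbitrary: p q I)
  case 0
  then have "card I \<ge> 1" by simp
  then obtain x where "x \<in> I"
    by (metis card.empty ex_in_conv not_one_le_zero)
  then show ?case
    using 0 by (intro disjI1 exI[of _ "{x}"]) auto
next
  case (Suc m)
  show ?case
  proof (cases "p = 0 \<or> q = 0")
    case True
    have "I \<noteq> {}"
      using Suc.prems(2) by (metis binomial_eq_0_iff card.empty le_add1 le_zero_eq not_less)
    then obtain x where "x \<in> I" by auto
    then show ?thesis
      using True
      by (metis card_1_singleton_iff empty_subsetI insert_subset pairwise_singleton One_nat_def)
  next
    case False
    then obtain p' q' where pq: "p = Suc p'" "q = Suc q'"
      by (metis old.nat.exhaust)
    have le: "((p' + q) choose p') + ((p + q') choose p) \<le> card I"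
      using Suc.prems(2) pq by simp
    then have "card I \<noteq> 0"
      using pq by (metis add_is_0 binomial_eq_0_iff le_add1 le_zero_eq not_less)
    then obtain x where x: "x \<in> I"
      by (metis card.empty ex_in_conv)
    define Y where "Y = {y \<in> I - {x}. T x y}"
    define Z where "Z = {y \<in> I - {x}. \<not> T x y}"
    have fin: "finite Y" "finite Z"
      using Suc.prems(1) by (auto simp: Y_def Z_def)
    have un: "I = insert x (Y \<union> Z)" and dj: "Y \<inter> Z = {}" "x \<notin> Y \<union> Z"
      using x by (auto simp: Y_def Z_def)
    have "card I = Suc (card Y + card Z)"
      using un dj fin by (simp add: card_Un_disjoint)
    then have "(p' + q) choose p' \<le> card Y \<or> (p + q') choose p \<le> card Z"
      using le by linarith
    then show ?thesis
    proof
      assume "(p' + q) choose p' \<le> card Y"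
      then consider J where "J \<subseteq> Y" "card J = Suc p'" "pairwise T J"
        | J where "J \<subseteq> Y" "card J = Suc q" "pairwise (\<lambda>x y. \<not> T x y) J"
        using Suc.hyps(1)[of p' q Y] Suc.hyps(2) fin pq by auto
      then show ?thesis
      proof cases
        case 1
        have "pairwise T (insert x J)"
          using 1 assms(3) unfolding pairwise_insert Y_def by blast
        moreover have "card (insert x J) = Suc p"
          using 1 dj fin pq by (metis card_insert_disjoint in_mono UnI1 finite_subset)
        moreover have "insert x J \<subseteq> I"
          using 1 un by auto
        ultimately show ?thesis by blast
      next
        case 2
        then show ?thesis using un by blast
      qed
    next
      assume "(p + q') choose p \<le> card Z"
      then consider J where "J \<subseteq> Z" "card J = Suc p" "pairwise T J"
        | J where "J \<subseteq> Z" "card J = Suc q'" "pairwise (\<lambda>x y. \<not> T x y) J"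
        using Suc.hyps(1)[of p q' Z] Suc.hyps(2) fin pq by auto
      then show ?thesis
      proof cases
        case 2
        have "pairwise (\<lambda>x y. \<not> T x y) (insert x J)"
          using 2 assms(3) unfolding pairwise_insert Z_def by blast
        moreover have "card (insert x J) = Suc q"
          using 2 dj fin pq by (metis card_insert_disjoint in_mono UnI2 finite_subset)
        moreover have "insert x J \<subseteq> I"
          using 2 un by auto
        ultimately show ?thesis by blast
      next
        case 1
        then show ?thesis using un by blast
      qed
    qed
  qed
qed

text \<open>The finite free set theorem for set mappings on \<open>d\<close>-sets with images of
  size at most \<open>b\<close>. The sets of \<open>d + 1\<close> points are coloured by whether one
  of the points lies in the image of the others: a homogeneous set of the good colour is free, and a
  large one of the bad colour is excluded by counting.\<close>

lemma free_subset:
  "\<exists>N::nat. \<forall>(I :: 'b set) (f :: 'b set => 'b set). finite I \<and> N \<le> card I \<and>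
     (\<forall>D\<subseteq>I. card D = d \<longrightarrow> finite (f D) \<and> card (f D) \<le> b) \<longrightarrow>
     (\<exists>J\<subseteq>I. card J = m \<and> (\<forall>D\<subseteq>J. card D = d \<longrightarrow> f D \<inter> J \<subseteq> D))"
proof -
  \<comment> \<open>Chosen for the count below: a bad homogeneous set of this size would give
    \<open>L - d \<le> b * Suc d\<close>, and \<open>L - d\<close> is larger by one.\<close>
  define L where "L = b * Suc d + d + 1"
  obtain N where N: "partn_lst {..<N::nat} [m, L] (Suc d)"
    using ramsey_full by blast
  show ?thesis
  proof (rule exI[of _ N], intro allI impI, elim conjE)
    fix I :: "'b set" and f :: "'b set => 'b set"
    assume I: "finite I" "N \<le> card I"
      and f: "\<forall>D\<subseteq>I. card D = d \<longrightarrow> finite (f D) \<and> card (f D) \<le> b"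
    obtain g where g: "inj_on g {..<N}" "g ` {..<N} \<subseteq> I"
      using I by (metis card_le_inj card_lessThan finite_lessThan)
    define bad where "bad X \<longleftrightarrow> (\<exists>x\<in>g ` X. x \<in> f (g ` X - {x}))" for X
    define c where "c X = (if bad X then 1 else 0::nat)" for X
    have "c \<in> nsets {..<N} (Suc d) \<rightarrow> {..<2}"
      by (auto simp: c_def)
    then obtain i H where i: "i < 2" "H \<in> nsets {..<N} ([m, L] ! i)" "c ` nsets H (Suc d) \<subseteq> {i}"
      using partn_lstE[OF N, of c 2] by (metis length_Cons list.size(3) numeral_2_eq_2)
    have HN: "H \<subseteq> {..<N}" "finite H" "card H = [m, L] ! i"
      using i(2) by (auto simp: nsets_def)
    have injH: "inj_on g X" if "X \<subseteq> H" for X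
      using g HN that by (meson inj_on_subset order_trans)
    consider "i = 0" | "i = 1" using i(1) by linarith
    then show "\<exists>J\<subseteq>I. card J = m \<and> (\<forall>D\<subseteq>J. card D = d \<longrightarrow> f D \<inter> J \<subseteq> D)"
    proof cases
      case 1
      have "f D \<inter> g ` H \<subseteq> D" if D: "D \<subseteq> g ` H" "card D = d" for D
      proof
        fix x assume x: "x \<in> f D \<inter> g ` H"
        show "x \<in> D"
        proof (rule ccontr)
          assume xD: "x \<notin> D"
          define X where "X = {h \<in> H. g h \<in> insert x D}"
          have gX: "g ` X = insert x D"
            using D x by (auto simp: X_def)
          have "card X = card (g ` X)"
            using injH[of X] by (metis (lifting) X_def card_image mem_Collect_eq subsetI)
          also have "\<dots> = Suc d"
            using gX xD D HN(2) by (metis card_insert_disjoint finite_imageI finite_subset)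
          finally have "X \<in> nsets H (Suc d)"
            using HN(2) by (auto simp: nsets_def X_def)
          then have "c X = 0" using i(3) 1 by auto
          then have "\<not> bad X" by (auto simp: c_def split: if_splits)
          then show False
            using gX x xD unfolding bad_def by (metis IntD1 Diff_insert_absorb insertI1)
        qed
      qed
      moreover have "card (g ` H) = m"
        using injH[of H] HN 1 by (simp add: card_image)
      moreover have "g ` H \<subseteq> I"
        using g HN by blast
      ultimately show ?thesis by blast
    next
      case 2
      then have cH: "card H = L" using HN by simp
      have badX: "bad X" if "X \<in> nsets H (Suc d)" for X
        using i(3) 2 that by (force simp: c_def split: if_splits)
      define r where "r X = (SOME h. h \<in> X \<and> g h \<in> f (g ` X - {g h}))" for X
      have r: "r X \<in> X \<and> g (r X) \<in> f (g ` X - {g (r X)})" if "X \<in> nsets H (Suc d)" for X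
      proof -
        have "\<exists>h. h \<in> X \<and> g h \<in> f (g ` X - {g h})"
          using badX[OF that] by (auto simp: bad_def)
        then show ?thesis unfolding r_def by (rule someI_ex)
      qed
      \<comment> \<open>Pairs of a \<open>d\<close>-set and a point of its image, at most
        \<open>(L choose d) * b\<close> in number. Every bad set \<open>X\<close> of
        \<open>d + 1\<close> points yields a pair of its own by splitting off
        \<open>r X\<close>.\<close>
      define S where "S = Sigma (nsets H d) (\<lambda>D. {h \<in> H. g h \<in> f (g ` D)})"
      have fib: "card {h \<in> H. g h \<in> f (g ` D)} \<le> b" if "D \<in> nsets H d" for D
      proof -
        have D: "D \<subseteq> H" "card D = d" using that by (auto simp: nsets_def)
        have cD: "card (g ` D) = d" using D injH by (simp add: card_image)
        have "g ` D \<subseteq> I" using D g HN by blast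
        then have fD: "finite (f (g ` D))" "card (f (g ` D)) \<le> b"
          using f cD by auto
        have "card {h \<in> H. g h \<in> f (g ` D)} = card (g ` {h \<in> H. g h \<in> f (g ` D)})"
          by (rule card_image[symmetric], rule injH) auto
        also have "\<dots> \<le> card (f (g ` D))"
          by (rule card_mono) (use fD in auto)
        finally show ?thesis using fD by simp
      qed
      have finS: "finite S"
        unfolding S_def by (intro finite_SigmaI finite_imp_finite_nsets) (use HN in auto)
      have "card S = (\<Sum>D\<in>nsets H d. card {h \<in> H. g h \<in> f (g ` D)})"
        unfolding S_def by (rule card_SigmaI) (use HN in \<open>auto intro: finite_imp_finite_nsets\<close>)
      also have "\<dots> \<le> (\<Sum>D\<in>nsets H d. b)"
        by (rule sum_mono) (use fib in auto)
      finally have cS: "card S \<le> (L choose d) * b"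
        by (simp add: cH)
      have "inj_on (\<lambda>X. (X - {r X}, r X)) (nsets H (Suc d))"
      proof (rule inj_onI)
        fix X Y assume "X \<in> nsets H (Suc d)" "Y \<in> nsets H (Suc d)"
          "(X - {r X}, r X) = (Y - {r Y}, r Y)"
        then show "X = Y" using r by (metis insert_Diff prod.inject)
      qed
      moreover have "(\<lambda>X. (X - {r X}, r X)) ` nsets H (Suc d) \<subseteq> S"
      proof
        fix z assume "z \<in> (\<lambda>X. (X - {r X}, r X)) ` nsets H (Suc d)"
        then obtain X where X: "X \<in> nsets H (Suc d)" "z = (X - {r X}, r X)" by auto
        have XH: "X \<subseteq> H" "finite X" "card X = Suc d" using X by (auto simp: nsets_def)
        have "g ` (X - {r X}) = g ` X - {g (r X)}"
          using r[OF X(1)] injH[OF XH(1)] by (auto simp: inj_on_def)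
        then show "z \<in> S"
          using X XH r[OF X(1)] by (auto simp: S_def nsets_def)
      qed
      ultimately have "card (nsets H (Suc d)) \<le> card S"
        using finS by (meson card_inj_on_le)
      then have "L choose Suc d \<le> (L choose d) * b"
        using cS by (simp add: cH)
      then have "Suc d * (L choose Suc d) \<le> (L choose d) * (b * Suc d)"
        by (metis mult.assoc mult.commute mult_le_mono1)
      moreover have "Suc d * (L choose Suc d) = (L - d) * (L choose d)"
        by (metis binomial_absorb_comp binomial_absorption mult.commute)
      ultimately have "(L - d) * (L choose d) \<le> (b * Suc d) * (L choose d)"
        by (simp add: mult.commute)
      moreover have "0 < L choose d"
        by (simp add: L_def)
      ultimately have "L - d \<le> b * Suc d"
        by simp
      then show ?thesis by (simp add: L_def)
    qed
  qed
qed

section \<open>Menger's theorem\<close>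

definition walk :: "('a \<times> 'a) set => 'a list => bool" where
  "walk R xs \<longleftrightarrow> xs \<noteq> [] \<and> successively (\<lambda>x y. (x, y) \<in> R) xs"

lemma walk_append:
  "xs \<noteq> [] ==> ys \<noteq> [] ==> walk R (xs @ ys) \<longleftrightarrow> walk R xs \<and> walk R ys \<and> (last xs, hd ys) \<in> R"
  by (auto simp: walk_def successively_append_iff)

lemma walk_rev: "walk (R\<inverse>) (rev xs) \<longleftrightarrow> walk R xs"
  by (simp add: walk_def)

lemma walk_mono: "walk R xs ==> R \<subseteq> R' ==> walk R' xs"
  unfolding walk_def by (auto intro: successively_mono)

lemma walk_singleton [simp]: "walk R [x]"
  by (simp add: walk_def)

lemma walk_prefix: "walk R (xs @ ys) ==> xs \<noteq> [] ==> walk R xs"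
  by (auto simp: walk_def successively_append_iff)

lemma walk_join:
  assumes "walk R (xs @ [v])" "walk R (v # ys)"
  shows "walk R (xs @ v # ys)"
  using assms by (cases "xs = []"; cases ys)
    (auto simp: walk_def successively_append_iff successively_Cons)

lemma walk_Diff_edge:
  assumes "walk R xs" "x \<notin> set (butlast xs) \<or> y \<notin> set (tl xs)"
  shows "walk (R - {(x, y)}) xs"
  using assms
proof (induction xs rule: induct_list012)
  case (3 a b zs)
  then have "walk R (b # zs)" and ab: "(a, b) \<in> R"
    by (auto simp: walk_def)
  moreover have "x \<notin> set (butlast (b # zs)) \<or> y \<notin> set (tl (b # zs))"
    using 3(4) by auto
  ultimately have "walk (R - {(x, y)}) (b # zs)"
    using 3(2) by blast
  moreover have "(a, b) \<noteq> (x, y)"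
    using 3(4) by auto
  ultimately show ?case
    using ab by (auto simp: walk_def)
qed (auto simp: walk_def)

definition separates :: "('a \<times> 'a) set => 'a set => 'a set => 'a set => bool" where
  "separates R A B S \<longleftrightarrow> (\<forall>xs. walk R xs \<longrightarrow> hd xs \<in> A \<longrightarrow> last xs \<in> B \<longrightarrow> set xs \<inter> S \<noteq> {})"

lemma split_first:
  assumes "set xs \<inter> S \<noteq> {}"
  obtains ys s zs where "xs = ys @ s # zs" "s \<in> S" "set ys \<inter> S = {}"
  using assms split_list_first_prop[of xs "\<lambda>x. x \<in> S"] by blast

text \<open>Up to its first vertex in \<open>insert x S\<close> a walk never leaves
  \<open>x\<close>, so this part does not use the arc from \<open>x\<close> to \<open>y\<close> and
  survives the deletion.\<close>

lemma separates_edge_prefix: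
  assumes Sx: "separates R A B (insert x S)"
    and Z: "separates (R - {(x, y)}) A (insert x S) Z"
  shows "separates R A B Z"
  unfolding separates_def
proof (intro allI impI)
  fix xs assume xs: "walk R xs" "hd xs \<in> A" "last xs \<in> B"
  then have "set xs \<inter> insert x S \<noteq> {}"
    using Sx by (auto simp: separates_def)
  then obtain ys s zs where sp: "xs = ys @ s # zs" "s \<in> insert x S" "set ys \<inter> insert x S = {}"
    using split_first by metis
  have "walk R (ys @ [s])"
    using xs(1) sp(1) walk_prefix[of R "ys @ [s]" zs] by simp
  then have "walk (R - {(x, y)}) (ys @ [s])"
    by (rule walk_Diff_edge) (use sp in auto)
  moreover have "hd (ys @ [s]) \<in> A"
    using xs(2) sp(1) by (cases ys) auto
  ultimately have "set (ys @ [s]) \<inter> Z \<noteq> {}"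
    using Z sp(2) unfolding separates_def by (metis last_snoc)
  then show "set xs \<inter> Z \<noteq> {}"
    using sp(1) by auto
qed

lemma separates_converse: "separates (R\<inverse>) B A S \<longleftrightarrow> separates R A B S"
proof -
  have "separates (R\<inverse>) B A S" if "separates R A B S" for R :: "('a \<times> 'a) set" and A B
    unfolding separates_def
  proof (intro allI impI)
    fix xs assume xs: "walk (R\<inverse>) xs" "hd xs \<in> B" "last xs \<in> A"
    have "walk R (rev xs)"
      using walk_rev[of "R\<inverse>" xs] xs(1) by simp
    moreover have "xs \<noteq> []" using xs by (auto simp: walk_def)
    ultimately show "set xs \<inter> S \<noteq> {}"
      using that xs unfolding separates_def by (metis hd_rev last_rev set_rev)
  qed
  from this[of R A B] this[of "R\<inverse>" B A] show ?thesis by auto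
qed

text \<open>The paths are indexed by their last vertices, so that two families can be glued along a
  common set of ends without matching indices.\<close>

definition linked :: "('a \<times> 'a) set => 'a set => 'a set => nat => bool" where
  "linked R A B k \<longleftrightarrow> (\<exists>T P. T \<subseteq> B \<and> card T = k \<and>
    (\<forall>b\<in>T. walk R (P b) \<and> distinct (P b) \<and> hd (P b) \<in> A \<and> last (P b) = b) \<and>
    (\<forall>b\<in>T. \<forall>c\<in>T. b \<noteq> c \<longrightarrow> set (P b) \<inter> set (P c) = {}))"

lemma linkedE:
  assumes "linked R A B k"
  obtains T P where "T \<subseteq> B" "card T = k"
    "\<And>b. b \<in> T ==> walk R (P b) \<and> distinct (P b) \<and> hd (P b) \<in> A \<and> last (P b) = b"
    "\<And>b c. b \<in> T ==> c \<in> T ==> b \<noteq> c ==> set (P b) \<inter> set (P c) = {}"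
proof -
  obtain T P where *: "T \<subseteq> B \<and> card T = k \<and>
    (\<forall>b\<in>T. walk R (P b) \<and> distinct (P b) \<and> hd (P b) \<in> A \<and> last (P b) = b) \<and>
    (\<forall>b\<in>T. \<forall>c\<in>T. b \<noteq> c \<longrightarrow> set (P b) \<inter> set (P c) = {})"
    using assms unfolding linked_def by (elim exE)
  show thesis
    by (rule that[of T P]) (use * in auto)
qed

text \<open>Goering's proof. An arc from \<open>x\<close> to \<open>y\<close> is deleted. If fewer
  than \<open>k\<close> vertices \<open>S\<close> separate what is left, then
  \<open>insert x S\<close> and \<open>insert y S\<close> are separators of size \<open>k\<close>
  for the whole relation; induction links \<open>A\<close> to the first and the second to
  \<open>B\<close>, and the two families are glued along \<open>S\<close> and across the
  arc.\<close>

theorem menger_relation: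
  assumes "finite R" "finite A" "finite B"
    and "\<And>S. finite S ==> separates R A B S ==> k \<le> card S"
  shows "linked R A B k"
  using assms
proof (induction "card R" arbitrary: R A B)
  case 0
  then have R: "R = {}" by simp
  have "separates R A B (A \<inter> B)"
    unfolding separates_def
  proof (intro allI impI)
    fix xs assume "walk R xs" "hd xs \<in> A" "last xs \<in> B"
    moreover then obtain x where "xs = [x]"
      by (cases xs; cases "tl xs") (auto simp: walk_def R)
    ultimately show "set xs \<inter> (A \<inter> B) \<noteq> {}" by simp
  qed
  then have "k \<le> card (A \<inter> B)"
    using 0 by simp
  then obtain T where "T \<subseteq> A \<inter> B" "card T = k"
    by (meson obtain_subset_with_card_n)
  then show ?case
    unfolding linked_def by (intro exI[of _ T] exI[of _ "\<lambda>b. [b]"]) auto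
next
  case (Suc m)
  obtain x y where e: "(x, y) \<in> R"
    using Suc.hyps(2) by (metis card.empty ex_in_conv nat.distinct(1) surj_pair)
  define R' where "R' = R - {(x, y)}"
  have cR: "m = card R'" "finite R'"
    using Suc.hyps(2) Suc.prems(1) e by (auto simp: R'_def)
  show ?case
  proof (cases "\<forall>S. finite S \<longrightarrow> separates R' A B S \<longrightarrow> k \<le> card S")
    case True
    then have "linked R' A B k"
      using Suc.hyps(1)[OF cR(1) cR(2) Suc.prems(2,3)] by blast
    then show ?thesis
      unfolding linked_def using walk_mono[of R' _ R] R'_def by blast
  next
    case False
    then obtain S where S: "finite S" "separates R' A B S" "card S < k" by auto
    have Sxy: "separates R A B (insert z S)" if z: "z = x \<or> z = y" for z
      unfolding separates_def
    proof (intro allI impI)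
      fix xs assume xs: "walk R xs" "hd xs \<in> A" "last xs \<in> B"
      show "set xs \<inter> insert z S \<noteq> {}"
      proof (cases "z \<in> set xs")
        case False
        then have "x \<notin> set (butlast xs) \<or> y \<notin> set (tl xs)"
          using z in_set_butlastD[of x xs] by (cases xs) auto
        then have "walk R' xs"
          unfolding R'_def using xs(1) by (intro walk_Diff_edge)
        then show ?thesis using S(2) xs by (auto simp: separates_def)
      qed auto
    qed
    have cSz: "z \<notin> S \<and> card (insert z S) = k" if "z = x \<or> z = y" for z
    proof -
      have "k \<le> card (insert z S)"
        using Suc.prems(4)[OF _ Sxy[OF that]] S(1) by simp
      then show ?thesis
        using S(1,3) by (cases "z \<in> S") (auto simp: insert_absorb)
    qed
    have "k \<le> card Z" if "finite Z" "separates R' A (insert x S) Z" for Z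
      using Suc.prems(4)[OF that(1)] separates_edge_prefix[OF Sxy[of x], of y Z] that(2) by (simp add: R'_def)
    then have "linked R' A (insert x S) k"
      using Suc.hyps(1)[OF cR(1) cR(2) Suc.prems(2), of "insert x S"] S(1) by blast
    then obtain T P where TP: "T \<subseteq> insert x S" "card T = k"
      "\<And>b. b \<in> T ==> walk R' (P b) \<and> distinct (P b) \<and> hd (P b) \<in> A \<and> last (P b) = b"
      "\<And>b c. b \<in> T ==> c \<in> T ==> b \<noteq> c ==> set (P b) \<inter> set (P c) = {}"
      by (rule linkedE) blast
    have T: "T = insert x S"
      using TP(1,2) cSz[of x] S(1) by (metis card_subset_eq finite_insert)
    \<comment> \<open>The second family comes from the same argument in the converse relation, so
      its paths \<open>Q\<close> run from \<open>B\<close> and are read backwards.\<close>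
    have Sy: "separates (R\<inverse>) B A (insert y S)"
      using Sxy[of y] by (simp add: separates_converse)
    have "(R\<inverse>) - {(y, x)} = R'\<inverse>" by (auto simp: R'_def)
    then have "k \<le> card Z" if "finite Z" "separates (R'\<inverse>) B (insert y S) Z" for Z
      using Suc.prems(4)[OF that(1)] separates_edge_prefix[OF Sy, of x Z] that(2) by (simp add: separates_converse)
    then have "linked (R'\<inverse>) B (insert y S) k"
      using Suc.hyps(1)[of "R'\<inverse>" B "insert y S"] cR S(1) Suc.prems(3) by (simp add: card_inverse)
    then obtain T' Q where TQ: "T' \<subseteq> insert y S" "card T' = k"
      "\<And>b. b \<in> T' ==> walk (R'\<inverse>) (Q b) \<and> distinct (Q b) \<and> hd (Q b) \<in> B \<and> last (Q b) = b"
      "\<And>b c. b \<in> T' ==> c \<in> T' ==> b \<noteq> c ==> set (Q b) \<inter> set (Q c) = {}"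
      by (rule linkedE) blast
    have T': "T' = insert y S"
      using TQ(1,2) cSz[of y] S(1) by (metis card_subset_eq finite_insert)
    have inS: "z \<in> set (P z)" if "z \<in> T" for z
      using TP(3)[OF that] by (metis last_in_set walk_def)
    have inS': "z \<in> set (Q z)" if "z \<in> T'" for z
      using TQ(3)[OF that] by (metis last_in_set walk_def)
    have PS: "set (P b) \<inter> insert x S \<subseteq> {b}" if "b \<in> T" for b
      using TP(4)[OF that] inS T by blast
    have QS: "set (Q b) \<inter> insert y S \<subseteq> {b}" if "b \<in> T'" for b
      using TQ(4)[OF that] inS' T' by blast
    \<comment> \<open>Before its last vertex a path of either family avoids \<open>S\<close>. A
      meeting point outside \<open>S\<close> would therefore splice two initial parts into a walk
      from \<open>A\<close> to \<open>B\<close> that avoids both \<open>S\<close> and the deleted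
      arc.\<close>
    have meet: "v \<in> S" if v: "v \<in> set (P b)" "v \<in> set (Q c)" "b \<in> T" "c \<in> T'" for b c v
    proof (rule ccontr)
      assume vS: "v \<notin> S"
      obtain p1 p2 where p: "P b = p1 @ v # p2" using v(1) by (meson split_list)
      obtain q1 q2 where q: "Q c = q1 @ v # q2" using v(2) by (meson split_list)
      have p1: "walk R' (p1 @ [v])"
        using TP(3)[OF v(3)] p walk_prefix[of R' "p1 @ [v]" p2] by simp
      have q1: "walk (R'\<inverse>) (q1 @ [v])"
        using TQ(3)[OF v(4)] q walk_prefix[of "R'\<inverse>" "q1 @ [v]" q2] by simp
      have "walk R' (v # rev q1)"
        using q1 walk_rev[of "R'" "v # rev q1"] by simp
      then have w: "walk R' (p1 @ v # rev q1)"
        using p1 walk_join by metis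
      have "hd (p1 @ v # rev q1) \<in> A"
        using TP(3)[OF v(3)] p by (cases p1) auto
      moreover have "last (p1 @ v # rev q1) \<in> B"
        using TQ(3)[OF v(4)] q by (cases q1) auto
      ultimately have "set (p1 @ v # rev q1) \<inter> S \<noteq> {}"
        using S(2) w unfolding separates_def by blast
      then consider s where "s \<in> S" "s \<in> set p1" | s where "s \<in> S" "s \<in> set q1"
        using vS by auto
      then show False
      proof cases
        case 1
        then have "s = b" using PS[OF v(3)] p by auto
        moreover have "last (P b) = b" "distinct (P b)" using TP(3)[OF v(3)] by auto
        ultimately show False
          using 1(2) p by (cases p2 rule: rev_cases) auto
      next
        case 2
        then have "s = c" using QS[OF v(4)] q by auto
        moreover have "last (Q c) = c" "distinct (Q c)" using TQ(3)[OF v(4)] by auto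
        ultimately show False
          using 2(2) q by (cases q2 rule: rev_cases) auto
      qed
    qed
    \<comment> \<open>At \<open>x\<close> the path crosses the deleted arc to \<open>y\<close>; at a
      vertex of \<open>S\<close> both halves contain this vertex, and \<open>tl\<close> drops one
      copy.\<close>
    define J where "J z = (if z = x then P x @ rev (Q y) else P z @ tl (rev (Q z)))" for z
    have xS: "x \<notin> S" and yS: "y \<notin> S" using cSz by auto
    have J: "walk R (J z) \<and> distinct (J z) \<and> hd (J z) \<in> A \<and> last (J z) = hd (Q (if z = x then y else z))
       \<and> set (J z) = set (P z) \<union> set (Q (if z = x then y else z))" if z: "z \<in> T" for z
    proof (cases "z = x")
      case True
      have P: "walk R' (P x)" "distinct (P x)" "hd (P x) \<in> A" "last (P x) = x"
        using TP(3) z True by auto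
      have Q: "walk (R'\<inverse>) (Q y)" "distinct (Q y)" "hd (Q y) \<in> B" "last (Q y) = y"
        using TQ(3)[of y] T' by auto
      have ne: "P x \<noteq> []" "Q y \<noteq> []" using P Q by (auto simp: walk_def)
      have "set (P x) \<inter> set (Q y) = {}"
      proof (rule ccontr)
        assume "set (P x) \<inter> set (Q y) \<noteq> {}"
        then obtain v where v: "v \<in> set (P x)" "v \<in> set (Q y)" by auto
        then have "v \<in> S" using meet z True T' by blast
        then show False using PS[of x] v(1) z True xS by auto
      qed
      moreover have "walk R (P x @ rev (Q y))"
        using ne P Q e walk_mono[of R' _ R] walk_rev[of R' "rev (Q y)"]
        by (auto simp: walk_append R'_def hd_rev)
      ultimately show ?thesis
        using True P Q ne by (auto simp: J_def last_rev)
    next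
      case False
      then have zS: "z \<in> S" "z \<in> T'" using z T T' by auto
      have P: "walk R' (P z)" "distinct (P z)" "hd (P z) \<in> A" "last (P z) = z"
        using TP(3) z by auto
      have Q: "walk (R'\<inverse>) (Q z)" "distinct (Q z)" "hd (Q z) \<in> B" "last (Q z) = z"
        using TQ(3) zS by auto
      obtain p where p: "P z = p @ [z]"
        using P by (metis append_butlast_last_id walk_def)
      obtain q where q: "Q z = q @ [z]"
        using Q by (metis append_butlast_last_id walk_def)
      have "set p \<inter> set q = {}"
      proof (rule ccontr)
        assume "set p \<inter> set q \<noteq> {}"
        then obtain v where v: "v \<in> set p" "v \<in> set q" by auto
        then have "v \<in> S" using meet[OF _ _ z zS(2)] p q by simp
        then have "v = z" using PS[OF z] v(1) p by simp blast
        then show False using v P(2) p by auto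
      qed
      moreover have "walk R' (p @ [z])" "walk R' (z # rev q)"
        using P(1) Q(1) p q walk_rev[of R' "z # rev q"] by simp_all
      then have "walk R' (p @ z # rev q)"
        by (rule walk_join)
      then have "walk R (p @ z # rev q)"
        using walk_mono[of R' _ R] R'_def by blast
      moreover have "J z = p @ z # rev q"
        using False by (simp add: J_def p q)
      moreover have "last (p @ z # rev q) = hd (Q z)" "hd (p @ z # rev q) \<in> A"
        using q p P(3) by (cases p; cases q; simp)+
      ultimately show ?thesis
        using False P(2) Q(2) p q by simp
    qed
    define h where "h z = hd (Q (if z = x then y else z))" for z
    have sw: "(if z = x then y else z) \<in> T'" if "z \<in> T" for z
      using that T T' by auto
    have disj: "set (J z) \<inter> set (J z') = {}" if z: "z \<in> T" "z' \<in> T" "z \<noteq> z'" for z z'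
    proof -
      let ?q = "\<lambda>z. if z = x then y else z"
      have qq: "?q z \<noteq> ?q z'" using z T yS xS by auto
      have PQ: "set (P a) \<inter> set (Q (?q b)) = {}" if "a \<in> T" "b \<in> T" "a \<noteq> b" for a b
      proof (rule ccontr)
        assume "set (P a) \<inter> set (Q (?q b)) \<noteq> {}"
        then obtain v where v: "v \<in> set (P a)" "v \<in> set (Q (?q b))" by auto
        then have "v \<in> S" using meet that(1) sw[OF that(2)] by blast
        then have "v = a" "v = ?q b"
          using PS[OF that(1)] QS[OF sw[OF that(2)]] v by auto
        then show False using that \<open>v \<in> S\<close> yS by (auto split: if_splits)
      qed
      have "set (Q (?q z)) \<inter> set (Q (?q z')) = {}"
        using TQ(4)[OF sw[OF z(1)] sw[OF z(2)] qq] .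
      moreover have "set (P z) \<inter> set (P z') = {}" "set (P z) \<inter> set (Q (?q z')) = {}" "set (P z') \<inter> set (Q (?q z)) = {}"
        using TP(4)[OF z] PQ[OF z] PQ[of z' z] z by simp_all
      moreover have "set (J z) = set (P z) \<union> set (Q (?q z))" "set (J z') = set (P z') \<union> set (Q (?q z'))"
        using J z by simp_all
      ultimately show ?thesis by (metis Int_Un_distrib Int_Un_distrib2 Int_commute Un_empty)
    qed
    have hJ: "h z \<in> set (J z)" if "z \<in> T" for z
      using J[OF that] by (metis h_def last_in_set walk_def)
    have inj: "inj_on h T"
      unfolding inj_on_def using hJ disj by (metis IntI empty_iff)
    \<comment> \<open>The glued paths are indexed by \<open>T\<close> and have to be indexed by
      their ends \<open>h z\<close> in \<open>B\<close>.\<close>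
    define P' where "P' b = J (the_inv_into T h b)" for b
    have P': "P' (h z) = J z" if "z \<in> T" for z
      using the_inv_into_f_f[OF inj that] by (simp add: P'_def)
    show ?thesis
      unfolding linked_def
    proof (intro exI[of _ "h ` T"] exI[of _ P'] conjI)
      show "h ` T \<subseteq> B"
        using TQ(3)[OF sw] by (auto simp: h_def)
      show "card (h ` T) = k"
        using inj TP(2) by (simp add: card_image)
      show "\<forall>b\<in>h ` T. walk R (P' b) \<and> distinct (P' b) \<and> hd (P' b) \<in> A \<and> last (P' b) = b"
        using J P' by (auto simp: h_def)
      show "\<forall>b\<in>h ` T. \<forall>c\<in>h ` T. b \<noteq> c \<longrightarrow> set (P' b) \<inter> set (P' c) = {}"
        using P' disj by auto
    qed
  qed
qed

section \<open>Connected sets and induced paths\<close>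

locale fin_graph =
  fixes V :: "'a set" and E :: "'a => 'a => bool"
  assumes finite_V: "finite V"
    and E_in_V: "E x y ==> x \<in> V"
    and E_sym: "E x y ==> E y x"
    and E_irrefl: "\<not> E x x"
begin

text \<open>Sharing a vertex counts, so that \<open>\<not> touch\<close> means disjoint and
  anticomplete at once.\<close>

definition touch :: "'a set => 'a set => bool" where
  "touch A B \<longleftrightarrow> (\<exists>a\<in>A. \<exists>b\<in>B. a = b \<or> E a b)"

text \<open>Connectedness by cuts instead of walks: most uses show that a part closed under
  adjacency is everything, which is this definition read directly.\<close>

definition conn :: "'a set => bool" where
  "conn S \<longleftrightarrow> S \<noteq> {} \<and> (\<forall>A\<subseteq>S. A \<noteq> {} \<longrightarrow> A \<noteq> S \<longrightarrow> (\<exists>a\<in>A. \<exists>b\<in>S - A. E a b))"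

definition ipath :: "'a list => bool" where
  "ipath xs \<longleftrightarrow> xs \<noteq> [] \<and> distinct xs \<and> set xs \<subseteq> V \<and>
     (\<forall>i<length xs. \<forall>j<length xs. E (xs ! i) (xs ! j) \<longleftrightarrow> j = Suc i \<or> i = Suc j)"

lemma touch_sym: "touch A B \<longleftrightarrow> touch B A"
  using E_sym by (auto simp: touch_def)

lemma touch_mono: "touch A B ==> A \<subseteq> A' ==> B \<subseteq> B' ==> touch A' B'"
  by (auto simp: touch_def)

lemma touch_Un: "touch (A \<union> B) C \<longleftrightarrow> touch A C \<or> touch B C"
  by (auto simp: touch_def)

lemma touch_Un2: "touch A (B \<union> C) \<longleftrightarrow> touch A B \<or> touch A C"
  by (auto simp: touch_def)

lemma touch_UN: "touch (\<Union>i\<in>I. A i) C \<longleftrightarrow> (\<exists>i\<in>I. touch (A i) C)"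
  by (auto simp: touch_def)

lemma touch_UN2: "touch C (\<Union>i\<in>I. A i) \<longleftrightarrow> (\<exists>i\<in>I. touch C (A i))"
  by (auto simp: touch_def)

lemma touch_iff_singleton: "touch A B \<longleftrightarrow> (\<exists>a\<in>A. touch {a} B)"
  by (auto simp: touch_def)

lemma touch_iff_singleton2: "touch A B \<longleftrightarrow> (\<exists>b\<in>B. touch A {b})"
  by (auto simp: touch_def)

lemma touch_Int: "A \<inter> B \<noteq> {} ==> touch A B"
  by (auto simp: touch_def)

lemma not_touch_disjoint: "\<not> touch A B ==> A \<inter> B = {}"
  by (auto simp: touch_def)

lemma touch_empty [simp]: "\<not> touch {} B" "\<not> touch A {}"
  by (auto simp: touch_def)

lemma conn_nonempty: "conn S ==> S \<noteq> {}"
  by (simp add: conn_def)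

lemma conn_singleton [simp]: "conn {x}"
  by (auto simp: conn_def)

lemma conn_subset_closed:
  assumes "conn S" "S \<inter> A \<noteq> {}" "\<And>a b. a \<in> S ==> a \<in> A ==> b \<in> S ==> E a b ==> b \<in> A"
  shows "S \<subseteq> A"
proof (rule ccontr)
  assume "\<not> S \<subseteq> A"
  then have "S \<inter> A \<noteq> S" by auto
  then obtain a b where "a \<in> S \<inter> A" "b \<in> S - S \<inter> A" "E a b"
    using assms(1,2) unfolding conn_def by (metis Int_lower1)
  then show False using assms(3) by auto
qed

lemma connI_closed:
  assumes "x \<in> S" "\<And>A. A \<subseteq> S ==> x \<in> A ==> (\<And>a b. a \<in> A ==> b \<in> S ==> E a b ==> b \<in> A) ==> A = S"
  shows "conn S"
  unfolding conn_def
proof (intro conjI allI impI)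
  show "S \<noteq> {}" using assms(1) by auto
  fix A assume A: "A \<subseteq> S" "A \<noteq> {}" "A \<noteq> S"
  show "\<exists>a\<in>A. \<exists>b\<in>S - A. E a b"
  proof (rule ccontr)
    assume *: "\<not> ?thesis"
    show False
    proof (cases "x \<in> A")
      case True
      then show False using assms(2)[OF A(1)] A(3) * by blast
    next
      case False
      have "S - A = S"
        by (rule assms(2)) (use False assms(1) * E_sym in blast)+
      then show False using A by auto
    qed
  qed
qed

lemma conn_Un:
  assumes "conn S" "conn T" "touch S T"
  shows "conn (S \<union> T)"
proof -
  obtain x y where xy: "x \<in> S" "y \<in> T" "x = y \<or> E x y"
    using assms(3) by (auto simp: touch_def)
  show ?thesis
  proof (rule connI_closed[of x])
    show "x \<in> S \<union> T" using xy by auto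
    fix A assume A: "A \<subseteq> S \<union> T" "x \<in> A" "\<And>a b. a \<in> A ==> b \<in> S \<union> T ==> E a b ==> b \<in> A"
    have "S \<subseteq> A"
      by (rule conn_subset_closed[OF assms(1)]) (use A xy in auto)
    moreover have "T \<subseteq> A"
      by (rule conn_subset_closed[OF assms(2)]) (use A xy in auto)
    ultimately show "A = S \<union> T" using A by auto
  qed
qed

lemma conn_insert: "conn S ==> y \<in> S ==> E x y ==> conn (insert x S)"
  using conn_Un[of "{x}" S] by (auto simp: touch_def)

lemma conn_UN:
  assumes "I \<noteq> {}" "\<And>i. i \<in> I ==> conn (A i)" "\<And>i j. i \<in> I ==> j \<in> I ==> touch (A i) (A j)"
  shows "conn (\<Union>i\<in>I. A i)"
proof -
  obtain i x where i: "i \<in> I" "x \<in> A i"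
    using assms(1,2) conn_nonempty by blast
  show ?thesis
  proof (rule connI_closed[of x])
    show "x \<in> \<Union> (A ` I)" using i by auto
    fix B assume B: "B \<subseteq> \<Union> (A ` I)" "x \<in> B" "\<And>a b. a \<in> B ==> b \<in> \<Union> (A ` I) ==> E a b ==> b \<in> B"
    have "A i \<subseteq> B"
      by (rule conn_subset_closed[OF assms(2)[OF i(1)]]) (use B i in auto)
    have "A j \<subseteq> B" if j: "j \<in> I" for j
    proof -
      obtain a b where "a \<in> A i" "b \<in> A j" "a = b \<or> E a b"
        using assms(3)[OF i(1) j] by (auto simp: touch_def)
      then have "A j \<inter> B \<noteq> {}"
        using \<open>A i \<subseteq> B\<close> B(3) j by blast
      then show ?thesis
        using conn_subset_closed[OF assms(2)[OF j]] B(3) j by blast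
    qed
    then show "B = \<Union> (A ` I)" using B(1) by blast
  qed
qed

lemma successively_conn: "xs \<noteq> [] ==> successively E xs ==> conn (set xs)"
proof (induction xs rule: induct_list012)
  case (3 x y zs)
  then show ?case using conn_insert[of "set (y # zs)" y x] by auto
qed auto

lemma conn_walk:
  assumes "conn S" "a \<in> S" "b \<in> S"
  shows "\<exists>xs. xs \<noteq> [] \<and> successively E xs \<and> hd xs = a \<and> last xs = b \<and> set xs \<subseteq> S"
proof -
  define R where "R = {b \<in> S. \<exists>xs. xs \<noteq> [] \<and> successively E xs \<and> hd xs = a \<and> last xs = b \<and> set xs \<subseteq> S}"
  have "S \<subseteq> R"
  proof (rule conn_subset_closed[OF assms(1)])
    have "a \<in> R" using assms(2) by (auto simp: R_def intro!: exI[of _ "[a]"])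
    then show "S \<inter> R \<noteq> {}" using assms by auto
    fix c d assume c: "c \<in> S" "c \<in> R" "d \<in> S" "E c d"
    then obtain xs where "xs \<noteq> []" "successively E xs" "hd xs = a" "last xs = c" "set xs \<subseteq> S"
      by (auto simp: R_def)
    then show "d \<in> R"
      using c by (auto simp: R_def successively_append_iff intro!: exI[of _ "xs @ [d]"])
  qed
  then show ?thesis using assms by (auto simp: R_def)
qed

text \<open>A shortest walk in \<open>S\<close> from \<open>A\<close> to \<open>B\<close>:
  minimality excludes repetitions, chords and further vertices in \<open>A\<close> or
  \<open>B\<close>.\<close>

lemma exists_ipath:
  assumes "conn S" "S \<subseteq> V" "S \<inter> A \<noteq> {}" "S \<inter> B \<noteq> {}"
  obtains xs where "ipath xs" "set xs \<subseteq> S" "hd xs \<in> A" "last xs \<in> B"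
    "\<And>i. i < length xs ==> xs ! i \<in> A ==> i = 0"
    "\<And>i. i < length xs ==> xs ! i \<in> B ==> i = length xs - 1"
proof -
  define W where "W xs \<longleftrightarrow> xs \<noteq> [] \<and> successively E xs \<and> hd xs \<in> A \<and> last xs \<in> B \<and> set xs \<subseteq> S" for xs
  obtain a b where "a \<in> S" "a \<in> A" "b \<in> S" "b \<in> B" using assms by auto
  then have "\<exists>xs. W xs"
    using conn_walk[OF assms(1), of a b] by (auto simp: W_def)
  then obtain xs where xs: "W xs" and min: "\<And>ys. W ys ==> length xs \<le> length ys"
    using arg_min_natI[of W _ length] arg_min_nat_le[of W _ length] by metis
  let ?n = "length xs"
  have ne: "xs \<noteq> []" and suc: "successively E xs" using xs by (auto simp: W_def)
  have E_Suc: "E (xs ! i) (xs ! Suc i)" if "Suc i < ?n" for i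
    using suc that by (simp add: successively_conv_nth)
  \<comment> \<open>Deleting the entries \<open>i\<close>, ..., \<open>j - 1\<close> must not leave
    a walk from \<open>A\<close> to \<open>B\<close>. A repetition, a chord and a second vertex in
    \<open>A\<close> would each allow such a deletion.\<close>
  have cut: "False" if ij: "i < j" "j < ?n" "0 < i ==> E (xs ! (i - 1)) (xs ! j)" "i = 0 ==> xs ! j \<in> A" for i j
  proof -
    have dj: "drop j xs \<noteq> []" "hd (drop j xs) = xs ! j" using ij by (auto simp: hd_drop_conv_nth)
    have "successively E (take i xs @ drop j xs)"
      unfolding successively_append_iff
    proof (intro conjI impI)
      show "successively E (take i xs)" "successively E (drop j xs)"
        using suc by (metis append_take_drop_id successively_append_iff)+
      have "last (take i xs) = xs ! (i - 1)" if "0 < i"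
        using ij ne that by (subst last_conv_nth) (auto simp: min_def)
      then show "take i xs = [] \<or> drop j xs = [] \<or> E (last (take i xs)) (hd (drop j xs))"
        using ij dj by (cases "i = 0") simp_all
    qed
    moreover have "hd (take i xs @ drop j xs) \<in> A"
    proof (cases "i = 0")
      case True then show ?thesis using ij dj by simp
    next
      case False
      then have "hd (take i xs @ drop j xs) = hd xs"
        using ij ne by (simp add: hd_append)
      then show ?thesis using xs by (simp add: W_def)
    qed
    moreover have "last (take i xs @ drop j xs) \<in> B"
      using xs dj ij by (simp add: W_def last_drop)
    moreover have "set (take i xs @ drop j xs) \<subseteq> S"
      using xs by (auto simp: W_def dest: in_set_takeD in_set_dropD)
    ultimately have "W (take i xs @ drop j xs)"
      using dj by (simp add: W_def)
    then show False
      using min ij by fastforce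
  qed
  have ndist: "False" if "i < j" "j < ?n" "xs ! i = xs ! j" for i j
  proof (rule cut[OF that(1,2)])
    assume "0 < i"
    then show "E (xs ! (i - 1)) (xs ! j)" using E_Suc[of "i - 1"] that by simp
  next
    assume "i = 0"
    then show "xs ! j \<in> A" using that xs ne by (simp add: W_def hd_conv_nth)
  qed
  have dist: "distinct xs"
    unfolding distinct_conv_nth using ndist by (metis linorder_neqE_nat)
  have nE: "j = Suc i" if "i < j" "j < ?n" "E (xs ! i) (xs ! j)" for i j
  proof (rule ccontr)
    assume "j \<noteq> Suc i"
    then have "Suc i < j" using that by simp
    then show False using cut[of "Suc i" j] that by simp
  qed
  have "ipath xs"
    unfolding ipath_def
  proof (intro conjI allI impI)
    show "set xs \<subseteq> V" using xs assms(2) by (auto simp: W_def)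
    fix i j assume ij: "i < ?n" "j < ?n"
    show "E (xs ! i) (xs ! j) \<longleftrightarrow> j = Suc i \<or> i = Suc j"
      using nE[of i j] nE[of j i] ij E_Suc E_sym E_irrefl by (metis linorder_neqE_nat)
  qed (use ne dist in auto)
  moreover have "i = 0" if "i < ?n" "xs ! i \<in> A" for i
    using cut[of 0 i] that by blast
  moreover have "i = ?n - 1" if i: "i < ?n" "xs ! i \<in> B" for i
  proof (rule ccontr)
    assume "i \<noteq> ?n - 1"
    then have lt: "Suc i < ?n" using i by simp
    have "successively E (take (Suc i) xs)"
      using suc by (metis append_take_drop_id successively_append_iff)
    moreover have "hd (take (Suc i) xs) = hd xs" by (cases xs) auto
    moreover have "last (take (Suc i) xs) = xs ! i"
      using i(1) by (simp add: take_Suc_conv_app_nth)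
    ultimately have "W (take (Suc i) xs)"
      using xs i by (auto simp: W_def dest: in_set_takeD)
    then show False using min lt by fastforce
  qed
  ultimately show ?thesis
    using that xs by (metis W_def)
qed

lemma ipathD:
  assumes "ipath xs"
  shows "xs \<noteq> []" "distinct xs" "set xs \<subseteq> V"
    "\<And>i j. i < length xs ==> j < length xs ==> E (xs ! i) (xs ! j) \<longleftrightarrow> j = Suc i \<or> i = Suc j"
  using assms by (auto simp: ipath_def)

lemma ipath_successively: "ipath xs ==> successively E xs"
  by (auto simp: ipath_def successively_conv_nth)

lemma ipath_singleton: "x \<in> V ==> ipath [x]"
  by (simp add: ipath_def E_irrefl)

lemma conn_ipath: "ipath xs ==> conn (set xs)"
  using ipath_successively successively_conn ipathD(1) by blast

lemma ipath_rev: "ipath xs ==> ipath (rev xs)"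
  unfolding ipath_def by (auto simp: rev_nth)

lemma ipath_append_left:
  assumes "ipath (xs @ ys)" "xs \<noteq> []"
  shows "ipath xs"
  unfolding ipath_def
proof (intro conjI allI impI)
  fix i j assume "i < length xs" "j < length xs"
  then show "E (xs ! i) (xs ! j) \<longleftrightarrow> j = Suc i \<or> i = Suc j"
    using ipathD(4)[OF assms(1), of i j] by (simp add: nth_append)
qed (use assms in \<open>auto simp: ipath_def\<close>)

lemma ipath_append_right:
  assumes "ipath (xs @ ys)" "ys \<noteq> []"
  shows "ipath ys"
  using ipath_rev[OF assms(1)] ipath_append_left[of "rev ys" "rev xs"] ipath_rev[of "rev ys"] assms(2)
  by simp

definition seg :: "'a list => nat => nat => 'a set" where
  "seg xs a b = (\<lambda>i. xs ! i) ` {a..b}"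

lemma seg_subset: "b < length xs ==> seg xs a b \<subseteq> set xs"
  by (auto simp: seg_def)

lemma conn_seg:
  assumes "ipath xs" "a \<le> b" "b < length xs"
  shows "conn (seg xs a b)"
  using assms(2,3)
proof (induction b rule: dec_induct)
  case base
  then show ?case by (simp add: seg_def)
next
  case (step n)
  have "seg xs a (Suc n) = insert (xs ! Suc n) (seg xs a n)"
    using step by (auto simp: seg_def atLeastAtMostSuc_conv)
  moreover have "E (xs ! Suc n) (xs ! n)"
    using ipathD(4)[OF assms(1)] step by auto
  ultimately show ?case
    using step conn_insert[of "seg xs a n" "xs ! n"] by (auto simp: seg_def)
qed

subsection \<open>Linkages\<close>

definition linkage :: "'a set => 'a set => 'a set => nat => (nat => 'a list) => bool" where
  "linkage H A B k R \<longleftrightarrow> (\<forall>i<k. ipath (R i) \<and> set (R i) \<subseteq> H \<and> hd (R i) \<in> A \<and> last (R i) \<in> B) \<and>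
     (\<forall>i<k. \<forall>j<k. i \<noteq> j \<longrightarrow> set (R i) \<inter> set (R j) = {})"

text \<open>Separation is phrased by connected sets because it is contradicted by gluing segments of
  paths and columns into one connected set that meets both sides.\<close>

definition sep :: "'a set => 'a set => 'a set => 'a set => bool" where
  "sep H A B C \<longleftrightarrow> (\<forall>D. D \<subseteq> H - C \<longrightarrow> conn D \<longrightarrow> D \<inter> A = {} \<or> D \<inter> B = {})"

lemma linkageD:
  assumes "linkage H A B k R"
  shows "\<And>i. i < k ==> ipath (R i)" "\<And>i. i < k ==> set (R i) \<subseteq> H"
    "\<And>i. i < k ==> hd (R i) \<in> A" "\<And>i. i < k ==> last (R i) \<in> B"
    "\<And>i j. i < k ==> j < k ==> i \<noteq> j ==> set (R i) \<inter> set (R j) = {}"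
  using assms by (auto simp: linkage_def)

theorem menger:
  assumes "H \<subseteq> V" "\<And>C. C \<subseteq> H ==> sep H A B C ==> k \<le> card C"
  shows "\<exists>R. linkage H A B k R"
proof -
  define R where "R = {(x, y). x \<in> H \<and> y \<in> H \<and> E x y}"
  have finH: "finite H" using assms(1) finite_V finite_subset by blast
  have finR: "finite R"
    by (rule finite_subset[of _ "H \<times> H"]) (use finH in \<open>auto simp: R_def\<close>)
  \<comment> \<open>A walk with one vertex is not confined to \<open>H\<close> by the relation, so
    the ends are intersected with \<open>H\<close> below.\<close>
  have walkR: "walk R xs \<longleftrightarrow> xs \<noteq> [] \<and> successively E xs \<and> (length xs \<ge> 2 \<longrightarrow> set xs \<subseteq> H)" for xs
  proof (induction xs rule: induct_list012)
    case (3 x y zs)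
    then show ?case by (cases zs) (auto simp: walk_def R_def)
  qed (auto simp: walk_def)
  have "linked R (A \<inter> H) (B \<inter> H) k"
  proof (rule menger_relation)
    fix S assume S: "finite S" "separates R (A \<inter> H) (B \<inter> H) S"
    have "sep H A B (S \<inter> H)"
      unfolding sep_def
    proof (intro allI impI, rule ccontr)
      fix D assume D: "D \<subseteq> H - S \<inter> H" "conn D" "\<not> (D \<inter> A = {} \<or> D \<inter> B = {})"
      then obtain a b where ab: "a \<in> D" "a \<in> A" "b \<in> D" "b \<in> B" by auto
      obtain xs where xs: "xs \<noteq> []" "successively E xs" "hd xs = a" "last xs = b" "set xs \<subseteq> D"
        using conn_walk[OF D(2) ab(1,3)] by auto
      then have "walk R xs" using D(1) by (auto simp: walkR)
      then have "set xs \<inter> S \<noteq> {}"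
        using S(2) xs ab D(1) unfolding separates_def by blast
      then show False using xs D(1) by auto
    qed
    then have "k \<le> card (S \<inter> H)" using assms(2) by auto
    then show "k \<le> card S"
      using S(1) by (meson card_mono inf_le1 le_trans)
  qed (use finR finH in auto)
  then obtain T P where TP: "T \<subseteq> B \<inter> H" "card T = k"
    "\<And>b. b \<in> T ==> walk R (P b) \<and> distinct (P b) \<and> hd (P b) \<in> A \<inter> H \<and> last (P b) = b"
    "\<And>b c. b \<in> T ==> c \<in> T ==> b \<noteq> c ==> set (P b) \<inter> set (P c) = {}"
    by (rule linkedE) blast
  \<comment> \<open>Each path is replaced by an induced path inside its own vertex set, which keeps
    the family disjoint.\<close>
  have ex: "\<exists>xs. ipath xs \<and> set xs \<subseteq> set (P b) \<and> set (P b) \<subseteq> H \<and> hd xs \<in> A \<and> last xs \<in> B" if b: "b \<in> T" for b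
  proof -
    have P: "P b \<noteq> []" "successively E (P b)" "hd (P b) \<in> A \<inter> H" "last (P b) \<in> B \<inter> H"
      using TP(1,3) b walkR by auto
    have PH: "set (P b) \<subseteq> H"
      using TP(3)[OF b] walkR[of "P b"] P by (cases "P b"; cases "tl (P b)") auto
    then have PV: "set (P b) \<subseteq> V" using assms(1) by auto
    have "set (P b) \<inter> A \<noteq> {}" "set (P b) \<inter> B \<noteq> {}"
      using P hd_in_set[OF P(1)] last_in_set[OF P(1)] by blast+
    from exists_ipath[OF successively_conn[OF P(1,2)] PV this]
    show ?thesis using PH by metis
  qed
  obtain Q where Q: "\<And>b. b \<in> T ==> ipath (Q b) \<and> set (Q b) \<subseteq> set (P b) \<and> set (P b) \<subseteq> H \<and> hd (Q b) \<in> A \<and> last (Q b) \<in> B"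
    using bchoice[of T "\<lambda>b xs. ipath xs \<and> set xs \<subseteq> set (P b) \<and> set (P b) \<subseteq> H \<and> hd xs \<in> A \<and> last xs \<in> B"] ex by blast
  have "finite T" using TP(1) finH by (meson finite_Int finite_subset)
  then obtain g where g: "bij_betw g {..<k} T"
    using TP(2) by (metis ex_bij_betw_nat_finite atLeast0LessThan)
  have gT: "g i \<in> T" if "i < k" for i
    using g that by (auto simp: bij_betw_def)
  have "linkage H A B k (\<lambda>i. Q (g i))"
    unfolding linkage_def
  proof (intro conjI allI impI)
    fix i j assume ij: "i < k" "j < k" "i \<noteq> j"
    then have "g i \<noteq> g j" using g by (auto simp: bij_betw_def inj_on_def)
    then show "set (Q (g i)) \<inter> set (Q (g j)) = {}"
      using TP(4) Q gT ij by blast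
  qed (use Q gT in blast)+
  then show ?thesis by blast
qed

subsection \<open>Path models of complete bipartite graphs\<close>

definition ip :: "'a set => bool" where
  "ip S \<longleftrightarrow> (\<exists>xs. ipath xs \<and> set xs = S)"

definition PM :: "nat => bool" where
  "PM n \<longleftrightarrow> (\<exists>A B :: nat => 'a set. (\<forall>i<n. ip (A i) \<and> ip (B i)) \<and>
     (\<forall>i<n. \<forall>j<n. i \<noteq> j \<longrightarrow> A i \<inter> A j = {} \<and> B i \<inter> B j = {}) \<and>
     (\<forall>i<n. \<forall>j<n. A i \<inter> B j = {} \<and> touch (A i) (B j)))"

lemma ip_singleton: "x \<in> V ==> ip {x}"
  using ipath_singleton by (auto simp: ip_def intro: exI[of _ "[x]"])

lemma ip_set: "ipath xs ==> ip (set xs)"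
  by (auto simp: ip_def)

lemma PM_I:
  assumes "finite I" "finite J" "n \<le> card I" "n \<le> card J"
    and "\<And>i. i \<in> I ==> ip (A i)" "\<And>j. j \<in> J ==> ip (B j)"
    and "\<And>i j. i \<in> I ==> j \<in> I ==> i \<noteq> j ==> A i \<inter> A j = {}"
    and "\<And>i j. i \<in> J ==> j \<in> J ==> i \<noteq> j ==> B i \<inter> B j = {}"
    and "\<And>i j. i \<in> I ==> j \<in> J ==> A i \<inter> B j = {}"
    and "\<And>i j. i \<in> I ==> j \<in> J ==> touch (A i) (B j)"
  shows "PM n"
proof -
  obtain f where f: "inj_on f {..<n}" "f ` {..<n} \<subseteq> I"
    using assms(1,3) by (metis card_le_inj card_lessThan finite_lessThan)
  obtain g where g: "inj_on g {..<n}" "g ` {..<n} \<subseteq> J"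
    using assms(2,4) by (metis card_le_inj card_lessThan finite_lessThan)
  have "\<And>i. i < n ==> f i \<in> I" "\<And>i. i < n ==> g i \<in> J"
    using f g by auto
  moreover have "\<And>i j. i < n ==> j < n ==> i \<noteq> j ==> f i \<noteq> f j" "\<And>i j. i < n ==> j < n ==> i \<noteq> j ==> g i \<noteq> g j"
    using f g by (auto simp: inj_on_def)
  ultimately show ?thesis
    unfolding PM_def using assms(5-10)
    by (intro exI[of _ "\<lambda>i. A (f i)"] exI[of _ "\<lambda>i. B (g i)"]) simp
qed

text \<open>Any \<open>n\<close> of the paths serve as one side of the model and the others as the
  second side.\<close>

lemma PM_clique:
  assumes "finite I" "2 * n \<le> card I" "\<And>i. i \<in> I ==> ip (A i)"
    and "\<And>i j. i \<in> I ==> j \<in> I ==> i \<noteq> j ==> A i \<inter> A j = {} \<and> touch (A i) (A j)"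
  shows "PM n"
proof -
  obtain J where J: "J \<subseteq> I" "card J = n" "finite J"
    using obtain_subset_with_card_n[of n I] assms(2) by auto
  have "card (I - J) = card I - n"
    using J assms(1) by (simp add: card_Diff_subset)
  then have c: "n \<le> card (I - J)" using assms(2) by simp
  show ?thesis
  proof (rule PM_I[of J "I - J" n A A])
    fix i j assume "i \<in> J" "j \<in> I - J"
    then show "A i \<inter> A j = {}" "touch (A i) (A j)"
      using assms(4)[of i j] J by auto
  next
    fix i j assume "i \<in> J" "j \<in> J" "i \<noteq> j"
    then show "A i \<inter> A j = {}" using assms(4)[of i j] J by auto
  next
    fix i j assume "i \<in> I - J" "j \<in> I - J" "i \<noteq> j"
    then show "A i \<inter> A j = {}" using assms(4)[of i j] J by auto
  qed (use J c assms(1,3) in auto)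
qed

text \<open>Paths that pairwise touch form a path model, so Ramsey's theorem leaves pairwise anticomplete ones.\<close>
lemma ramsey_anticomplete:
  assumes "\<not> PM n" "finite I" "(2 * n + q) choose (2 * n) \<le> card I" "\<And>i. i \<in> I ==> ip (A i)"
    and "\<And>i j. i \<in> I ==> j \<in> I ==> i \<noteq> j ==> A i \<inter> A j = {}"
  obtains J where "J \<subseteq> I" "card J = Suc q" "\<And>i j. i \<in> J ==> j \<in> J ==> i \<noteq> j ==> \<not> touch (A i) (A j)"
proof -
  consider J where "J \<subseteq> I" "card J = Suc (2 * n)" "pairwise (\<lambda>i j. touch (A i) (A j)) J"
    | J where "J \<subseteq> I" "card J = Suc q" "pairwise (\<lambda>i j. \<not> touch (A i) (A j)) J"
    using ramsey_binomial[OF assms(2,3), of "\<lambda>i j. touch (A i) (A j)"] touch_sym by metis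
  then show ?thesis
  proof cases
    case 1
    have "PM n"
    proof (rule PM_clique[of J n A])
      fix i j assume "i \<in> J" "j \<in> J" "i \<noteq> j"
      then show "A i \<inter> A j = {} \<and> touch (A i) (A j)"
        using 1 assms(5)[of i j] by (auto simp: pairwise_def)
    qed (use 1 assms(2,4) finite_subset in auto)
    then show ?thesis using assms(1) by simp
  next
    case 2
    then show ?thesis using that[of J] by (auto simp: pairwise_def)
  qed
qed

end

section \<open>Subdivisions as families of paths\<close>

text \<open>
  A graph \<open>F\<close> given by a list of its edges; \<open>N\<close> bounds the first coordinates of its vertices, so
  that \<open>(N + k, i)\<close> can serve as the \<open>i\<close>-th subdivision vertex of the \<open>k\<close>-th edge.
\<close>
locale edge_list =
  fixes F :: "(nat \<times> nat) pair_pre_digraph" and n :: nat and u v :: "nat => nat \<times> nat" and N :: nat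
  assumes finite_F: "finite (pverts F)"
    and arcs_F: "parcs F = (\<Union>k<n. {(u k, v k), (v k, u k)})"
    and ends_F: "k < n ==> u k \<in> pverts F \<and> v k \<in> pverts F \<and> u k \<noteq> v k"
    and edges_distinct: "k < n ==> k' < n ==> {u k, v k} = {u k', v k'} ==> k = k'"
    and fst_less: "x \<in> pverts F ==> fst x < N"
begin

definition pt :: "(nat => nat) => nat => nat => nat \<times> nat" where
  "pt m k i = (if i = 0 then u k else if i \<le> m k then (N + k, i - 1) else v k)"

definition sub :: "(nat => nat) => (nat \<times> nat) pair_pre_digraph" where
  "sub m = \<lparr> pverts = pverts F \<union> {(N + k, i) | k i. k < n \<and> i < m k},
     parcs = (\<Union>k<n. \<Union>i\<in>{..m k}. {(pt m k i, pt m k (Suc i)), (pt m k (Suc i), pt m k i)}) \<rparr>"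

lemma sub_arc_iff:
  "(x, y) \<in> parcs (sub m) \<longleftrightarrow> (\<exists>k<n. \<exists>i\<le>m k. (x = pt m k i \<and> y = pt m k (Suc i)) \<or> (x = pt m k (Suc i) \<and> y = pt m k i))"
  by (simp add: sub_def Bex_def)

lemma sub_arcI:
  assumes "k < n" "i \<le> m k"
  shows "(pt m k i, pt m k (Suc i)) \<in> parcs (sub m)" "(pt m k (Suc i), pt m k i) \<in> parcs (sub m)"
  using assms unfolding sub_arc_iff by blast+

lemma new_notin: "(N + k, i) \<notin> pverts F"
  using fst_less by force

lemma ends_neq_new:
  assumes "k < n"
  shows "u k \<noteq> (N + k', i)" "v k \<noteq> (N + k', i)" "(N + k', i) \<noteq> u k" "(N + k', i) \<noteq> v k"
  using new_notin ends_F[OF assms] by metis+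

lemma pt_0 [simp]: "pt m k 0 = u k"
  by (simp add: pt_def)

lemma pt_last [simp]: "pt m k (Suc (m k)) = v k"
  by (simp add: pt_def)

lemma pt_eq_iff:
  assumes "k < n" "k' < n" "i \<le> Suc (m k)" "j \<le> Suc (m k')"
  shows "pt m k i = pt m k' j \<longleftrightarrow> (k = k' \<and> i = j) \<or> (i = 0 \<and> j = 0 \<and> u k = u k') \<or>
    (i = 0 \<and> j = Suc (m k') \<and> u k = v k') \<or> (i = Suc (m k) \<and> j = 0 \<and> v k = u k') \<or>
    (i = Suc (m k) \<and> j = Suc (m k') \<and> v k = v k')"
  using assms ends_neq_new[OF assms(1)] ends_neq_new[OF assms(2)] ends_F[OF assms(1)] ends_F[OF assms(2)]
  unfolding pt_def by (auto simp: le_Suc_eq)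

lemma pair_graph_F: "pair_graph F"
proof
  show "finite (parcs F)" by (simp add: arcs_F)
  have "sym (parcs F)" unfolding arcs_F sym_def by blast
  then show "symmetric (with_proj F)" by (simp add: symmetric_def)
  fix e assume "e \<in> parcs F"
  then obtain k where "k < n" "e = (u k, v k) \<or> e = (v k, u k)"
    unfolding arcs_F by blast
  then show "fst e \<in> pverts F" "snd e \<in> pverts F" "fst e \<noteq> snd e"
    using ends_F[of k] by auto
qed (rule finite_F)

text \<open>Induction on the total number of subdivision vertices. Suppressing the last one on some
  edge \<open>k\<close> gives a smaller subdivision, from which one \<open>subdivide\<close> step on
  the final arc of that edge restores it.\<close>

lemma subdivision_sub: "subdivision_pair F (sub m)"
proof (induction "\<Sum>k<n. m k" arbitrary: m)
  case 0
  then have "m k = 0" if "k < n" for k using that by simp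
  then have "pverts (sub m) = pverts F" "parcs (sub m) = parcs F"
    by (auto simp: sub_def arcs_F pt_def)
  then have "sub m = F" by simp
  moreover have "pair_bidirected_digraph F"
    using pair_graph_F by (simp add: pair_graph_def pair_digraph_def pair_pseudo_graph_def pair_bidirected_digraph_def)
  ultimately show ?case by (simp add: subdivision_pair_base)
next
  case (Suc s)
  then obtain k where k: "k < n" "m k > 0"
    by (metis (no_types, lifting) gr0I lessThan_iff sum.neutral nat.distinct(1))
  define m' where "m' = m(k := m k - 1)"
  have mk: "m k = Suc (m' k)" using k by (simp add: m'_def)
  have mo: "m j = m' j" if "j \<noteq> k" for j using that by (simp add: m'_def)
  have "(\<Sum>k<n. m k) = m k + (\<Sum>j\<in>{..<n} - {k}. m j)" "(\<Sum>k<n. m' k) = m' k + (\<Sum>j\<in>{..<n} - {k}. m' j)"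
    using k by (simp_all add: sum.remove)
  moreover have "(\<Sum>j\<in>{..<n} - {k}. m j) = (\<Sum>j\<in>{..<n} - {k}. m' j)"
    by (rule sum.cong) (use mo in auto)
  ultimately have "s = (\<Sum>k<n. m' k)" using Suc.hyps(2) mk by simp
  then have IH: "subdivision_pair F (sub m')" by (rule Suc.hyps(1))
  let ?a = "pt m' k (m' k)" and ?w = "(N + k, m' k)"
  have pto: "pt m j i = pt m' j i" if "j \<noteq> k" for j i
    using mo[OF that] by (simp add: pt_def)
  have ptk: "pt m k i = pt m' k i" if "i \<le> m' k" for i
    using that mk by (simp add: pt_def)
  have ptw: "pt m k (Suc (m' k)) = ?w" "pt m k (Suc (Suc (m' k))) = v k"
    using mk by (simp_all add: pt_def)
  have av: "(?a, v k) \<in> parcs (sub m')"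
    using sub_arcI[OF k(1), of "m' k" m'] by simp
  have wn: "?w \<notin> pverts (sub m')"
    using new_notin by (auto simp: sub_def)
  have "i < m j \<longleftrightarrow> i < m' j \<or> (j = k \<and> i = m' k)" for i j
    using mk mo by (cases "j = k") auto
  then have pv: "pverts (sub m) = pverts (sub m') \<union> {?w}"
    using k(1) unfolding sub_def by auto
  \<comment> \<open>With the arcs grouped by edges of \<open>F\<close>, only the group of
    \<open>k\<close> changes.\<close>
  define B where "B m k i = {(pt m k i, pt m k (Suc i)), (pt m k (Suc i), pt m k i)}" for m k i
  define Ar where "Ar m k = (\<Union>i\<in>{..m k}. B m k i)" for m k
  have pa: "parcs (sub m) = (\<Union>k<n. Ar m k)" for m
    by (simp add: Ar_def B_def sub_def)
  have Aro: "Ar m j = Ar m' j" if "j \<noteq> k" for j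
    using pto[OF that] mo[OF that] by (simp add: Ar_def B_def)
  \<comment> \<open>The subdivided arc belongs to no other edge. If both edges are still without
    subdivision vertices, this is \<open>edges_distinct\<close>.\<close>
  have Arfree: "Ar m' j \<inter> {(?a, v k), (v k, ?a)} = {}" if j: "j \<noteq> k" "j < n" for j
  proof (rule ccontr)
    assume "\<not> ?thesis"
    then obtain i where i: "i \<le> m' j" "{pt m' j i, pt m' j (Suc i)} = {?a, pt m' k (Suc (m' k))}"
      by (auto simp: Ar_def B_def doubleton_eq_iff)
    show False
      using i j k edges_distinct[OF j(2) k(1)] ends_F[OF j(2)] ends_F[OF k(1)]
      unfolding doubleton_eq_iff by (auto simp: pt_eq_iff simp del: pt_last)
  qed
  have Ark: "Ar m k = Ar m' k - {(?a, v k), (v k, ?a)} \<union> {(?a, ?w), (?w, ?a), (?w, v k), (v k, ?w)}"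
  proof -
    have "{..m k} = {..<m' k} \<union> {m' k, Suc (m' k)}" "{..m' k} = {..<m' k} \<union> {m' k}"
      using mk by auto
    then have "Ar m k = (\<Union>i<m' k. B m k i) \<union> (B m k (m' k) \<union> B m k (Suc (m' k)))"
      and 2: "Ar m' k = (\<Union>i<m' k. B m' k i) \<union> {(?a, v k), (v k, ?a)}"
      by (auto simp: Ar_def B_def)
    moreover have "(\<Union>i<m' k. B m k i) = (\<Union>i<m' k. B m' k i)"
      using ptk by (auto simp: B_def)
    moreover have "B m k (m' k) \<union> B m k (Suc (m' k)) = {(?a, ?w), (?w, ?a), (?w, v k), (v k, ?w)}"
      using ptw ptk[of "m' k"] by (auto simp: B_def)
    ultimately have 1: "Ar m k = (\<Union>i<m' k. B m' k i) \<union> {(?a, ?w), (?w, ?a), (?w, v k), (v k, ?w)}"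
      by simp
    have 3: "(pt m' k i, pt m' k (Suc i)) \<notin> {(?a, v k), (v k, ?a)}" "(pt m' k (Suc i), pt m' k i) \<notin> {(?a, v k), (v k, ?a)}"
      if "i < m' k" for i
    proof -
      have "pt m' k i \<noteq> ?a" "pt m' k i \<noteq> v k"
        using pt_eq_iff[of k k i m' "m' k"] pt_eq_iff[of k k i m' "Suc (m' k)"] that k(1) ends_F[OF k(1)] by auto
      then show "(pt m' k i, pt m' k (Suc i)) \<notin> {(?a, v k), (v k, ?a)}" "(pt m' k (Suc i), pt m' k i) \<notin> {(?a, v k), (v k, ?a)}"
        by auto
    qed
    have "B m' k i \<inter> {(?a, v k), (v k, ?a)} = {}" if "i < m' k" for i
      using 3[OF that] unfolding B_def by blast
    then show ?thesis unfolding 1 2 by blast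
  qed
  have "parcs (sub m) = (\<Union>j\<in>{..<n} - {k}. Ar m j) \<union> Ar m k"
    unfolding pa using k by blast
  also have "\<dots> = (\<Union>j\<in>{..<n} - {k}. Ar m' j) \<union> Ar m k"
    using Aro by auto
  also have "\<dots> = ((\<Union>j\<in>{..<n} - {k}. Ar m' j) \<union> Ar m' k) - {(?a, v k), (v k, ?a)} \<union> {(?a, ?w), (?w, ?a), (?w, v k), (v k, ?w)}"
    unfolding Ark using Arfree by blast
  also have "(\<Union>j\<in>{..<n} - {k}. Ar m' j) \<union> Ar m' k = parcs (sub m')"
    unfolding pa using k by blast
  finally have "sub m = subdivide (sub m') (?a, v k) ?w"
    using pv by (intro pair_pre_digraph.equality) auto
  then show ?case
    using subdivision_pair_divide[OF av wn IH] by simp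
qed

end

section \<open>Induced copies of subdivisions and of their line graphs\<close>

context fin_graph begin

definition induces :: "'c pair_pre_digraph => bool" where
  "induces P \<longleftrightarrow> (\<exists>f. inj_on f (pverts P) \<and> f ` pverts P \<subseteq> V \<and>
     (\<forall>x\<in>pverts P. \<forall>y\<in>pverts P. E (f x) (f y) \<longleftrightarrow> (x, y) \<in> parcs P))"

definition wall_like :: "nat => bool" where
  "wall_like t \<longleftrightarrow> (\<exists>W. subdivision_pair (wall t) W \<and> (induces W \<or> induces (line_graph W)))"

text \<open>Branch vertices are represented by single vertices and edges by induced paths between
  them. The inner vertices of a path are the subdivision vertices, hence their number
  \<open>length (P k) - 2\<close>; as there is at least one, no two branch vertices are
  adjacent.\<close>

lemma induces_claw:
  assumes "edge_list F n u v N"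
    and c: "inj_on c (pverts F)" "c ` pverts F \<subseteq> V"
    and P: "\<And>k. k < n ==> ipath (P k) \<and> length (P k) \<ge> 3 \<and> hd (P k) = c (u k) \<and> last (P k) = c (v k)"
    and Pc: "\<And>k i. k < n ==> 0 < i ==> i < length (P k) - 1 ==> P k ! i \<notin> c ` pverts F"
    and PP: "\<And>k k' i j. k < n ==> k' < n ==> k \<noteq> k' ==> 0 < i ==> i < length (P k) - 1 ==> 0 < j ==> j < length (P k') - 1 ==>
        P k ! i \<noteq> P k' ! j \<and> \<not> E (P k ! i) (P k' ! j)"
    and Ec: "\<And>x y. x \<in> pverts F ==> y \<in> pverts F ==> \<not> E (c x) (c y)"
    and EPc: "\<And>k i x. k < n ==> 0 < i ==> i < length (P k) - 1 ==> x \<in> pverts F ==> E (P k ! i) (c x) ==> x = u k \<or> x = v k"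
  shows "induces (edge_list.sub F n u v N (\<lambda>k. length (P k) - 2))"
proof -
  interpret edge_list F n u v N by fact
  define m where "m k = length (P k) - 2" for k
  have len: "length (P k) = Suc (Suc (m k))" "m k \<ge> 1" if "k < n" for k
    using P[OF that] by (auto simp: m_def)
  \<comment> \<open>The new vertex \<open>(N + k, i)\<close> has position \<open>i + 1\<close> on
    its path, since position \<open>0\<close> is taken by the branch vertex.\<close>
  define f where "f x = (if x \<in> pverts F then c x else P (fst x - N) ! Suc (snd x))" for x
  have fpt: "f (pt m k i) = P k ! i" if "k < n" "i \<le> Suc (m k)" for k i
  proof -
    have "P k \<noteq> []" using len[OF that(1)] by auto
    then have "P k ! 0 = c (u k)" "P k ! Suc (m k) = c (v k)"
      using P[OF that(1)] len[OF that(1)] by (auto simp: hd_conv_nth last_conv_nth)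
    then show ?thesis
      using that ends_F[OF that(1)] new_notin by (auto simp: f_def pt_def le_Suc_eq)
  qed
  have cases: thesis
    if x_in: "x \<in> pverts (sub m)" and old: "x \<in> pverts F ==> f x = c x ==> thesis"
      and new: "\<And>k i. k < n ==> 0 < i ==> i \<le> m k ==> x = pt m k i ==> f x = P k ! i ==> x \<notin> pverts F ==> thesis" for x thesis
  proof (cases "x \<in> pverts F")
    case True then show ?thesis using old by (simp add: f_def)
  next
    case False
    then obtain k i where x: "x = (N + k, i)" "k < n" "i < m k"
      using x_in by (auto simp: sub_def)
    then have "x = pt m k (Suc i)" by (simp add: pt_def)
    then show ?thesis using new[of k "Suc i"] x fpt[of k "Suc i"] False by auto
  qed
  have E_in: "E (P k ! i) (P k ! j) \<longleftrightarrow> j = Suc i \<or> i = Suc j" if "k < n" "i \<le> Suc (m k)" "j \<le> Suc (m k)" for k i j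
    using P[OF that(1)] len[OF that(1)] that ipathD(4)[of "P k" i j] by auto
  have neq_in: "P k ! i \<noteq> P k ! j" if "k < n" "i \<le> Suc (m k)" "j \<le> Suc (m k)" "i \<noteq> j" for k i j
    using P[OF that(1)] len[OF that(1)] that ipathD(2)[of "P k"] nth_eq_iff_index_eq by fastforce
  have arc_iff: "(pt m k i, y) \<in> parcs (sub m) \<longleftrightarrow> (y = pt m k (Suc i) \<or> y = pt m k (i - 1))"
    if "k < n" "0 < i" "i \<le> m k" for k i y
  proof -
    have "(pt m k i, pt m k (Suc i)) \<in> parcs (sub m)"
      using sub_arcI that by blast
    moreover have "(pt m k i, pt m k (i - 1)) \<in> parcs (sub m)"
      using sub_arcI(2)[of k "i - 1" m] that by simp
    moreover have "y = pt m k (Suc i) \<or> y = pt m k (i - 1)" if y: "(pt m k i, y) \<in> parcs (sub m)"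
    proof -
      consider k' j where "k' < n" "j \<le> m k'" "pt m k i = pt m k' j" "y = pt m k' (Suc j)"
        | k' j where "k' < n" "j \<le> m k'" "pt m k i = pt m k' (Suc j)" "y = pt m k' j"
        using y unfolding sub_arc_iff by blast
      then show ?thesis
        by cases (use \<open>k < n\<close> \<open>0 < i\<close> \<open>i \<le> m k\<close> in \<open>auto simp: pt_eq_iff\<close>)
    qed
    ultimately show ?thesis by blast
  qed
  have sym_arcs: "(x, y) \<in> parcs (sub m) \<longleftrightarrow> (y, x) \<in> parcs (sub m)" for x y
    unfolding sub_arc_iff by blast
  have no_arc: "(x, y) \<notin> parcs (sub m)" if xy: "x \<in> pverts F" "y \<in> pverts F" for x y
  proof
    assume "(x, y) \<in> parcs (sub m)"
    then obtain k i where ki: "k < n" "i \<le> m k" "{x, y} = {pt m k i, pt m k (Suc i)}"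
      unfolding sub_arc_iff by auto
    then have "pt m k i \<in> pverts F" "pt m k (Suc i) \<in> pverts F" using xy by auto
    then show False
      using ki(1,2) len[OF ki(1)] new_notin by (auto simp: pt_def split: if_splits)
  qed
  have int_iff: "E (P k ! i) (f y) \<longleftrightarrow> (pt m k i, y) \<in> parcs (sub m)"
    if ki: "k < n" "0 < i" "i \<le> m k" and y: "y \<in> pverts (sub m)" for k i y
    using y
  proof (rule cases)
    assume yF: "y \<in> pverts F" "f y = c y"
    have "E (P k ! i) (c y) \<longleftrightarrow> (y = u k \<and> i = 1) \<or> (y = v k \<and> i = m k)"
    proof -
      have "c (u k) = P k ! 0" "c (v k) = P k ! Suc (m k)"
        using fpt[OF ki(1), of 0] fpt[OF ki(1), of "Suc (m k)"] ends_F[OF ki(1)] by (auto simp: f_def)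
      then have "E (P k ! i) (c (u k)) \<longleftrightarrow> i = 1" "E (P k ! i) (c (v k)) \<longleftrightarrow> i = m k"
        using E_in[OF ki(1), of i 0] E_in[OF ki(1), of i "Suc (m k)"] ki by auto
      then show ?thesis
        using EPc[OF ki(1,2), of y] yF ki len[OF ki(1)] ends_F[OF ki(1)] by auto
    qed
    moreover have "(y = pt m k (Suc i) \<or> y = pt m k (i - 1)) \<longleftrightarrow> (y = u k \<and> i = 1) \<or> (y = v k \<and> i = m k)"
      using yF(1) ki new_notin by (auto simp: pt_def split: if_splits)
    ultimately show ?thesis
      using arc_iff[OF ki, of y] yF by simp
  next
    fix k' j assume y': "k' < n" "0 < j" "j \<le> m k'" "y = pt m k' j" "f y = P k' ! j" "y \<notin> pverts F"
    show ?thesis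
    proof (cases "k' = k")
      case True
      then show ?thesis
        using arc_iff[OF ki, of y] y' E_in[OF ki(1), of i j] ki by (auto simp: pt_eq_iff)
    next
      case False
      then have "\<not> E (P k ! i) (P k' ! j)"
        using PP[of k k' i j] ki y' len by force
      moreover have "y \<noteq> pt m k (Suc i)" "y \<noteq> pt m k (i - 1)"
        using False ki y' by (auto simp: pt_eq_iff)
      ultimately show ?thesis
        using arc_iff[OF ki, of y] y' by simp
    qed
  qed
  show ?thesis
    unfolding induces_def m_def[symmetric]
  proof (intro exI[of _ f] conjI ballI)
    show "inj_on f (pverts (sub m))"
    proof (rule inj_onI)
      fix x y assume xy: "x \<in> pverts (sub m)" "y \<in> pverts (sub m)" "f x = f y"
      have cc: "False" if "k < n" "0 < i" "i \<le> m k" "z \<in> pverts F" "P k ! i = c z" for k i z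
        using Pc[OF that(1,2)] len[OF that(1)] that by auto
      show "x = y"
        using xy(1)
      proof (rule cases)
        assume x: "x \<in> pverts F" "f x = c x"
        show ?thesis using xy(2)
        proof (rule cases)
          assume "y \<in> pverts F" "f y = c y"
          then show ?thesis using c(1) x xy(3) by (metis inj_onD)
        next
          fix k i assume "k < n" "0 < i" "i \<le> m k" "f y = P k ! i"
          then show ?thesis using cc[of k i x] x xy(3) by auto
        qed
      next
        fix k i assume x: "k < n" "0 < i" "i \<le> m k" "x = pt m k i" "f x = P k ! i"
        show ?thesis using xy(2)
        proof (rule cases)
          assume "y \<in> pverts F" "f y = c y"
          then show ?thesis using cc[of k i y] x xy(3) by auto
        next
          fix k' j assume y: "k' < n" "0 < j" "j \<le> m k'" "y = pt m k' j" "f y = P k' ! j"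
          have "k = k'"
            using PP[of k k' i j] x y xy(3) len[of k] len[of k'] by force
          moreover then have "i = j"
            using neq_in[of k i j] x y xy(3) by fastforce
          ultimately show ?thesis using x y by simp
        qed
      qed
    qed
    show "f ` pverts (sub m) \<subseteq> V"
    proof
      fix z assume "z \<in> f ` pverts (sub m)"
      then obtain x where x: "x \<in> pverts (sub m)" "z = f x" by auto
      from x(1) show "z \<in> V"
      proof (rule cases)
        fix k i assume "k < n" "0 < i" "i \<le> m k" "f x = P k ! i"
        then show ?thesis using P[of k] len[of k] ipathD(3)[of "P k"] x(2) nth_mem[of i "P k"] by auto
      qed (use c x in auto)
    qed
    fix x y assume xy: "x \<in> pverts (sub m)" "y \<in> pverts (sub m)"
    show "E (f x) (f y) \<longleftrightarrow> (x, y) \<in> parcs (sub m)"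
      using xy(1)
    proof (rule cases)
      assume x: "x \<in> pverts F" "f x = c x"
      show ?thesis using xy(2)
      proof (rule cases)
        assume "y \<in> pverts F" "f y = c y"
        then show ?thesis using Ec x no_arc by simp
      next
        fix k i assume y: "k < n" "0 < i" "i \<le> m k" "y = pt m k i" "f y = P k ! i"
        then show ?thesis
          using int_iff[OF y(1-3) xy(1)] sym_arcs[of x y] E_sym by metis
      qed
    next
      fix k i assume x: "k < n" "0 < i" "i \<le> m k" "x = pt m k i" "f x = P k ! i"
      then show ?thesis using int_iff[OF x(1-3) xy(2)] by simp
    qed
  qed
qed

text \<open>The vertices of the line graph are the edges of the subdivision. An edge with
  \<open>m\<close> subdivision vertices thus becomes a path on \<open>m + 1\<close> vertices, and a
  branch vertex becomes a clique of path ends; this is why adjacency of different paths is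
  prescribed at common ends and nowhere else.\<close>

lemma induces_triangle:
  assumes "edge_list F n u v N"
    and P: "\<And>k. k < n ==> ipath (P k)"
    and dj: "\<And>k k'. k < n ==> k' < n ==> k \<noteq> k' ==> set (P k) \<inter> set (P k') = {}"
    and PP: "\<And>k k' i j. k < n ==> k' < n ==> k \<noteq> k' ==> i < length (P k) ==> j < length (P k') ==>
        E (P k ! i) (P k' ! j) \<longleftrightarrow> (i = 0 \<and> j = 0 \<and> u k = u k') \<or> (i = 0 \<and> j = length (P k') - 1 \<and> u k = v k') \<or>
          (i = length (P k) - 1 \<and> j = 0 \<and> v k = u k') \<or> (i = length (P k) - 1 \<and> j = length (P k') - 1 \<and> v k = v k')"
  shows "induces (line_graph (edge_list.sub F n u v N (\<lambda>k. length (P k) - 1)))"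
proof -
  interpret edge_list F n u v N by fact
  define m where "m k = length (P k) - 1" for k
  have len: "length (P k) = Suc (m k)" if "k < n" for k
    using P[OF that] ipathD(1)[of "P k"] by (auto simp: m_def)
  define ed where "ed k i = {pt m k i, pt m k (Suc i)}" for k i
  have ed_verts: "{{x, y} | x y. (x, y) \<in> parcs (sub m)} = {ed k i | k i. k < n \<and> i \<le> m k}"
  proof (intro equalityI subsetI)
    fix e assume "e \<in> {{x, y} | x y. (x, y) \<in> parcs (sub m)}"
    then obtain x y where xy: "e = {x, y}" "(x, y) \<in> parcs (sub m)" by blast
    from xy(2) obtain k i where ki: "k < n" "i \<le> m k"
        "(x = pt m k i \<and> y = pt m k (Suc i)) \<or> (x = pt m k (Suc i) \<and> y = pt m k i)"
      unfolding sub_arc_iff by blast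
    then have "{x, y} = ed k i" by (auto simp: ed_def)
    with ki(1,2) show "e \<in> {ed k i | k i. k < n \<and> i \<le> m k}" using xy(1) by blast
  next
    fix e assume "e \<in> {ed k i | k i. k < n \<and> i \<le> m k}"
    then show "e \<in> {{x, y} | x y. (x, y) \<in> parcs (sub m)}"
      using sub_arcI(1) unfolding ed_def by blast
  qed
  have ed_eq: "k = k' \<and> i = j" if "ed k i = ed k' j" "k < n" "k' < n" "i \<le> m k" "j \<le> m k'" for k k' i j
    using that ends_F[OF that(2)] ends_F[OF that(3)] edges_distinct[OF that(2,3)]
    unfolding ed_def doubleton_eq_iff by (auto simp: pt_eq_iff)
  have ed_int: "ed k i \<inter> ed k' j \<noteq> {} \<longleftrightarrow> E (P k ! i) (P k' ! j)"
    if "k < n" "k' < n" "i \<le> m k" "j \<le> m k'" "ed k i \<noteq> ed k' j" for k k' i j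
  proof -
    have *: "ed k i \<inter> ed k' j \<noteq> {} \<longleftrightarrow> pt m k i = pt m k' j \<or> pt m k i = pt m k' (Suc j) \<or> pt m k (Suc i) = pt m k' j \<or> pt m k (Suc i) = pt m k' (Suc j)"
      by (auto simp: ed_def)
    show ?thesis
    proof (cases "k = k'")
      case True
      then have "i \<noteq> j" using that by auto
      then show ?thesis
        using True that ends_F[OF that(1)] len[OF that(1)] ipathD(4)[OF P[OF that(1)], of i j]
        unfolding * by (auto simp: pt_eq_iff)
    next
      case False
      then show ?thesis
        using that len[of k] len[of k'] PP[OF that(1,2) False, of i j]
        unfolding * by (auto simp: pt_eq_iff)
    qed
  qed
  \<comment> \<open>By \<open>ed_eq\<close> an edge of the subdivision has only one place
    \<open>(k, i)\<close>, so the choice recovers it.\<close>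
  define g where "g e = (SOME (k, i). k < n \<and> i \<le> m k \<and> e = ed k i)" for e
  have g: "g (ed k i) = (k, i)" if "k < n" "i \<le> m k" for k i
    unfolding g_def
  proof (rule some_equality)
    fix x assume "case x of (k', j) => k' < n \<and> j \<le> m k' \<and> ed k i = ed k' j"
    then show "x = (k, i)"
      using ed_eq[of k i "fst x" "snd x"] that by (cases x) auto
  qed (use that in simp)
  define f where "f e = P (fst (g e)) ! snd (g e)" for e
  have f: "f (ed k i) = P k ! i" if "k < n" "i \<le> m k" for k i
    using g[OF that] by (simp add: f_def)
  let ?L = "line_graph (sub m)"
  have pv: "pverts ?L = {ed k i | k i. k < n \<and> i \<le> m k}"
    using ed_verts by (simp add: line_graph_def Let_def)
  have pa: "(e, e') \<in> parcs ?L \<longleftrightarrow> e \<in> pverts ?L \<and> e' \<in> pverts ?L \<and> e \<noteq> e' \<and> e \<inter> e' \<noteq> {}" for e e'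
    by (auto simp: line_graph_def Let_def)
  show ?thesis
    unfolding induces_def m_def[symmetric]
  proof (intro exI[of _ f] conjI ballI)
    show "inj_on f (pverts ?L)"
    proof (rule inj_onI)
      fix e e' assume "e \<in> pverts ?L" "e' \<in> pverts ?L" and eq: "f e = f e'"
      then obtain k i k' j where k: "k < n" "i \<le> m k" "e = ed k i" and k': "k' < n" "j \<le> m k'" "e' = ed k' j"
        unfolding pv by blast
      have "P k ! i = P k' ! j" using eq f k k' by simp
      moreover have "P k ! i \<in> set (P k)" "P k' ! j \<in> set (P k')" using k k' len by auto
      ultimately have "k = k'" using dj[OF k(1) k'(1)] by auto
      moreover then have "i = j"
        using \<open>P k ! i = P k' ! j\<close> ipathD(2)[OF P[OF k(1)]] len[OF k(1)] k k' by (auto simp: nth_eq_iff_index_eq)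
      ultimately show "e = e'" using k k' by simp
    qed
    show "f ` pverts ?L \<subseteq> V"
      unfolding pv using f ipathD(3)[OF P] len by (auto simp: subset_iff)
    fix e e' assume e: "e \<in> pverts ?L" "e' \<in> pverts ?L"
    then obtain k i k' j where k: "k < n" "i \<le> m k" "e = ed k i" and k': "k' < n" "j \<le> m k'" "e' = ed k' j"
      unfolding pv by blast
    show "E (f e) (f e') \<longleftrightarrow> (e, e') \<in> parcs ?L"
    proof (cases "e = e'")
      case True
      then show ?thesis using E_irrefl pa by simp
    next
      case False
      then show ?thesis
        using ed_int[of k k' i j] pa[of e e'] e f k k' by simp
    qed
  qed
qed

end

section \<open>The staircase wall\<close>

text \<open>
  The wall is drawn on rows and connectors between consecutive rows so that every branch vertex lies at
  the lower end of a connector: the vertex \<open>(a, b)\<close> uses its row to the left and to the right and the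
  connector upwards. An edge then runs along one row only, and ends in at most one connector.
\<close>

definition nodes :: "nat => (nat \<times> nat) set" where
  "nodes t = {..<t} \<times> {..<2 * t}"

text \<open>Steps to the right alternately keep the drawn row and lower it by one, while a vertical
  edge raises it by one. The offset \<open>2 * t\<close> keeps the truncating subtraction
  exact.\<close>

definition row :: "nat => nat \<times> nat => nat" where
  "row t x = 2 * t + 2 * fst x - (fst x + snd x + 1) div 2"

text \<open>Column by column, and upwards within a column: the order in which the nodes are met
  along the drawn rows from left to right.\<close>

definition region :: "nat => nat \<times> nat => nat" where
  "region t x = snd x * t + fst x"

definition vert_edge :: "(nat \<times> nat) \<times> (nat \<times> nat) => bool" where
  "vert_edge e \<longleftrightarrow> fst (snd e) = Suc (fst (fst e))"

text \<open>A horizontal edge whose right end is drawn one row lower; it arrives there through the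
  connector of that end.\<close>

definition down_edge :: "(nat \<times> nat) \<times> (nat \<times> nat) => bool" where
  "down_edge e \<longleftrightarrow> \<not> vert_edge e \<and> even (fst (fst e) + snd (fst e))"

definition wall_edges :: "nat => ((nat \<times> nat) \<times> (nat \<times> nat)) set" where
  "wall_edges t = {e. fst e \<in> nodes t \<and> snd e \<in> nodes t \<and>
     ((fst (snd e) = fst (fst e) \<and> snd (snd e) = Suc (snd (fst e))) \<or>
      (fst (snd e) = Suc (fst (fst e)) \<and> snd (snd e) = snd (fst e) \<and> even (fst (fst e) + snd (fst e))))}"

text \<open>The upper one of the rows of the two ends; the edge runs along it, and a lower end is
  reached through the connector of that end.\<close>

definition edge_row :: "nat => (nat \<times> nat) \<times> (nat \<times> nat) => nat" where
  "edge_row t e = (if vert_edge e then row t (snd e) else row t (fst e))"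

lemma region_le_iff:
  assumes "x \<in> nodes t" "y \<in> nodes t"
  shows "region t x \<le> region t y \<longleftrightarrow> snd x < snd y \<or> snd x = snd y \<and> fst x \<le> fst y"
proof -
  have less: "b * t + a < b' * t + a'" if "b < b'" "a < t" for a b a' b' :: nat
  proof -
    have "Suc b * t \<le> b' * t" using that by (intro mult_le_mono1) simp
    then show ?thesis using that by simp
  qed
  have t: "fst x < t" "fst y < t" using assms by (auto simp: nodes_def)
  consider "snd x < snd y" | "snd x = snd y" | "snd y < snd x" by linarith
  then show ?thesis
    unfolding region_def
    by cases (use less[of "snd x" "snd y" "fst x" "fst y"] less[of "snd y" "snd x" "fst y" "fst x"] t in auto)
qed

lemma region_inj: "x \<in> nodes t ==> y \<in> nodes t ==> region t x = region t y ==> x = y"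
  using region_le_iff[of x t y] region_le_iff[of y t x] by (auto simp: prod_eq_iff)

lemma row_less: "x \<in> nodes t ==> row t x < 4 * t"
  by (auto simp: nodes_def row_def)

lemma row_sub: "x \<in> nodes t ==> (fst x + snd x + 1) div 2 \<le> 2 * t + 2 * fst x"
  by (auto simp: nodes_def)

lemma edge_rows:
  assumes "e \<in> wall_edges t"
  shows "row t (fst e) = (if vert_edge e then edge_row t e - 1 else edge_row t e)"
    "row t (snd e) = (if down_edge e then edge_row t e - 1 else edge_row t e)"
    "vert_edge e \<or> down_edge e ==> edge_row t e \<ge> 1"
proof -
  obtain a b c d where e: "e = ((a, b), (c, d))" by (metis prod.collapse)
  have N: "(a, b) \<in> nodes t" "(c, d) \<in> nodes t" using assms e by (auto simp: wall_edges_def)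
  have cases: "(c = a \<and> d = Suc b) \<or> (c = Suc a \<and> d = b \<and> even (a + b))"
    using assms e by (auto simp: wall_edges_def)
  note defs = e vert_edge_def down_edge_def edge_row_def row_def
  note s = row_sub[OF N(1)] row_sub[OF N(2)]
  have lt: "a < t" "b < 2 * t" "c < t" "d < 2 * t" using N by (auto simp: nodes_def)
  show "row t (fst e) = (if vert_edge e then edge_row t e - 1 else edge_row t e)"
    "row t (snd e) = (if down_edge e then edge_row t e - 1 else edge_row t e)"
    "vert_edge e \<or> down_edge e ==> edge_row t e \<ge> 1"
    using cases s lt by (auto simp: defs)
qed

lemma edge_region_less:
  assumes "e \<in> wall_edges t"
  shows "region t (fst e) < region t (snd e)"
proof -
  have N: "fst e \<in> nodes t" "snd e \<in> nodes t" using assms by (auto simp: wall_edges_def)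
  have "\<not> region t (snd e) \<le> region t (fst e)"
    unfolding region_le_iff[OF N(2) N(1)] using assms by (auto simp: wall_edges_def)
  then show ?thesis by simp
qed

text \<open>The nodes whose connectors meet a row are those drawn on it or just below it. An edge
  joins equal or adjacent columns of the wall, and the rounding in \<open>row\<close> leaves no
  third such node between its ends, so its stretch of the row is undisturbed.\<close>

lemma no_node_between:
  assumes e: "e \<in> wall_edges t" and z: "z \<in> nodes t"
    and r: "row t z = edge_row t e \<or> Suc (row t z) = edge_row t e"
    and b: "region t (fst e) \<le> region t z" "region t z \<le> region t (snd e)"
  shows "z = fst e \<or> z = snd e"
proof -
  obtain a b c d where ev: "e = ((a, b), (c, d))" by (metis prod.collapse)
  obtain p q where zv: "z = (p, q)" by (metis prod.collapse)
  have N: "(a, b) \<in> nodes t" "(c, d) \<in> nodes t" using e ev by (auto simp: wall_edges_def)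
  have cases: "(c = a \<and> d = Suc b) \<or> (c = Suc a \<and> d = b \<and> even (a + b))"
    using e ev by (auto simp: wall_edges_def)
  note s = row_sub[OF N(1)] row_sub[OF N(2)] row_sub[OF z]
  have l: "b < q \<or> b = q \<and> a \<le> p" "q < d \<or> q = d \<and> p \<le> c"
    using assms(4,5) region_le_iff[of "(a, b)" t z] region_le_iff[of z t "(c, d)"] N z ev zv by auto
  from cases show ?thesis
  proof
    assume h: "c = a \<and> d = Suc b"
    have nv: "\<not> vert_edge e" using h by (simp add: ev vert_edge_def)
    then have rr: "row t z = row t (a, b) \<or> Suc (row t z) = row t (a, b)"
      using r by (simp add: edge_row_def ev)
    define m n where "m = (p + q + 1) div 2" and "n = (a + b + 1) div 2"
    have mn: "row t z + m = 2 * t + 2 * p" "row t (a, b) + n = 2 * t + 2 * a"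
      using s by (auto simp: row_def zv m_def n_def)
    have half: "2 * m \<le> p + q + 1" "p + q \<le> 2 * m" "2 * n \<le> a + b + 1" "a + b \<le> 2 * n"
      by (auto simp: m_def n_def)
    from l h consider "q = b" "a \<le> p" | "q = Suc b" "p \<le> a" by linarith
    then show ?thesis
    proof cases
      case 1
      have "p = a"
        using rr mn half 1 by linarith
      then show ?thesis using 1 by (simp add: ev zv)
    next
      case 2
      have "p = a"
        using rr mn half 2 by linarith
      then show ?thesis using 2 h by (simp add: ev zv)
    qed
  next
    assume "c = Suc a \<and> d = b \<and> even (a + b)"
    then show ?thesis using l by (auto simp: ev zv)
  qed
qed

text \<open>Overlapping stretches would put an end of one edge between the ends of the other. By
  \<open>no_node_between\<close> this forces both the left and the right ends to coincide.\<close>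

lemma same_row_edges:
  assumes e: "e \<in> wall_edges t" and f: "f \<in> wall_edges t" and "e \<noteq> f" "edge_row t e = edge_row t f"
  shows "region t (snd e) \<le> region t (fst f) \<or> region t (snd f) \<le> region t (fst e)"
proof (rule ccontr)
  assume "\<not> ?thesis"
  then have o: "region t (fst f) < region t (snd e)" "region t (fst e) < region t (snd f)" by auto
  have N: "fst e \<in> nodes t" "snd e \<in> nodes t" "fst f \<in> nodes t" "snd f \<in> nodes t"
    using e f by (auto simp: wall_edges_def)
  have rows: "row t z = edge_row t g \<or> Suc (row t z) = edge_row t g"
    if "g \<in> wall_edges t" "z = fst g \<or> z = snd g" for g z
    using edge_rows[OF that(1)] that(2) by (auto split: if_splits)
  have "fst e = fst f"
  proof (cases "region t (fst e) \<le> region t (fst f)")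
    case True
    then have "fst f = fst e \<or> fst f = snd e"
      using no_node_between[OF e N(3)] rows[OF f, of "fst f"] assms(4) o by auto
    then show ?thesis using o by auto
  next
    case False
    then have "fst e = fst f \<or> fst e = snd f"
      using no_node_between[OF f N(1)] rows[OF e, of "fst e"] assms(4) o by auto
    then show ?thesis using o by auto
  qed
  moreover have "snd e = snd f"
  proof (cases "region t (snd e) \<le> region t (snd f)")
    case True
    then have "snd e = fst f \<or> snd e = snd f"
      using no_node_between[OF f N(2)] rows[OF e, of "snd e"] assms(4) o by auto
    then show ?thesis using o by auto
  next
    case False
    then have "snd f = fst e \<or> snd f = snd e"
      using no_node_between[OF e N(4)] rows[OF f, of "snd f"] assms(4) o by auto
    then show ?thesis using o by auto
  qed
  ultimately show False using assms(3) by (simp add: prod_eq_iff)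
qed

text \<open>A connector serves at most one edge: a vertical edge leaves upwards from a node with
  even coordinate sum, a down edge arrives at a node with odd sum.\<close>

lemma vert_down_ends:
  assumes "e \<in> wall_edges t" "f \<in> wall_edges t"
  shows "vert_edge e ==> vert_edge f ==> fst e = fst f ==> e = f"
    "down_edge e ==> down_edge f ==> snd e = snd f ==> e = f"
    "vert_edge e ==> down_edge f ==> fst e \<noteq> snd f"
  using assms by (auto simp: wall_edges_def vert_edge_def down_edge_def prod_eq_iff)

text \<open>Vertices of degree one are missing from the wall, so only edges with both ends left are
  listed. Directing them towards the larger \<open>region\<close> makes every undirected edge occur
  once.\<close>

lemma wall_edge_list:
  obtains e n where "bij_betw e {..<n} {g \<in> wall_edges t. fst g \<in> pverts (wall t) \<and> snd g \<in> pverts (wall t)}"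
    "edge_list (wall t) n (\<lambda>k. fst (e k)) (\<lambda>k. snd (e k)) t" "pverts (wall t) \<subseteq> nodes t"
proof -
  let ?V = "pverts (wall t)"
  let ?G = "{g \<in> wall_edges t. fst g \<in> ?V \<and> snd g \<in> ?V}"
  have VN: "?V \<subseteq> nodes t" "parcs (wall t) = parcs (wall_grid t) \<inter> ?V \<times> ?V"
    by (simp_all add: wall_def Let_def) (auto simp: wall_grid_def nodes_def Let_def)
  have finN: "finite (nodes t)" by (simp add: nodes_def)
  have "finite (wall_edges t)"
    by (rule finite_subset[of _ "nodes t \<times> nodes t"]) (use finN in \<open>auto simp: wall_edges_def\<close>)
  then have "finite ?G" by simp
  from ex_bij_betw_nat_finite[OF this] obtain e where e': "bij_betw e {..<card ?G} ?G"
    unfolding atLeast0LessThan by (elim exE)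
  define n where "n = card ?G"
  have e: "bij_betw e {..<n} ?G" using e' by (simp only: n_def)
  have E: "(x, y) \<in> {((i, j), (i, Suc j)) | i j. True} \<union> {((i, j), (Suc i, j)) | i j. even (i + j)}
      \<longleftrightarrow> (fst y = fst x \<and> snd y = Suc (snd x)) \<or> (fst y = Suc (fst x) \<and> snd y = snd x \<and> even (fst x + snd x))" for x y :: "nat \<times> nat"
    by (cases x; cases y) auto
  have grid: "(x, y) \<in> parcs (wall_grid t) \<longleftrightarrow> (x, y) \<in> wall_edges t \<or> (y, x) \<in> wall_edges t" for x y
  proof -
    have "(x, y) \<in> parcs (wall_grid t) \<longleftrightarrow> x \<in> nodes t \<and> y \<in> nodes t \<and>
      ((x, y) \<in> {((i, j), (i, Suc j)) | i j. True} \<union> {((i, j), (Suc i, j)) | i j. even (i + j)} \<or>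
       (y, x) \<in> {((i, j), (i, Suc j)) | i j. True} \<union> {((i, j), (Suc i, j)) | i j. even (i + j)})"
      unfolding wall_grid_def nodes_def Let_def pair_pre_digraph.simps Int_iff Un_iff converse_iff mem_Sigma_iff by blast
    then show ?thesis unfolding E by (auto simp: wall_edges_def)
  qed
  have arcs: "parcs (wall t) = ?G \<union> ?G\<inverse>"
  proof (rule set_eqI)
    fix e show "e \<in> parcs (wall t) \<longleftrightarrow> e \<in> ?G \<union> ?G\<inverse>"
      using grid[of "fst e" "snd e"] VN(2) by (cases e) auto
  qed
  have img: "e ` {..<n} = ?G" using e by (simp add: bij_betw_def)
  have eG: "e k \<in> wall_edges t \<and> fst (e k) \<in> ?V \<and> snd (e k) \<in> ?V" if "k < n" for k
    using img that by auto
  have "edge_list (wall t) (n) (\<lambda>k. fst (e k)) (\<lambda>k. snd (e k)) t"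
  proof
    show "finite ?V" using VN(1) finN by (rule finite_subset)
    have "?G\<inverse> = (\<lambda>k. (snd (e k), fst (e k))) ` {..<n}"
      unfolding img[symmetric]
    proof (rule set_eqI)
      fix x :: "(nat \<times> nat) \<times> (nat \<times> nat)"
      obtain p q where x: "x = (p, q)" by (cases x)
      have "x \<in> (e ` {..<n})\<inverse> \<longleftrightarrow> (\<exists>k<n. e k = (q, p))"
        unfolding x image_iff converse_iff Bex_def lessThan_iff by metis
      also have "\<dots> \<longleftrightarrow> x \<in> (\<lambda>k. (snd (e k), fst (e k))) ` {..<n}"
        unfolding x image_iff Bex_def lessThan_iff by (metis fst_conv snd_conv prod.collapse)
      finally show "x \<in> (e ` {..<n})\<inverse> \<longleftrightarrow> x \<in> (\<lambda>k. (snd (e k), fst (e k))) ` {..<n}" .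
    qed
    then have "parcs (wall t) = (\<Union>k<n. {e k, (snd (e k), fst (e k))})"
      unfolding arcs using img by blast
    then show "parcs (wall t) = (\<Union>k<n. {(fst (e k), snd (e k)), (snd (e k), fst (e k))})"
      by simp
    show "fst (e k) \<in> ?V \<and> snd (e k) \<in> ?V \<and> fst (e k) \<noteq> snd (e k)" if "k < n" for k
      using eG[OF that] by (auto simp: wall_edges_def)
    show "fst x < t" if "x \<in> ?V" for x using VN(1) that by (auto simp: nodes_def)
    fix k k' assume k: "k < n" "k' < n" "{fst (e k), snd (e k)} = {fst (e k'), snd (e k')}"
    have "region t (fst (e k)) < region t (snd (e k))" "region t (fst (e k')) < region t (snd (e k'))"
      using eG k edge_region_less by auto
    then have "fst (e k) = fst (e k') \<and> snd (e k) = snd (e k')"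
      using k(3) unfolding doubleton_eq_iff by (metis less_asym)
    then have "e k = e k'" by (simp add: prod_eq_iff)
    then show "k = k'" using e k by (auto simp: bij_betw_def inj_on_def)
  qed
  then show thesis using that[OF e] VN(1) by blast
qed

context fin_graph begin

lemma ipath_extend:
  assumes xs: "ipath xs" and ab: "a \<in> V" "b \<in> V" "a \<noteq> b" "\<not> E a b" "a \<notin> set xs" "b \<notin> set xs"
    and a: "\<And>i. i < length xs ==> E (xs ! i) a \<longleftrightarrow> i = 0"
    and b: "\<And>i. i < length xs ==> E (xs ! i) b \<longleftrightarrow> i = length xs - 1"
  shows "ipath (a # xs @ [b])"
proof -
  have 1: "ipath (xs @ [b])"
    unfolding ipath_def
  proof (intro conjI allI impI)
    fix i j assume ij: "i < length (xs @ [b])" "j < length (xs @ [b])"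
    have "b \<noteq> xs ! i" if "i < length xs" for i using ab(6) that by auto
    then show "E ((xs @ [b]) ! i) ((xs @ [b]) ! j) \<longleftrightarrow> j = Suc i \<or> i = Suc j"
      using ij ipathD(4)[OF xs, of i j] b[of i] b[of j] E_sym E_irrefl[of b] ipathD(1)[OF xs]
      by (cases "i < length xs"; cases "j < length xs") (auto simp: nth_append less_Suc_eq)
  qed (use xs ab in \<open>auto simp: ipath_def\<close>)
  let ?ys = "xs @ [b]"
  have ne: "xs \<noteq> []" using xs by (rule ipathD)
  have a': "E (?ys ! i) a \<longleftrightarrow> i = 0" if "i < length ?ys" for i
    using that a[of i] ab E_sym ne by (cases "i < length xs") (auto simp: nth_append less_Suc_eq)
  show ?thesis
    unfolding ipath_def
  proof (intro conjI allI impI)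
    fix i j assume ij: "i < length (a # ?ys)" "j < length (a # ?ys)"
    show "E ((a # ?ys) ! i) ((a # ?ys) ! j) \<longleftrightarrow> j = Suc i \<or> i = Suc j"
    proof (cases i)
      case 0
      then show ?thesis
        using ij a'[of "j - 1"] E_sym E_irrefl[of a] by (cases j) auto
    next
      case (Suc i')
      then show ?thesis
        using ij a'[of i'] ipathD(4)[OF 1, of i' "j - 1"] by (cases j) auto
    qed
  qed (use 1 ab in \<open>auto simp: ipath_def\<close>)
qed

lemma seg_anti_row:
  assumes "ipath xs" "p < length xs" "q < length xs" "xs ! p = xs ! q \<or> E (xs ! p) (xs ! q)"
  shows "p \<le> Suc q \<and> q \<le> Suc p"
  using assms ipathD(4)[OF assms(1-3)] ipathD(2)[OF assms(1)] by (auto simp: nth_eq_iff_index_eq)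

end

section \<open>Carriers of the wall edges in an induced drawing\<close>

locale staircase = fin_graph V E for V :: "'a set" and E +
  fixes t :: nat and \<rho> :: "nat => 'a list" and \<kappa> :: "nat \<times> nat => 'a list"
  assumes rows: "r \<le> 4 * t ==> ipath (\<rho> r)"
    and rows_anti: "r \<le> 4 * t ==> r' \<le> 4 * t ==> r \<noteq> r' ==> \<not> touch (set (\<rho> r)) (set (\<rho> r'))"
    and connectors: "x \<in> nodes t ==> ipath (\<kappa> x)"
    and connector_rows: "x \<in> nodes t ==> r \<le> 4 * t ==> set (\<kappa> x) \<inter> set (\<rho> r) = {}"
    and connector_touch: "x \<in> nodes t ==> r \<le> 4 * t ==> i < length (\<kappa> x) ==> p < length (\<rho> r) ==> E (\<kappa> x ! i) (\<rho> r ! p) ==>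
        (r = row t x \<and> i = 0) \<or> (r = Suc (row t x) \<and> i = length (\<kappa> x) - 1)"
    and connector_low: "x \<in> nodes t ==> \<exists>p<length (\<rho> (row t x)). E (hd (\<kappa> x)) (\<rho> (row t x) ! p)"
    and connector_up: "x \<in> nodes t ==> \<exists>p<length (\<rho> (Suc (row t x))). E (last (\<kappa> x)) (\<rho> (Suc (row t x)) ! p)"
    and connectors_anti: "x \<in> nodes t ==> y \<in> nodes t ==> x \<noteq> y ==> \<not> touch (set (\<kappa> x)) (set (\<kappa> y))"
    and ordered: "x \<in> nodes t ==> y \<in> nodes t ==> region t x < region t y ==> r \<le> 4 * t ==>
        w \<in> set (\<kappa> x) ==> w' \<in> set (\<kappa> y) ==> p < length (\<rho> r) ==> p' < length (\<rho> r) ==>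
        E w (\<rho> r ! p) ==> E w' (\<rho> r ! p') ==> Suc p < p'"
begin

definition touched :: "nat \<times> nat => nat => nat set" where
  "touched x r = {p. p < length (\<rho> r) \<and> (\<exists>w\<in>set (\<kappa> x). E w (\<rho> r ! p))}"

definition lo where "lo x = Min (touched x (row t x))"
definition hi where "hi x = Max (touched x (row t x))"
definition ulo where "ulo x = Min (touched x (Suc (row t x)))"
definition uhi where "uhi x = Max (touched x (Suc (row t x)))"

lemma finite_touched [simp]: "finite (touched x r)"
  by (simp add: touched_def)

lemma row_le: "x \<in> nodes t ==> row t x \<le> 4 * t" "x \<in> nodes t ==> Suc (row t x) \<le> 4 * t"
  using row_less[of x t] by auto

lemma kappa_ne: "x \<in> nodes t ==> \<kappa> x \<noteq> []"
  using connectors ipathD(1) by blast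

lemma touched_ne: "x \<in> nodes t ==> touched x (row t x) \<noteq> {}" "x \<in> nodes t ==> touched x (Suc (row t x)) \<noteq> {}"
  unfolding touched_def
  using connector_low[of x] connector_up[of x] hd_in_set[OF kappa_ne[of x]] last_in_set[OF kappa_ne[of x]] by blast+

lemma lo_in: "x \<in> nodes t ==> lo x \<in> touched x (row t x)"
  and hi_in: "x \<in> nodes t ==> hi x \<in> touched x (row t x)"
  and ulo_in: "x \<in> nodes t ==> ulo x \<in> touched x (Suc (row t x))"
  and uhi_in: "x \<in> nodes t ==> uhi x \<in> touched x (Suc (row t x))"
  using touched_ne unfolding lo_def hi_def ulo_def uhi_def by simp_all

lemma lo_le: "p \<in> touched x (row t x) ==> lo x \<le> p"
  and hi_ge: "p \<in> touched x (row t x) ==> p \<le> hi x"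
  and ulo_le: "p \<in> touched x (Suc (row t x)) ==> ulo x \<le> p"
  and uhi_ge: "p \<in> touched x (Suc (row t x)) ==> p \<le> uhi x"
  unfolding lo_def hi_def ulo_def uhi_def by simp_all

lemma lo_le_hi: "x \<in> nodes t ==> lo x \<le> hi x"
  using lo_le hi_in by blast

lemma touched_row:
  assumes "x \<in> nodes t" "r \<le> 4 * t" "p \<in> touched x r"
  shows "r = row t x \<or> r = Suc (row t x)"
  using assms connector_touch[of x r _ p] by (auto simp: touched_def in_set_conv_nth)

lemma touched_hd:
  assumes x: "x \<in> nodes t" and "w \<in> set (\<kappa> x)" "p < length (\<rho> (row t x))" "E w (\<rho> (row t x) ! p)"
  shows "w = hd (\<kappa> x)"
  using assms connector_touch[OF x row_le(1)[OF x], of _ p] kappa_ne[OF x] by (auto simp: in_set_conv_nth hd_conv_nth)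

lemma touched_last:
  assumes x: "x \<in> nodes t" and "w \<in> set (\<kappa> x)" "p < length (\<rho> (Suc (row t x)))" "E w (\<rho> (Suc (row t x)) ! p)"
  shows "w = last (\<kappa> x)"
  using assms connector_touch[OF x row_le(2)[OF x], of _ p] kappa_ne[OF x] by (auto simp: in_set_conv_nth last_conv_nth)

lemma touched_order:
  assumes "x \<in> nodes t" "y \<in> nodes t" "region t x < region t y" "r \<le> 4 * t" "p \<in> touched x r" "q \<in> touched y r"
  shows "Suc p < q"
  using assms ordered[OF assms(1-4)] by (auto simp: touched_def)

lemma E_hd_lo: "x \<in> nodes t ==> E (hd (\<kappa> x)) (\<rho> (row t x) ! lo x)"
  using lo_in[of x] touched_hd[of x _ "lo x"] by (auto simp: touched_def)

lemma E_hd_hi: "x \<in> nodes t ==> E (hd (\<kappa> x)) (\<rho> (row t x) ! hi x)"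
  using hi_in[of x] touched_hd[of x _ "hi x"] by (auto simp: touched_def)

lemma E_last_ulo: "x \<in> nodes t ==> E (last (\<kappa> x)) (\<rho> (Suc (row t x)) ! ulo x)"
  using ulo_in[of x] touched_last[of x _ "ulo x"] by (auto simp: touched_def)

lemma E_last_uhi: "x \<in> nodes t ==> E (last (\<kappa> x)) (\<rho> (Suc (row t x)) ! uhi x)"
  using uhi_in[of x] touched_last[of x _ "uhi x"] by (auto simp: touched_def)

end

text \<open>
  \<open>Lp\<close> and \<open>Rp\<close> are the positions where the left and right edges at a node start on its row,
  and \<open>Ut\<close> is the part of the connector that belongs to the upward edge.
\<close>
locale ports = staircase V E t \<rho> \<kappa> for V :: "'a set" and E t \<rho> \<kappa> +
  fixes Lp Rp :: "nat \<times> nat => nat" and Ut :: "nat \<times> nat => 'a set"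
  assumes Lp: "x \<in> nodes t ==> Lp x \<le> lo x \<and> lo x \<le> Suc (Lp x)"
    and Rp: "x \<in> nodes t ==> hi x \<le> Rp x \<and> Rp x \<le> Suc (hi x)"
    and LR: "x \<in> nodes t ==> Lp x < Rp x"
    and Ut: "x \<in> nodes t ==> Ut x = set (\<kappa> x) \<or> Ut x = set (tl (\<kappa> x))"
begin

text \<open>The set \<open>S e\<close> carries the edge \<open>e\<close>: the stretch of its row
  from \<open>al e\<close> to \<open>be e\<close>, extended by the part \<open>Te e\<close> of a
  connector if the edge uses one. Two carriers will be seen to have contact only between the
  vertices \<open>port z e\<close> at a common end \<open>z\<close>.\<close>

definition al where "al e = (if vert_edge e then uhi (fst e) else Rp (fst e))"
definition be where "be e = (if down_edge e then ulo (snd e) else Lp (snd e))"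
definition Te where "Te e = (if vert_edge e then Ut (fst e) else if down_edge e then Ut (snd e) else {})"
definition S where "S e = seg (\<rho> (edge_row t e)) (al e) (be e) \<union> Te e"
definition port where
  "port z e = (if vert_edge e \<and> z = fst e \<or> down_edge e \<and> z = snd e then hd (\<kappa> z)
     else if z = snd e then \<rho> (row t z) ! Lp z else \<rho> (row t z) ! Rp z)"

lemma ends: "e \<in> wall_edges t ==> fst e \<in> nodes t \<and> snd e \<in> nodes t"
  by (auto simp: wall_edges_def)

lemma vert_not_down: "vert_edge e ==> \<not> down_edge e"
  by (simp add: down_edge_def)

lemma edge_row_le: "e \<in> wall_edges t ==> edge_row t e \<le> 4 * t"
  using ends row_le by (auto simp: edge_row_def)

lemma rows_of:
  assumes "e \<in> wall_edges t"
  shows "vert_edge e ==> edge_row t e = Suc (row t (fst e))" "\<not> vert_edge e ==> edge_row t e = row t (fst e)"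
    "down_edge e ==> edge_row t e = Suc (row t (snd e))" "\<not> down_edge e ==> edge_row t e = row t (snd e)"
  using edge_rows[OF assms] by auto

lemma Ut_subset: "x \<in> nodes t ==> Ut x \<subseteq> set (\<kappa> x)"
  using Ut[of x] kappa_ne[of x] by (auto dest: list.set_sel(2))

text \<open>The common form of both kinds of start: the carrier begins at or just after the last
  attachment of its left end.\<close>

lemma al_bound:
  assumes e: "e \<in> wall_edges t"
  obtains m where "m \<in> touched (fst e) (edge_row t e)" "\<And>p. p \<in> touched (fst e) (edge_row t e) ==> p \<le> m"
    "m \<le> al e" "al e \<le> Suc m"
proof (cases "vert_edge e")
  case True
  then show ?thesis
    using that[of "uhi (fst e)"] uhi_in uhi_ge ends[OF e] rows_of[OF e] by (auto simp: al_def)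
next
  case False
  then show ?thesis
    using that[of "hi (fst e)"] hi_in hi_ge Rp ends[OF e] rows_of[OF e] by (auto simp: al_def)
qed

lemma be_bound:
  assumes e: "e \<in> wall_edges t"
  obtains m where "m \<in> touched (snd e) (edge_row t e)" "\<And>p. p \<in> touched (snd e) (edge_row t e) ==> m \<le> p"
    "be e \<le> m" "m \<le> Suc (be e)"
proof (cases "down_edge e")
  case True
  then show ?thesis
    using that[of "ulo (snd e)"] ulo_in ulo_le ends[OF e] rows_of[OF e] by (auto simp: be_def)
next
  case False
  then show ?thesis
    using that[of "lo (snd e)"] lo_in lo_le Lp ends[OF e] rows_of[OF e] by (auto simp: be_def)
qed

lemma al_le_be:
  assumes e: "e \<in> wall_edges t"
  shows "al e \<le> be e" "be e < length (\<rho> (edge_row t e))"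
proof -
  obtain m where m: "m \<in> touched (fst e) (edge_row t e)" "al e \<le> Suc m"
    using al_bound[OF e] by metis
  obtain m' where m': "m' \<in> touched (snd e) (edge_row t e)" "be e \<le> m'" "m' \<le> Suc (be e)"
    using be_bound[OF e] by metis
  have "Suc m < m'"
    using touched_order[OF _ _ edge_region_less[OF e] edge_row_le[OF e] m(1) m'(1)] ends[OF e] by auto
  then show "al e \<le> be e" using m m' by simp
  show "be e < length (\<rho> (edge_row t e))" using m' by (auto simp: touched_def)
qed

lemma S_row:
  assumes "e \<in> wall_edges t" "s \<in> seg (\<rho> (edge_row t e)) (al e) (be e)"
  obtains p where "s = \<rho> (edge_row t e) ! p" "al e \<le> p" "p \<le> be e" "p < length (\<rho> (edge_row t e))"
  using assms al_le_be[OF assms(1)] by (auto simp: seg_def)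

lemma Te_cases:
  assumes "e \<in> wall_edges t" "s \<in> Te e"
  obtains z where "z \<in> nodes t" "z = fst e \<or> z = snd e" "s \<in> Ut z" "s \<in> set (\<kappa> z)" "port z e = hd (\<kappa> z)"
    "edge_row t e = Suc (row t z)" "vert_edge e \<and> z = fst e \<or> down_edge e \<and> z = snd e"
proof -
  consider "vert_edge e" "s \<in> Ut (fst e)" | "down_edge e" "\<not> vert_edge e" "s \<in> Ut (snd e)"
    using assms(2) by (auto simp: Te_def split: if_splits)
  then show thesis
  proof cases
    case 1
    then show ?thesis
      using that[of "fst e"] ends[OF assms(1)] rows_of(1)[OF assms(1)] Ut_subset[of "fst e"] by (auto simp: port_def)
  next
    case 2
    then show ?thesis
      using that[of "snd e"] ends[OF assms(1)] rows_of(3)[OF assms(1)] Ut_subset[of "snd e"] by (auto simp: port_def)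
  qed
qed

text \<open>Attachments on a row follow the order of \<open>region\<close>, and by
  \<open>no_node_between\<close> no third node comes between the ends of \<open>e\<close>. The gaps
  of two in this order exclude even positions next to the carrier.\<close>

lemma near_touched:
  assumes e: "e \<in> wall_edges t" and z: "z \<in> nodes t" and q: "q \<in> touched z (edge_row t e)"
    and p: "al e \<le> p" "p \<le> be e" "p \<le> Suc q" "q \<le> Suc p"
  shows "z = fst e \<or> z = snd e"
proof (rule ccontr)
  assume nz: "\<not> ?thesis"
  have r: "row t z = edge_row t e \<or> Suc (row t z) = edge_row t e"
    using touched_row[OF z edge_row_le[OF e] q] by auto
  obtain m where m: "m \<in> touched (fst e) (edge_row t e)" "m \<le> al e"
    using al_bound[OF e] by metis
  obtain m' where m': "m' \<in> touched (snd e) (edge_row t e)" "be e \<le> m'"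
    using be_bound[OF e] by metis
  have "region t z < region t (fst e) \<or> region t (snd e) < region t z"
    using no_node_between[OF e z r] nz by (meson not_le)
  then show False
    using touched_order[OF z _ _ edge_row_le[OF e] q m(1)] touched_order[OF _ z _ edge_row_le[OF e] m'(1) q]
      ends[OF e] m m' p by fastforce
qed

lemma seg_touched:
  assumes e: "e \<in> wall_edges t" and z: "z \<in> nodes t" and q: "p \<in> touched z (edge_row t e)"
    and p: "al e \<le> p" "p \<le> be e"
  shows "(z = fst e \<and> p = al e) \<or> (z = snd e \<and> p = be e)"
proof -
  obtain m where m: "\<And>q. q \<in> touched (fst e) (edge_row t e) ==> q \<le> m" "m \<le> al e"
    by (rule al_bound[OF e]) blast
  obtain m' where m': "\<And>q. q \<in> touched (snd e) (edge_row t e) ==> m' \<le> q" "be e \<le> m'"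
    by (rule be_bound[OF e]) blast
  have "z = fst e \<or> z = snd e"
    using near_touched[OF e z q p] by simp
  then show ?thesis
  proof
    assume "z = fst e"
    then show ?thesis using m(1)[of p] m(2) p q by simp
  next
    assume "z = snd e"
    then show ?thesis using m'(1)[of p] m'(2) p q by simp
  qed
qed

lemma conn_S:
  assumes e: "e \<in> wall_edges t"
  shows "conn (S e)" "S e \<subseteq> V"
proof -
  note ab = al_le_be[OF e]
  let ?r = "edge_row t e"
  have rV: "set (\<rho> ?r) \<subseteq> V" using rows[OF edge_row_le[OF e]] by (rule ipathD)
  have sV: "seg (\<rho> ?r) (al e) (be e) \<subseteq> V" using seg_subset[OF ab(2)] rV by blast
  have cs: "conn (seg (\<rho> ?r) (al e) (be e))" by (rule conn_seg[OF rows[OF edge_row_le[OF e]] ab])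
  show "S e \<subseteq> V"
  proof
    fix s assume "s \<in> S e"
    then consider "s \<in> seg (\<rho> ?r) (al e) (be e)" | "s \<in> Te e" by (auto simp: S_def)
    then show "s \<in> V"
    proof cases
      case 2
      then show ?thesis using Te_cases[OF e] connectors ipathD(3) by blast
    qed (use sV in auto)
  qed
  \<comment> \<open>\<open>Ut z\<close> is empty if it is the tail of a connector with one vertex;
    then the row alone is the carrier.\<close>
  have U: "conn (seg (\<rho> ?r) (al e) (be e) \<union> Ut z)"
    if z: "z \<in> nodes t" and p: "p \<in> {al e..be e}" "E (last (\<kappa> z)) (\<rho> ?r ! p)" for z p
  proof (cases "Ut z = {}")
    case False
    have k: "\<kappa> z \<noteq> []" using kappa_ne[OF z] .
    have kk: "\<kappa> z = [hd (\<kappa> z)] @ tl (\<kappa> z)" using k by simp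
    have "conn (Ut z) \<and> last (\<kappa> z) \<in> Ut z"
    proof (cases "Ut z = set (\<kappa> z)")
      case True
      then show ?thesis using conn_ipath[OF connectors[OF z]] k by simp
    next
      case 2: False
      then have Uz: "Ut z = set (tl (\<kappa> z))" using Ut[OF z] by auto
      then have "tl (\<kappa> z) \<noteq> []" using False by auto
      moreover then have "ipath (tl (\<kappa> z))"
        using ipath_append_right[of "[hd (\<kappa> z)]" "tl (\<kappa> z)"] connectors[OF z] k by simp
      ultimately show ?thesis
        using Uz conn_ipath k by (metis last_in_set last_tl)
    qed
    moreover then have "touch (seg (\<rho> ?r) (al e) (be e)) (Ut z)"
      using p E_sym unfolding touch_def seg_def by blast
    ultimately show ?thesis using conn_Un[OF cs] by blast
  qed (use cs in simp)
  show "conn (S e)"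
  proof -
    consider "vert_edge e" | "down_edge e" | "\<not> vert_edge e" "\<not> down_edge e" by auto
    then show ?thesis
    proof cases
      case 1
      then show ?thesis
        using U[of "fst e" "al e"] E_last_uhi[of "fst e"] ends[OF e] rows_of(1)[OF e] ab
        by (auto simp: S_def Te_def al_def)
    next
      case 2
      then show ?thesis
        using U[of "snd e" "be e"] E_last_ulo[of "snd e"] ends[OF e] rows_of(3)[OF e] ab vert_not_down[of e]
        by (auto simp: S_def Te_def be_def)
    next
      case 3
      then show ?thesis using cs by (simp add: S_def Te_def)
    qed
  qed
qed

lemma Te_anti:
  assumes e: "e \<in> wall_edges t" and f: "f \<in> wall_edges t" and "e \<noteq> f" "s \<in> Te e" "s' \<in> Te f"
  shows "s \<noteq> s'" "\<not> E s s'"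
proof -
  obtain z where z: "z \<in> nodes t" "s \<in> set (\<kappa> z)" "vert_edge e \<and> z = fst e \<or> down_edge e \<and> z = snd e"
    using Te_cases[OF e assms(4)] by metis
  obtain z' where z': "z' \<in> nodes t" "s' \<in> set (\<kappa> z')" "vert_edge f \<and> z' = fst f \<or> down_edge f \<and> z' = snd f"
    using Te_cases[OF f assms(5)] by metis
  have "z \<noteq> z'"
    using z(3) z'(3) vert_down_ends[OF e f] vert_down_ends(3)[OF f e] assms(3) by auto
  then have "\<not> touch (set (\<kappa> z)) (set (\<kappa> z'))" using connectors_anti z z' by simp
  then show "s \<noteq> s'" "\<not> E s s'" using z z' by (auto simp: touch_def)
qed

lemma Te_row:
  assumes e: "e \<in> wall_edges t" "s \<in> Te e" and r: "r \<le> 4 * t" "s' \<in> set (\<rho> r)"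
  shows "s \<noteq> s'"
proof -
  obtain z where "z \<in> nodes t" "s \<in> set (\<kappa> z)" using Te_cases[OF e] by metis
  then show ?thesis using connector_rows[of z r] r by auto
qed

text \<open>If \<open>f\<close> ran along the upper row of the connector of \<open>z\<close>, it
  would end at \<open>z\<close> and use that connector itself, but a connector serves one edge. So
  the contact is on the lower row, where only the head of the connector has neighbours.\<close>

lemma Te_seg:
  assumes e: "e \<in> wall_edges t" and f: "f \<in> wall_edges t" and "e \<noteq> f" and s: "s \<in> Te e"
    and s': "s' \<in> seg (\<rho> (edge_row t f)) (al f) (be f)" and E: "E s s'"
  shows "\<exists>z. (z = fst e \<or> z = snd e) \<and> (z = fst f \<or> z = snd f) \<and> z \<in> nodes t \<and> s = port z e \<and> s' = port z f \<and> s = hd (\<kappa> z) \<and> s \<in> Ut z"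
proof -
  obtain z where z: "z \<in> nodes t" "z = fst e \<or> z = snd e" "s \<in> Ut z" "s \<in> set (\<kappa> z)" "port z e = hd (\<kappa> z)"
    "edge_row t e = Suc (row t z)" "vert_edge e \<and> z = fst e \<or> down_edge e \<and> z = snd e"
    by (rule Te_cases[OF e s])
  obtain p where p: "s' = \<rho> (edge_row t f) ! p" "al f \<le> p" "p \<le> be f" "p < length (\<rho> (edge_row t f))"
    by (rule S_row[OF f s'])
  have pt: "p \<in> touched z (edge_row t f)" using p z E by (auto simp: touched_def)
  have zf: "(z = fst f \<and> p = al f) \<or> (z = snd f \<and> p = be f)"
    using seg_touched[OF f z(1) pt p(2,3)] .
  have nUf: "\<not> (vert_edge f \<and> z = fst f)" "\<not> (down_edge f \<and> z = snd f)"
    using z(7) vert_down_ends[OF e f] vert_down_ends(3)[OF f e] assms(3) by auto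
  have rz: "edge_row t f = row t z"
    using zf nUf rows_of[OF f] by auto
  then have hd: "s = hd (\<kappa> z)" using touched_hd[OF z(1,4)] p E by auto
  have "fst f \<noteq> snd f" using edge_region_less[OF f] by auto
  then have "s' = port z f"
    using zf nUf p(1) rz by (auto simp: port_def al_def be_def)
  then show ?thesis using z zf hd by (intro exI[of _ z]) auto
qed

text \<open>On a common row the order of attachments keeps stretches apart unless one edge arrives
  at the node from which the other departs. There the positions are \<open>Lp\<close> and
  \<open>Rp\<close>, which have contact only if they are consecutive.\<close>

lemma seg_seg:
  assumes e: "e \<in> wall_edges t" and f: "f \<in> wall_edges t" and ef: "e \<noteq> f"
    and le: "region t (snd e) \<le> region t (fst f)"
    and s: "s \<in> seg (\<rho> (edge_row t e)) (al e) (be e)" and s': "s' \<in> seg (\<rho> (edge_row t f)) (al f) (be f)"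
    and E: "s = s' \<or> E s s'"
  shows "\<exists>z. z = snd e \<and> z = fst f \<and> z \<in> nodes t \<and> s = port z e \<and> s' = port z f \<and>
    s = \<rho> (row t z) ! Lp z \<and> s' = \<rho> (row t z) ! Rp z \<and> Rp z = Suc (Lp z) \<and> al e \<le> Lp z \<and> edge_row t e = row t z"
proof -
  obtain p where p: "s = \<rho> (edge_row t e) ! p" "al e \<le> p" "p \<le> be e" "p < length (\<rho> (edge_row t e))"
    by (rule S_row[OF e s])
  obtain p' where p': "s' = \<rho> (edge_row t f) ! p'" "al f \<le> p'" "p' \<le> be f" "p' < length (\<rho> (edge_row t f))"
    by (rule S_row[OF f s'])
  have rr: "edge_row t e = edge_row t f"
  proof (rule ccontr)
    assume "edge_row t e \<noteq> edge_row t f"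
    then have "\<not> touch (set (\<rho> (edge_row t e))) (set (\<rho> (edge_row t f)))"
      using rows_anti edge_row_le e f by simp
    then show False using p p' E by (auto simp: touch_def)
  qed
  have near: "p' \<le> Suc p"
    using seg_anti_row[OF rows[OF edge_row_le[OF e]], of p p'] p p' E rr by auto
  obtain m where m: "m \<in> touched (snd e) (edge_row t e)" "be e \<le> m"
    using be_bound[OF e] by metis
  obtain m' where m': "m' \<in> touched (fst f) (edge_row t f)" "m' \<le> al f"
    using al_bound[OF f] by metis
  have eq: "snd e = fst f"
  proof (rule ccontr)
    assume "snd e \<noteq> fst f"
    then have "region t (snd e) < region t (fst f)"
      using le region_inj ends[OF e] ends[OF f] by (metis le_neq_implies_less)
    then have "Suc m < m'"
      using touched_order[OF _ _ _ edge_row_le[OF e] m(1), of "fst f" m'] m' rr ends[OF e] ends[OF f] by simp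
    then show False using near p p' m m' by linarith
  qed
  let ?z = "snd e"
  have "\<not> down_edge e" "\<not> vert_edge f"
    using rows_of[OF e] rows_of[OF f] rr eq vert_down_ends(3)[OF f e] by (auto simp: vert_not_down)
      (metis n_not_Suc_n)+
  then have rz: "edge_row t e = row t ?z" and L: "be e = Lp ?z" and R: "al f = Rp ?z"
    using rows_of(4)[OF e] eq by (auto simp: al_def be_def)
  have pp: "p = Lp ?z" "p' = Rp ?z" "Rp ?z = Suc (Lp ?z)"
    using LR[of ?z] ends[OF e] L R p p' near by auto
  have "fst f \<noteq> snd f" using edge_region_less[OF f] by auto
  then have "s = port ?z e" "s' = port ?z f"
    using p(1) p'(1) pp rz rr eq \<open>\<not> down_edge e\<close> \<open>\<not> vert_edge f\<close> edge_region_less[OF e] by (auto simp: port_def)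
  then show ?thesis using p(1,2) p'(1) pp rz rr eq ends[OF e] by (intro exI[of _ ?z]) auto
qed

text \<open>The case distinction behind all three drawings: a contact of two carriers involves the
  head of a connector that belongs to a carrier, or two consecutive row ports. In the last case an
  earlier attachment on the row is recorded, to exclude that the ports are consecutive only because
  \<open>lo - 1\<close> was truncated at \<open>0\<close>.\<close>

lemma S_touch:
  assumes e: "e \<in> wall_edges t" and f: "f \<in> wall_edges t" and ef: "e \<noteq> f"
    and s: "s \<in> S e" "s' \<in> S f" and E: "s = s' \<or> E s s'"
  shows "\<exists>z. (z = fst e \<or> z = snd e) \<and> (z = fst f \<or> z = snd f) \<and> z \<in> nodes t \<and> s = port z e \<and> s' = port z f \<and> s \<noteq> s' \<and>
    ((s = hd (\<kappa> z) \<and> s \<in> Ut z) \<or> (s' = hd (\<kappa> z) \<and> s' \<in> Ut z) \<or>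
     (Rp z = Suc (Lp z) \<and> (\<exists>p q. p \<in> touched q (row t z) \<and> q \<in> nodes t \<and> region t q < region t z)))"
proof -
  let ?se = "seg (\<rho> (edge_row t e)) (al e) (be e)" and ?sf = "seg (\<rho> (edge_row t f)) (al f) (be f)"
  have left: "\<exists>p q. p \<in> touched q (row t (snd g)) \<and> q \<in> nodes t \<and> region t q < region t (snd g)"
    if "g \<in> wall_edges t" "edge_row t g = row t (snd g)" for g
    using al_bound[OF that(1)] that ends[OF that(1)] edge_region_less[OF that(1)] by metis
  have neq: "\<rho> (row t z) ! Lp z \<noteq> \<rho> (row t z) ! Rp z"
    if "z \<in> nodes t" "g \<in> wall_edges t" "edge_row t g = row t z" "al g = Rp z" for z g
    using LR[OF that(1)] al_le_be[OF that(2)] that ipathD(2)[OF rows[OF row_le(1)[OF that(1)]]]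
    by (auto simp: nth_eq_iff_index_eq)
  consider "s \<in> Te e" "s' \<in> Te f" | "s \<in> Te e" "s' \<in> ?sf" | "s \<in> ?se" "s' \<in> Te f" | "s \<in> ?se" "s' \<in> ?sf"
    using s by (auto simp: S_def)
  then show ?thesis
  proof cases
    case 1
    then show ?thesis using Te_anti[OF e f ef] E by auto
  next
    case 2
    have ne: "s \<noteq> s'"
      using Te_row[OF e 2(1) edge_row_le[OF f]] 2(2) seg_subset[OF al_le_be(2)[OF f]] by auto
    then have "E s s'" using E by auto
    from Te_seg[OF e f ef 2 this] ne show ?thesis by metis
  next
    case 3
    have ne: "s \<noteq> s'"
      using Te_row[OF f 3(2) edge_row_le[OF e]] 3(1) seg_subset[OF al_le_be(2)[OF e]] by auto
    then have "E s' s" using E E_sym by auto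
    from Te_seg[OF f e ef[symmetric] 3(2,1) this] ne show ?thesis by metis
  next
    case 4
    have rr: "edge_row t e = edge_row t f"
    proof (rule ccontr)
      assume "edge_row t e \<noteq> edge_row t f"
      then have "\<not> touch (set (\<rho> (edge_row t e))) (set (\<rho> (edge_row t f)))"
        using rows_anti edge_row_le e f by simp
      moreover have "s \<in> set (\<rho> (edge_row t e))" "s' \<in> set (\<rho> (edge_row t f))"
        using 4 seg_subset[OF al_le_be(2)[OF e]] seg_subset[OF al_le_be(2)[OF f]] by auto
      ultimately show False using E by (auto simp: touch_def)
    qed
    from same_row_edges[OF e f ef rr] show ?thesis
    proof
      assume le: "region t (snd e) \<le> region t (fst f)"
      from seg_seg[OF e f ef le 4 E] obtain z where z: "z = snd e" "z = fst f" "z \<in> nodes t" "s = port z e" "s' = port z f"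
        "s = \<rho> (row t z) ! Lp z" "s' = \<rho> (row t z) ! Rp z" "Rp z = Suc (Lp z)" "al e \<le> Lp z" "edge_row t e = row t z"
        by metis
      have "\<not> vert_edge f" using rows_of[OF f] rr z by auto
      then have "s \<noteq> s'" using neq[OF z(3) f] z rr by (simp add: al_def)
      then show ?thesis using z left[OF e] by (intro exI[of _ z]) auto
    next
      assume le: "region t (snd f) \<le> region t (fst e)"
      have E': "s' = s \<or> E s' s" using E E_sym by auto
      from seg_seg[OF f e ef[symmetric] le 4(2,1) E'] obtain z where z: "z = snd f" "z = fst e" "z \<in> nodes t" "s' = port z f" "s = port z e"
        "s' = \<rho> (row t z) ! Lp z" "s = \<rho> (row t z) ! Rp z" "Rp z = Suc (Lp z)" "al f \<le> Lp z" "edge_row t f = row t z"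
        by metis
      have "\<not> vert_edge e" using rows_of[OF e] rr z by auto
      then have "s \<noteq> s'" using neq[OF z(3) e] z rr by (auto simp add: al_def)
      then show ?thesis using z left[OF f] by (intro exI[of _ z]) auto
    qed
  qed
qed

end

section \<open>Induced walls and line graphs from the carriers\<close>

context ports begin

text \<open>The left end of the edge is attached to the same row, earlier and with a gap, so
  \<open>lo - 1\<close> is not truncated where it is used.\<close>

lemma left_port:
  assumes e: "e \<in> wall_edges t" and "\<not> down_edge e"
  shows "2 \<le> lo (snd e)"
proof -
  obtain m where m: "m \<in> touched (fst e) (edge_row t e)" by (rule al_bound[OF e])
  have "edge_row t e = row t (snd e)" using rows_of(4)[OF e] assms(2) .
  then have "Suc m < lo (snd e)"
    using touched_order[OF _ _ edge_region_less[OF e] edge_row_le[OF e] m] lo_in ends[OF e] by simp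
  then show ?thesis by simp
qed

lemma port_cases:
  assumes "e \<in> wall_edges t" "z = fst e \<or> z = snd e"
  obtains "vert_edge e \<and> z = fst e \<or> down_edge e \<and> z = snd e" "port z e = hd (\<kappa> z)"
  | "z = snd e" "\<not> down_edge e" "port z e = \<rho> (row t z) ! Lp z" "be e = Lp z"
  | "z = fst e" "\<not> vert_edge e" "port z e = \<rho> (row t z) ! Rp z" "al e = Rp z"
proof -
  have ne: "fst e \<noteq> snd e" using edge_region_less[OF assms(1)] by auto
  consider "vert_edge e \<and> z = fst e \<or> down_edge e \<and> z = snd e" | "z = snd e" "\<not> down_edge e" "z \<noteq> fst e"
    | "z = fst e" "\<not> vert_edge e" "z \<noteq> snd e"
    using assms(2) ne by metis
  then show thesis
  proof cases
    case 1
    then show ?thesis by (intro that(1)) (simp_all add: port_def)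
  next
    case 2
    then show ?thesis by (intro that(2)) (simp_all add: port_def be_def)
  next
    case 3
    then show ?thesis by (intro that(3)) (simp_all add: port_def al_def)
  qed
qed

text \<open>The carriers are anticomplete to each other and adjacent only to the centres of their
  ends. A shortest path in a carrier from the neighbours of one centre to those of the other, with
  the centres added at both ends, is a subdivided edge.\<close>

lemma wall_like_claw:
  assumes c1: "\<And>x. x \<in> nodes t ==> cen x \<in> V"
    and c2: "\<And>e z. e \<in> wall_edges t ==> z \<in> nodes t ==> cen z \<notin> S e"
    and c3: "\<And>e z s. e \<in> wall_edges t ==> z \<in> nodes t ==> s \<in> S e ==> E s (cen z) ==> z = fst e \<or> z = snd e"
    and c4: "\<And>e. e \<in> wall_edges t ==> \<exists>s\<in>S e. E s (cen (fst e))" "\<And>e. e \<in> wall_edges t ==> \<exists>s\<in>S e. E s (cen (snd e))"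
    and c5: "\<And>x y. x \<in> nodes t ==> y \<in> nodes t ==> x \<noteq> y ==> cen x \<noteq> cen y \<and> \<not> E (cen x) (cen y)"
    and c6: "\<And>e f s s'. e \<in> wall_edges t ==> f \<in> wall_edges t ==> e \<noteq> f ==> s \<in> S e ==> s' \<in> S f ==> s \<noteq> s' \<and> \<not> E s s'"
  shows "wall_like t"
proof -
  have ex: "\<exists>xs. ipath xs \<and> set xs \<subseteq> S g \<and> (\<forall>i<length xs. E (xs ! i) (cen (fst g)) \<longleftrightarrow> i = 0) \<and>
      (\<forall>i<length xs. E (xs ! i) (cen (snd g)) \<longleftrightarrow> i = length xs - 1)" if g: "g \<in> wall_edges t" for g
  proof -
    have "S g \<inter> {s. E s (cen (fst g))} \<noteq> {}" "S g \<inter> {s. E s (cen (snd g))} \<noteq> {}"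
      using c4[OF g] by auto
    from exists_ipath[OF conn_S[OF g] this] obtain xs where xs: "ipath xs" "set xs \<subseteq> S g"
      "hd xs \<in> {s. E s (cen (fst g))}" "last xs \<in> {s. E s (cen (snd g))}"
      "\<And>i. i < length xs ==> xs ! i \<in> {s. E s (cen (fst g))} ==> i = 0"
      "\<And>i. i < length xs ==> xs ! i \<in> {s. E s (cen (snd g))} ==> i = length xs - 1"
      by metis
    moreover have "hd xs = xs ! 0" "last xs = xs ! (length xs - 1)"
      using ipathD(1)[OF xs(1)] by (simp_all add: hd_conv_nth last_conv_nth)
    ultimately show ?thesis by (intro exI[of _ xs]) auto
  qed
  define Q where "Q g = (SOME xs. ipath xs \<and> set xs \<subseteq> S g \<and> (\<forall>i<length xs. E (xs ! i) (cen (fst g)) \<longleftrightarrow> i = 0) \<and>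
      (\<forall>i<length xs. E (xs ! i) (cen (snd g)) \<longleftrightarrow> i = length xs - 1))" for g
  have Q: "ipath (Q g)" "set (Q g) \<subseteq> S g" "\<And>i. i < length (Q g) ==> E (Q g ! i) (cen (fst g)) \<longleftrightarrow> i = 0"
      "\<And>i. i < length (Q g) ==> E (Q g ! i) (cen (snd g)) \<longleftrightarrow> i = length (Q g) - 1" if "g \<in> wall_edges t" for g
    using someI_ex[OF ex[OF that]] unfolding Q_def[symmetric] by blast+
  obtain e n where e: "bij_betw e {..<n} {g \<in> wall_edges t. fst g \<in> pverts (wall t) \<and> snd g \<in> pverts (wall t)}"
    and el: "edge_list (wall t) n (\<lambda>k. fst (e k)) (\<lambda>k. snd (e k)) t" and VN: "pverts (wall t) \<subseteq> nodes t"
    by (rule wall_edge_list)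
  have ek: "e k \<in> wall_edges t" if "k < n" for k using e that by (auto simp: bij_betw_def)
  have einj: "e k \<noteq> e k'" if "k < n" "k' < n" "k \<noteq> k'" for k k'
    using e that by (auto simp: bij_betw_def inj_on_def)
  define P where "P k = cen (fst (e k)) # Q (e k) @ [cen (snd (e k))]" for k
  have int: "P k ! i \<in> S (e k)" if "k < n" "0 < i" "i < length (P k) - 1" for k i
  proof -
    have "P k ! i = Q (e k) ! (i - 1)" "i - 1 < length (Q (e k))"
      using that by (auto simp: P_def nth_append nth_Cons')
    then show ?thesis using Q(2)[OF ek[OF that(1)]] nth_mem[of "i - 1" "Q (e k)"] by auto
  qed
  have "induces (edge_list.sub (wall t) n (\<lambda>k. fst (e k)) (\<lambda>k. snd (e k)) t (\<lambda>k. length (P k) - 2))"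
  proof (rule induces_claw[OF el, where c = cen])
    show "inj_on cen (pverts (wall t))" using c5 VN unfolding inj_on_def by (metis subsetD)
    show "cen ` pverts (wall t) \<subseteq> V" using c1 VN by auto
    show "\<not> E (cen x) (cen y)" if "x \<in> pverts (wall t)" "y \<in> pverts (wall t)" for x y
      using c5[of x y] that VN E_irrefl by (cases "x = y") auto
    fix k assume k: "k < n"
    have N: "fst (e k) \<in> nodes t" "snd (e k) \<in> nodes t" using ends[OF ek[OF k]] by auto
    have "fst (e k) \<noteq> snd (e k)" using edge_region_less[OF ek[OF k]] by auto
    then have "ipath (P k)"
      unfolding P_def
      using ipath_extend[OF Q(1)[OF ek[OF k]] c1[OF N(1)] c1[OF N(2)]] c5[OF N] c2[OF ek[OF k]] N
        Q(2,3,4)[OF ek[OF k]] by blast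
    moreover have "length (P k) \<ge> 3"
      using ipathD(1)[OF Q(1)[OF ek[OF k]]] by (cases "Q (e k)") (auto simp: P_def)
    ultimately show "ipath (P k) \<and> length (P k) \<ge> 3 \<and> hd (P k) = cen (fst (e k)) \<and> last (P k) = cen (snd (e k))"
      by (simp add: P_def)
    fix i assume i: "0 < i" "i < length (P k) - 1"
    show "P k ! i \<notin> cen ` pverts (wall t)"
      using int[OF k i] c2[OF ek[OF k]] VN by auto
    show "x = fst (e k) \<or> x = snd (e k)" if "x \<in> pverts (wall t)" "E (P k ! i) (cen x)" for x
      using c3[OF ek[OF k] _ int[OF k i], of x] that VN by auto
    show "P k ! i \<noteq> P k' ! j \<and> \<not> E (P k ! i) (P k' ! j)"
      if "k' < n" "k \<noteq> k'" "0 < j" "j < length (P k') - 1" for k' j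
      using c6[OF ek[OF k] ek[OF that(1)] einj[OF k that(1,2)] int[OF k i] int[OF that(1,3,4)]] .
  qed
  then show ?thesis
    unfolding wall_like_def using edge_list.subdivision_sub[OF el] by blast
qed

text \<open>Together with \<open>vert_down_ends\<close>: different edges at a node have different
  ports there.\<close>

lemma ports_unique:
  assumes e: "e \<in> wall_edges t" and f: "f \<in> wall_edges t" and "e \<noteq> f"
  shows "\<not> (snd e = snd f \<and> \<not> down_edge e \<and> \<not> down_edge f)"
    "\<not> (fst e = fst f \<and> \<not> vert_edge e \<and> \<not> vert_edge f)"
proof -
  obtain a b c d where ev: "e = ((a, b), (c, d))" by (metis prod.collapse)
  obtain a' b' c' d' where fv: "f = ((a', b'), (c', d'))" by (metis prod.collapse)
  have ce: "(c = a \<and> d = Suc b) \<or> (c = Suc a \<and> d = b \<and> even (a + b))"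
    using e ev by (auto simp: wall_edges_def)
  have cf: "(c' = a' \<and> d' = Suc b') \<or> (c' = Suc a' \<and> d' = b' \<and> even (a' + b'))"
    using f fv by (auto simp: wall_edges_def)
  show "\<not> (snd e = snd f \<and> \<not> down_edge e \<and> \<not> down_edge f)"
    "\<not> (fst e = fst f \<and> \<not> vert_edge e \<and> \<not> vert_edge f)"
    using ce cf assms(3) by (auto simp: ev fv down_edge_def vert_edge_def)
qed

text \<open>The possible ports at a node are the head of its connector and two consecutive vertices
  of its row. They are pairwise adjacent, and by \<open>S_touch\<close> the carriers have no other
  contacts.\<close>

lemma wall_like_triangle:
  assumes tri: "\<And>x. x \<in> nodes t ==> hi x = Suc (lo x) \<and> Lp x = lo x \<and> Rp x = hi x \<and> Ut x = set (\<kappa> x)"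
  shows "wall_like t"
proof -
  have term_in: "port z g \<in> S g" if g: "g \<in> wall_edges t" and z: "z = fst g \<or> z = snd g" for g z
  proof -
    have zN: "z \<in> nodes t" using ends[OF g] z by auto
    from g z show ?thesis
    proof (cases rule: port_cases)
      case 1
      then show ?thesis
        using tri[OF zN] hd_in_set[OF kappa_ne[OF zN]] vert_not_down[of g] by (auto simp: S_def Te_def)
    next
      case 2
      then show ?thesis
        using al_le_be[OF g] rows_of(4)[OF g] by (auto simp: S_def seg_def)
    next
      case 3
      then show ?thesis
        using al_le_be[OF g] rows_of(2)[OF g] by (auto simp: S_def seg_def)
    qed
  qed
  have ex: "\<exists>xs. ipath xs \<and> set xs \<subseteq> S g \<and> hd xs = port (fst g) g \<and> last xs = port (snd g) g"
    if g: "g \<in> wall_edges t" for g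
  proof -
    have "S g \<inter> {port (fst g) g} \<noteq> {}" "S g \<inter> {port (snd g) g} \<noteq> {}"
      using term_in[OF g] by auto
    from exists_ipath[OF conn_S[OF g] this] show ?thesis by (metis singletonD)
  qed
  define P where "P g = (SOME xs. ipath xs \<and> set xs \<subseteq> S g \<and> hd xs = port (fst g) g \<and> last xs = port (snd g) g)" for g
  have P: "ipath (P g)" "set (P g) \<subseteq> S g" "hd (P g) = port (fst g) g" "last (P g) = port (snd g) g"
    if "g \<in> wall_edges t" for g
    using someI_ex[OF ex[OF that]] unfolding P_def[symmetric] by blast+
  have P0: "P g ! 0 = port (fst g) g" "P g ! (length (P g) - 1) = port (snd g) g" "length (P g) > 0"
    if g: "g \<in> wall_edges t" for g
    using P(3,4)[OF g] ipathD(1)[OF P(1)[OF g]] by (simp_all add: hd_conv_nth last_conv_nth)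
  have idx: "i = 0 \<and> z = fst g \<or> i = length (P g) - 1 \<and> z = snd g"
    if g: "g \<in> wall_edges t" "i < length (P g)" "z = fst g \<or> z = snd g" "P g ! i = port z g" for g i z
    using g(3)
  proof
    assume "z = fst g"
    then have "P g ! i = P g ! 0" using g P0[OF g(1)] by simp
    then have "i = 0" using ipathD(2)[OF P(1)[OF g(1)]] g(2) P0(3)[OF g(1)] nth_eq_iff_index_eq by metis
    then show ?thesis using \<open>z = fst g\<close> by simp
  next
    assume "z = snd g"
    then have "P g ! i = P g ! (length (P g) - 1)" using g P0[OF g(1)] by simp
    moreover have "length (P g) - 1 < length (P g)" using P0(3)[OF g(1)] by simp
    ultimately have "i = length (P g) - 1" using ipathD(2)[OF P(1)[OF g(1)]] g(2) nth_eq_iff_index_eq by metis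
    then show ?thesis using \<open>z = snd g\<close> by simp
  qed
  have adj: "E (port z g) (port z h)"
    if g: "g \<in> wall_edges t" and h: "h \<in> wall_edges t" and gh: "g \<noteq> h"
      and zg: "z = fst g \<or> z = snd g" and zh: "z = fst h \<or> z = snd h" for g h z
  proof -
    have zN: "z \<in> nodes t" using ends[OF g] zg by auto
    have lh: "lo z < length (\<rho> (row t z))" "hi z < length (\<rho> (row t z))"
      using lo_in[OF zN] hi_in[OF zN] by (auto simp: touched_def)
    have E1: "E (hd (\<kappa> z)) (\<rho> (row t z) ! Lp z)" "E (hd (\<kappa> z)) (\<rho> (row t z) ! Rp z)"
      using E_hd_lo[OF zN] E_hd_hi[OF zN] tri[OF zN] by simp_all
    have E2: "E (\<rho> (row t z) ! Lp z) (\<rho> (row t z) ! Rp z)"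
      using ipathD(4)[OF rows[OF row_le(1)[OF zN]] lh] tri[OF zN] by simp
    note uniq = vert_down_ends(1,2)[OF g h] vert_down_ends(3)[OF g h] vert_down_ends(3)[OF h g] ports_unique[OF g h gh] gh
    from g zg show ?thesis
    proof (cases rule: port_cases)
      case g1: 1
      from h zh show ?thesis
        by (cases rule: port_cases) (use g1 uniq E1 in auto)
    next
      case g2: 2
      from h zh show ?thesis
        by (cases rule: port_cases) (use g2 uniq E1 E2 E_sym in auto)
    next
      case g3: 3
      from h zh show ?thesis
        by (cases rule: port_cases) (use g3 uniq E1 E2 E_sym in auto)
    qed
  qed
  obtain e n where e: "bij_betw e {..<n} {g \<in> wall_edges t. fst g \<in> pverts (wall t) \<and> snd g \<in> pverts (wall t)}"
    and el: "edge_list (wall t) n (\<lambda>k. fst (e k)) (\<lambda>k. snd (e k)) t" and VN: "pverts (wall t) \<subseteq> nodes t"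
    by (rule wall_edge_list)
  have ek: "e k \<in> wall_edges t" if "k < n" for k using e that by (auto simp: bij_betw_def)
  have einj: "e k \<noteq> e k'" if "k < n" "k' < n" "k \<noteq> k'" for k k'
    using e that by (auto simp: bij_betw_def inj_on_def)
  have PS: "P g ! i \<in> S g" if "g \<in> wall_edges t" "i < length (P g)" for g i
    using P(2)[OF that(1)] nth_mem[OF that(2)] by auto
  have "induces (line_graph (edge_list.sub (wall t) n (\<lambda>k. fst (e k)) (\<lambda>k. snd (e k)) t (\<lambda>k. length (P (e k)) - 1)))"
  proof (rule induces_triangle[OF el])
    show "ipath (P (e k))" if "k < n" for k using P ek that by blast
    fix k k' assume k: "k < n" "k' < n" "k \<noteq> k'"
    let ?g = "e k" and ?h = "e k'"
    note gh = ek[OF k(1)] ek[OF k(2)] einj[OF k]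
    show "set (P ?g) \<inter> set (P ?h) = {}"
      using S_touch[OF gh] P(2)[OF gh(1)] P(2)[OF gh(2)] by blast
    fix i j assume ij: "i < length (P ?g)" "j < length (P ?h)"
    show "E (P ?g ! i) (P ?h ! j) \<longleftrightarrow> (i = 0 \<and> j = 0 \<and> fst ?g = fst ?h) \<or>
        (i = 0 \<and> j = length (P ?h) - 1 \<and> fst ?g = snd ?h) \<or>
        (i = length (P ?g) - 1 \<and> j = 0 \<and> snd ?g = fst ?h) \<or>
        (i = length (P ?g) - 1 \<and> j = length (P ?h) - 1 \<and> snd ?g = snd ?h)" (is "_ \<longleftrightarrow> ?R")
    proof
      assume "E (P ?g ! i) (P ?h ! j)"
      then obtain z where z: "z = fst ?g \<or> z = snd ?g" "z = fst ?h \<or> z = snd ?h"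
        "P ?g ! i = port z ?g" "P ?h ! j = port z ?h"
        using S_touch[OF gh PS[OF gh(1) ij(1)] PS[OF gh(2) ij(2)]] by blast
      show ?R
        using idx[OF gh(1) ij(1) z(1,3)] idx[OF gh(2) ij(2) z(2,4)] by auto
    next
      assume ?R
      then obtain z where "z = fst ?g \<or> z = snd ?g" "z = fst ?h \<or> z = snd ?h"
        "P ?g ! i = port z ?g" "P ?h ! j = port z ?h"
        using P0[OF gh(1)] P0[OF gh(2)] by metis
      then show "E (P ?g ! i) (P ?h ! j)" using adj[OF gh] by simp
    qed
  qed
  then show ?thesis
    unfolding wall_like_def using edge_list.subdivision_sub[OF el] by blast
qed

end

context staircase begin

lemma wall_like_if_triangles:
  assumes "\<And>x. x \<in> nodes t ==> hi x = Suc (lo x)"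
  shows "wall_like t"
proof -
  interpret ports V E t \<rho> \<kappa> lo hi "\<lambda>x. set (\<kappa> x)"
    by unfold_locales (use assms in auto)
  show ?thesis by (rule wall_like_triangle) (use assms in auto)
qed

text \<open>The head of the connector has non-consecutive neighbours at positions \<open>lo\<close>
  and \<open>hi\<close>, so it can be the branch vertex itself. It is taken out of the connector
  part, and the carriers at the node leave out the row between \<open>lo\<close> and
  \<open>hi\<close>.\<close>

lemma wall_like_if_wide:
  assumes wide: "\<And>x. x \<in> nodes t ==> Suc (Suc (lo x)) \<le> hi x"
  shows "wall_like t"
proof -
  interpret ports V E t \<rho> \<kappa> lo hi "\<lambda>x. set (tl (\<kappa> x))"
    by unfold_locales (use wide in \<open>auto dest: wide\<close>)
  have hdU: "hd (\<kappa> z) \<notin> set (tl (\<kappa> z))" if "z \<in> nodes t" for z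
    using ipathD(2)[OF connectors[OF that]] kappa_ne[OF that] by (cases "\<kappa> z") auto
  show ?thesis
  proof (rule wall_like_claw[of "\<lambda>z. hd (\<kappa> z)"])
    fix x assume "x \<in> nodes t"
    then show "hd (\<kappa> x) \<in> V" using connectors ipathD(1,3) hd_in_set by blast
    fix y assume "y \<in> nodes t" "x \<noteq> y"
    then show "hd (\<kappa> x) \<noteq> hd (\<kappa> y) \<and> \<not> E (hd (\<kappa> x)) (hd (\<kappa> y))"
      using connectors_anti[OF \<open>x \<in> nodes t\<close>] kappa_ne \<open>x \<in> nodes t\<close> unfolding touch_def by (meson hd_in_set)
  next
    fix e z assume e: "e \<in> wall_edges t" and z: "z \<in> nodes t"
    have sub: "seg (\<rho> (edge_row t e)) (al e) (be e) \<subseteq> set (\<rho> (edge_row t e))"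
      by (rule seg_subset[OF al_le_be(2)[OF e]])
    have hz: "hd (\<kappa> z) \<in> set (\<kappa> z)" using kappa_ne[OF z] by simp
    have TeU: "\<exists>z'. z' \<in> nodes t \<and> (z' = fst e \<or> z' = snd e) \<and> s \<in> set (tl (\<kappa> z')) \<and> s \<in> set (\<kappa> z')" if s: "s \<in> Te e" for s
      by (rule Te_cases[OF e s]) blast
    show "hd (\<kappa> z) \<notin> S e"
    proof
      assume "hd (\<kappa> z) \<in> S e"
      then consider "hd (\<kappa> z) \<in> set (\<rho> (edge_row t e))" | "hd (\<kappa> z) \<in> Te e"
        using sub by (auto simp: S_def)
      then show False
      proof cases
        case 1
        then show ?thesis using connector_rows[OF z edge_row_le[OF e]] hz by auto
      next
        case 2
        from TeU[OF this] obtain z' where z': "z' \<in> nodes t" "hd (\<kappa> z) \<in> set (tl (\<kappa> z'))" "hd (\<kappa> z) \<in> set (\<kappa> z')" by auto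
        then have "z = z'" using connectors_anti[OF z z'(1)] hz not_touch_disjoint by blast
        then show ?thesis using z' hdU by simp
      qed
    qed
    fix s assume s: "s \<in> S e" "E s (hd (\<kappa> z))"
    then consider "s \<in> seg (\<rho> (edge_row t e)) (al e) (be e)" | "s \<in> Te e" by (auto simp: S_def)
    then show "z = fst e \<or> z = snd e"
    proof cases
      case 1
      obtain p where p: "s = \<rho> (edge_row t e) ! p" "al e \<le> p" "p \<le> be e" "p < length (\<rho> (edge_row t e))"
        by (rule S_row[OF e 1])
      then have "p \<in> touched z (edge_row t e)"
        using s(2) hz E_sym unfolding touched_def by blast
      then show ?thesis using near_touched[OF e z _ p(2,3)] by simp
    next
      case 2
      from TeU[OF this] obtain z' where z': "z' \<in> nodes t" "z' = fst e \<or> z' = snd e" "s \<in> set (\<kappa> z')" by auto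
      then have "z' = z" using connectors_anti[OF z'(1) z] s(2) hz by (auto simp: touch_def)
      then show ?thesis using z' by simp
    qed
  next
    have tlE: "\<exists>s\<in>set (tl (\<kappa> z)). E s (hd (\<kappa> z))" if z: "z \<in> nodes t" "tl (\<kappa> z) \<noteq> []" for z
    proof -
      have l: "1 < length (\<kappa> z)" using z(2) by (cases "\<kappa> z"; cases "tl (\<kappa> z)") auto
      have "E (\<kappa> z ! 1) (\<kappa> z ! 0)" using ipathD(4)[OF connectors[OF z(1)], of 1 0] l kappa_ne[OF z(1)] by simp
      moreover have "\<kappa> z ! 1 \<in> set (tl (\<kappa> z))" using l by (cases "\<kappa> z") auto
      moreover have "hd (\<kappa> z) = \<kappa> z ! 0" using kappa_ne[OF z(1)] by (rule hd_conv_nth)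
      ultimately show ?thesis by metis
    qed
    \<comment> \<open>If the connector is a single vertex, the branch vertex is itself adjacent to
      the upper row.\<close>
    have tl0: "last (\<kappa> z) = hd (\<kappa> z)" if "z \<in> nodes t" "tl (\<kappa> z) = []" for z
      using that kappa_ne by (cases "\<kappa> z") auto
    fix e assume e: "e \<in> wall_edges t"
    note N = ends[OF e] and r = rows_of[OF e] and b = al_le_be[OF e]
    have seg: "\<rho> (edge_row t e) ! al e \<in> S e" "\<rho> (edge_row t e) ! be e \<in> S e"
      using b by (auto simp: S_def seg_def)
    show "\<exists>s\<in>S e. E s (hd (\<kappa> (fst e)))"
    proof (cases "vert_edge e")
      case False
      then show ?thesis using E_hd_hi[of "fst e"] N r(2) seg(1) E_sym by (auto simp: al_def)
    next
      case True
      show ?thesis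
      proof (cases "tl (\<kappa> (fst e)) = []")
        case t: True
        have "E (hd (\<kappa> (fst e))) (\<rho> (edge_row t e) ! al e)"
          using True E_last_uhi[of "fst e"] N r(1) tl0[OF _ t] by (auto simp: al_def)
        then show ?thesis using seg(1) E_sym by blast
      next
        case False
        then show ?thesis using tlE[of "fst e"] N True by (auto simp: S_def Te_def)
      qed
    qed
    show "\<exists>s\<in>S e. E s (hd (\<kappa> (snd e)))"
    proof (cases "down_edge e")
      case False
      then show ?thesis using E_hd_lo[of "snd e"] N r(4) seg(2) E_sym by (auto simp: be_def)
    next
      case True
      show ?thesis
      proof (cases "tl (\<kappa> (snd e)) = []")
        case t: True
        have "E (hd (\<kappa> (snd e))) (\<rho> (edge_row t e) ! be e)"
          using True E_last_ulo[of "snd e"] N r(3) tl0[OF _ t] by (auto simp: be_def)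
        then show ?thesis using seg(2) E_sym by blast
      next
        case False
        then show ?thesis using tlE[of "snd e"] N True vert_not_down[of e] by (auto simp: S_def Te_def)
      qed
    qed
  next
    fix e f s s' assume ef: "e \<in> wall_edges t" "f \<in> wall_edges t" "e \<noteq> f" "s \<in> S e" "s' \<in> S f"
    show "s \<noteq> s' \<and> \<not> E s s'"
    proof (rule ccontr)
      assume "\<not> ?thesis"
      then have "s = s' \<or> E s s'" by auto
      from S_touch[OF ef this] obtain z where "z \<in> nodes t" "hd (\<kappa> z) \<in> set (tl (\<kappa> z)) \<or> hi z = Suc (lo z)" by metis
      then show False using hdU[of z] wide[of z] by auto
    qed
  qed
qed

text \<open>The only neighbour of the connector on its row becomes the branch vertex; the row
  carriers begin next to it, and the whole connector belongs to the third edge.\<close>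

lemma wall_like_if_single:
  assumes single: "\<And>x. x \<in> nodes t ==> hi x = lo x"
  shows "wall_like t"
proof -
  interpret ports V E t \<rho> \<kappa> "\<lambda>x. lo x - Suc 0" "\<lambda>x. Suc (hi x)" "\<lambda>x. set (\<kappa> x)"
    by unfold_locales (use single in auto)
  let ?c = "\<lambda>z. \<rho> (row t z) ! lo z"
  have len: "lo z < length (\<rho> (row t z))" if "z \<in> nodes t" for z
    using lo_in[OF that] by (auto simp: touched_def)
  have crow: "?c z \<in> set (\<rho> (row t z))" if "z \<in> nodes t" for z using len[OF that] by simp
  show ?thesis
  proof (rule wall_like_claw[of ?c])
    fix x assume x: "x \<in> nodes t"
    show "?c x \<in> V" using crow[OF x] rows[OF row_le(1)[OF x]] ipathD(3) by blast
    fix y assume y: "y \<in> nodes t" "x \<noteq> y"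
    show "?c x \<noteq> ?c y \<and> \<not> E (?c x) (?c y)"
    proof (cases "row t x = row t y")
      case False
      then have "\<not> touch (set (\<rho> (row t x))) (set (\<rho> (row t y)))"
        using rows_anti row_le(1) x y by simp
      then show ?thesis using crow[OF x] crow[OF y(1)] by (auto simp: touch_def)
    next
      case True
      have "region t x < region t y \<or> region t y < region t x"
        using region_inj[OF x y(1)] y(2) by (meson linorder_neqE_nat)
      then have "Suc (lo x) < lo y \<or> Suc (lo y) < lo x"
        using touched_order[OF x y(1) _ row_le(1)[OF x] lo_in[OF x]] touched_order[OF y(1) x _ row_le(1)[OF x]]
          lo_in[OF y(1)] lo_in[OF x] True by auto
      then show ?thesis
        using seg_anti_row[OF rows[OF row_le(1)[OF x]] len[OF x], of "lo y"] len[OF y(1)] True by fastforce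
    qed
  next
    fix e z assume e: "e \<in> wall_edges t" and z: "z \<in> nodes t"
    have same: "edge_row t e = row t z" if "s \<in> seg (\<rho> (edge_row t e)) (al e) (be e)" "s = ?c z \<or> E s (?c z)" for s
    proof (rule ccontr)
      assume "edge_row t e \<noteq> row t z"
      then have "\<not> touch (set (\<rho> (edge_row t e))) (set (\<rho> (row t z)))"
        using rows_anti edge_row_le[OF e] row_le(1)[OF z] by simp
      then show False
        using that crow[OF z] seg_subset[OF al_le_be(2)[OF e]] by (auto simp: touch_def)
    qed
    show "?c z \<notin> S e"
    proof
      assume cS: "?c z \<in> S e"
      have "?c z \<notin> Te e" using Te_row[OF e _ row_le(1)[OF z] crow[OF z]] by blast
      then have sg: "?c z \<in> seg (\<rho> (edge_row t e)) (al e) (be e)" using cS unfolding S_def by blast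
      obtain p where p: "?c z = \<rho> (edge_row t e) ! p" "al e \<le> p" "p \<le> be e" "p < length (\<rho> (edge_row t e))"
        by (rule S_row[OF e sg])
      have rz: "edge_row t e = row t z" using same[OF sg] by simp
      then have pl: "p = lo z"
        using p len[OF z] ipathD(2)[OF rows[OF row_le(1)[OF z]]] by (simp add: nth_eq_iff_index_eq)
      then have "(z = fst e \<and> p = al e) \<or> (z = snd e \<and> p = be e)"
        using seg_touched[OF e z _ p(2,3)] lo_in[OF z] rz by simp
      then show False
      proof
        assume "z = fst e \<and> p = al e"
        then show False using rz rows_of(1)[OF e] pl single[OF z] by (auto simp: al_def split: if_splits)
      next
        assume zp: "z = snd e \<and> p = be e"
        then have nd: "\<not> down_edge e" using rz rows_of(3)[OF e] by auto
        then have "be e = lo (snd e) - 1" unfolding be_def by simp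
        then show False using zp pl left_port[OF e nd] by auto
      qed
    qed
    fix s assume s: "s \<in> S e" "E s (?c z)"
    then consider "s \<in> seg (\<rho> (edge_row t e)) (al e) (be e)" | "s \<in> Te e" by (auto simp: S_def)
    then show "z = fst e \<or> z = snd e"
    proof cases
      case 1
      obtain p where p: "s = \<rho> (edge_row t e) ! p" "al e \<le> p" "p \<le> be e" "p < length (\<rho> (edge_row t e))"
        by (rule S_row[OF e 1])
      have rz: "edge_row t e = row t z" using same[OF 1] s by simp
      have "p \<le> Suc (lo z) \<and> lo z \<le> Suc p"
        using seg_anti_row[OF rows[OF row_le(1)[OF z]], of p "lo z"] p s len[OF z] rz by auto
      then show ?thesis using near_touched[OF e z _ p(2,3), of "lo z"] lo_in[OF z] rz by simp
    next
      case 2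
      obtain z' where z': "z' \<in> nodes t" "z' = fst e \<or> z' = snd e" "s \<in> set (\<kappa> z')"
        by (rule Te_cases[OF e 2]) blast
      have t': "lo z \<in> touched z' (row t z)" using z' s len[OF z] by (auto simp: touched_def)
      have "z' = z"
      proof (rule ccontr)
        assume "z' \<noteq> z"
        then have "region t z' < region t z \<or> region t z < region t z'"
          using region_inj[OF z'(1) z] by (meson linorder_neqE_nat)
        then show False
          using touched_order[OF z'(1) z _ row_le(1)[OF z] t' lo_in[OF z]]
            touched_order[OF z z'(1) _ row_le(1)[OF z] lo_in[OF z] t'] by auto
      qed
      then show ?thesis using z' by simp
    qed
  next
    fix e assume e: "e \<in> wall_edges t"
    note N = ends[OF e] and r = rows_of[OF e] and b = al_le_be[OF e]
    have seg: "\<rho> (edge_row t e) ! al e \<in> S e" "\<rho> (edge_row t e) ! be e \<in> S e"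
      using b by (auto simp: S_def seg_def)
    show "\<exists>s\<in>S e. E s (?c (fst e))"
    proof (cases "vert_edge e")
      case True
      then have "hd (\<kappa> (fst e)) \<in> S e" using N kappa_ne[of "fst e"] by (auto simp: S_def Te_def)
      then show ?thesis using E_hd_lo[of "fst e"] N by blast
    next
      case False
      then have "al e = Suc (lo (fst e))" using single[of "fst e"] N by (simp add: al_def)
      then have "E (\<rho> (edge_row t e) ! al e) (?c (fst e))"
        using ipathD(4)[OF rows[OF edge_row_le[OF e]], of "al e" "lo (fst e)"] b r(2)[OF False] by simp
      then show ?thesis using seg by blast
    qed
    show "\<exists>s\<in>S e. E s (?c (snd e))"
    proof (cases "down_edge e")
      case True
      then have "hd (\<kappa> (snd e)) \<in> S e" using N kappa_ne[of "snd e"] vert_not_down[of e] by (auto simp: S_def Te_def)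
      then show ?thesis using E_hd_lo[of "snd e"] N by blast
    next
      case False
      then have "Suc (be e) = lo (snd e)" using left_port[OF e False] by (simp add: be_def)
      then have "E (\<rho> (edge_row t e) ! be e) (?c (snd e))"
        using ipathD(4)[OF rows[OF edge_row_le[OF e]], of "be e" "lo (snd e)"] b r(4)[OF False] len[of "snd e"] N by simp
      then show ?thesis using seg by blast
    qed
  next
    \<comment> \<open>The row ports lie just outside the attachments from \<open>lo\<close> to
      \<open>hi\<close>, so the head of the connector does not see them.\<close>
    have no: False if z: "z \<in> nodes t" and g: "g \<in> wall_edges t" and zg: "z = fst g \<or> z = snd g"
        and E: "E (hd (\<kappa> z)) (port z g)" for z g
      using g zg
    proof (cases rule: port_cases)
      case 1
      then show ?thesis using E E_irrefl by simp
    next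
      case 2
      have "lo z - 1 \<in> touched z (row t z)"
        using 2 E len[OF z] hd_in_set[OF kappa_ne[OF z]] by (auto simp: touched_def)
      then show ?thesis using lo_le[of "lo z - 1" z] left_port[OF g 2(2)] 2(1) by auto
    next
      case 3
      have "Suc (hi z) \<in> touched z (row t z)"
        using 3 E al_le_be[OF g] rows_of(2)[OF g] hd_in_set[OF kappa_ne[OF z]] by (auto simp: touched_def)
      then show ?thesis using hi_ge[of "Suc (hi z)" z] by auto
    qed
    fix e f s s' assume ef: "e \<in> wall_edges t" "f \<in> wall_edges t" "e \<noteq> f" "s \<in> S e" "s' \<in> S f"
    show "s \<noteq> s' \<and> \<not> E s s'"
    proof (rule ccontr)
      assume "\<not> ?thesis"
      then have EE: "s = s' \<or> E s s'" by auto
      from S_touch[OF ef this] obtain z where z: "z = fst e \<or> z = snd e" "z = fst f \<or> z = snd f" "z \<in> nodes t"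
        "s = port z e" "s' = port z f" "s \<noteq> s'" and
        alt: "(s = hd (\<kappa> z) \<and> s \<in> set (\<kappa> z)) \<or> (s' = hd (\<kappa> z) \<and> s' \<in> set (\<kappa> z)) \<or>
          (Suc (hi z) = Suc (lo z - Suc 0) \<and> (\<exists>p q. p \<in> touched q (row t z) \<and> q \<in> nodes t \<and> region t q < region t z))"
        by blast
      have ss: "E s s'" "E s' s" using EE z E_sym by auto
      from alt show False
      proof (elim disjE conjE exE)
        assume "s = hd (\<kappa> z)"
        then show False using no[OF z(3) ef(2) z(2)] ss z by simp
      next
        assume "s' = hd (\<kappa> z)"
        then show False using no[OF z(3) ef(1) z(1)] ss z by simp
      next
        fix p q assume "Suc (hi z) = Suc (lo z - Suc 0)" "p \<in> touched q (row t z)" "q \<in> nodes t" "region t q < region t z"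
        then show False
          using touched_order[OF _ z(3) _ row_le(1)[OF z(3)] _ lo_in[OF z(3)], of q p] single[OF z(3)] by simp
      qed
    qed
  qed
qed

end

lemma strict_enumeration:
  fixes I :: "nat set"
  assumes "card I = n" "n > 0 \<or> finite I"
  obtains f where "\<And>i. i < n ==> f i \<in> I" "\<And>i j. i < j ==> j < n ==> f i < f j"
proof -
  have fin: "finite I" using assms card.infinite by fastforce
  let ?xs = "sorted_list_of_set I"
  have len: "length ?xs = n" using assms(1) by simp
  show ?thesis
  proof
    show "?xs ! i \<in> I" if "i < n" for i
      using nth_mem[of i ?xs] that len fin by simp
    show "?xs ! i < ?xs ! j" if "i < j" "j < n" for i j
      using strict_sorted_list_of_set[of I] that len by (simp add: sorted_wrt_nth_less)
  qed
qed

section \<open>Walls from wires between consecutive rows\<close>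

locale wiring = fin_graph V E for V :: "'a set" and E +
  fixes M D :: nat and \<rho> :: "nat => 'a list" and W :: "nat => nat => 'a set"
  assumes rows: "r < M ==> ipath (\<rho> r)"
    and rows_anti: "r < M ==> r' < M ==> r \<noteq> r' ==> \<not> touch (set (\<rho> r)) (set (\<rho> r'))"
    and W_conn: "j < D ==> Suc s < M ==> conn (W j s) \<and> W j s \<subseteq> V"
    and W_rows: "j < D ==> Suc s < M ==> r < M ==> W j s \<inter> set (\<rho> r) = {}"
    and W_touch: "j < D ==> Suc s < M ==> r < M ==> touch (W j s) (set (\<rho> r)) \<longleftrightarrow> r = s \<or> r = Suc s"
    and W_anti: "j < D ==> j' < D ==> j \<noteq> j' ==> Suc s < M ==> Suc s' < M ==> \<not> touch (W j s) (W j' s')"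
    and W_ordered: "j < j' ==> j' < D ==> Suc s < M ==> Suc s' < M ==> r < M ==> w \<in> W j s ==> w' \<in> W j' s' ==>
        p < length (\<rho> r) ==> p' < length (\<rho> r) ==> E w (\<rho> r ! p) ==> E w' (\<rho> r ! p') ==> Suc p < p'"
begin

definition nbr :: "nat => 'a set" where
  "nbr r = {w. \<exists>v\<in>set (\<rho> r). E w v}"

definition K :: "nat => nat => 'a list" where
  "K j s = (SOME xs. ipath xs \<and> set xs \<subseteq> W j s \<and> hd xs \<in> nbr s \<and> last xs \<in> nbr (Suc s) \<and>
     (\<forall>i<length xs. xs ! i \<in> nbr s \<longrightarrow> i = 0) \<and> (\<forall>i<length xs. xs ! i \<in> nbr (Suc s) \<longrightarrow> i = length xs - 1))"

lemma W_nbr: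
  assumes "j < D" "Suc s < M" "r < M"
  shows "W j s \<inter> nbr r \<noteq> {} \<longleftrightarrow> r = s \<or> r = Suc s"
  using W_touch[OF assms] W_rows[OF assms] by (auto simp: touch_def nbr_def)

lemma K:
  assumes "j < D" "Suc s < M"
  shows "ipath (K j s)" "set (K j s) \<subseteq> W j s" "hd (K j s) \<in> nbr s" "last (K j s) \<in> nbr (Suc s)"
    "\<And>w. w \<in> set (K j s) ==> w \<in> nbr s ==> w = hd (K j s)"
proof -
  have "W j s \<inter> nbr s \<noteq> {}" "W j s \<inter> nbr (Suc s) \<noteq> {}"
    using W_nbr[OF assms] assms by auto
  from exists_ipath[OF conjunct1[OF W_conn[OF assms]] conjunct2[OF W_conn[OF assms]] this]
  have "\<exists>xs. ipath xs \<and> set xs \<subseteq> W j s \<and> hd xs \<in> nbr s \<and> last xs \<in> nbr (Suc s) \<and>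
     (\<forall>i<length xs. xs ! i \<in> nbr s \<longrightarrow> i = 0) \<and> (\<forall>i<length xs. xs ! i \<in> nbr (Suc s) \<longrightarrow> i = length xs - 1)"
    by metis
  from someI_ex[OF this] have *: "ipath (K j s)" "set (K j s) \<subseteq> W j s" "hd (K j s) \<in> nbr s" "last (K j s) \<in> nbr (Suc s)"
    "\<forall>i<length (K j s). K j s ! i \<in> nbr s \<longrightarrow> i = 0"
    unfolding K_def[symmetric] by blast+
  show "ipath (K j s)" "set (K j s) \<subseteq> W j s" "hd (K j s) \<in> nbr s" "last (K j s) \<in> nbr (Suc s)"
    using * by blast+
  show "w = hd (K j s)" if "w \<in> set (K j s)" "w \<in> nbr s" for w
    using * that ipathD(1)[OF *(1)] by (auto simp: in_set_conv_nth hd_conv_nth)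
qed

definition Z :: "nat => nat => nat set" where
  "Z j r = {p. p < length (\<rho> r) \<and> (\<exists>s w. Suc s < M \<and> w \<in> W j s \<and> E w (\<rho> r ! p))}"

text \<open>The interval of a row spanned by the attachments of one column. It joins the wires of
  this column below and above the row, so that connectors can pass over rows that are not
  selected.\<close>

definition J :: "nat => nat => 'a set" where
  "J j r = seg (\<rho> r) (Min (Z j r)) (Max (Z j r))"

lemma finite_Z [simp]: "finite (Z j r)"
  by (simp add: Z_def)

lemma Z_order: "j < j' ==> j' < D ==> r < M ==> p \<in> Z j r ==> p' \<in> Z j' r ==> Suc p < p'"
  unfolding Z_def using W_ordered[of j j' _ _ r _ _ p p'] by blast

lemma Z_between:
  assumes "j < D" "j' < D" "j \<noteq> j'" "r < M" "Z j r \<noteq> {}" "p \<in> Z j' r" "Min (Z j r) \<le> q" "q \<le> Max (Z j r)"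
  shows "\<not> (p \<le> Suc q \<and> q \<le> Suc p)"
proof -
  have mm: "Min (Z j r) \<in> Z j r" "Max (Z j r) \<in> Z j r" using assms(5) by simp_all
  show ?thesis
  proof (cases "j < j'")
    case True
    then show ?thesis using Z_order[OF True assms(2,4) mm(2) assms(6)] assms(8) by linarith
  next
    case False
    then have "j' < j" using assms(3) by simp
    then show ?thesis using Z_order[OF _ assms(1,4,6) mm(1)] assms(7) by linarith
  qed
qed

lemma W_in_Z: "Suc s < M ==> w \<in> W j s ==> p < length (\<rho> r) ==> E w (\<rho> r ! p) ==> p \<in> Z j r"
  unfolding Z_def by blast

lemma J_elem:
  assumes "Z j r \<noteq> {}" "v \<in> J j r"
  obtains p where "v = \<rho> r ! p" "p < length (\<rho> r)" "Min (Z j r) \<le> p" "p \<le> Max (Z j r)"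
proof -
  have "Max (Z j r) < length (\<rho> r)" using Max_in[OF finite_Z assms(1)] by (simp add: Z_def)
  then show ?thesis using assms(2) that by (auto simp: J_def seg_def)
qed

lemma W_J_anti:
  assumes "j < D" "j' < D" "j \<noteq> j'" "Suc s < M" "r < M" "Z j' r \<noteq> {}"
  shows "\<not> touch (W j s) (J j' r)"
proof
  assume "touch (W j s) (J j' r)"
  then obtain w v where w: "w \<in> W j s" "v \<in> J j' r" "w = v \<or> E w v" by (auto simp: touch_def)
  obtain p where p: "v = \<rho> r ! p" "p < length (\<rho> r)" "Min (Z j' r) \<le> p" "p \<le> Max (Z j' r)"
    by (rule J_elem[OF assms(6) w(2)])
  have "w \<noteq> v" using W_rows[OF assms(1,4,5)] w(1) p by auto
  then have "p \<in> Z j r" using W_in_Z[OF assms(4) w(1) p(2)] w(3) p by auto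
  then show False
    using Z_between[OF assms(2,1) assms(3)[symmetric] assms(5,6) _ p(3,4), of p] by simp
qed

lemma J_J_anti:
  assumes "j < D" "j' < D" "j \<noteq> j'" "r < M" "r' < M" "Z j r \<noteq> {}" "Z j' r' \<noteq> {}"
  shows "\<not> touch (J j r) (J j' r')"
proof
  assume "touch (J j r) (J j' r')"
  then obtain v v' where v: "v \<in> J j r" "v' \<in> J j' r'" "v = v' \<or> E v v'" by (auto simp: touch_def)
  obtain p where p: "v = \<rho> r ! p" "p < length (\<rho> r)" "Min (Z j r) \<le> p" "p \<le> Max (Z j r)"
    by (rule J_elem[OF assms(6) v(1)])
  obtain p' where p': "v' = \<rho> r' ! p'" "p' < length (\<rho> r')" "Min (Z j' r') \<le> p'" "p' \<le> Max (Z j' r')"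
    by (rule J_elem[OF assms(7) v(2)])
  have "v \<in> set (\<rho> r)" "v' \<in> set (\<rho> r')" using p p' by simp_all
  then have rr: "r = r'"
    using rows_anti[OF assms(4,5)] v(3) unfolding touch_def by blast
  have near: "p \<le> Suc p' \<and> p' \<le> Suc p"
    using seg_anti_row[OF rows[OF assms(4)] p(2)] p' v p rr by auto
  have mm: "Min (Z j r) \<in> Z j r" "Max (Z j r) \<in> Z j r" "Min (Z j' r) \<in> Z j' r" "Max (Z j' r) \<in> Z j' r"
    using assms(6,7) rr by simp_all
  consider "j < j'" | "j' < j" using assms(3) by linarith
  then show False
  proof cases
    case 1
    then show ?thesis using Z_order[OF 1 assms(2,4) mm(2,3)] near p p' rr by simp
  next
    case 2
    then show ?thesis using Z_order[OF 2 assms(1,4) mm(4,1)] near p p' rr by simp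
  qed
qed

lemma Z_ne:
  assumes "j < D" "Suc s < M"
  shows "Z j s \<noteq> {}" "Z j (Suc s) \<noteq> {}" "touch (set (K j s)) (J j s)" "touch (set (K j s)) (J j (Suc s))"
proof -
  have *: "Z j r \<noteq> {} \<and> touch (set (K j s)) (J j r)" if w: "w \<in> set (K j s)" "w \<in> nbr r" for w r
  proof -
    obtain p where p: "p < length (\<rho> r)" "E w (\<rho> r ! p)"
      using w(2) by (auto simp: nbr_def in_set_conv_nth)
    have "p \<in> Z j r" using W_in_Z[OF assms(2) _ p] K(2)[OF assms] w(1) by auto
    moreover then have "\<rho> r ! p \<in> J j r" by (auto simp: J_def seg_def)
    ultimately show ?thesis using w p by (auto simp: touch_def)
  qed
  have "hd (K j s) \<in> set (K j s)" "last (K j s) \<in> set (K j s)"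
    using ipathD(1)[OF K(1)[OF assms]] by auto
  then show "Z j s \<noteq> {}" "Z j (Suc s) \<noteq> {}" "touch (set (K j s)) (J j s)" "touch (set (K j s)) (J j (Suc s))"
    using * K(3,4)[OF assms] by blast+
qed

lemma conn_J:
  assumes "r < M" "Z j r \<noteq> {}"
  shows "conn (J j r)"
proof -
  have "Max (Z j r) < length (\<rho> r)" using Max_in[OF finite_Z assms(2)] by (simp add: Z_def)
  then show ?thesis unfolding J_def
    by (intro conn_seg rows assms(1)) (use assms(2) in auto)
qed

lemma J_row: "Z j r \<noteq> {} ==> J j r \<subseteq> set (\<rho> r)"
  using J_elem by (metis nth_mem subsetI)

text \<open>A wire between rows that need not be consecutive: the short wires of column
  \<open>j\<close>, joined by intervals of the rows strictly in between. Selected rows contribute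
  nothing, hence the open range for \<open>J\<close>.\<close>

definition C :: "nat => nat => nat => 'a set" where
  "C j a b = (\<Union>s\<in>{a..<b}. set (K j s)) \<union> (\<Union>s\<in>{a<..<b}. J j s)"

lemma conn_C:
  assumes "j < D" "a < b" "b < M"
  shows "conn (C j a b)"
proof -
  have "Suc a \<le> b" using assms by simp
  then show ?thesis
    using assms(3)
  proof (induction b rule: dec_induct)
    case base
    have "{a..<Suc a} = {a}" "{a<..<Suc a} = {}" by auto
    then show ?case using conn_ipath[OF K(1)[OF assms(1)], of a] base by (simp add: C_def)
  next
    case (step n)
    have eq: "C j a (Suc n) = (C j a n \<union> J j n) \<union> set (K j n)"
    proof -
      have "{a..<Suc n} = insert n {a..<n}" "{a<..<Suc n} = insert n {a<..<n}" using step by auto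
      then show ?thesis by (auto simp: C_def)
    qed
    obtain m where m: "n = Suc m" using step by (cases n) auto
    have n: "Suc n < M" "Suc m < M" using step m by auto
    have "touch (set (K j m)) (J j n)" using Z_ne(4)[OF assms(1) n(2)] m by simp
    moreover have "set (K j m) \<subseteq> C j a n" using step m by (auto simp: C_def)
    ultimately have "touch (C j a n) (J j n)" by (rule touch_mono) simp
    moreover have "conn (J j n)" using conn_J Z_ne(1)[OF assms(1) n(1)] n by simp
    moreover have "conn (C j a n)" using step n by simp
    ultimately have 1: "conn (C j a n \<union> J j n)" using conn_Un by blast
    have "touch (J j n) (set (K j n))" using Z_ne(3)[OF assms(1) n(1)] touch_sym by blast
    then have "touch (C j a n \<union> J j n) (set (K j n))" by (rule touch_mono) auto
    then show ?case
      unfolding eq using conn_Un[OF 1 conn_ipath[OF K(1)[OF assms(1) n(1)]]] by simp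
  qed
qed

lemma C_cases:
  assumes "j < D" "b < M" "w \<in> C j a b"
  obtains s where "a \<le> s" "s < b" "Suc s < M" "w \<in> set (K j s)" "w \<in> W j s"
  | s where "a < s" "s < b" "w \<in> J j s" "w \<in> set (\<rho> s)" "Z j s \<noteq> {}" "s < M"
proof -
  from assms(3) consider s where "a \<le> s" "s < b" "w \<in> set (K j s)" | s where "a < s" "s < b" "w \<in> J j s"
    by (auto simp: C_def)
  then show thesis
  proof cases
    case (1 s)
    then show ?thesis using that(1)[of s] assms K(2)[OF assms(1), of s] by auto
  next
    case (2 s)
    then have s: "Suc s < M" using assms by simp
    show ?thesis using that(2)[of s] 2 Z_ne(1)[OF assms(1) s] J_row s by auto
  qed
qed

lemma C_subset: "j < D ==> b < M ==> C j a b \<subseteq> V"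
proof
  fix w assume j: "j < D" "b < M" "w \<in> C j a b"
  then show "w \<in> V"
  proof (cases rule: C_cases)
    case (1 s)
    then show ?thesis using W_conn[OF j(1), of s] by auto
  next
    case (2 s)
    then show ?thesis using ipathD(3)[OF rows[OF 2(6)]] by auto
  qed
qed

lemma C_rows:
  assumes "j < D" "b < M" "r < M" "r \<le> a \<or> b \<le> r"
  shows "C j a b \<inter> set (\<rho> r) = {}"
proof (rule ccontr)
  assume "\<not> ?thesis"
  then obtain w where w: "w \<in> C j a b" "w \<in> set (\<rho> r)" by auto
  from assms(1,2) w(1) show False
  proof (cases rule: C_cases)
    case (1 s)
    then show ?thesis using W_rows[OF assms(1), of s r] assms w by auto
  next
    case (2 s)
    then have "\<not> touch (set (\<rho> s)) (set (\<rho> r))" using rows_anti[of s r] assms by auto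
    then show ?thesis using not_touch_disjoint 2 w by blast
  qed
qed

text \<open>The contact with the lower row \<open>a\<close> is the head of the short wire that
  starts there, for every upper row \<open>b\<close>. Thus the shape of a crossing is determined
  before the rows are selected.\<close>

lemma C_nbr:
  assumes "j < D" "b < M" "r < M" "r \<le> a \<or> b \<le> r" "w \<in> C j a b" "w \<in> nbr r"
  shows "(r = a \<and> w = hd (K j a)) \<or> r = b"
  using assms(1,2,5)
proof (cases rule: C_cases)
  case (1 s)
  then have "r = s \<or> r = Suc s"
    using W_nbr[OF assms(1), of s r] assms by auto
  then show ?thesis
  proof
    assume "r = s"
    then have "s = a" using 1 assms(4) by auto
    then show ?thesis using K(5)[OF assms(1) 1(3,4)] assms(6) \<open>r = s\<close> by auto
  next
    assume "r = Suc s" then show ?thesis using 1 assms(4) by auto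
  qed
next
  case (2 s)
  then have "\<not> touch (set (\<rho> s)) (set (\<rho> r))" using rows_anti[of s r] assms by auto
  then show ?thesis using 2 assms(6) by (auto simp: touch_def nbr_def)
qed

lemma C_anti:
  assumes "j < D" "j' < D" "j \<noteq> j'" "b < M" "b' < M"
  shows "\<not> touch (C j a b) (C j' a' b')"
proof
  assume "touch (C j a b) (C j' a' b')"
  then obtain w w' where w: "w \<in> C j a b" "w' \<in> C j' a' b'" "w = w' \<or> E w w'" by (auto simp: touch_def)
  have t: "touch {w} {w'}" "touch {w'} {w}" using w(3) E_sym by (auto simp: touch_def)
  have no: False if "\<not> touch A B" "w \<in> A" "w' \<in> B" for A B
    using that t touch_mono[of "{w}" "{w'}" A B] by blast
  from assms(1,4) w(1) show False
  proof (cases rule: C_cases)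
    case s: (1 s)
    from assms(2,5) w(2) show ?thesis
    proof (cases rule: C_cases)
      case (1 s')
      then show ?thesis using W_anti[OF assms(1,2,3), of s s'] no s by blast
    next
      case (2 s')
      then show ?thesis using W_J_anti[OF assms(1,2,3), of s s'] no s by blast
    qed
  next
    case s: (2 s)
    from assms(2,5) w(2) show ?thesis
    proof (cases rule: C_cases)
      case (1 s')
      then show ?thesis using W_J_anti[OF assms(2,1) assms(3)[symmetric], of s' s] no s touch_sym by blast
    next
      case (2 s')
      then show ?thesis using J_J_anti[OF assms(1,2,3), of s s'] no s by blast
    qed
  qed
qed

lemma C_order:
  assumes "j < j'" "j' < D" "b < M" "b' < M" "r < M" "r \<le> a \<or> b \<le> r" "r \<le> a' \<or> b' \<le> r" "w \<in> C j a b" "w' \<in> C j' a' b'"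
    "p < length (\<rho> r)" "p' < length (\<rho> r)" "E w (\<rho> r ! p)" "E w' (\<rho> r ! p')"
  shows "Suc p < p'"
proof -
  have inZ: "p \<in> Z j r" if "j < D" "b < M" "r \<le> a \<or> b \<le> r" "w \<in> C j a b" "p < length (\<rho> r)" "E w (\<rho> r ! p)" for j a b w p
    using that(1,2,4)
  proof (cases rule: C_cases)
    case (1 s)
    then show ?thesis using W_in_Z that by blast
  next
    case (2 s)
    then have "\<not> touch (set (\<rho> s)) (set (\<rho> r))" using rows_anti[of s r] assms(5) that by auto
    then show ?thesis using 2 that by (auto simp: touch_def)
  qed
  have "j < D" using assms by simp
  then show ?thesis
    using Z_order[OF assms(1,2,5)] inZ[of j b a w p] inZ[of j' b' a' w' p'] assms by blast
qed

definition feet :: "nat => nat => nat set" where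
  "feet j s = {p. p < length (\<rho> s) \<and> E (hd (K j s)) (\<rho> s ! p)}"

text \<open>The three shapes of a crossing: one attachment, two consecutive ones, or attachments
  further apart. They are realised by a branch vertex on the row, a triangle and a branch vertex on
  the connector.\<close>

definition foot_type :: "nat => nat => nat" where
  "foot_type j s = min 2 (Max (feet j s) - Min (feet j s))"

end

text \<open>All rows but the top one carry feet, and a column has a word of three possible foot
  types over them. Some \<open>2 * t * t\<close> columns, one for each node of the wall, share their
  word, and \<open>4 * t + 1\<close> of the rows have equal letters in it. Connectors over these
  rows form a uniform staircase.\<close>

theorem (in fin_graph) wiring_wall_like:
  assumes "wiring V E (Suc (3 * (4 * t + 1))) (2 * t * t * 3 ^ (3 * (4 * t + 1))) \<rho> W"
  shows "wall_like t"
proof -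
  define S where "S = 3 * (4 * t + 1)"
  define D where "D = 2 * t * t * 3 ^ S"
  interpret wiring V E "Suc S" D \<rho> W
    using assms by (simp add: S_def D_def)
  define ty where "ty j = map (foot_type j) [0..<S]" for j
  let ?F = "{xs. set xs \<subseteq> {0, 1, 2 :: nat} \<and> length xs = S}"
  have c3: "card {0, 1, 2 :: nat} = 3" by simp
  have F: "finite ?F" "card ?F = 3 ^ S"
  proof -
    have fin: "finite {0, 1, 2 :: nat}" by simp
    show "finite ?F" by (rule finite_lists_length_eq[OF fin])
    show "card ?F = 3 ^ S" using card_lists_length_eq[OF fin, of S] unfolding c3 .
  qed
  have F_ne: "?F \<noteq> {}" using F(2) by (metis card.empty power_eq_0_iff zero_neq_numeral)
  have img: "ty ` {..<D} \<subseteq> ?F"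
    by (auto simp: ty_def foot_type_def min_def)
  have le: "2 * t * t * card ?F \<le> card {..<D}" by (simp only: F(2) D_def card_lessThan)
  obtain y Js where Js: "Js \<subseteq> {..<D}" "card Js = 2 * t * t" "\<And>j. j \<in> Js ==> ty j = y"
    by (rule pigeonhole_fiber_subset[OF finite_lessThan F(1) F_ne img le]) blast
  \<comment> \<open>\<open>min 2\<close> keeps the values among the three types without any
    information on \<open>y\<close>.\<close>
  define g where "g s = min 2 (y ! s)" for s
  have g: "foot_type j s = g s" if "j \<in> Js" "s < S" for j s
    using Js(3)[OF that(1)] that(2) by (auto simp: ty_def g_def foot_type_def)
  obtain c Is where Is: "Is \<subseteq> {..<S}" "card Is = 4 * t + 1" "\<And>s. s \<in> Is ==> g s = c"
    by (rule pigeonhole_fiber_subset[of "{..<S}" "{0, 1, 2 :: nat}" g "4 * t + 1"])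
      (auto simp: g_def S_def min_def)
  obtain f where f: "\<And>i. i < 4 * t + 1 ==> f i \<in> Is" "\<And>i j. i < j ==> j < 4 * t + 1 ==> f i < f j"
    by (rule strict_enumeration[OF Is(2)]) (simp, blast)
  have "finite Js" using Js(1) by (rule finite_subset) simp
  then have "2 * t * t > 0 \<or> finite Js" by simp
  then obtain jn where jn: "\<And>i. i < 2 * t * t ==> jn i \<in> Js" "\<And>i j. i < j ==> j < 2 * t * t ==> jn i < jn j"
    by (rule strict_enumeration[OF Js(2)]) blast
  have fM: "f r < S" if "r \<le> 4 * t" for r using f(1)[of r] Is(1) that by auto
  have f_mono: "f r \<le> f r'" if "r \<le> r'" "r' \<le> 4 * t" for r r'
    using f(2)[of r r'] that by (cases "r = r'") auto
  have f_inj: "f r = f r' \<longleftrightarrow> r = r'" if "r \<le> 4 * t" "r' \<le> 4 * t" for r r'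
    using f(2)[of r r'] f(2)[of r' r] that by (cases r r' rule: linorder_cases) auto
  have reg: "region t x < 2 * t * t" if "x \<in> nodes t" for x
  proof -
    have "Suc (snd x) * t \<le> 2 * t * t" using that by (intro mult_le_mono1) (auto simp: nodes_def)
    then show ?thesis using that by (auto simp: region_def nodes_def)
  qed
  \<comment> \<open>A node uses the column numbered by its region, so that the order of columns on
    the rows becomes the order of \<open>region\<close>.\<close>
  define z where "z x = jn (region t x)" for x
  define lw where "lw x = f (row t x)" for x
  define up where "up x = f (Suc (row t x))" for x
  have zD: "z x \<in> Js" "z x < D" if "x \<in> nodes t" for x
    using jn(1)[OF reg[OF that]] Js(1) by (auto simp: z_def)
  have z_less: "z x < z y" if "region t x < region t y" "y \<in> nodes t" for x y
    using jn(2)[OF that(1) reg[OF that(2)]] by (simp add: z_def)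
  have lu: "lw x < up x" "up x < S" "lw x < S" "Suc (lw x) < Suc S" if "x \<in> nodes t" for x
    using row_less[OF that] f(2)[of "row t x" "Suc (row t x)"] fM[of "Suc (row t x)"] by (auto simp: lw_def up_def)
  define good where "good x xs \<longleftrightarrow> ipath xs \<and> set xs \<subseteq> C (z x) (lw x) (up x) \<and> hd xs \<in> nbr (lw x) \<and> last xs \<in> nbr (up x) \<and>
     (\<forall>i<length xs. xs ! i \<in> nbr (lw x) \<longrightarrow> i = 0) \<and> (\<forall>i<length xs. xs ! i \<in> nbr (up x) \<longrightarrow> i = length xs - 1)" for x xs
  define \<kappa> where "\<kappa> x = (SOME xs. good x xs)" for x
  have \<kappa>: "good x (\<kappa> x)" if x: "x \<in> nodes t" for x
  proof -
    note l = lu[OF x] and zd = zD(2)[OF x]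
    have "hd (K (z x) (lw x)) \<in> C (z x) (lw x) (up x)"
      using l hd_in_set[OF ipathD(1)[OF K(1)[OF zd l(4)]]] unfolding C_def by fastforce
    then have n1: "C (z x) (lw x) (up x) \<inter> nbr (lw x) \<noteq> {}" using K(3)[OF zd l(4)] by auto
    obtain b where b: "up x = Suc b" using l(1) by (cases "up x") auto
    have "last (K (z x) b) \<in> C (z x) (lw x) (up x)"
      using l b last_in_set[OF ipathD(1)[OF K(1)[OF zd, of b]]] unfolding C_def by fastforce
    then have n2: "C (z x) (lw x) (up x) \<inter> nbr (up x) \<noteq> {}" using K(4)[OF zd, of b] b l by auto
    have "\<exists>xs. good x xs"
      unfolding good_def
      by (rule exists_ipath[OF conn_C[OF zd l(1)] C_subset[OF zd] n1 n2]) (use l in auto)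
    then show ?thesis unfolding \<kappa>_def by (rule someI_ex)
  qed
  have sideM: "f r < Suc S \<and> (f r \<le> lw x \<or> up x \<le> f r)" if "x \<in> nodes t" "r \<le> 4 * t" for x r
    using fM[OF that(2)] f_mono[of r "row t x"] f_mono[of "Suc (row t x)" r] that row_less[OF that(1)]
    by (cases "r \<le> row t x") (auto simp: lw_def up_def)
  have kC: "w \<in> C (z x) (lw x) (up x)" if "x \<in> nodes t" "w \<in> set (\<kappa> x)" for x w
    using \<kappa>[OF that(1)] that(2) by (auto simp: good_def)
  have hdK: "hd (\<kappa> x) = hd (K (z x) (lw x))" if x: "x \<in> nodes t" for x
  proof -
    have "hd (\<kappa> x) \<in> set (\<kappa> x)" "hd (\<kappa> x) \<in> nbr (lw x)" using \<kappa>[OF x] ipathD(1) by (auto simp: good_def)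
    then show ?thesis
      using C_nbr[OF zD(2)[OF x], of "up x" "lw x" "lw x" "hd (\<kappa> x)"] kC[OF x] lu[OF x] by auto
  qed
  interpret st: staircase V E t "\<lambda>r. \<rho> (f r)" \<kappa>
  proof
    fix r assume r: "r \<le> 4 * t"
    show "ipath (\<rho> (f r))" using rows fM[OF r] by simp
    show "\<not> touch (set (\<rho> (f r))) (set (\<rho> (f r')))" if "r' \<le> 4 * t" "r \<noteq> r'" for r'
      using rows_anti fM[OF r] fM[OF that(1)] f_inj[OF r that(1)] that by simp
  next
    fix x assume x: "x \<in> nodes t"
    show "ipath (\<kappa> x)" using \<kappa>[OF x] by (simp add: good_def)
    note sm = sideM[OF x] and zd = zD(2)[OF x] and l = lu[OF x]
    show "set (\<kappa> x) \<inter> set (\<rho> (f r)) = {}" if "r \<le> 4 * t" for r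
      using C_rows[OF zd, of "up x" "f r" "lw x"] sm[OF that] l kC[OF x] by auto
    show "(r = row t x \<and> i = 0) \<or> (r = Suc (row t x) \<and> i = length (\<kappa> x) - 1)"
      if "r \<le> 4 * t" "i < length (\<kappa> x)" "p < length (\<rho> (f r))" "E (\<kappa> x ! i) (\<rho> (f r) ! p)" for r i p
    proof -
      have nb: "\<kappa> x ! i \<in> nbr (f r)" using that by (auto simp: nbr_def)
      have "f r = lw x \<or> f r = up x"
        using C_nbr[OF zd, of "up x" "f r" "lw x" "\<kappa> x ! i"] sm[OF that(1)] l kC[OF x] nb that(2) by auto
      then show ?thesis
      proof
        assume eq: "f r = lw x"
        then have "r = row t x" using f_inj[OF that(1), of "row t x"] row_less[OF x] by (simp add: lw_def)
        then show ?thesis using \<kappa>[OF x] nb that(2) eq by (simp add: good_def)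
      next
        assume eq: "f r = up x"
        then have "r = Suc (row t x)" using f_inj[OF that(1), of "Suc (row t x)"] row_less[OF x] by (simp add: up_def)
        then show ?thesis using \<kappa>[OF x] nb that(2) eq by (simp add: good_def)
      qed
    qed
    show "\<exists>p<length (\<rho> (f (row t x))). E (hd (\<kappa> x)) (\<rho> (f (row t x)) ! p)"
      using \<kappa>[OF x] by (auto simp: good_def nbr_def lw_def in_set_conv_nth)
    show "\<exists>p<length (\<rho> (f (Suc (row t x)))). E (last (\<kappa> x)) (\<rho> (f (Suc (row t x))) ! p)"
      using \<kappa>[OF x] by (auto simp: good_def nbr_def up_def in_set_conv_nth)
    fix y assume y: "y \<in> nodes t"
    show "\<not> touch (set (\<kappa> x)) (set (\<kappa> y))" if "x \<noteq> y"
    proof -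
      have "z x \<noteq> z y"
        using region_inj[OF x y] that z_less[of x y] z_less[of y x] x y by (metis less_irrefl linorder_neqE_nat)
      then show ?thesis
        using C_anti[OF zd zD(2)[OF y], of "up x" "up y" "lw x" "lw y"] lu[OF x] lu[OF y] kC[OF x] kC[OF y]
        unfolding touch_def by (meson less_SucI)
    qed
    fix r w w' p p'
    assume "region t x < region t y" "r \<le> 4 * t" "w \<in> set (\<kappa> x)" "w' \<in> set (\<kappa> y)"
      "p < length (\<rho> (f r))" "p' < length (\<rho> (f r))" "E w (\<rho> (f r) ! p)" "E w' (\<rho> (f r) ! p')"
    then show "Suc p < p'"
      using C_order[OF z_less zD(2)[OF y], of x "up x" "up y" "f r" "lw x" "lw y" w w' p p'] y
        sideM[OF x, of r] sideM[OF y, of r] lu[OF x] lu[OF y] kC[OF x] kC[OF y] by auto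
  qed
  have feet: "st.touched x (row t x) = feet (z x) (lw x)" if x: "x \<in> nodes t" for x
  proof -
    have "w = hd (\<kappa> x)" if "w \<in> set (\<kappa> x)" "p < length (\<rho> (f (row t x)))" "E w (\<rho> (f (row t x)) ! p)" for w p
      using st.touched_hd[OF x that] .
    moreover have "hd (\<kappa> x) \<in> set (\<kappa> x)" using st.kappa_ne[OF x] by simp
    ultimately have "st.touched x (row t x) = {p. p < length (\<rho> (f (row t x))) \<and> E (hd (\<kappa> x)) (\<rho> (f (row t x)) ! p)}"
      unfolding st.touched_def by blast
    then show ?thesis
      by (simp add: feet_def hdK[OF x] lw_def)
  qed
  have ty: "min 2 (st.hi x - st.lo x) = c" if x: "x \<in> nodes t" for x
    using g[OF zD(1)[OF x] lu(3)[OF x]] Is(3)[of "lw x"] f(1)[of "row t x"] row_less[OF x]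
    unfolding st.hi_def st.lo_def feet[OF x] foot_type_def by (simp add: lw_def)
  have lh: "st.lo x \<le> st.hi x" if "x \<in> nodes t" for x using st.lo_le_hi[OF that] .
  consider "c = 0" | "c = 1" | "c \<ge> 2" by linarith
  then show ?thesis
  proof cases
    case 1
    then have "st.hi x = st.lo x" if "x \<in> nodes t" for x using ty[OF that] lh[OF that] by (auto simp: min_def split: if_splits)
    then show ?thesis by (rule st.wall_like_if_single)
  next
    case 2
    then have "st.hi x = Suc (st.lo x)" if "x \<in> nodes t" for x using ty[OF that] lh[OF that] by (auto simp: min_def split: if_splits)
    then show ?thesis by (rule st.wall_like_if_triangles)
  next
    case 3
    then have "Suc (Suc (st.lo x)) \<le> st.hi x" if "x \<in> nodes t" for x using ty[OF that] lh[OF that] by (auto simp: min_def split: if_splits)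
    then show ?thesis by (rule st.wall_like_if_wide)
  qed
qed

section \<open>Rows crossed by ordered columns\<close>

text \<open>For connected hypergraphs \<open>\<E>\<close> on \<open>{..<K}\<close>: the two cases are an induced star with centre \<open>c\<close> and an induced path.\<close>
lemma star_or_path:
  "\<exists>K. \<forall>\<E> :: nat set set. (\<forall>e\<in>\<E>. e \<subseteq> {..<K} \<and> card e \<le> b) \<and>
      (\<forall>A\<subseteq>{..<K}. A \<noteq> {} \<longrightarrow> A \<noteq> {..<K} \<longrightarrow> (\<exists>e\<in>\<E>. e \<inter> A \<noteq> {} \<and> e - A \<noteq> {})) \<longrightarrow>
    (\<exists>c v e. inj_on v {..<M} \<and> c < K \<and> (\<forall>s<M. v s < K \<and> v s \<noteq> c \<and> e s \<in> \<E> \<and> c \<in> e s \<and> e s \<inter> v ` {..<M} = {v s})) \<or>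
    (\<exists>v e. inj_on v {..<M} \<and> (\<forall>s<M. v s < K) \<and> (\<forall>s. Suc s < M \<longrightarrow> e s \<in> \<E> \<and> e s \<inter> v ` {..<M} = {v s, v (Suc s)}))"
    (is "\<exists>K. \<forall>\<E>. _ \<longrightarrow> ?star K \<E> \<or> ?path K \<E>")
proof -
  from free_subset[where 'b = nat and d = 1 and b = b and m = M]
  obtain N :: nat where N: "\<forall>(I :: nat set) f. finite I \<and> N \<le> card I \<and>
     (\<forall>D\<subseteq>I. card D = 1 \<longrightarrow> finite (f D) \<and> card (f D) \<le> b) \<longrightarrow>
     (\<exists>J\<subseteq>I. card J = M \<and> (\<forall>D\<subseteq>J. card D = 1 \<longrightarrow> f D \<inter> J \<subseteq> D))"
    by (elim exE)
  \<comment> \<open>With fewer than \<open>N\<close> neighbours at each vertex, a ball of radius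
    \<open>k\<close> has at most \<open>Suc N ^ k\<close> elements. As \<open>K\<close> exceeds this
    for radius \<open>M\<close>, the balls must grow that long.\<close>
  define K where "K = Suc (Suc N ^ M)"
  show ?thesis
  proof (rule exI[of _ K], intro allI impI, elim conjE)
    fix \<E> :: "nat set set"
    assume small: "\<forall>e\<in>\<E>. e \<subseteq> {..<K} \<and> card e \<le> b"
      and cross: "\<forall>A\<subseteq>{..<K}. A \<noteq> {} \<longrightarrow> A \<noteq> {..<K} \<longrightarrow> (\<exists>e\<in>\<E>. e \<inter> A \<noteq> {} \<and> e - A \<noteq> {})"
    define adj where "adj i i' \<longleftrightarrow> (\<exists>e\<in>\<E>. i \<in> e \<and> i' \<in> e)" for i i'
    have adjK: "i < K \<and> i' < K" if "adj i i'" for i i' using that small by (auto simp: adj_def)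
    have adj_sym: "adj i i' \<longleftrightarrow> adj i' i" for i i' by (auto simp: adj_def)
    define nb where "nb c = {i. adj c i \<and> i \<noteq> c}" for c
    have nbK: "nb c \<subseteq> {..<K}" for c using adjK by (auto simp: nb_def)
    have fin_nb: "finite (nb c)" for c using nbK finite_subset by blast
    show "?star K \<E> \<or> ?path K \<E>"
    proof (cases "\<exists>c<K. N \<le> card (nb c)")
      case True
      then obtain c where c: "c < K" "N \<le> card (nb c)" by auto
      define h where "h i = (SOME e. e \<in> \<E> \<and> c \<in> e \<and> i \<in> e)" for i
      have h: "h i \<in> \<E> \<and> c \<in> h i \<and> i \<in> h i" if "i \<in> nb c" for i
      proof -
        have "\<exists>e. e \<in> \<E> \<and> c \<in> e \<and> i \<in> e" using that by (auto simp: nb_def adj_def)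
        then show ?thesis unfolding h_def by (rule someI_ex)
      qed
      \<comment> \<open>The set mapping sends \<open>i\<close> to a chosen edge through
        \<open>c\<close> and \<open>i\<close>; in a free set these edges contain no other selected
        vertex.\<close>
      have "\<forall>D\<subseteq>nb c. card D = 1 \<longrightarrow> finite (h (the_elem D)) \<and> card (h (the_elem D)) \<le> b"
      proof (intro allI impI)
        fix D assume "D \<subseteq> nb c" "card D = 1"
        then obtain i where "D = {i}" "i \<in> nb c" by (auto simp: card_1_singleton_iff)
        then show "finite (h (the_elem D)) \<and> card (h (the_elem D)) \<le> b"
          using h[of i] small finite_subset[of "h i" "{..<K}"] by auto
      qed
      then obtain J where J: "J \<subseteq> nb c" "card J = M" "\<forall>D\<subseteq>J. card D = 1 \<longrightarrow> h (the_elem D) \<inter> J \<subseteq> D"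
        using N[rule_format, of "nb c" "\<lambda>D. h (the_elem D)"] fin_nb c(2) by blast
      have "finite J" using J(1) fin_nb finite_subset by blast
      then obtain v where v: "bij_betw v {..<M} J"
        using ex_bij_betw_nat_finite[of J] J(2) by (auto simp: atLeast0LessThan)
      have img: "v ` {..<M} = J" using v by (simp add: bij_betw_def)
      have "v s < K \<and> v s \<noteq> c \<and> h (v s) \<in> \<E> \<and> c \<in> h (v s) \<and> h (v s) \<inter> v ` {..<M} = {v s}" if s: "s < M" for s
      proof -
        have vJ: "v s \<in> J" using s img by auto
        then have "h (v s) \<inter> J \<subseteq> {v s}" using J(3)[rule_format, of "{v s}"] by simp
        then show ?thesis
          using vJ J(1) h[of "v s"] nbK img by (auto simp: nb_def)
      qed
      then have "?star K \<E>"
        using c(1) v by (intro exI[of _ c] exI[of _ v] exI[of _ "\<lambda>s. h (v s)"]) (simp add: bij_betw_def)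
      then show ?thesis ..
    next
      case False
      \<comment> \<open>Balls around the vertex \<open>0\<close>. A shortest path takes one vertex
        from each distance layer, and an edge of the hypergraph meets at most two consecutive
        layers.\<close>
      define B where "B k = ((\<lambda>S. S \<union> (\<Union>x\<in>S. nb x)) ^^ k) {0}" for k :: nat
      have B_Suc: "B (Suc k) = B k \<union> (\<Union>x\<in>B k. nb x)" for k by (simp add: B_def)
      have BK: "B k \<subseteq> {..<K}" for k
        by (induction k) (use nbK in \<open>auto simp: B_Suc\<close>, simp_all add: B_def K_def)
      have finB: "finite (B k)" for k using BK finite_subset by blast
      have B0: "B 0 = {0}" by (simp add: B_def)
      have Bmono: "B k \<subseteq> B l" if "k \<le> l" for k l
        using that by (induction l rule: dec_induct) (auto simp: B_Suc)
      have cardB: "card (B k) \<le> Suc N ^ k" for k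
      proof (induction k)
        case (Suc k)
        have "card (\<Union>x\<in>B k. nb x) \<le> (\<Sum>x\<in>B k. card (nb x))" by (rule card_UN_le[OF finB])
        also have "\<dots> \<le> (\<Sum>x\<in>B k. N)"
          by (rule sum_mono) (use False BK in \<open>auto simp: not_le intro: less_imp_le\<close>)
        finally have "card (B (Suc k)) \<le> card (B k) + card (B k) * N"
          unfolding B_Suc using card_Un_le[of "B k" "\<Union>x\<in>B k. nb x"] by simp
        also have "\<dots> \<le> Suc N ^ Suc k" using Suc by (simp add: algebra_simps add_mono)
        finally show ?case .
      qed (simp add: B0)
      have grow: "B k \<noteq> B (Suc k)" if "k \<le> M" for k
      proof
        assume eq: "B k = B (Suc k)"
        have "card (B k) \<le> Suc N ^ M"
          by (rule le_trans[OF cardB[of k] power_increasing[OF that]]) simp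
        then have "card (B k) < K" unfolding K_def by (rule le_imp_less_Suc)
        then have "B k \<noteq> {..<K}" by (metis card_lessThan less_irrefl)
        moreover have "B k \<noteq> {}" using Bmono[of 0 k] B0 by auto
        ultimately obtain e where e: "e \<in> \<E>" "e \<inter> B k \<noteq> {}" "e - B k \<noteq> {}"
          using cross BK by meson
        then obtain x y where "x \<in> e" "x \<in> B k" "y \<in> e" "y \<notin> B k" by auto
        then have "y \<in> nb x" using e(1) by (auto simp: nb_def adj_def)
        then show False using eq \<open>x \<in> B k\<close> \<open>y \<notin> B k\<close> B_Suc by auto
      qed
      define L where "L k = (if k = 0 then {0} else B k - B (k - 1))" for k
      have chain: "\<exists>v. v k = x \<and> (\<forall>i\<le>k. v i \<in> L i) \<and> (\<forall>i<k. adj (v i) (v (Suc i)))" if "x \<in> L k" for k x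
        using that
      proof (induction k arbitrary: x)
        case 0
        then show ?case by (intro exI[of _ "\<lambda>_. x"]) auto
      next
        case (Suc k)
        then have x: "x \<in> B (Suc k)" "x \<notin> B k" by (auto simp: L_def)
        then obtain w where w: "w \<in> B k" "x \<in> nb w" by (auto simp: B_Suc)
        have "w \<in> L k"
        proof (cases k)
          case 0 then show ?thesis using w B0 by (simp add: L_def)
        next
          case (Suc k')
          then have "w \<notin> B k'" using w x by (auto simp: B_Suc)
          then show ?thesis using w Suc by (simp add: L_def)
        qed
        then obtain v where v: "v k = w" "\<forall>i\<le>k. v i \<in> L i" "\<forall>i<k. adj (v i) (v (Suc i))"
          using Suc.IH by blast
        show ?case
          by (rule exI[of _ "v(Suc k := x)"]) (use v w Suc.prems in \<open>auto simp: le_Suc_eq less_Suc_eq nb_def\<close>)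
      qed
      have "L M \<noteq> {}"
        using grow[of "M - 1"] Bmono[of "M - 1" M] by (cases M) (auto simp: L_def)
      then obtain v where v: "\<And>i. i \<le> M ==> v i \<in> L i" "\<And>i. i < M ==> adj (v i) (v (Suc i))"
        using chain by (metis ex_in_conv)
      have LB: "L k \<subseteq> B k" for k using B0 by (auto simp: L_def)
      have far: "\<not> adj (v i) (v j) \<and> v i \<noteq> v j" if "Suc i < j" "j \<le> M" for i j
      proof -
        have vi: "v i \<in> B i" using v(1)[of i] LB that by auto
        have "v j \<notin> B (j - 1)" using v(1)[of j] that by (auto simp: L_def split: if_splits)
        moreover have "Suc i \<le> j - 1" using that by linarith
        ultimately have "v j \<notin> B (Suc i)" using Bmono[of "Suc i" "j - 1"] by blast
        then have "v j \<notin> nb (v i)" "v j \<noteq> v i" using vi by (auto simp: B_Suc)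
        then show ?thesis by (auto simp: nb_def)
      qed
      have near: "v i \<noteq> v (Suc i)" if "i < M" for i
      proof -
        have "v i \<in> B i" using v(1)[of i] LB that by auto
        moreover have "v (Suc i) \<notin> B i" using v(1)[of "Suc i"] that by (auto simp: L_def)
        ultimately show ?thesis by auto
      qed
      have neq: "v i \<noteq> v j" if "i < j" "j \<le> M" for i j
        using far[of i j] near[of i] that by (cases "j = Suc i") auto
      define e where "e s = (SOME e. e \<in> \<E> \<and> v s \<in> e \<and> v (Suc s) \<in> e)" for s
      have e: "e s \<in> \<E> \<and> v s \<in> e s \<and> v (Suc s) \<in> e s" if "s < M" for s
      proof -
        have "\<exists>e. e \<in> \<E> \<and> v s \<in> e \<and> v (Suc s) \<in> e" using v(2)[OF that] by (auto simp: adj_def)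
        then show ?thesis unfolding e_def by (rule someI_ex)
      qed
      have "e s \<inter> v ` {..<M} = {v s, v (Suc s)}" if s: "Suc s < M" for s
      proof -
        have "l = s \<or> l = Suc s" if l: "l < M" "v l \<in> e s" for l
        proof (rule ccontr)
          assume "\<not> ?thesis"
          then consider "Suc l < Suc s" "l < s" | "Suc s < l" by linarith
          then show False
          proof cases
            case 1
            then have "adj (v l) (v (Suc s))" using e[of s] l s by (auto simp: adj_def)
            then show False using far[of l "Suc s"] 1 s by simp
          next
            case 2
            then have "adj (v s) (v l)" using e[of s] l s by (auto simp: adj_def)
            then show False using far[of s l] 2 l by simp
          qed
        qed
        then show ?thesis using e[of s] s by auto
      qed
      moreover have "inj_on v {..<M}"
        using neq by (intro linorder_inj_onI) auto
      moreover have "v s < K" if "s < M" for s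
        using v(1)[of s] LB BK that by (meson lessThan_iff less_imp_le subsetD)
      ultimately have "?path K \<E>" using e by (intro exI[of _ v] exI[of _ e]) auto
      then show ?thesis ..
    qed
  qed
qed

section \<open>Ladders and the rows touched by parts of their columns\<close>

locale ladder = fin_graph V E for V :: "'a set" and E +
  fixes K D :: nat and \<rho> :: "nat => 'a list" and Q :: "nat => 'a set"
  assumes rows: "r < K ==> ipath (\<rho> r)"
    and rows_anti: "r < K ==> r' < K ==> r \<noteq> r' ==> \<not> touch (set (\<rho> r)) (set (\<rho> r'))"
    and Q_conn: "j < D ==> conn (Q j) \<and> Q j \<subseteq> V"
    and Q_anti: "j < D ==> j' < D ==> j \<noteq> j' ==> \<not> touch (Q j) (Q j')"
    and Q_touch: "j < D ==> r < K ==> touch (Q j) (set (\<rho> r))"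
    and Q_ordered: "j < j' ==> j' < D ==> r < K ==> p < length (\<rho> r) ==> p' < length (\<rho> r) ==>
        touch (Q j) {\<rho> r ! p} ==> touch (Q j') {\<rho> r ! p'} ==> Suc p < p'"
begin

definition on_rows :: "'a set" where "on_rows = (\<Union>r<K. set (\<rho> r))"

definition T :: "'a set => nat set" where "T X = {r. r < K \<and> touch X (set (\<rho> r))}"

lemma finite_T [simp]: "finite (T X)" by (simp add: T_def)

lemma T_subset: "T X \<subseteq> {..<K}" by (auto simp: T_def)

lemma T_mono: "X \<subseteq> Y ==> T X \<subseteq> T Y"
  unfolding T_def using touch_mono by blast

lemma T_on_row: "r < K ==> x \<in> set (\<rho> r) ==> T {x} = {r}"
  using rows_anti[of r] by (auto simp: T_def touch_def)

lemma T_UN: "r \<in> T X \<longleftrightarrow> (\<exists>x\<in>X. r \<in> T {x})"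
  unfolding T_def using touch_iff_singleton[of X] by blast

definition heavy :: "nat => nat => bool" where
  "heavy n j \<longleftrightarrow> (\<exists>x\<in>Q j. x \<notin> on_rows \<and> n \<le> card (T {x}))"

text \<open>Many heavy columns would include \<open>n + 1\<close> whose heavy vertices touch the
  same rows. These vertices, as paths of length zero, and the rows form a path model.\<close>

lemma few_heavy:
  assumes "\<not> PM n"
  shows "card {j. j < D \<and> heavy n j} < Suc n * 2 ^ K"
proof (rule ccontr)
  assume *: "\<not> ?thesis"
  define x where "x j = (SOME x. x \<in> Q j \<and> x \<notin> on_rows \<and> n \<le> card (T {x}))" for j
  have x: "x j \<in> Q j" "x j \<notin> on_rows" "n \<le> card (T {x j})" if "heavy n j" for j
    using someI_ex[of "\<lambda>x. x \<in> Q j \<and> x \<notin> on_rows \<and> n \<le> card (T {x})"] that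
    unfolding heavy_def x_def by blast+
  let ?H = "{j. j < D \<and> heavy n j}"
  obtain R J where J: "R \<in> Pow {..<K}" "J \<subseteq> ?H" "card J = Suc n" "\<And>j. j \<in> J ==> T {x j} = R"
    by (rule pigeonhole_fiber_subset[of ?H "Pow {..<K}" "\<lambda>j. T {x j}" "Suc n"])
      (use * T_subset in \<open>auto simp: card_Pow\<close>)
  have finJ: "finite J" using J(3) by (metis card.infinite nat.distinct(1))
  have finR: "finite R" using J(1) finite_subset by auto
  obtain j0 where j0: "j0 \<in> J" using J(3) by (metis card.empty ex_in_conv nat.distinct(1))
  have xV: "x j \<in> V" if "j \<in> J" for j using x(1)[of j] Q_conn[of j] J(2) that by auto
  have "PM n"
  proof (rule PM_I[of J R n "\<lambda>j. {x j}" "\<lambda>r. set (\<rho> r)"])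
    show "n \<le> card J" using J by simp
    show "n \<le> card R" using x(3)[of j0] J(2,4) j0 by auto
    show "ip {x j}" if "j \<in> J" for j using ip_singleton xV that by blast
    show "ip (set (\<rho> r))" if "r \<in> R" for r using ip_set rows that J(1) by auto
    show "{x i} \<inter> {x j} = {}" if "i \<in> J" "j \<in> J" "i \<noteq> j" for i j
    proof -
      have "i < D" "j < D" "x i \<in> Q i" "x j \<in> Q j" using that J(2) x(1) by auto
      then show ?thesis using Q_anti[of i j] that(3) by (auto simp: touch_def)
    qed
    show "set (\<rho> i) \<inter> set (\<rho> j) = {}" if "i \<in> R" "j \<in> R" "i \<noteq> j" for i j
      using rows_anti[of i j] that J(1) not_touch_disjoint by auto
    show "{x i} \<inter> set (\<rho> j) = {}" if "i \<in> J" "j \<in> R" for i j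
      using x(2)[of i] that J(1,2) by (auto simp: on_rows_def)
    show "touch {x i} (set (\<rho> j))" if "i \<in> J" "j \<in> R" for i j
      using J(4)[OF that(1)] that(2) by (auto simp: T_def)
  qed (use finJ finR in auto)
  then show False using assms by simp
qed

text \<open>A hypergraph on the rows that forgets the vertices of the column, so that many columns
  can have the same one. Its edges are kept small, as required by
  \<open>star_or_path\<close>.\<close>

definition pieces :: "nat => nat => nat set set" where
  "pieces n j = {T Z | Z. Z \<subseteq> Q j \<and> conn Z \<and> Z \<inter> on_rows = {} \<and> card (T Z) \<le> 2 * n}"

text \<open>
  A shortest path in a column between two sets of rows: its ends lie off the rows, and only its ends
  touch rows of the two sets.
\<close>
lemma pieces_cross:
  assumes j: "j < D" "\<not> heavy n j" and A: "A \<subseteq> {..<K}" "A \<noteq> {}" "A \<noteq> {..<K}"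
  shows "\<exists>e\<in>pieces n j. e \<inter> A \<noteq> {} \<and> e - A \<noteq> {}"
proof -
  define A1 where "A1 = {x. T {x} \<inter> A \<noteq> {}}"
  define A2 where "A2 = {x. T {x} - A \<noteq> {}}"
  obtain a b where ab: "a \<in> A" "b < K" "b \<notin> A" using A by auto
  have "a \<in> T (Q j)" "b \<in> T (Q j)" using Q_touch[OF j(1)] ab A by (auto simp: T_def)
  then have ne: "Q j \<inter> A1 \<noteq> {}" "Q j \<inter> A2 \<noteq> {}"
    using ab unfolding A1_def A2_def T_UN[of _ "Q j"] by auto
  obtain xs where xs: "ipath xs" "set xs \<subseteq> Q j" "hd xs \<in> A1" "last xs \<in> A2"
    "\<And>i. i < length xs ==> xs ! i \<in> A1 ==> i = 0"
    "\<And>i. i < length xs ==> xs ! i \<in> A2 ==> i = length xs - 1"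
    using exists_ipath[OF conjunct1[OF Q_conn[OF j(1)]] conjunct2[OF Q_conn[OF j(1)]] ne] by metis
  have nex: "xs \<noteq> []" using ipathD(1)[OF xs(1)] .
  have T_all: "T {x} = {}" if "x \<notin> A1" "x \<notin> A2" for x using that by (auto simp: A1_def A2_def)
  have ends: "T {xs ! i} = {}" if "i < length xs" "i \<noteq> 0" "i \<noteq> length xs - 1" for i
    using T_all xs(5,6) that by blast
  have adjT: "r \<in> T {y}" if "r < K" "x \<in> set (\<rho> r)" "E x y" for r x y
    using that E_sym by (auto simp: T_def touch_def)
  have off: "xs ! i \<notin> on_rows" if i: "i < length xs" for i
  proof
    assume "xs ! i \<in> on_rows"
    then obtain r where r: "r < K" "xs ! i \<in> set (\<rho> r)" by (auto simp: on_rows_def)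
    then have Ti: "T {xs ! i} = {r}" using T_on_row by simp
    have l: "length xs \<noteq> 1"
    proof
      assume "length xs = 1"
      then have "i = 0" "hd xs = xs ! 0" "last xs = xs ! 0" using i nex by (auto simp: hd_conv_nth last_conv_nth)
      then show False using xs(3,4) Ti by (auto simp: A1_def A2_def)
    qed
    have l2: "length xs \<ge> 2" using l nex by (cases xs; cases "tl xs") auto
    consider "r \<in> A" | "r \<notin> A" by blast
    then show False
    proof cases
      case 1
      then have "xs ! i \<in> A1" using Ti unfolding A1_def by blast
      then have "i = 0" by (rule xs(5)[OF i])
      moreover have "E (xs ! 0) (xs ! 1)" using ipathD(4)[OF xs(1), of 0 1] l2 nex by simp
      ultimately have "r \<in> T {xs ! 1}" using adjT r by simp
      then have "xs ! 1 \<in> A1" using 1 unfolding A1_def by blast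
      from xs(5)[OF _ this] l2 show False by simp
    next
      case 2
      then have "xs ! i \<in> A2" using Ti unfolding A2_def by blast
      then have il: "i = length xs - 1" by (rule xs(6)[OF i])
      obtain m where m: "length xs = Suc (Suc m)" using l2 by (metis Suc_le_D numeral_2_eq_2 Suc_le_mono)
      then have "E (xs ! i) (xs ! (i - 1))" using ipathD(4)[OF xs(1), of "Suc m" m] il by simp
      then have "r \<in> T {xs ! (i - 1)}" using adjT r by simp
      then have "xs ! (i - 1) \<in> A2" using 2 unfolding A2_def by blast
      from xs(6)[OF _ this] m il show False by simp
    qed
  qed
  have sub: "T (set xs) \<subseteq> T {hd xs} \<union> T {last xs}"
  proof
    fix r assume "r \<in> T (set xs)"
    then obtain i where i: "i < length xs" "r \<in> T {xs ! i}"
      unfolding T_UN[of _ "set xs"] by (auto simp: in_set_conv_nth)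
    then show "r \<in> T {hd xs} \<union> T {last xs}"
      using ends[OF i(1)] nex by (auto simp: hd_conv_nth last_conv_nth)
  qed
  have light: "card (T {x}) \<le> n" if "x \<in> set xs" for x
  proof -
    have "x \<in> Q j" using that xs(2) by blast
    moreover have "x \<notin> on_rows" using off that by (auto simp: in_set_conv_nth)
    ultimately show ?thesis using j(2) by (auto simp: heavy_def not_le intro: less_imp_le)
  qed
  have "card (T (set xs)) \<le> card (T {hd xs} \<union> T {last xs})" by (rule card_mono) (use sub in auto)
  also have "\<dots> \<le> card (T {hd xs}) + card (T {last xs})" by (rule card_Un_le)
  also have "\<dots> \<le> 2 * n" using light[of "hd xs"] light[of "last xs"] nex by simp
  finally have c: "card (T (set xs)) \<le> 2 * n" .
  have "set xs \<inter> on_rows = {}" using off by (auto simp: in_set_conv_nth)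
  then have "T (set xs) \<in> pieces n j"
    using xs(2) conn_ipath[OF xs(1)] c unfolding pieces_def by blast
  moreover have "T {hd xs} \<subseteq> T (set xs)" "T {last xs} \<subseteq> T (set xs)"
    by (rule T_mono; use nex in simp)+
  then have "T (set xs) \<inter> A \<noteq> {}" "T (set xs) - A \<noteq> {}"
    using xs(3,4) unfolding A1_def A2_def by blast+
  ultimately show ?thesis by blast
qed

end

context ladder begin

definition zc :: "nat => nat => nat set" where
  "zc r j = {p. p < length (\<rho> r) \<and> touch (Q j) {\<rho> r ! p}}"

text \<open>The interval of a row spanned by a column. If the row is given up, the column may pass
  through this interval.\<close>

definition G :: "nat => nat => 'a set" where
  "G r j = seg (\<rho> r) (Min (zc r j)) (Max (zc r j))"

lemma finite_zc [simp]: "finite (zc r j)" by (simp add: zc_def)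

lemma zc_ne:
  assumes "j < D" "r < K"
  shows "zc r j \<noteq> {}"
proof -
  obtain b where "b \<in> set (\<rho> r)" "touch (Q j) {b}"
    using Q_touch[OF assms] unfolding touch_iff_singleton2[of _ "set (\<rho> r)"] by blast
  then obtain p where "p < length (\<rho> r)" "touch (Q j) {\<rho> r ! p}" by (metis in_set_conv_nth)
  then have "p \<in> zc r j" by (simp add: zc_def)
  then show ?thesis by blast
qed

lemma zc_order: "j < j' ==> j' < D ==> r < K ==> p \<in> zc r j ==> p' \<in> zc r j' ==> Suc p < p'"
  unfolding zc_def using Q_ordered[of j j' r p p'] by blast

lemma zc_between:
  assumes "j < D" "j' < D" "j \<noteq> j'" "r < K" "p \<in> zc r j'" "Min (zc r j) \<le> q" "q \<le> Max (zc r j)"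
  shows "\<not> (p \<le> Suc q \<and> q \<le> Suc p)"
proof -
  have mm: "Min (zc r j) \<in> zc r j" "Max (zc r j) \<in> zc r j" using zc_ne[OF assms(1,4)] by simp_all
  show ?thesis
  proof (cases "j < j'")
    case True
    then show ?thesis using zc_order[OF True assms(2,4) mm(2) assms(5)] assms(7) by linarith
  next
    case False
    then have "j' < j" using assms(3) by simp
    then show ?thesis using zc_order[OF _ assms(1,4,5) mm(1)] assms(6) by linarith
  qed
qed

lemma G_elem:
  assumes "j < D" "r < K" "x \<in> G r j"
  obtains p where "x = \<rho> r ! p" "p < length (\<rho> r)" "Min (zc r j) \<le> p" "p \<le> Max (zc r j)"
proof -
  have "Max (zc r j) \<in> zc r j" using zc_ne[OF assms(1,2)] by simp
  then have "Max (zc r j) < length (\<rho> r)" by (simp add: zc_def)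
  then show ?thesis using assms(3) that by (auto simp: G_def seg_def)
qed

lemma G_row: "j < D ==> r < K ==> G r j \<subseteq> set (\<rho> r)"
  using G_elem by (metis nth_mem subsetI)

lemma conn_G:
  assumes "j < D" "r < K"
  shows "conn (G r j)"
proof -
  have mm: "Min (zc r j) \<le> Max (zc r j)" "Max (zc r j) \<in> zc r j" using zc_ne[OF assms] by simp_all
  then show ?thesis unfolding G_def by (intro conn_seg rows assms) (auto simp: zc_def)
qed

lemma G_anti_Q:
  assumes "j < D" "j' < D" "j \<noteq> j'" "r < K"
  shows "\<not> touch (Q j) (G r j')"
proof
  assume "touch (Q j) (G r j')"
  then obtain x where x: "x \<in> G r j'" "touch (Q j) {x}"
    unfolding touch_iff_singleton2[of _ "G r j'"] by blast
  obtain p where p: "x = \<rho> r ! p" "p < length (\<rho> r)" "Min (zc r j') \<le> p" "p \<le> Max (zc r j')"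
    by (rule G_elem[OF assms(2,4) x(1)])
  have "p \<in> zc r j" using p x by (simp add: zc_def)
  then show False using zc_between[OF assms(2,1) _ assms(4) _ p(3,4), of p] assms(3) by simp
qed

lemma G_anti_G:
  assumes "j < D" "j' < D" "j \<noteq> j'" "r < K"
  shows "\<not> touch (G r j) (G r j')"
proof
  assume "touch (G r j) (G r j')"
  then obtain x x' where x: "x \<in> G r j" "x' \<in> G r j'" "x = x' \<or> E x x'" unfolding touch_def by blast
  obtain p where p: "x = \<rho> r ! p" "p < length (\<rho> r)" "Min (zc r j) \<le> p" "p \<le> Max (zc r j)"
    by (rule G_elem[OF assms(1,4) x(1)])
  obtain p' where p': "x' = \<rho> r ! p'" "p' < length (\<rho> r)" "Min (zc r j') \<le> p'" "p' \<le> Max (zc r j')"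
    by (rule G_elem[OF assms(2,4) x(2)])
  have near: "p \<le> Suc p' \<and> p' \<le> Suc p"
    using seg_anti_row[OF rows[OF assms(4)] p(2) p'(2)] x(3) p(1) p'(1) by simp
  have mm: "Min (zc r j) \<in> zc r j" "Max (zc r j) \<in> zc r j" "Min (zc r j') \<in> zc r j'" "Max (zc r j') \<in> zc r j'"
    using zc_ne assms by simp_all
  show False
  proof (cases "j < j'")
    case True
    then show ?thesis using zc_order[OF True assms(2,4) mm(2,3)] near p p' by linarith
  next
    case False
    then have "j' < j" using assms(3) by simp
    then show ?thesis using zc_order[OF _ assms(1,4) mm(4,1)] near p p' by linarith
  qed
qed

end

text \<open>There are at most \<open>2 ^ (2 ^ K)\<close> hypergraphs on the rows, so enough columns
  without heavy vertices share one. On an induced path its edges are wires between consecutive rows.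
  On an induced star the centre row is given up, and a wire leads from one leaf to the next through
  the interval of the column on the centre row.\<close>

theorem ladder_wall_like:
  "\<exists>K D. \<forall>(V :: 'a set) E \<rho> Q. ladder V E K D \<rho> Q \<and> \<not> fin_graph.PM V E n \<longrightarrow> fin_graph.wall_like V E t"
proof -
  define M where "M = Suc (3 * (4 * t + 1))"
  define Dw where "Dw = 2 * t * t * 3 ^ (3 * (4 * t + 1))"
  from star_or_path[of "2 * n" M] obtain K where K: "\<forall>\<E> :: nat set set. (\<forall>e\<in>\<E>. e \<subseteq> {..<K} \<and> card e \<le> 2 * n) \<and>
      (\<forall>A\<subseteq>{..<K}. A \<noteq> {} \<longrightarrow> A \<noteq> {..<K} \<longrightarrow> (\<exists>e\<in>\<E>. e \<inter> A \<noteq> {} \<and> e - A \<noteq> {})) \<longrightarrow>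
    (\<exists>c v e. inj_on v {..<M} \<and> c < K \<and> (\<forall>s<M. v s < K \<and> v s \<noteq> c \<and> e s \<in> \<E> \<and> c \<in> e s \<and> e s \<inter> v ` {..<M} = {v s})) \<or>
    (\<exists>v e. inj_on v {..<M} \<and> (\<forall>s<M. v s < K) \<and> (\<forall>s. Suc s < M \<longrightarrow> e s \<in> \<E> \<and> e s \<inter> v ` {..<M} = {v s, v (Suc s)}))"
    by (elim exE)
  \<comment> \<open>The first summand pays for heavy columns. \<open>Suc Dw\<close> guarantees one
    column, whose hypergraph is the common one, even if \<open>Dw\<close> is zero.\<close>
  define D where "D = Suc n * 2 ^ K + Suc Dw * 2 ^ (2 ^ K)"
  show ?thesis
  proof (rule exI[of _ K], rule exI[of _ D], intro allI impI, elim conjE)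
    fix V :: "'a set" and E \<rho> Q
    assume lad: "ladder V E K D \<rho> Q" and nPM: "\<not> fin_graph.PM V E n"
    interpret ladder V E K D \<rho> Q by fact
    define Li where "Li = {..<D} - {j. j < D \<and> heavy n j}"
    have "card Li = D - card {j. j < D \<and> heavy n j}"
      unfolding Li_def by (subst card_Diff_subset) auto
    then have cLi: "Suc Dw * 2 ^ (2 ^ K) \<le> card Li"
      using few_heavy[OF nPM] by (simp add: D_def)
    have fLi: "finite Li" by (simp add: Li_def)
    let ?F = "Pow (Pow {..<K})"
    have F: "finite ?F" "?F \<noteq> {}" "pieces n ` Li \<subseteq> ?F" "Suc Dw * card ?F \<le> card Li"
      using cLi T_subset by (auto simp: card_Pow pieces_def)
    obtain \<E> J where J: "\<E> \<in> ?F" "J \<subseteq> Li" "card J = Suc Dw" "\<And>j. j \<in> J ==> pieces n j = \<E>"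
      by (rule pigeonhole_fiber_subset[OF fLi F]) blast
    obtain jn where jn: "\<And>i. i < Suc Dw ==> jn i \<in> J" "\<And>i j. i < j ==> j < Suc Dw ==> jn i < jn j"
      by (rule strict_enumeration[OF J(3)]) (simp, blast)
    have jD: "jn i < D" if "i < Dw" for i
      using jn(1)[of i] J(2) that by (auto simp: Li_def)
    have jneq: "jn i \<noteq> jn j" if "i \<noteq> j" "i < Dw" "j < Dw" for i j
      using jn(2)[of i j] jn(2)[of j i] that by (cases i j rule: linorder_cases) auto
    have "jn 0 \<in> J" using jn(1) by simp
    then have j0: "jn 0 < D" "\<not> heavy n (jn 0)" "pieces n (jn 0) = \<E>" using J(2,4) by (auto simp: Li_def)
    have small: "\<forall>e\<in>\<E>. e \<subseteq> {..<K} \<and> card e \<le> 2 * n"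
      using j0(3) T_subset by (auto simp: pieces_def)
    have cross: "\<forall>A\<subseteq>{..<K}. A \<noteq> {} \<longrightarrow> A \<noteq> {..<K} \<longrightarrow> (\<exists>e\<in>\<E>. e \<inter> A \<noteq> {} \<and> e - A \<noteq> {})"
      using pieces_cross[OF j0(1,2)] j0(3) by simp
    define P where "P j e = (SOME Z. Z \<subseteq> Q j \<and> conn Z \<and> Z \<inter> on_rows = {} \<and> T Z = e)" for j e
    have P: "P (jn i) e \<subseteq> Q (jn i)" "conn (P (jn i) e)" "P (jn i) e \<inter> on_rows = {}" "T (P (jn i) e) = e"
      if "i < Dw" "e \<in> \<E>" for i e
    proof -
      have "e \<in> pieces n (jn i)" using J(4)[OF jn(1)] that by simp
      then have "\<exists>Z. Z \<subseteq> Q (jn i) \<and> conn Z \<and> Z \<inter> on_rows = {} \<and> T Z = e" by (auto simp: pieces_def)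
      from someI_ex[OF this] show "P (jn i) e \<subseteq> Q (jn i)" "conn (P (jn i) e)" "P (jn i) e \<inter> on_rows = {}" "T (P (jn i) e) = e"
        unfolding P_def[symmetric] by blast+
    qed
    have P_touch: "touch (P (jn i) e) (set (\<rho> r)) \<longleftrightarrow> r \<in> e" if "i < Dw" "e \<in> \<E>" "r < K" for i e r
      using P(4)[OF that(1,2)] that(3) by (auto simp: T_def)
    have P_row: "P (jn i) e \<inter> set (\<rho> r) = {}" if "i < Dw" "e \<in> \<E>" "r < K" for i e r
      using P(3)[OF that(1,2)] that(3) by (auto simp: on_rows_def)
    have QQ: "\<not> touch A B" if "A \<subseteq> Q (jn i)" "B \<subseteq> Q (jn j)" "i \<noteq> j" "i < Dw" "j < Dw" for A B i j
      using Q_anti[OF jD[OF that(4)] jD[OF that(5)] jneq[OF that(3-5)]] touch_mono[OF _ that(1,2)] by blast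
    have Q_order: "Suc p < p'" if "i < j" "j < Dw" "r < K" "p < length (\<rho> r)" "p' < length (\<rho> r)"
      "w \<in> Q (jn i)" "w' \<in> Q (jn j)" "E w (\<rho> r ! p)" "E w' (\<rho> r ! p')" for i j r p p' w w'
      by (rule Q_ordered[OF jn(2)[OF that(1)] jD[OF that(2)] that(3-5)]) (use that in \<open>auto simp: touch_def\<close>)
    from K[rule_format, OF conjI[OF small cross]]
    show "wall_like t"
    proof
      assume "\<exists>c v e. inj_on v {..<M} \<and> c < K \<and> (\<forall>s<M. v s < K \<and> v s \<noteq> c \<and> e s \<in> \<E> \<and> c \<in> e s \<and> e s \<inter> v ` {..<M} = {v s})"
      then obtain c v e where v: "inj_on v {..<M}" and c: "c < K"
        and ve: "\<forall>s<M. v s < K \<and> v s \<noteq> c \<and> e s \<in> \<E> \<and> c \<in> e s \<and> e s \<inter> v ` {..<M} = {v s}"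
        by blast
      have vs: "v s < K" "v s \<noteq> c" "e s \<in> \<E>" "c \<in> e s" "e s \<inter> v ` {..<M} = {v s}" if "s < M" for s
        using ve that by simp_all
      have mem: "v r \<in> e s \<longleftrightarrow> r = s" if "r < M" "s < M" for r s
        using vs(5)[OF that(2)] that v by (auto simp: inj_on_def)
      define W where "W i s = P (jn i) (e s) \<union> G c (jn i) \<union> P (jn i) (e (Suc s))" for i s
      have PG: "touch (P (jn i) (e s)) (G c (jn i))" if "i < Dw" "s < M" for i s
      proof -
        have "touch (P (jn i) (e s)) (set (\<rho> c))" using P_touch[OF that(1) vs(3)[OF that(2)] c] vs(4)[OF that(2)] by simp
        then obtain b where "b \<in> set (\<rho> c)" "touch (P (jn i) (e s)) {b}"
          unfolding touch_iff_singleton2[of _ "set (\<rho> c)"] by blast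
        then obtain p where p: "p < length (\<rho> c)" "touch (P (jn i) (e s)) {\<rho> c ! p}" by (metis in_set_conv_nth)
        then have "touch (Q (jn i)) {\<rho> c ! p}" using touch_mono P(1)[OF that(1) vs(3)[OF that(2)]] by blast
        then have "p \<in> zc c (jn i)" using p by (simp add: zc_def)
        then have "\<rho> c ! p \<in> G c (jn i)" by (auto simp: G_def seg_def)
        then show ?thesis using touch_mono[OF p(2)] by blast
      qed
      have "wiring V E M Dw (\<lambda>r. \<rho> (v r)) W"
      proof
        fix r assume r: "r < M"
        show "ipath (\<rho> (v r))" using rows vs r by simp
        show "\<not> touch (set (\<rho> (v r))) (set (\<rho> (v r')))" if "r' < M" "r \<noteq> r'" for r'
          using rows_anti[OF vs(1)[OF r] vs(1)[OF that(1)]] inj_onD[OF v, of r r'] r that by auto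
      next
        fix i s assume iss: "i < Dw" "Suc s < M"
        then have s: "s < M" by simp
        note ps = P[OF iss(1) vs(3)[OF s]] and pt = P[OF iss(1) vs(3)[OF iss(2)]]
        have "conn (P (jn i) (e s) \<union> G c (jn i))"
          using conn_Un[OF ps(2) conn_G[OF jD[OF iss(1)] c] PG[OF iss(1) s]] .
        moreover have "touch (P (jn i) (e s) \<union> G c (jn i)) (P (jn i) (e (Suc s)))"
          unfolding touch_Un using PG[OF iss] touch_sym[of "G c (jn i)"] by blast
        ultimately have "conn (W i s)" unfolding W_def using conn_Un pt(2) by blast
        moreover have "G c (jn i) \<subseteq> V"
          using G_row[OF jD[OF iss(1)] c] ipathD(3)[OF rows[OF c]] by blast
        ultimately show "conn (W i s) \<and> W i s \<subseteq> V"
          unfolding W_def using ps(1) pt(1) Q_conn[OF jD[OF iss(1)]] by blast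
        fix r assume r: "r < M"
        have cr: "\<not> touch (set (\<rho> c)) (set (\<rho> (v r)))" using rows_anti[OF c vs(1)[OF r]] vs(2)[OF r] by simp
        then have Gr: "\<not> touch (G c (jn i)) (set (\<rho> (v r)))"
          using G_row[OF jD[OF iss(1)] c] touch_mono by blast
        show "W i s \<inter> set (\<rho> (v r)) = {}"
          unfolding W_def using P_row[OF iss(1) vs(3)[OF s] vs(1)[OF r]] P_row[OF iss(1) vs(3)[OF iss(2)] vs(1)[OF r]]
            not_touch_disjoint[OF Gr] by blast
        show "touch (W i s) (set (\<rho> (v r))) \<longleftrightarrow> r = s \<or> r = Suc s"
          unfolding W_def touch_Un
          using P_touch[OF iss(1) vs(3)[OF s] vs(1)[OF r]] P_touch[OF iss(1) vs(3)[OF iss(2)] vs(1)[OF r]]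
            Gr mem[OF r s] mem[OF r iss(2)] by blast
      next
        fix i j s s' assume ij: "i < Dw" "j < Dw" "i \<noteq> j" "Suc s < M" "Suc s' < M"
        have sub: "P (jn i) (e s) \<subseteq> Q (jn i)" "P (jn i) (e (Suc s)) \<subseteq> Q (jn i)"
          "P (jn j) (e s') \<subseteq> Q (jn j)" "P (jn j) (e (Suc s')) \<subseteq> Q (jn j)"
          using P(1) vs(3) ij by simp_all
        have W1: "W i s \<subseteq> Q (jn i) \<union> G c (jn i)" "W j s' \<subseteq> Q (jn j) \<union> G c (jn j)"
          using sub by (auto simp: W_def)
        have jj: "jn i < D" "jn j < D" "jn i \<noteq> jn j" using jD jneq ij by simp_all
        have g2: "\<not> touch (G c (jn i)) (Q (jn j))"
          using G_anti_Q[OF jj(2,1) jj(3)[symmetric] c] by (subst touch_sym)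
        have "\<not> touch (Q (jn i) \<union> G c (jn i)) (Q (jn j) \<union> G c (jn j))"
          unfolding touch_Un touch_Un2
          using Q_anti[OF jj] G_anti_Q[OF jj c] g2 G_anti_G[OF jj c] by blast
        then show "\<not> touch (W i s) (W j s')" using touch_mono[OF _ W1] by blast
      next
        fix i j s s' r w w' p p'
        assume a: "i < j" "j < Dw" "Suc s < M" "Suc s' < M" "r < M" "w \<in> W i s" "w' \<in> W j s'"
          "p < length (\<rho> (v r))" "p' < length (\<rho> (v r))" "E w (\<rho> (v r) ! p)" "E w' (\<rho> (v r) ! p')"
        have cr: "\<not> touch (set (\<rho> c)) (set (\<rho> (v r)))" using rows_anti[OF c vs(1)[OF a(5)]] vs(2)[OF a(5)] by simp
        \<comment> \<open>The interval on the centre row is anticomplete to the remaining rows, so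
          every attachment comes from the column and inherits its order.\<close>
        have inQ: "w \<in> Q (jn i)" if "i < Dw" "Suc s < M" "w \<in> W i s" "p < length (\<rho> (v r))" "E w (\<rho> (v r) ! p)" for i s w p
        proof -
          have "w \<notin> G c (jn i)"
          proof
            assume "w \<in> G c (jn i)"
            then have "w \<in> set (\<rho> c)" using G_row[OF jD[OF that(1)] c] by blast
            then show False using cr that(4,5) unfolding touch_def by (meson nth_mem)
          qed
          then show ?thesis using that P(1)[OF that(1) vs(3)] unfolding W_def by (meson Suc_lessD UnE subsetD)
        qed
        show "Suc p < p'"
          by (rule Q_order[OF a(1,2) vs(1)[OF a(5)] a(8,9) inQ inQ a(10,11)]) (use a in auto)
      qed
      then show ?thesis
        unfolding M_def Dw_def by (rule wiring_wall_like)
    next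
      assume "\<exists>v e. inj_on v {..<M} \<and> (\<forall>s<M. v s < K) \<and> (\<forall>s. Suc s < M \<longrightarrow> e s \<in> \<E> \<and> e s \<inter> v ` {..<M} = {v s, v (Suc s)})"
      then obtain v e where v: "inj_on v {..<M}" and vK0: "\<forall>s<M. v s < K"
        and ve: "\<forall>s. Suc s < M \<longrightarrow> e s \<in> \<E> \<and> e s \<inter> v ` {..<M} = {v s, v (Suc s)}"
        by blast
      have vK: "v s < K" if "s < M" for s using vK0 that by simp
      have es: "e s \<in> \<E>" "e s \<inter> v ` {..<M} = {v s, v (Suc s)}" if "Suc s < M" for s
        using ve that by simp_all
      have mem: "v r \<in> e s \<longleftrightarrow> r = s \<or> r = Suc s" if "r < M" "Suc s < M" for r s
      proof -
        have "v r \<in> e s \<longleftrightarrow> v r = v s \<or> v r = v (Suc s)" using es(2)[OF that(2)] that(1) by blast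
        then show ?thesis using v that by (auto simp: inj_on_def)
      qed
      define W where "W i s = P (jn i) (e s)" for i s
      have "wiring V E M Dw (\<lambda>r. \<rho> (v r)) W"
      proof
        fix r assume r: "r < M"
        show "ipath (\<rho> (v r))" using rows vK r by simp
        show "\<not> touch (set (\<rho> (v r))) (set (\<rho> (v r')))" if "r' < M" "r \<noteq> r'" for r'
          using rows_anti[OF vK[OF r] vK[OF that(1)]] inj_onD[OF v, of r r'] r that by auto
      next
        fix i s assume iss: "i < Dw" "Suc s < M"
        note ps = P[OF iss(1) es(1)[OF iss(2)]]
        show "conn (W i s) \<and> W i s \<subseteq> V"
          unfolding W_def using ps(1,2) Q_conn[OF jD[OF iss(1)]] by blast
        fix r assume r: "r < M"
        show "W i s \<inter> set (\<rho> (v r)) = {}"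
          unfolding W_def using P_row[OF iss(1) es(1)[OF iss(2)] vK[OF r]] .
        show "touch (W i s) (set (\<rho> (v r))) \<longleftrightarrow> r = s \<or> r = Suc s"
          unfolding W_def using P_touch[OF iss(1) es(1)[OF iss(2)] vK[OF r]] mem[OF r iss(2)] by simp
      next
        fix i j s s' assume ij: "i < Dw" "j < Dw" "i \<noteq> j" "Suc s < M" "Suc s' < M"
        show "\<not> touch (W i s) (W j s')"
          unfolding W_def by (rule QQ[OF P(1)[OF ij(1) es(1)[OF ij(4)]] P(1)[OF ij(2) es(1)[OF ij(5)]] ij(3,1,2)])
      next
        fix i j s s' r w w' p p'
        assume a: "i < j" "j < Dw" "Suc s < M" "Suc s' < M" "r < M" "w \<in> W i s" "w' \<in> W j s'"
          "p < length (\<rho> (v r))" "p' < length (\<rho> (v r))" "E w (\<rho> (v r) ! p)" "E w' (\<rho> (v r) ! p')"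
        have "i < Dw" using a by simp
        have "w \<in> Q (jn i)" using P(1)[OF \<open>i < Dw\<close> es(1)[OF a(3)]] a(6) unfolding W_def by blast
        moreover have "w' \<in> Q (jn j)" using P(1)[OF a(2) es(1)[OF a(4)]] a(7) unfolding W_def by blast
        ultimately show "Suc p < p'"
          by (rule Q_order[OF a(1,2) vK[OF a(5)] a(8,9) _ _ a(10,11)])
      qed
      then show ?thesis
        unfolding M_def Dw_def by (rule wiring_wall_like)
    qed
  qed
qed

section \<open>Linkages crossing many columns\<close>

context fin_graph begin

lemma conn_in_one:
  assumes "conn S" "S \<subseteq> (\<Union>j\<in>J. Q j)" "\<And>i j. i \<in> J ==> j \<in> J ==> i \<noteq> j ==> \<not> touch (Q i) (Q j)"
  shows "\<exists>j\<in>J. S \<subseteq> Q j"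
proof -
  obtain x where x: "x \<in> S" using conn_nonempty[OF assms(1)] by auto
  then obtain j where j: "j \<in> J" "x \<in> Q j" using assms(2) by auto
  have "S \<subseteq> Q j"
  proof (rule conn_subset_closed[OF assms(1)])
    show "S \<inter> Q j \<noteq> {}" using x j by auto
    fix a b assume ab: "a \<in> S" "a \<in> Q j" "b \<in> S" "E a b"
    then obtain i where i: "i \<in> J" "b \<in> Q i" using assms(2) by auto
    then show "b \<in> Q j"
      using assms(3)[OF j(1) i(1)] ab unfolding touch_def by blast
  qed
  then show ?thesis using j by auto
qed

lemma linkage_mono: "linkage H A B k R ==> H \<subseteq> H' ==> linkage H' A B k R"
  unfolding linkage_def by blast

lemma linkage_subset_V: "linkage H A B k R ==> linkage (H \<inter> V) A B k R"
  unfolding linkage_def using ipathD(3) by blast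

end

text \<open>
  \<open>U\<close> is minimal such that \<open>U\<close> and the columns contain the linkage, so every vertex of \<open>U\<close> lies in a
  separator with only \<open>k\<close> vertices.
\<close>
locale tight_linkage = fin_graph V E for V :: "'a set" and E +
  fixes J :: "'i set" and Q :: "'i => 'a set" and U A B :: "'a set" and k :: nat and R :: "nat => 'a list"
  assumes finJ: "finite J"
    and Q_conn: "j \<in> J ==> Q j = {} \<or> ip (Q j)"
    and Q_anti: "i \<in> J ==> j \<in> J ==> i \<noteq> j ==> \<not> touch (Q i) (Q j)"
    and UV: "U \<subseteq> V" "U \<inter> (\<Union>j\<in>J. Q j) = {}"
    and link: "linkage (U \<union> (\<Union>j\<in>J. Q j)) A B k R"
    and tight: "u \<in> U ==> \<not> (\<exists>R. linkage (U \<union> (\<Union>j\<in>J. Q j) - {u}) A B k R)"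
begin

definition H where "H = U \<union> (\<Union>j\<in>J. Q j)"

lemma QV: "j \<in> J ==> Q j \<subseteq> V"
  using Q_conn[of j] ipathD(3) by (auto simp: ip_def)

lemma HV: "H \<subseteq> V"
  using UV QV by (auto simp: H_def)

lemma R: "i < k ==> ipath (R i)" "i < k ==> set (R i) \<subseteq> H" "i < k ==> hd (R i) \<in> A" "i < k ==> last (R i) \<in> B"
  "i < k ==> j < k ==> i \<noteq> j ==> set (R i) \<inter> set (R j) = {}"
  using linkageD[OF link] by (simp_all add: H_def)

definition cut :: "'a => 'a set" where
  "cut u = (SOME C. C \<subseteq> H \<and> u \<in> C \<and> card C \<le> k \<and> sep H A B C)"

text \<open>Without \<open>u\<close> the linkage is lost, so by Menger's theorem fewer than
  \<open>k\<close> vertices separate the rest; \<open>u\<close> completes them to a separator of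
  size at most \<open>k\<close>.\<close>

lemma cut:
  assumes "u \<in> U"
  shows "cut u \<subseteq> H" "u \<in> cut u" "card (cut u) \<le> k" "sep H A B (cut u)"
proof -
  have HuV: "H - {u} \<subseteq> V" using HV by auto
  obtain C where C: "C \<subseteq> H - {u}" "sep (H - {u}) A B C" "card C < k"
  proof (rule ccontr)
    assume "\<not> thesis"
    then have "k \<le> card C" if "C \<subseteq> H - {u}" "sep (H - {u}) A B C" for C
      using that \<open>\<And>C. C \<subseteq> H - {u} ==> sep (H - {u}) A B C ==> card C < k ==> thesis\<close> by (meson not_le)
    then have "\<exists>R. linkage (H - {u}) A B k R" by (rule menger[OF HuV])
    then show False using tight[OF assms] by (simp add: H_def)
  qed
  have "insert u C \<subseteq> H \<and> u \<in> insert u C \<and> card (insert u C) \<le> k \<and> sep H A B (insert u C)"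
  proof (intro conjI)
    show "insert u C \<subseteq> H" using C assms by (auto simp: H_def)
    show "card (insert u C) \<le> k" using C(3) card_insert_le_m1[of k C u] by simp
    have "H - insert u C = H - {u} - C" by auto
    then show "sep H A B (insert u C)" using C(2) by (simp add: sep_def)
  qed simp
  then have "\<exists>C. C \<subseteq> H \<and> u \<in> C \<and> card C \<le> k \<and> sep H A B C" by blast
  from someI_ex[OF this] show "cut u \<subseteq> H" "u \<in> cut u" "card (cut u) \<le> k" "sep H A B (cut u)"
    unfolding cut_def by blast+
qed

text \<open>The \<open>k\<close> disjoint paths all meet a set of at most \<open>k\<close> vertices,
  so each meets it exactly once.\<close>

lemma cut_row:
  assumes u: "u \<in> U" and i: "i < k"
  shows "\<exists>p<length (R i). R i ! p \<in> cut u \<and> (\<forall>q<length (R i). R i ! q \<in> cut u \<longrightarrow> q = p)"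
proof -
  have fin: "finite (cut u)" using cut(1)[OF u] HV finite_V by (meson finite_subset)
  have meets: "set (R i) \<inter> cut u \<noteq> {}" if "i < k" for i
  proof
    assume "set (R i) \<inter> cut u = {}"
    then have "set (R i) \<subseteq> H - cut u" using R(2)[OF that] by auto
    then have "set (R i) \<inter> A = {} \<or> set (R i) \<inter> B = {}"
      using cut(4)[OF u] conn_ipath[OF R(1)[OF that]] unfolding sep_def by blast
    then show False
      using R(3,4)[OF that] hd_in_set[OF ipathD(1)[OF R(1)[OF that]]] last_in_set[OF ipathD(1)[OF R(1)[OF that]]] by blast
  qed
  define c where "c i = (SOME x. x \<in> set (R i) \<inter> cut u)" for i
  have c: "c i \<in> set (R i) \<inter> cut u" if "i < k" for i
    unfolding c_def using meets[OF that] by (meson ex_in_conv someI_ex)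
  have inj: "inj_on c {..<k}"
  proof (rule inj_onI)
    fix a b assume "a \<in> {..<k}" "b \<in> {..<k}" "c a = c b"
    then show "a = b" using c[of a] c[of b] R(5)[of a b] by auto
  qed
  have img: "c ` {..<k} = cut u"
    by (rule card_seteq[OF fin]) (use c inj cut(3)[OF u] in \<open>auto simp: card_image\<close>)
  obtain p where p: "p < length (R i)" "R i ! p = c i" using c[OF i] by (auto simp: in_set_conv_nth)
  have "q = p" if q: "q < length (R i)" "R i ! q \<in> cut u" for q
  proof -
    obtain j where j: "j < k" "R i ! q = c j" using q(2) img by auto
    then have "R i ! q \<in> set (R j)" "R i ! q \<in> set (R i)" using c[of j] j q(1) nth_mem[of q "R i"] by auto
    then have "j = i" using R(5)[OF j(1) i] by blast
    then show ?thesis using j p q nth_eq_iff_index_eq[OF ipathD(2)[OF R(1)[OF i]]] by metis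
  qed
  moreover have "R i ! p \<in> cut u" using p c[OF i] by simp
  ultimately show ?thesis using p(1) by blast
qed

definition pos :: "'a => nat => nat" where
  "pos u i = (SOME p. p < length (R i) \<and> R i ! p \<in> cut u \<and> (\<forall>q<length (R i). R i ! q \<in> cut u \<longrightarrow> q = p))"

lemma pos:
  assumes "u \<in> U" "i < k"
  shows "pos u i < length (R i)" "R i ! pos u i \<in> cut u"
    "\<And>q. q < length (R i) ==> R i ! q \<in> cut u ==> q = pos u i"
proof -
  note * = someI_ex[OF cut_row[OF assms], folded pos_def]
  show "pos u i < length (R i)" using * by (rule conjunct1)
  show "R i ! pos u i \<in> cut u" using conjunct2[OF *] by (rule conjunct1)
  show "q = pos u i" if "q < length (R i)" "R i ! q \<in> cut u" for q
    using conjunct2[OF conjunct2[OF *]] that by simp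
qed

text \<open>A connected set off the separator that touched one path before it and another one after
  it would join the start of the former to the end of the latter. So a column that avoids the
  separator stays on one side of it on all paths, and this is the source of the common order of
  crossings.\<close>

lemma not_across:
  assumes u: "u \<in> U" and D: "conn D" "D \<subseteq> H - cut u" and i: "i < k" "p < pos u i" "touch D {R i ! p}"
    and j: "j < k" "pos u j < q" "q < length (R j)" "touch D {R j ! q}"
  shows False
proof -
  have pl: "p < length (R i)" using i pos(1)[OF u i(1)] by simp
  let ?P = "seg (R i) 0 p" and ?S = "seg (R j) q (length (R j) - 1)"
  have avoid: "seg (R l) a b \<subseteq> H - cut u" if "l < k" "b < length (R l)" "pos u l < a \<or> b < pos u l" for l a b
  proof
    fix x assume "x \<in> seg (R l) a b"
    then obtain m where m: "a \<le> m" "m \<le> b" "x = R l ! m" by (auto simp: seg_def)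
    have ml: "m < length (R l)" "m \<noteq> pos u l" using m that by linarith+
    then have "x \<in> set (R l)" "x \<notin> cut u" using pos(3)[OF u that(1) ml(1)] m(3) by auto
    then show "x \<in> H - cut u" using R(2)[OF that(1)] by blast
  qed
  have "0 < length (R i)" "0 < length (R j)" using pl j(3) by linarith+
  have mem: "R l ! x \<in> seg (R l) a b" if "a \<le> x" "x \<le> b" for l x a b using that by (auto simp: seg_def)
  have pb: "pos u i < 0 \<or> p < pos u i" "pos u j < q \<or> length (R j) - 1 < pos u j" using i j by simp_all
  have bb: "length (R j) - 1 < length (R j)" "q \<le> length (R j) - 1" using j(3) by simp_all
  have P: "conn ?P" "?P \<subseteq> H - cut u" "R i ! p \<in> ?P" "R i ! 0 \<in> ?P"
    using conn_seg[OF R(1)[OF i(1)] _ pl, of 0] avoid[OF i(1) pl, of 0] pb(1) by (simp_all add: mem)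
  have S: "conn ?S" "?S \<subseteq> H - cut u" "R j ! q \<in> ?S" "R j ! (length (R j) - 1) \<in> ?S"
    using conn_seg[OF R(1)[OF j(1)] bb(2,1)] avoid[OF j(1) bb(1) pb(2)] bb by (simp_all add: mem)
  have t1: "touch ?P D" using touch_mono[OF i(3), of D ?P] P(3) touch_sym[of D ?P] by (simp only: simp_thms insert_subset empty_subsetI subset_refl)
  have t2: "touch (?P \<union> D) ?S" using touch_mono[OF j(4), of "?P \<union> D" ?S] S(3) by simp
  have "conn (?P \<union> D \<union> ?S)" using conn_Un[OF conn_Un[OF P(1) D(1) t1] S(1) t2] .
  moreover have "?P \<union> D \<union> ?S \<subseteq> H - cut u" using P S D by blast
  ultimately have "(?P \<union> D \<union> ?S) \<inter> A = {} \<or> (?P \<union> D \<union> ?S) \<inter> B = {}"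
    using cut(4)[OF u] unfolding sep_def by blast
  moreover have "R i ! 0 \<in> A" "R j ! (length (R j) - 1) \<in> B"
    using R(3)[OF i(1)] R(4)[OF j(1)] ipathD(1)[OF R(1)[OF i(1)]] ipathD(1)[OF R(1)[OF j(1)]]
    by (simp_all add: hd_conv_nth last_conv_nth)
  ultimately show False using P(4) S(4) by blast
qed

definition cols :: "'i set => 'a => 'i set" where
  "cols J' x = {j \<in> J'. touch (Q j) {x}}"

text \<open>Vertices of \<open>n\<close> different rows that touch \<open>n\<close> common columns would form a path model with these columns.\<close>
lemma thin_rows:
  assumes nPM: "\<not> PM n" and I: "I \<subseteq> {..<k}" and J0: "J0 \<subseteq> J" "f 0 \<le> card J0" and fn: "n + 2 \<le> f n"
  shows "\<exists>s I' J'. s < n \<and> I' \<subseteq> I \<and> card I \<le> card I' + n \<and> J' \<subseteq> J0 \<and> f s \<le> card J' \<and>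
    (\<forall>i\<in>I'. \<forall>x\<in>set (R i). card (cols J' x) < f (Suc s))"
proof (rule ccontr)
  assume neg: "\<not> ?thesis"
  have finI: "finite I" using I finite_subset by blast
  \<comment> \<open>If the claim fails, there is always another row with a vertex that touches
    \<open>f (Suc s)\<close> of the remaining columns. After \<open>n\<close> rounds the chosen
    vertices and the surviving columns form a path model.\<close>
  have "\<exists>M x J'. M \<subseteq> I \<and> card M = s \<and> (\<forall>i\<in>M. x i \<in> set (R i)) \<and> J' \<subseteq> J0 \<and> f s \<le> card J' \<and> (\<forall>i\<in>M. J' \<subseteq> cols J0 (x i))"
    if "s \<le> n" for s
    using that
  proof (induction s)
    case 0
    then show ?case using J0 by (intro exI[of _ "{}"] exI[of _ undefined] exI[of _ J0]) auto
  next
    case (Suc s)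
    then have "s \<le> n" by simp
    from Suc.IH[OF this] obtain M x J' where M: "M \<subseteq> I" "card M = s" "\<forall>i\<in>M. x i \<in> set (R i)" "J' \<subseteq> J0" "f s \<le> card J'"
      "\<forall>i\<in>M. J' \<subseteq> cols J0 (x i)" by (elim exE conjE)
    have "finite M" using M(1) finI finite_subset by blast
    then have "card I \<le> card (I - M) + n"
      using M(1,2) Suc.prems by (simp add: card_Diff_subset)
    then have "\<not> (\<forall>i\<in>I - M. \<forall>y\<in>set (R i). card (cols J' y) < f (Suc s))"
      using neg M(4,5) Suc.prems Suc_le_lessD[of s n] by (metis Diff_subset)
    then obtain i y where i: "i \<in> I" "i \<notin> M" "y \<in> set (R i)" "f (Suc s) \<le> card (cols J' y)" by (auto simp: not_less)
    have finM: "finite M" using M finI finite_subset by blast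
    show ?case
      by (rule exI[of _ "insert i M"], rule exI[of _ "x(i := y)"], rule exI[of _ "cols J' y"])
        (use M i finM in \<open>auto simp: cols_def\<close>)
  qed
  from this[of n, OF order_refl] obtain M x J' where M: "M \<subseteq> I" "card M = n" "\<forall>i\<in>M. x i \<in> set (R i)" "J' \<subseteq> J0" "f n \<le> card J'"
      "\<forall>i\<in>M. J' \<subseteq> cols J0 (x i)" by (elim exE conjE)
  have tch: "touch (Q j) {x i}" if "i \<in> M" "j \<in> J'" for i j using M(6) that by (auto simp: cols_def)
  have JJ: "J' \<subseteq> J" using M J0 by auto
  have finJ': "finite J'" using JJ finJ finite_subset by blast
  have ik: "i < k" if "i \<in> M" for i using M I that by auto
  \<comment> \<open>By \<open>n + 2 \<le> f n\<close> a second column is left; a chosen vertex on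
    one column would make the two columns touch.\<close>
  have notin: "x i \<notin> Q j" if "i \<in> M" "j \<in> J'" for i j
  proof
    assume "x i \<in> Q j"
    have "card (J' - {j}) \<ge> 1" using M(5) fn that(2) finJ' by simp
    then obtain j' where "j' \<in> J'" "j' \<noteq> j" by (metis card.empty DiffE ex_in_conv insertCI not_one_le_zero)
    then have "touch (Q j') (Q j)" using touch_mono[OF tch[OF that(1) \<open>j' \<in> J'\<close>], of "Q j'" "Q j"] \<open>x i \<in> Q j\<close> by simp
    then show False using Q_anti JJ \<open>j' \<in> J'\<close> \<open>j' \<noteq> j\<close> that(2) by blast
  qed
  have "PM n"
  proof (rule PM_I[of M J' n "\<lambda>i. {x i}" Q])
    show "finite M" using M finI finite_subset by blast
    show "finite J'" by fact
    show "n \<le> card M" "n \<le> card J'" using M fn by auto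
    show "ip {x i}" if "i \<in> M" for i
      using ip_singleton[of "x i"] M(3) that R(2)[OF ik[OF that]] HV by auto
    fix j assume j: "j \<in> J'"
    show "Q i \<inter> Q j = {}" if "i \<in> J'" "i \<noteq> j" for i
      using not_touch_disjoint Q_anti JJ that j by blast
    show "ip (Q j)"
    proof (cases "n = 0")
      case False
      then obtain i where "i \<in> M" using M(2) by (metis card.empty ex_in_conv)
      then have "Q j \<noteq> {}" using tch[OF _ j] by (auto simp: touch_def)
      then show ?thesis using Q_conn JJ j by auto
    next
      case True
      then show ?thesis using nPM by (simp add: PM_def)
    qed
    fix i assume i: "i \<in> M"
    show "{x i} \<inter> Q j = {}" using notin[OF i j] by simp
    show "touch {x i} (Q j)" using tch[OF i j] touch_sym[of "{x i}" "Q j"] by simp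
  next
    fix i j assume "i \<in> M" "j \<in> M" "i \<noteq> j"
    then have "set (R i) \<inter> set (R j) = {}" by (intro R(5) ik)
    moreover have "x i \<in> set (R i)" "x j \<in> set (R j)" using M(3) \<open>i \<in> M\<close> \<open>j \<in> M\<close> by simp_all
    ultimately have "x i \<noteq> x j" by (metis IntI empty_iff)
    then show "{x i} \<inter> {x j} = {}" by simp
  qed
  then show False using nPM by simp
qed

end

text \<open>Unrolled backwards along \<open>thin_rows\<close>: \<open>g\<close> bounds the columns
  at one vertex, and \<open>d\<close> columns suffice to pick \<open>D\<close> of them at distance
  \<open>2 * g\<close>. A block of \<open>Suc d * k + 3\<close> positions supplies a separator from
  its first two positions and still has more columns than the \<open>Suc d\<close> separators have
  vertices.\<close>

fun crossing_bound :: "nat => nat => nat => nat => nat" where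
  "crossing_bound n D k 0 = n + 2"
| "crossing_bound n D k (Suc m) =
     (let g = crossing_bound n D k m; d = 2 * g * D + 1 in Suc d * (Suc d * k + 3) * g)"

context tight_linkage begin

text \<open>One row \<open>p\<close> fixes the order: on it, separators through vertices of
  \<open>U\<close> alternate with columns that avoid all these separators. By
  \<open>not_across\<close> the columns are met in the same order on every selected row.\<close>

lemma crossing:
  assumes nPM: "\<not> PM n" and I: "I \<subseteq> {..<k}" "(2 * n + (K + n)) choose (2 * n) \<le> card I"
    and J0: "J0 \<subseteq> J" "crossing_bound n D k n \<le> card J0"
    and tch: "\<And>i j. i \<in> I ==> j \<in> J0 ==> touch (Q j) (set (R i))"
  shows "\<exists>\<rho> Q'. ladder V E K D \<rho> Q'"
proof -
  have finI: "finite I" using I finite_subset by blast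
  obtain I1 where I1: "I1 \<subseteq> I" "card I1 = Suc (K + n)" "\<And>i j. i \<in> I1 ==> j \<in> I1 ==> i \<noteq> j ==> \<not> touch (set (R i)) (set (R j))"
  proof (rule ramsey_anticomplete[OF nPM finI I(2), of "\<lambda>i. set (R i)"])
    show "ip (set (R i))" if "i \<in> I" for i using ip_set R(1) I(1) that by auto
    show "set (R i) \<inter> set (R j) = {}" if "i \<in> I" "j \<in> I" "i \<noteq> j" for i j using R(5)[of i j] I(1) that by auto
  qed blast
  define f where "f s = crossing_bound n D k (n - s)" for s
  obtain s I2 J2 where s: "s < n" and I2: "I2 \<subseteq> I1" "card I1 \<le> card I2 + n" and J2: "J2 \<subseteq> J0" "f s \<le> card J2"
    and thin: "\<And>i x. i \<in> I2 ==> x \<in> set (R i) ==> card (cols J2 x) < f (Suc s)"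
    using thin_rows[OF nPM order_trans[OF I1(1) I(1)] J0(1), of f] J0(2) by (auto simp: f_def)
  define g where "g = f (Suc s)"
  define d where "d = 2 * g * D + 1"
  define Bs where "Bs = Suc d * k + 3"
  have "n - s = Suc (n - Suc s)" using s by simp
  then have fs: "f s = Suc d * Bs * g" by (simp add: f_def g_def d_def Bs_def Let_def)
  have I2k: "i < k" if "i \<in> I2" for i using I2 I1 I that by auto
  have JJ: "J2 \<subseteq> J" using J2 J0 by auto
  have finJ2: "finite J2" using JJ finJ finite_subset by blast
  have finI2: "finite I2" using I2k by (meson finite_lessThan finite_subset lessThan_iff subsetI)
  have cI2: "Suc K \<le> card I2" using I2 I1 by simp
  then obtain p where p: "p \<in> I2" by (metis Suc_n_not_le_n card.empty ex_in_conv le_zero_eq not_less_eq_eq zero_le)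
  note pk = I2k[OF p]
  have t2: "touch (Q j) (set (R i))" if "i \<in> I2" "j \<in> J2" for i j using tch I2 I1 J2 that by blast
  \<comment> \<open>One contact of each column with the row \<open>p\<close>. As fewer than
    \<open>g\<close> columns touch the same vertex, many different positions occur.\<close>
  define \<tau> where "\<tau> j = (SOME a. a < length (R p) \<and> touch (Q j) {R p ! a})" for j
  have tau: "\<tau> j < length (R p)" "touch (Q j) {R p ! \<tau> j}" if j: "j \<in> J2" for j
  proof -
    obtain b where "b \<in> set (R p)" "touch (Q j) {b}"
      using t2[OF p j] unfolding touch_iff_singleton2[of _ "set (R p)"] by blast
    then have "\<exists>a. a < length (R p) \<and> touch (Q j) {R p ! a}" by (metis in_set_conv_nth)
    from someI_ex[OF this] show "\<tau> j < length (R p)" "touch (Q j) {R p ! \<tau> j}" unfolding \<tau>_def by blast+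
  qed
  have "card J2 \<le> (\<Sum>a\<in>\<tau> ` J2. card {j \<in> J2. \<tau> j = a})"
  proof -
    have "J2 = (\<Union>a\<in>\<tau> ` J2. {j \<in> J2. \<tau> j = a})" by auto
    then show ?thesis using card_UN_le[OF finite_imageI[OF finJ2], of "\<lambda>a. {j \<in> J2. \<tau> j = a}" \<tau>] by simp
  qed
  also have "\<dots> \<le> (\<Sum>a\<in>\<tau> ` J2. g)"
  proof (rule sum_mono)
    fix a assume "a \<in> \<tau> ` J2"
    then have a: "R p ! a \<in> set (R p)" using tau by auto
    have "card {j \<in> J2. \<tau> j = a} \<le> card (cols J2 (R p ! a))"
      by (rule card_mono) (use finJ2 tau in \<open>auto simp: cols_def\<close>)
    then show "card {j \<in> J2. \<tau> j = a} \<le> g" using thin[OF p a] by (simp add: g_def)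
  qed
  finally have "card J2 \<le> card (\<tau> ` J2) * g" by simp
  then have "Suc d * Bs * g \<le> card (\<tau> ` J2) * g" by (rule order_trans[OF J2(2)[unfolded fs]])
  moreover have "g > 0"
  proof -
    have "R p \<noteq> []" using ipathD(1)[OF R(1)[OF pk]] .
    then show ?thesis using thin[OF p, of "hd (R p)"] by (simp add: g_def)
  qed
  ultimately have "Suc d * Bs \<le> card (\<tau> ` J2)" by (simp only: mult_le_cancel2)
  then obtain Pos where Pos: "Pos \<subseteq> \<tau> ` J2" "card Pos = Suc d * Bs" by (meson obtain_subset_with_card_n)
  have "finite Pos" using Pos(1) finJ2 finite_subset by blast
  then have "Suc d * Bs > 0 \<or> finite Pos" by simp
  then obtain a where a: "\<And>i. i < Suc d * Bs ==> a i \<in> Pos" "\<And>i j. i < j ==> j < Suc d * Bs ==> a i < a j"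
    by (rule strict_enumeration[OF Pos(2)]) blast
  define b where "b i = (SOME j. j \<in> J2 \<and> \<tau> j = a i)" for i
  have b: "b i \<in> J2" "\<tau> (b i) = a i" if "i < Suc d * Bs" for i
  proof -
    have "a i \<in> \<tau> ` J2" using a(1)[OF that] Pos(1) by (rule subsetD[rotated])
    then have "\<exists>j. j \<in> J2 \<and> \<tau> j = a i" by (elim imageE) (intro exI conjI, assumption, simp)
    from someI_ex[OF this] show "b i \<in> J2" "\<tau> (b i) = a i" unfolding b_def by blast+
  qed
  have b_neq: "b i \<noteq> b j" if "i < j" "j < Suc d * Bs" for i j
    using b(2)[of i] b(2)[of j] a(2)[OF that] that by (metis less_irrefl less_trans)
  have a_len: "a i < length (R p)" if "i < Suc d * Bs" for i using tau(1)[OF b(1)[OF that]] b(2)[OF that] by simp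
  have a_touch: "touch (Q (b i)) {R p ! a i}" if "i < Suc d * Bs" for i using tau(2)[OF b(1)[OF that]] b(2)[OF that] by simp
  \<comment> \<open>A stretch without vertices of \<open>U\<close> lies inside the columns and,
    being connected, inside a single one. The two different columns that touch its ends would then
    touch this one or coincide.\<close>
  have ex_u: "\<exists>q. a i \<le> q \<and> q \<le> a (Suc i) \<and> R p ! q \<in> U" if i: "Suc i < Suc d * Bs" for i
  proof (rule ccontr)
    assume no: "\<not> ?thesis"
    have ii: "i < Suc d * Bs" using i by simp
    have le: "a i \<le> a (Suc i)" using a(2)[of i "Suc i"] i by simp
    have "seg (R p) (a i) (a (Suc i)) \<subseteq> (\<Union>j\<in>J. Q j)"
    proof
      fix x assume "x \<in> seg (R p) (a i) (a (Suc i))"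
      then obtain q where q: "a i \<le> q" "q \<le> a (Suc i)" "x = R p ! q" by (auto simp: seg_def)
      then have "x \<in> H" using R(2)[OF pk] a_len[OF i] nth_mem[of q "R p"] by auto
      then show "x \<in> (\<Union>j\<in>J. Q j)" using no q by (auto simp: H_def)
    qed
    from conn_in_one[OF conn_seg[OF R(1)[OF pk] le a_len[OF i]] this Q_anti]
    obtain j where j: "j \<in> J" "seg (R p) (a i) (a (Suc i)) \<subseteq> Q j" by blast
    have m: "R p ! a i \<in> Q j" "R p ! a (Suc i) \<in> Q j" using j(2) le by (auto simp: seg_def)
    have "b l = j" if "l < Suc d * Bs" "R p ! a l \<in> Q j" for l
    proof (rule ccontr)
      assume "b l \<noteq> j"
      then have "\<not> touch (Q (b l)) (Q j)" using Q_anti b(1)[OF that(1)] JJ j(1) by blast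
      then show False using touch_mono[OF a_touch[OF that(1)], of "Q (b l)" "Q j"] that(2) by simp
    qed
    then have "b i = b (Suc i)" using m i ii by simp
    then show False using b_neq[of i "Suc i"] i by simp
  qed
  define uq where "uq i = (SOME q. a (i * Bs) \<le> q \<and> q \<le> a (Suc (i * Bs)) \<and> R p ! q \<in> U)" for i
  have idx: "i * Bs + m < Suc d * Bs" if "i \<le> d" "m < Bs" for i m
  proof -
    have "i * Bs + m < Suc i * Bs" using that by simp
    also have "\<dots> \<le> Suc d * Bs" using that by (intro mult_le_mono1) simp
    finally show ?thesis .
  qed
  have Bs3: "3 \<le> Bs" by (simp add: Bs_def)
  have uq: "a (i * Bs) \<le> uq i" "uq i \<le> a (Suc (i * Bs))" "R p ! uq i \<in> U" if "i \<le> d" for i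
  proof -
    have "Suc (i * Bs) < Suc d * Bs" using idx[OF that, of 1] Bs3 by simp
    from someI_ex[OF ex_u[OF this]]
    show "a (i * Bs) \<le> uq i" "uq i \<le> a (Suc (i * Bs))" "R p ! uq i \<in> U" unfolding uq_def by blast+
  qed
  define u where "u i = R p ! uq i" for i
  have uU: "u i \<in> U" if "i \<le> d" for i using uq(3)[OF that] by (simp add: u_def)
  have uq_len: "uq i < length (R p)" if "i \<le> d" for i
    using uq(2)[OF that] a_len[of "Suc (i * Bs)"] idx[OF that, of 1] Bs3 by simp
  have pos_p: "pos (u i) p = uq i" if "i \<le> d" for i
    using pos(3)[OF uU[OF that] pk uq_len[OF that]] cut(2)[OF uU[OF that]] by (simp add: u_def)
  define CC where "CC = (\<Union>i\<in>{..d}. cut (u i))"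
  have finC: "finite (cut (u i))" if "i \<le> d" for i
    using cut(1)[OF uU[OF that]] HV finite_V by (meson finite_subset)
  have cCC: "card CC \<le> Suc d * k"
  proof -
    have "card CC \<le> (\<Sum>i\<in>{..d}. card (cut (u i)))" unfolding CC_def by (rule card_UN_le) simp
    also have "\<dots> \<le> (\<Sum>i\<in>{..d}. k)" by (rule sum_mono) (use cut(3)[OF uU] in auto)
    finally show ?thesis by simp
  qed
  have finCC: "finite CC" using finC by (auto simp: CC_def)
  \<comment> \<open>The columns of the block are disjoint, and there are more of them than vertices
    in all separators.\<close>
  have "\<exists>m. 2 \<le> m \<and> m < Bs \<and> Q (b (i * Bs + m)) \<inter> CC = {}" if i: "i < d" for i
  proof (rule ccontr)
    assume no: "\<not> ?thesis"
    define x where "x m = (SOME y. y \<in> Q (b (i * Bs + m)) \<inter> CC)" for m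
    have x: "x m \<in> Q (b (i * Bs + m)) \<inter> CC" if "m \<in> {2..<Bs}" for m
      unfolding x_def by (rule someI_ex) (use no that in auto)
    have "inj_on x {2..<Bs}"
    proof (rule linorder_inj_onI)
      fix m m' assume mm: "m < m'" "m \<in> {2..<Bs}" "m' \<in> {2..<Bs}"
      have l: "i * Bs + m' < Suc d * Bs" "i * Bs + m < Suc d * Bs" using idx[of i] i mm by auto
      have ne: "b (i * Bs + m) \<noteq> b (i * Bs + m')" by (rule b_neq) (use mm l in auto)
      have "Q (b (i * Bs + m)) \<inter> Q (b (i * Bs + m')) = {}"
        using not_touch_disjoint[OF Q_anti[OF _ _ ne]] b(1)[OF l(1)] b(1)[OF l(2)] JJ by blast
      then show "x m \<noteq> x m'" using x[OF mm(2)] x[OF mm(3)] by auto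
    qed auto
    then have "card {2..<Bs} \<le> card CC"
      by (rule card_inj_on_le) (use x finCC in auto)
    then show False using cCC by (simp add: Bs_def)
  qed
  then obtain mm where mm: "\<And>i. i < d ==> 2 \<le> mm i \<and> mm i < Bs \<and> Q (b (i * Bs + mm i)) \<inter> CC = {}" by metis
  define e where "e i = i * Bs + mm i" for i
  have e: "e i < Suc d * Bs" "Suc (i * Bs) < e i" "e i < Suc i * Bs" if "i < d" for i
    using mm[OF that] idx[of i "mm i"] that by (auto simp: e_def)
  define q where "q i = b (e i)" for i
  have qJ: "q i \<in> J2" if "i < d" for i using b(1)[OF e(1)[OF that]] by (simp add: q_def)
  have qJ': "q i \<in> J" if "i < d" for i using qJ[OF that] JJ by blast
  have q_ip: "ip (Q (q i))" if "i < d" for i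
  proof -
    have "Q (q i) \<noteq> {}" using t2[OF p qJ[OF that]] by (auto simp: touch_def)
    then show ?thesis using Q_conn[OF qJ'[OF that]] by simp
  qed
  have q_conn: "conn (Q (q i))" if "i < d" for i using q_ip[OF that] by (metis conn_ipath ip_def)
  have e_mono: "e i < e j" if "i < j" "j < d" for i j
  proof -
    have "e i < Suc i * Bs" using e(3)[of i] that by simp
    also have "\<dots> \<le> j * Bs" using that by (intro mult_le_mono1) simp
    finally show ?thesis using e(2)[of j] that by simp
  qed
  have q_neq: "q i \<noteq> q j" if "i < j" "j < d" for i j
    unfolding q_def by (rule b_neq[OF e_mono[OF that] e(1)[OF that(2)]])
  have q_avoid: "Q (q i) \<subseteq> H - cut (u l)" if "i < d" "l \<le> d" for i l
    using mm[OF that(1)] that(2) qJ'[OF that(1)] by (auto simp: q_def e_def CC_def H_def)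
  have right: "uq l < a (e i)" if "l \<le> i" "i < d" for l i
  proof -
    have "l * Bs \<le> i * Bs" using that by (intro mult_le_mono1)
    then have "Suc (l * Bs) < e i" using e(2)[OF that(2)] by (rule le_less_trans[OF Suc_le_mono[THEN iffD2]])
    then have "a (Suc (l * Bs)) < a (e i)" using a(2)[OF _ e(1)[OF that(2)]] by simp
    then show ?thesis using uq(2)[of l] that by simp
  qed
  have left: "a (e i) < uq l" if "i < l" "l \<le> d" for l i
  proof -
    have "Suc i * Bs \<le> l * Bs" using that by (intro mult_le_mono1) simp
    then have "e i < l * Bs" using e(3)[of i] that by (meson le_trans less_le_trans)
    then have "a (e i) < a (l * Bs)" using a(2) idx[OF that(2), of 0] Bs3 by simp
    then show ?thesis using uq(1)[OF that(2)] by simp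
  qed
  have weak: "z \<le> z'" if ii: "i < i'" "i' < d" and r: "r \<in> I2" and z: "z < length (R r)" "touch (Q (q i)) {R r ! z}"
    and z': "z' < length (R r)" "touch (Q (q i')) {R r ! z'}" for i i' r z z'
  proof -
    have l: "i' \<le> d" "i < d" using ii by simp_all
    have "z \<le> pos (u i') r"
    proof (rule ccontr)
      assume "\<not> ?thesis"
      then show False
        using not_across[OF uU[OF l(1)] q_conn[OF l(2)] q_avoid[OF l(2,1)] pk _ a_touch[OF e(1)[OF l(2)], folded q_def] I2k[OF r] _ z]
          left[OF ii(1) l(1)] pos_p[OF l(1)] by simp
    qed
    moreover have "pos (u i') r \<le> z'"
    proof (rule ccontr)
      assume "\<not> ?thesis"
      then show False
        using not_across[OF uU[OF l(1)] q_conn[OF ii(2)] q_avoid[OF ii(2) l(1)] I2k[OF r] _ z'(2) pk _ a_len[OF e(1)[OF ii(2)]] a_touch[OF e(1)[OF ii(2)], folded q_def]]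
          right[OF _ ii(2), of i'] pos_p[OF l(1)] by simp
    qed
    ultimately show ?thesis by simp
  qed
  have hit: "\<exists>z<length (R r). touch (Q (q i)) {R r ! z}" if "i < d" "r \<in> I2" for i r
  proof -
    note t = t2[OF that(2) qJ[OF that(1)]]
    obtain y where "y \<in> set (R r)" "touch (Q (q i)) {y}"
      using t unfolding touch_iff_singleton2[of _ "set (R r)"] by blast
    then show ?thesis by (metis in_set_conv_nth)
  qed
  \<comment> \<open>Equality would squeeze all columns from \<open>q i\<close> to
    \<open>q i'\<close> onto one vertex, which is more than a thin row allows.\<close>
  have strict: "z < z'" if ii: "i + g \<le> i'" "i' < d" and r: "r \<in> I2" and z: "z < length (R r)" "touch (Q (q i)) {R r ! z}"
    and z': "z' < length (R r)" "touch (Q (q i')) {R r ! z'}" for i i' r z z'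
  proof (rule ccontr)
    assume "\<not> z < z'"
    moreover have "z \<le> z'" using weak[OF _ ii(2) r z z'] ii(1) \<open>g > 0\<close> by simp
    ultimately have eq: "z' = z" by simp
    have "touch (Q (q l)) {R r ! z}" if l: "i \<le> l" "l \<le> i'" for l
    proof (cases "l = i \<or> l = i'")
      case True
      then show ?thesis using z z' eq by auto
    next
      case False
      then have l': "i < l" "l < i'" "l < d" using l ii by auto
      obtain y where y: "y < length (R r)" "touch (Q (q l)) {R r ! y}" using hit[OF l'(3) r] by auto
      have "y = z" using weak[OF l'(1,3) r z y] weak[OF l'(2) ii(2) r y z'] eq by simp
      then show ?thesis using y by simp
    qed
    then have "q ` {i..i'} \<subseteq> cols J2 (R r ! z)" using qJ ii by (auto simp: cols_def)
    moreover have "inj_on q {i..i'}" by (rule linorder_inj_onI) (use q_neq ii in auto)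
    ultimately have "card {i..i'} \<le> card (cols J2 (R r ! z))"
      by (intro card_inj_on_le[of q]) (use finJ2 in \<open>auto simp: cols_def\<close>)
    then show False using thin[OF r, of "R r ! z"] z(1) ii by (simp add: g_def)
  qed
  obtain h where h: "inj_on h {..<K}" "h ` {..<K} \<subseteq> I2"
    using card_le_inj[of "{..<K}" I2] finI2 cI2 by auto
  have hI: "h r \<in> I2" if "r < K" for r using h that by auto
  have md: "2 * g * j + m < d" if "j < D" "m \<le> 2 * g" for j m
  proof -
    have "2 * g * j + m \<le> 2 * g * Suc j" using that by simp
    also have "\<dots> \<le> 2 * g * D" using that by (intro mult_le_mono2) simp
    finally show ?thesis by (simp add: d_def)
  qed
  \<comment> \<open>Two strict steps of \<open>g\<close> columns each give the gap of two positions
    that a ladder demands; hence the spacing \<open>2 * g\<close>.\<close>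
  have "ladder V E K D (\<lambda>r. R (h r)) (\<lambda>j. Q (q (2 * g * j)))"
  proof
    fix r assume r: "r < K"
    show "ipath (R (h r))" using R(1) I2k hI[OF r] by blast
    show "\<not> touch (set (R (h r))) (set (R (h r')))" if "r' < K" "r \<noteq> r'" for r'
      using I1(3)[of "h r" "h r'"] hI[OF r] hI[OF that(1)] I2(1) inj_onD[OF h(1), of r r'] r that by auto
  next
    fix j assume j: "j < D"
    note jd = md[OF j, of 0, simplified]
    show "conn (Q (q (2 * g * j))) \<and> Q (q (2 * g * j)) \<subseteq> V" using q_conn[OF jd] QV[OF qJ'[OF jd]] by simp
    show "\<not> touch (Q (q (2 * g * j))) (Q (q (2 * g * j')))" if "j' < D" "j \<noteq> j'" for j'
    proof (rule Q_anti[OF qJ'[OF jd] qJ'[OF md[OF that(1), of 0, simplified]]])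
      have "2 * g * j \<noteq> 2 * g * j'" using that \<open>g > 0\<close> by simp
      then show "q (2 * g * j) \<noteq> q (2 * g * j')"
        using q_neq[OF _ jd] q_neq[OF _ md[OF that(1), of 0, simplified]] by (metis linorder_neqE_nat)
    qed
    show "touch (Q (q (2 * g * j))) (set (R (h r)))" if "r < K" for r using t2[OF hI[OF that] qJ[OF jd]] .
  next
    fix j j' r z z'
    assume jj: "j < j'" "j' < D" and r: "r < K" and z: "z < length (R (h r))" and z': "z' < length (R (h r))"
      and t: "touch (Q (q (2 * g * j))) {R (h r) ! z}" and t': "touch (Q (q (2 * g * j'))) {R (h r) ! z'}"
    have jD: "j < D" using jj by simp
    have md1: "2 * g * j + g < d" using md[OF jD, of g] by simp
    obtain y where y: "y < length (R (h r))" "touch (Q (q (2 * g * j + g))) {R (h r) ! y}"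
      using hit[OF md1 hI[OF r]] by auto
    have "z < y" by (rule strict[OF _ md1 hI[OF r] z t y]) simp
    moreover have "2 * g * Suc j \<le> 2 * g * j'" using jj by (intro mult_le_mono2) simp
    then have "y < z'" by (intro strict[OF _ md[OF jj(2), of 0, simplified] hI[OF r] y z' t']) simp
    ultimately show "Suc z < z'" by simp
  qed
  then show ?thesis by blast
qed

end

text \<open>A linkage whose set of vertices outside the columns is minimal under inclusion is tight,
  so \<open>crossing\<close> applies. The outcome is phrased for pigeonholing: no large set of paths
  is completely touched by a large set of columns.\<close>

theorem linkage_or_ladder:
  fixes V :: "'a set" and J :: "'i set"
  assumes g: "fin_graph V E" and nPM: "\<not> fin_graph.PM V E n" and nL: "\<And>\<rho> Q. \<not> ladder V E K D \<rho> Q"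
    and J: "finite J" "\<And>j. j \<in> J ==> Q j = {} \<or> fin_graph.ip V E (Q j)"
      "\<And>i j. i \<in> J ==> j \<in> J ==> i \<noteq> j ==> \<not> fin_graph.touch E (Q i) (Q j)"
    and Y: "fin_graph.linkage V E (Y \<union> (\<Union>j\<in>J. Q j)) A B k R0"
  obtains R where "fin_graph.linkage V E (Y \<union> (\<Union>j\<in>J. Q j)) A B k R"
    "\<And>I J'. I \<subseteq> {..<k} ==> J' \<subseteq> J ==> (2 * n + (K + n)) choose (2 * n) \<le> card I ==> crossing_bound n D k n \<le> card J' ==>
      \<exists>i\<in>I. \<exists>j\<in>J'. \<not> fin_graph.touch E (Q j) (set (R i))"
proof -
  interpret fin_graph V E by fact
  let ?Q = "\<Union>j\<in>J. Q j"
  define good where "good U \<longleftrightarrow> U \<subseteq> (Y \<inter> V) - ?Q \<and> (\<exists>R. linkage (U \<union> ?Q) A B k R)" for U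
  have "linkage ((Y \<inter> V - ?Q) \<union> ?Q) A B k R0"
    by (rule linkage_mono[OF linkage_subset_V[OF Y]]) auto
  then have "good (Y \<inter> V - ?Q)" by (auto simp: good_def)
  moreover have fin: "finite {U. good U}"
    by (rule finite_subset[of _ "Pow V"]) (use finite_V in \<open>auto simp: good_def\<close>)
  ultimately obtain U where U: "good U" and min: "\<And>U'. good U' ==> U' \<subseteq> U ==> U' = U"
    using finite_has_minimal2[OF fin, of "Y \<inter> V - ?Q"] by (metis mem_Collect_eq)
  obtain R where link: "linkage (U \<union> ?Q) A B k R" using U by (auto simp: good_def)
  interpret tight_linkage V E J Q U A B k R
  proof
    show "U \<subseteq> V" "U \<inter> ?Q = {}" using U by (auto simp: good_def)
    show "\<not> (\<exists>R. linkage (U \<union> ?Q - {u}) A B k R)" if u: "u \<in> U" for u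
    proof
      assume ex: "\<exists>R. linkage (U \<union> ?Q - {u}) A B k R"
      have "U \<union> ?Q - {u} = (U - {u}) \<union> ?Q" using U u by (auto simp: good_def)
      then have "good (U - {u})" using ex U by (auto simp: good_def)
      then show False using min[of "U - {u}"] u by auto
    qed
  qed (use J link in auto)
  show thesis
  proof (rule that)
    show "linkage (Y \<union> ?Q) A B k R"
      by (rule linkage_mono[OF link]) (use U in \<open>auto simp: good_def\<close>)
    fix I J' assume "I \<subseteq> {..<k}" "J' \<subseteq> J" "(2 * n + (K + n)) choose (2 * n) \<le> card I" "crossing_bound n D k n \<le> card J'"
    then show "\<exists>i\<in>I. \<exists>j\<in>J'. \<not> touch (Q j) (set (R i))"
      using crossing[OF nPM, of I K J' D] nL by blast
  qed
qed

section \<open>Anticomplete connections\<close>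

context fin_graph begin

definition bridge :: "'a set => 'a set => 'a set => 'a list => bool" where
  "bridge W A B xs \<longleftrightarrow> ipath xs \<and> set xs \<subseteq> W \<and> hd xs \<in> A \<and> last xs \<in> B \<and>
     (\<forall>i<length xs. (xs ! i \<in> A \<longrightarrow> i = 0) \<and> (xs ! i \<in> B \<longrightarrow> i = length xs - 1))"

lemma bridge_interior:
  assumes "bridge W A B xs"
  shows "set (butlast (tl xs)) \<subseteq> W - A - B" "set (butlast (tl xs)) = {} \<or> ip (set (butlast (tl xs)))"
    "set xs = {hd xs, last xs} \<union> set (butlast (tl xs))"
proof -
  have xs: "ipath xs" "set xs \<subseteq> W" using assms by (simp_all add: bridge_def)
  show "set (butlast (tl xs)) \<subseteq> W - A - B"
  proof
    fix x assume "x \<in> set (butlast (tl xs))"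
    then obtain i where i: "i < length (butlast (tl xs))" "x = butlast (tl xs) ! i" by (auto simp: in_set_conv_nth)
    then have il: "Suc i < length xs - 1" by simp
    then have x: "x = xs ! Suc i" using i by (simp add: nth_butlast nth_tl)
    have "Suc i < length xs" "Suc i \<noteq> 0" "Suc i \<noteq> length xs - 1" using il by linarith+
    then have "xs ! Suc i \<notin> A" "xs ! Suc i \<notin> B" using assms unfolding bridge_def by blast+
    moreover have "x \<in> W" using xs(2) x il nth_mem[of "Suc i" xs] by auto
    ultimately show "x \<in> W - A - B" using x by simp
  qed
  obtain x ys where c: "xs = x # ys" using ipathD(1)[OF xs(1)] by (cases xs) auto
  show "set xs = {hd xs, last xs} \<union> set (butlast (tl xs))"
    using c by (cases ys rule: rev_cases) auto
  show "set (butlast (tl xs)) = {} \<or> ip (set (butlast (tl xs)))"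
  proof (cases "butlast ys = []")
    case False
    then have "ys = butlast ys @ [last ys]" by (metis append_butlast_last_id butlast.simps(1))
    then have "xs = [x] @ butlast ys @ [last ys]" using c by simp
    then have "ipath (butlast ys)"
      using xs(1) False ipath_append_right[of "[x]" "butlast ys @ [last ys]"] ipath_append_left[of "butlast ys" "[last ys]"] by simp
    then show ?thesis using c ip_set by simp
  qed (use c in simp)
qed

lemma bridge_exists:
  assumes "ipath xs" "set xs \<subseteq> W" "hd xs \<in> A" "last xs \<in> B"
  shows "\<exists>ys. bridge W A B ys \<and> set ys \<subseteq> set xs"
proof -
  have "set xs \<inter> A \<noteq> {}" "set xs \<inter> B \<noteq> {}"
    using assms(3,4) hd_in_set[OF ipathD(1)[OF assms(1)]] last_in_set[OF ipathD(1)[OF assms(1)]] by blast+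
  from exists_ipath[OF conn_ipath[OF assms(1)] ipathD(3)[OF assms(1)] this]
  obtain ys where "ipath ys" "set ys \<subseteq> set xs" "hd ys \<in> A" "last ys \<in> B"
    "\<And>i. i < length ys ==> ys ! i \<in> A ==> i = 0" "\<And>i. i < length ys ==> ys ! i \<in> B ==> i = length ys - 1"
    by blast
  then show ?thesis using assms(2) unfolding bridge_def by blast
qed

text \<open>By disjointness at most \<open>n\<close> of the paths contain one of \<open>n\<close>
  chosen points. With \<open>2 * n\<close> paths, the other ones and these points would form a path
  model.\<close>

lemma few_rows:
  assumes nPM: "\<not> PM n" and X: "finite X" "n \<le> card X" "X \<subseteq> V"
    and T: "finite T" "\<And>r. r \<in> T ==> ip (R r)" "\<And>r r'. r \<in> T ==> r' \<in> T ==> r \<noteq> r' ==> R r \<inter> R r' = {}"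
    and tch: "\<And>x r. x \<in> X ==> r \<in> T ==> touch {x} (R r)"
  shows "card T < 2 * n"
proof (rule ccontr)
  assume "\<not> card T < 2 * n"
  then have cT: "2 * n \<le> card T" by simp
  obtain X' where X': "X' \<subseteq> X" "card X' = n" using obtain_subset_with_card_n[OF X(2)] by metis
  have finX': "finite X'" using X' X(1) finite_subset by blast
  define hit where "hit x = {r \<in> T. x \<in> R r}" for x
  have hit1: "card (hit x) \<le> 1" for x
  proof -
    have "r = r'" if "r \<in> hit x" "r' \<in> hit x" for r r'
      using T(3)[of r r'] that by (auto simp: hit_def)
    then show ?thesis using T(1) by (intro card_le_Suc0_iff_eq[THEN iffD2, folded One_nat_def]) (auto simp: hit_def)
  qed
  have "card (\<Union>x\<in>X'. hit x) \<le> (\<Sum>x\<in>X'. card (hit x))" by (rule card_UN_le[OF finX'])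
  also have "\<dots> \<le> (\<Sum>x\<in>X'. 1)" by (rule sum_mono) (rule hit1)
  finally have c: "card (\<Union>x\<in>X'. hit x) \<le> n" using X'(2) by simp
  have "finite (\<Union>x\<in>X'. hit x)" using finX' T(1) by (auto simp: hit_def)
  then have "card T - n \<le> card (T - (\<Union>x\<in>X'. hit x))" using diff_card_le_card_Diff[of "\<Union>x\<in>X'. hit x" T] c by linarith
  then have cR: "n \<le> card (T - (\<Union>x\<in>X'. hit x))" using cT by linarith
  have "PM n"
  proof (rule PM_I[of X' "T - (\<Union>x\<in>X'. hit x)" n "\<lambda>x. {x}" R])
    show "n \<le> card X'" using X' by simp
    show "ip {x}" if "x \<in> X'" for x using ip_singleton X' X(3) that by blast
    show "ip (R r)" if "r \<in> T - (\<Union>x\<in>X'. hit x)" for r using T(2) that by blast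
    show "{x} \<inter> {y} = {}" if "x \<noteq> y" for x y :: 'a using that by simp
    show "{x} \<inter> R r = {}" if "x \<in> X'" "r \<in> T - (\<Union>x\<in>X'. hit x)" for x r using that by (auto simp: hit_def)
    show "touch {x} (R r)" if "x \<in> X'" "r \<in> T - (\<Union>x\<in>X'. hit x)" for x r using tch X'(1) that by blast
    show "R r \<inter> R r' = {}" if "r \<in> T - (\<Union>x\<in>X'. hit x)" "r' \<in> T - (\<Union>x\<in>X'. hit x)" "r \<noteq> r'" for r r'
      using T(3)[of r r'] that by simp
  qed (use finX' T(1) cR in auto)
  then show False using nPM by simp
qed

text \<open>Every class keeps a reserve of candidates, because each further class that is added
  spoils some of those present.\<close>

definition anti_classes ::
  "'e set => ('e => 'a set) => ('e => 'a set) => ('e => 'a set) => nat => ('e => 'a list set) => bool" where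
  "anti_classes F W A B c \<C> \<longleftrightarrow>
     (\<forall>e\<in>F. finite (\<C> e) \<and> c \<le> card (\<C> e) \<and> (\<forall>xs\<in>\<C> e. bridge (W e) (A e) (B e) xs)) \<and>
     (\<forall>e\<in>F. \<forall>e'\<in>F. \<forall>xs\<in>\<C> e. \<forall>ys\<in>\<C> e'. e \<noteq> e' \<or> xs \<noteq> ys \<longrightarrow> \<not> touch (set xs) (set ys))"

text \<open>The interiors of the present bridges serve as columns for a new linkage; their ends may
  lie outside \<open>W f\<close> and are handled as single vertices by \<open>few_rows\<close>. Each
  old class is thinned until its members touch the same new paths. It then spoils only boundedly
  many of these, and Ramsey's theorem makes enough of the others anticomplete.\<close>

lemma add_class:
  fixes F :: "'e set"
  assumes nPM: "\<not> PM n" and nL: "\<And>\<rho> Q. \<not> ladder V E K D \<rho> Q"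
    and F: "finite F" "f \<notin> F" and W: "\<And>e. e \<in> F ==> W e - A e - B e \<subseteq> W f"
    and C: "anti_classes F W A B c1 \<C>" and R0: "linkage (W f) (A f) (B f) k R0"
    and k: "card F * (((2 * n + (K + n)) choose (2 * n)) + 4 * n) + ((2 * n + c) choose (2 * n)) \<le> k"
    and c1: "(c + crossing_bound n D k n + n) * (2 ^ k * (2 ^ k * 2 ^ k)) \<le> c1"
  shows "\<exists>\<C>'. anti_classes (insert f F) W A B c \<C>'"
proof -
  define K0 where "K0 = (2 * n + (K + n)) choose (2 * n)"
  \<comment> \<open>Large enough for the wanted class size \<open>c\<close>, for the columns in
    \<open>cross\<close> and for the \<open>n\<close> points in \<open>few_rows\<close>.\<close>
  define m where "m = c + crossing_bound n D k n + n"
  have Cb: "bridge (W e) (A e) (B e) xs" if "e \<in> F" "xs \<in> \<C> e" for e xs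
    using C that by (simp add: anti_classes_def)
  have Cfin: "finite (\<C> e)" "c1 \<le> card (\<C> e)" if "e \<in> F" for e
    using C that by (simp_all add: anti_classes_def)
  have Canti: "\<not> touch (set xs) (set ys)" if "e \<in> F" "e' \<in> F" "xs \<in> \<C> e" "ys \<in> \<C> e'" "e \<noteq> e' \<or> xs \<noteq> ys" for e e' xs ys
    using C that unfolding anti_classes_def by blast
  have Cip: "ipath xs" if "e \<in> F" "xs \<in> \<C> e" for e xs using Cb[OF that] by (simp add: bridge_def)
  define J where "J = (SIGMA e:F. \<C> e)"
  define Q where "Q j = set (butlast (tl (snd j)))" for j :: "'e \<times> 'a list"
  have Q_sub: "Q j \<subseteq> W f" if jJ: "j \<in> J" for j
  proof -
    obtain e xs where j: "j = (e, xs)" "e \<in> F" "xs \<in> \<C> e" using jJ unfolding J_def by (rule SigmaE)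
    then show ?thesis using bridge_interior(1)[OF Cb[OF j(2,3)]] W[OF j(2)] by (auto simp: Q_def)
  qed
  have Q_ip: "Q j = {} \<or> ip (Q j)" if jJ: "j \<in> J" for j
  proof -
    obtain e xs where j: "j = (e, xs)" "e \<in> F" "xs \<in> \<C> e" using jJ unfolding J_def by (rule SigmaE)
    then show ?thesis using bridge_interior(2)[OF Cb[OF j(2,3)]] by (simp add: Q_def)
  qed
  have Q_anti: "\<not> touch (Q i) (Q j)" if ij: "i \<in> J" "j \<in> J" "i \<noteq> j" for i j
  proof
    assume t: "touch (Q i) (Q j)"
    obtain e xs where i: "i = (e, xs)" "e \<in> F" "xs \<in> \<C> e" using ij(1) unfolding J_def by (rule SigmaE)
    obtain e' ys where j: "j = (e', ys)" "e' \<in> F" "ys \<in> \<C> e'" using ij(2) unfolding J_def by (rule SigmaE)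
    have "Q i \<subseteq> set xs" "Q j \<subseteq> set ys"
      using bridge_interior(3)[OF Cb[OF i(2,3)]] bridge_interior(3)[OF Cb[OF j(2,3)]] by (auto simp: Q_def i(1) j(1))
    then have "touch (set xs) (set ys)" using touch_mono[OF t] by blast
    moreover have "e \<noteq> e' \<or> xs \<noteq> ys" using ij(3) i(1) j(1) by auto
    ultimately show False using Canti[OF i(2) j(2) i(3) j(3)] by blast
  qed
  have finJ: "finite J" unfolding J_def using F(1) Cfin by (intro finite_SigmaI) auto
  have eqW: "W f \<union> (\<Union>j\<in>J. Q j) = W f" using Q_sub by blast
  have link0: "linkage (W f \<union> (\<Union>j\<in>J. Q j)) (A f) (B f) k R0" using R0 eqW by simp
  obtain R where R: "linkage (W f \<union> (\<Union>j\<in>J. Q j)) (A f) (B f) k R"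
    and cross: "\<And>I J'. I \<subseteq> {..<k} ==> J' \<subseteq> J ==> K0 \<le> card I ==> crossing_bound n D k n \<le> card J' ==>
      \<exists>i\<in>I. \<exists>j\<in>J'. \<not> touch (Q j) (set (R i))"
  proof (rule linkage_or_ladder[OF fin_graph_axioms nPM nL finJ _ _ link0, folded K0_def], goal_cases)
    case (3 R)
    show ?case by (rule that[OF 3(2)]) (rule 3(3))
  qed (use Q_ip Q_anti in \<open>simp_all\<close>)
  note R = R[unfolded eqW]
  have "\<exists>ys. bridge (W f) (A f) (B f) ys \<and> set ys \<subseteq> set (R r)" if "r < k" for r
    by (rule bridge_exists) (use linkageD[OF R] that in auto)
  then obtain S where S: "\<And>r. r < k ==> bridge (W f) (A f) (B f) (S r)" "\<And>r. r < k ==> set (S r) \<subseteq> set (R r)" by metis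
  have S_ip: "ip (set (S r))" if "r < k" for r using S(1)[OF that] ip_set by (simp add: bridge_def)
  have S_disj: "set (S r) \<inter> set (S r') = {}" if "r < k" "r' < k" "r \<noteq> r'" for r r'
    using linkageD(5)[OF R that] S(2)[OF that(1)] S(2)[OF that(2)] by blast
  define tc where "tc X = {r. r < k \<and> touch X (set (S r))}" for X
  have tc_sub: "tc X \<subseteq> {..<k}" for X by (auto simp: tc_def)
  have tc_fin: "finite (tc X)" for X using tc_sub finite_subset by blast
  have "\<exists>C'. C' \<subseteq> \<C> e \<and> card C' = m \<and> card (\<Union>xs\<in>C'. tc (set xs)) \<le> K0 + 4 * n" if e: "e \<in> F" for e
  proof -
    \<comment> \<open>The sets of new paths touched by the interior, the first and the last vertex;
      the three factors \<open>2 ^ k\<close> in the bound on \<open>c1\<close> count these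
      triples.\<close>
    define kind where "kind xs = (tc (Q (e, xs)), tc {hd xs}, tc {last xs})" for xs
    obtain y C' where y: "C' \<subseteq> \<C> e" "card C' = m" "\<And>xs. xs \<in> C' ==> kind xs = y"
    proof (rule pigeonhole_fiber_subset[of "\<C> e" "Pow {..<k} \<times> Pow {..<k} \<times> Pow {..<k}" kind m])
      show "kind ` \<C> e \<subseteq> Pow {..<k} \<times> Pow {..<k} \<times> Pow {..<k}" using tc_sub by (auto simp: kind_def)
      show "m * card (Pow {..<k} \<times> Pow {..<k} \<times> Pow {..<k}) \<le> card (\<C> e)"
        using c1 Cfin(2)[OF e] by (simp add: card_cartesian_product card_Pow m_def)
    qed (use Cfin[OF e] in auto)
    obtain T0 T1 T2 where T: "y = (T0, T1, T2)" by (cases y)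
    have T': "tc (Q (e, xs)) = T0" "tc {hd xs} = T1" "tc {last xs} = T2" if "xs \<in> C'" for xs
      using y(3)[OF that] by (simp_all add: kind_def T)
    have finC': "finite C'" using y(1) Cfin(1)[OF e] finite_subset by blast
    have in_C: "xs \<in> \<C> e" if "xs \<in> C'" for xs using y(1) that by blast
    have sub: "(\<Union>xs\<in>C'. tc (set xs)) \<subseteq> T0 \<union> T1 \<union> T2" if "C' \<noteq> {}"
    proof
      fix r assume "r \<in> (\<Union>xs\<in>C'. tc (set xs))"
      then obtain xs where xs: "xs \<in> C'" "r < k" "touch (set xs) (set (S r))" by (auto simp: tc_def)
      have "touch ({hd xs} \<union> {last xs} \<union> Q (e, xs)) (set (S r))"
        using xs(3) bridge_interior(3)[OF Cb[OF e in_C[OF xs(1)]]] by (simp add: Q_def insert_commute)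
      then have "touch {hd xs} (set (S r)) \<or> touch {last xs} (set (S r)) \<or> touch (Q (e, xs)) (set (S r))"
        unfolding touch_Un by blast
      then show "r \<in> T0 \<union> T1 \<union> T2" unfolding T'[OF xs(1), symmetric] tc_def using xs(2) by blast
    qed
    show ?thesis
    proof (cases "C' = {}")
      case True
      then show ?thesis using y by (intro exI[of _ C']) simp
    next
      case False
      then obtain x0 where x0: "x0 \<in> C'" by blast
      have Tk: "T0 \<subseteq> {..<k}" "T1 \<subseteq> {..<k}" "T2 \<subseteq> {..<k}" "finite T0" "finite T1" "finite T2"
        unfolding T'[OF x0, symmetric] by (rule tc_sub tc_fin)+
      have "card T0 \<le> K0"
      proof (rule ccontr)
        assume "\<not> card T0 \<le> K0"
        then have "K0 \<le> card T0" by simp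
        moreover have "Pair e ` C' \<subseteq> J" using in_C e by (auto simp: J_def)
        moreover have "card (Pair e ` C') = m" using y(2) by (simp add: card_image inj_on_def)
        ultimately obtain i xs where "i \<in> T0" "xs \<in> C'" "\<not> touch (Q (e, xs)) (set (R i))"
          using cross[OF Tk(1), of "Pair e ` C'"] by (auto simp: m_def)
        moreover have "i < k" "touch (Q (e, xs)) (set (S i))"
          using T'(1)[OF \<open>xs \<in> C'\<close>] \<open>i \<in> T0\<close> by (auto simp: tc_def)
        ultimately show False using touch_mono[of "Q (e, xs)" "set (S i)" "Q (e, xs)" "set (R i)"] S(2) by blast
      qed
      moreover have few: "card T' < 2 * n" if T': "T' \<subseteq> {..<k}" "\<And>xs. xs \<in> C' ==> tc {g xs} = T'"
        and g: "\<And>xs. xs \<in> C' ==> g xs \<in> set xs" for T' g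
      proof (rule few_rows[OF nPM, of "g ` C'" T' "\<lambda>r. set (S r)"])
        have "inj_on g C'"
        proof (rule inj_onI)
          fix xs ys assume a: "xs \<in> C'" "ys \<in> C'" "g xs = g ys"
          show "xs = ys"
          proof (rule ccontr)
            assume "xs \<noteq> ys"
            then have "set xs \<inter> set ys = {}" using Canti[OF e e in_C[OF a(1)] in_C[OF a(2)]] not_touch_disjoint by blast
            then show False using g[OF a(1)] g[OF a(2)] a(3) by (metis IntI empty_iff)
          qed
        qed
        then show "n \<le> card (g ` C')" using y(2) by (simp add: card_image m_def)
        show "finite (g ` C')" using finC' by simp
        show "g ` C' \<subseteq> V"
        proof
          fix x assume "x \<in> g ` C'"
          then obtain xs where "xs \<in> C'" "x = g xs" by blast
          then show "x \<in> V" using g[of xs] ipathD(3)[OF Cip[OF e in_C]] by blast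
        qed
        show "finite T'" using T'(1) finite_subset by blast
        show "ip (set (S r))" if "r \<in> T'" for r using S_ip T'(1) that by blast
        show "set (S r) \<inter> set (S r') = {}" if "r \<in> T'" "r' \<in> T'" "r \<noteq> r'" for r r'
          by (rule S_disj) (use T'(1) that in auto)
        show "touch {x} (set (S r))" if xr: "x \<in> g ` C'" "r \<in> T'" for x r
        proof -
          obtain xs where xs: "xs \<in> C'" "x = g xs" using xr(1) by blast
          then have "r \<in> tc {x}" using T'(2)[OF xs(1)] xr(2) by simp
          then show ?thesis by (simp add: tc_def)
        qed
      qed
      have "card T1 < 2 * n"
        by (rule few[OF Tk(2) T'(2)]) (use hd_in_set ipathD(1)[OF Cip[OF e in_C]] in auto)
      moreover have "card T2 < 2 * n"
        by (rule few[OF Tk(3) T'(3)]) (use last_in_set ipathD(1)[OF Cip[OF e in_C]] in auto)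
      moreover have "card (\<Union>xs\<in>C'. tc (set xs)) \<le> card (T0 \<union> T1 \<union> T2)"
        using Tk sub[OF False] by (intro card_mono) auto
      moreover have "card (T0 \<union> T1 \<union> T2) \<le> card T0 + card T1 + card T2"
        using card_Un_le[of "T0 \<union> T1" T2] card_Un_le[of T0 T1] by linarith
      ultimately have "card (\<Union>xs\<in>C'. tc (set xs)) \<le> K0 + 4 * n" by linarith
      then show ?thesis using y by blast
    qed
  qed
  then obtain C' where C': "\<And>e. e \<in> F ==> C' e \<subseteq> \<C> e" "\<And>e. e \<in> F ==> card (C' e) = m"
    "\<And>e. e \<in> F ==> card (\<Union>xs\<in>C' e. tc (set xs)) \<le> K0 + 4 * n" by metis
  define bad where "bad = (\<Union>e\<in>F. \<Union>xs\<in>C' e. tc (set xs))"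
  have "card bad \<le> (\<Sum>e\<in>F. card (\<Union>xs\<in>C' e. tc (set xs)))" unfolding bad_def by (rule card_UN_le[OF F(1)])
  also have "\<dots> \<le> (\<Sum>e\<in>F. K0 + 4 * n)" by (rule sum_mono) (rule C'(3))
  finally have cbad: "card bad \<le> card F * (K0 + 4 * n)" by simp
  have badk: "bad \<subseteq> {..<k}" using tc_sub unfolding bad_def by blast
  then have finbad: "finite bad" using finite_subset by blast
  have "(2 * n + c) choose (2 * n) \<le> card ({..<k} - bad)"
    using k cbad card_Diff_subset[OF finbad badk] by (simp add: K0_def)
  from ramsey_anticomplete[OF nPM _ this, of "\<lambda>r. set (S r)"]
  obtain G where G: "G \<subseteq> {..<k} - bad" "card G = Suc c" "\<And>r r'. r \<in> G ==> r' \<in> G ==> r \<noteq> r' ==> \<not> touch (set (S r)) (set (S r'))"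
    using S_ip S_disj by (metis (no_types, lifting) DiffE finite_Diff finite_lessThan lessThan_iff)
  have Gk: "r < k" if "r \<in> G" for r using G(1) that by blast
  have finG: "finite G" using G(2) card.infinite by fastforce
  have "inj_on S G"
  proof (rule inj_onI)
    fix r r' assume a: "r \<in> G" "r' \<in> G" "S r = S r'"
    have "ipath (S r)" using S(1)[OF Gk[OF a(1)]] by (simp add: bridge_def)
    then have "set (S r) \<noteq> {}" using ipathD(1) by simp
    then show "r = r'" using S_disj[OF Gk[OF a(1)] Gk[OF a(2)]] a(3) by auto
  qed
  then have cSG: "card (S ` G) = Suc c" using G(2) by (simp add: card_image)
  define C2 where "C2 = C'(f := S ` G)"
  have C2e: "C2 e = C' e" if "e \<in> F" for e using that F(2) by (auto simp: C2_def)
  have C2f: "C2 f = S ` G" by (simp add: C2_def)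
  have old_new: "\<not> touch (set xs) (set (S r))" if "e \<in> F" "xs \<in> C' e" "r \<in> G" for e xs r
    using G(1) that Gk[OF that(3)] unfolding bad_def tc_def by blast
  have "anti_classes (insert f F) W A B c C2"
    unfolding anti_classes_def
  proof (intro conjI ballI impI)
    fix e assume "e \<in> insert f F"
    then consider "e = f" | "e \<in> F" by blast
    then have "finite (C2 e) \<and> c \<le> card (C2 e) \<and> (\<forall>xs\<in>C2 e. bridge (W e) (A e) (B e) xs)"
    proof cases
      case 1
      then show ?thesis using finG cSG S(1) Gk by (simp add: C2f)
    next
      case 2
      have "finite (C' e)" using C'(1)[OF 2] Cfin(1)[OF 2] finite_subset by blast
      moreover have "bridge (W e) (A e) (B e) xs" if "xs \<in> C' e" for xs using Cb[OF 2] C'(1)[OF 2] that by blast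
      ultimately show ?thesis using C'(2)[OF 2] by (simp add: C2e[OF 2] m_def)
    qed
    then show "finite (C2 e)" "c \<le> card (C2 e)" "\<And>xs. xs \<in> C2 e ==> bridge (W e) (A e) (B e) xs" by blast+
  next
    fix e e' xs ys assume a: "e \<in> insert f F" "e' \<in> insert f F" "xs \<in> C2 e" "ys \<in> C2 e'" "e \<noteq> e' \<or> xs \<noteq> ys"
    show "\<not> touch (set xs) (set ys)"
    proof (cases "e = f")
      case ef: True
      then obtain r where r: "r \<in> G" "xs = S r" using a(3) C2f by auto
      show ?thesis
      proof (cases "e' = f")
        case True
        then obtain r' where r': "r' \<in> G" "ys = S r'" using a(4) C2f by auto
        then show ?thesis using G(3)[OF r(1) r'(1)] r a(5) ef True by auto
      next
        case False
        then have e': "e' \<in> F" using a(2) by simp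
        show ?thesis using old_new[OF e' _ r(1), of ys] a(4) C2e[OF e'] r(2) touch_sym[of "set xs" "set ys"] by simp
      qed
    next
      case ef: False
      then have e: "e \<in> F" using a(1) by simp
      show ?thesis
      proof (cases "e' = f")
        case True
        then obtain r' where r': "r' \<in> G" "ys = S r'" using a(4) C2f by auto
        then show ?thesis using old_new[OF e _ r'(1), of xs] a(3) C2e[OF e] by simp
      next
        case False
        then have e': "e' \<in> F" using a(2) by simp
        have "xs \<in> \<C> e" "ys \<in> \<C> e'" using a(3,4) C'(1)[OF e] C'(1)[OF e'] unfolding C2e[OF e] C2e[OF e'] by blast+
        then show ?thesis using Canti[OF e e' _ _ a(5)] by blast
      qed
    qed
  qed
  then show ?thesis by blast
qed

end

definition ladder_free :: "'a set => ('a => 'a => bool) => nat => nat => nat => bool" where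
  "ladder_free V E n K D \<longleftrightarrow> fin_graph V E \<and> \<not> fin_graph.PM V E n \<and> (\<forall>\<rho> Q. \<not> ladder V E K D \<rho> Q)"

text \<open>The inclusion makes the interior of any connection available as a column for the linkage
  of any other one.\<close>

definition linked_family ::
  "'a set => ('a => 'a => bool) => 'e set => ('e => 'a set) => ('e => 'a set) => ('e => 'a set) => nat => nat => bool" where
  "linked_family V E F W A B p k \<longleftrightarrow> finite F \<and> card F = p \<and> (\<forall>e\<in>F. \<forall>f\<in>F. W e - A e - B e \<subseteq> W f) \<and>
     (\<forall>e\<in>F. \<exists>R. fin_graph.linkage V E (W e) (A e) (B e) k R)"

text \<open>Induction on the number of classes. The class added last needs a linkage of size
  \<open>k0\<close>; this determines the reserve \<open>c1\<close> that all earlier classes must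
  have, and so the linkage size \<open>k1\<close> for them.\<close>

lemma anti_classes_exist:
  "\<exists>k. \<forall>(V::'a set) E (F::'e set) W A B. ladder_free V E n K D \<and> linked_family V E F W A B p k \<longrightarrow>
    (\<exists>\<C>. fin_graph.anti_classes V E F W A B c \<C>)"
proof (induction p arbitrary: c)
  case 0
  have "fin_graph.anti_classes V E F W A B c (\<lambda>_. {})"
    if l: "ladder_free V E n K D" "linked_family V E F W A B 0 0" for V :: "'a set" and E and F :: "'e set" and W A B
  proof -
    have g: "fin_graph V E" using l(1) by (simp add: ladder_free_def)
    show ?thesis unfolding fin_graph.anti_classes_def[OF g] using l(2) by (auto simp: linked_family_def)
  qed
  then show ?case by blast
next
  case (Suc p)
  define k0 where "k0 = p * (((2 * n + (K + n)) choose (2 * n)) + 4 * n) + ((2 * n + c) choose (2 * n))"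
  define c1 where "c1 = (c + crossing_bound n D k0 n + n) * (2 ^ k0 * (2 ^ k0 * 2 ^ k0))"
  from Suc.IH[of c1] obtain k1 where k1: "\<forall>(V::'a set) E (F::'e set) W A B. ladder_free V E n K D \<and>
    linked_family V E F W A B p k1 \<longrightarrow> (\<exists>\<C>. fin_graph.anti_classes V E F W A B c1 \<C>)" by (elim exE)
  show ?case
  proof (rule exI[of _ "k0 + k1"], intro allI impI, elim conjE)
    fix V :: "'a set" and E and F :: "'e set" and W A B
    assume l: "ladder_free V E n K D" and fam: "linked_family V E F W A B (Suc p) (k0 + k1)"
    interpret fin_graph V E using l by (simp add: ladder_free_def)
    have F: "finite F" "card F = Suc p" and W: "\<forall>e\<in>F. \<forall>f\<in>F. W e - A e - B e \<subseteq> W f"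
      and L: "\<forall>e\<in>F. \<exists>R. linkage (W e) (A e) (B e) (k0 + k1) R"
      using fam unfolding linked_family_def by simp_all
    obtain f F' where F': "F = insert f F'" "f \<notin> F'" "card F' = p" "finite F'"
      using F by (metis card_Suc_eq finite_insert)
    have shorter: "linkage H S T k' R" if "linkage H S T k R" "k' \<le> k" for H S T k k' R
      using that unfolding linkage_def by (meson less_le_trans)
    have "\<exists>R. linkage (W e) (A e) (B e) k1 R" if "e \<in> F'" for e
      using L F'(1) that shorter[of _ _ _ "k0 + k1" _ k1] by (meson insertI2 le_add2)
    then have "linked_family V E F' W A B p k1" using F' W by (simp add: linked_family_def)
    with l k1 have "\<exists>\<C>. anti_classes F' W A B c1 \<C>" by simp
    then obtain \<C> where C: "anti_classes F' W A B c1 \<C>" by (elim exE)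
    obtain R where R: "linkage (W f) (A f) (B f) k0 R"
      using L F'(1) shorter[of _ _ _ "k0 + k1" _ k0] by (meson insertI1 le_add1)
    have "\<exists>\<C>'. anti_classes (insert f F') W A B c \<C>'"
    proof (rule add_class[OF _ _ F'(4,2) _ C R])
      show "\<not> PM n" "\<not> ladder V E K D \<rho> Q" for \<rho> Q using l by (simp_all add: ladder_free_def)
      show "W e - A e - B e \<subseteq> W f" if "e \<in> F'" for e using W F'(1) that by blast
    qed (simp_all add: F' k0_def c1_def)
    then show "\<exists>\<C>. anti_classes F W A B c \<C>" using F'(1) by simp
  qed
qed

lemma anti_bridges_exist:
  "\<exists>k. \<forall>(V::'a set) E (F::'e set) W A B. ladder_free V E n K D \<and> linked_family V E F W A B p k \<longrightarrow>
    (\<exists>Q. (\<forall>e\<in>F. fin_graph.bridge V E (W e) (A e) (B e) (Q e)) \<and>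
      (\<forall>e\<in>F. \<forall>f\<in>F. e \<noteq> f \<longrightarrow> \<not> fin_graph.touch E (set (Q e)) (set (Q f))))"
proof -
  from anti_classes_exist[of n K D p 1] obtain k where k: "\<forall>(V::'a set) E (F::'e set) W A B. ladder_free V E n K D \<and>
    linked_family V E F W A B p k \<longrightarrow> (\<exists>\<C>. fin_graph.anti_classes V E F W A B 1 \<C>)" by (elim exE)
  show ?thesis
  proof (rule exI[of _ k], intro allI impI)
    fix V :: "'a set" and E and F :: "'e set" and W A B
    assume a: "ladder_free V E n K D \<and> linked_family V E F W A B p k"
    interpret fin_graph V E using a by (simp add: ladder_free_def)
    obtain \<C> where C: "anti_classes F W A B 1 \<C>" using k[rule_format, OF a] by blast
    have "\<exists>xs. xs \<in> \<C> e" if "e \<in> F" for e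
    proof -
      have "1 \<le> card (\<C> e)" using C that by (simp add: anti_classes_def)
      then show ?thesis by (metis card.empty ex_in_conv not_one_le_zero)
    qed
    then obtain Q where Q: "\<And>e. e \<in> F ==> Q e \<in> \<C> e" by metis
    show "\<exists>Q. (\<forall>e\<in>F. bridge (W e) (A e) (B e) (Q e)) \<and> (\<forall>e\<in>F. \<forall>f\<in>F. e \<noteq> f \<longrightarrow> \<not> touch (set (Q e)) (set (Q f)))"
    proof (intro exI[of _ Q] conjI ballI impI)
      show "bridge (W e) (A e) (B e) (Q e)" if "e \<in> F" for e using C Q[OF that] that by (simp add: anti_classes_def)
      show "\<not> touch (set (Q e)) (set (Q f))" if "e \<in> F" "f \<in> F" "e \<noteq> f" for e f
        using C Q[OF that(1)] Q[OF that(2)] that unfolding anti_classes_def by blast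
    qed
  qed
qed

section \<open>Ladders from many hubs\<close>

context fin_graph begin

lemma conn_chain:
  assumes "\<And>a. a \<le> N ==> conn (X a)" "\<And>a. a < N ==> touch (X a) (X (Suc a))"
  shows "conn (\<Union>a\<le>N. X a)"
  using assms
proof (induction N)
  case (Suc N)
  have "conn (\<Union>a\<le>N. X a)" using Suc by simp
  moreover have "touch (\<Union>a\<le>N. X a) (X (Suc N))"
    by (rule touch_mono[OF Suc.prems(2)[of N]]) auto
  ultimately have "conn ((\<Union>a\<le>N. X a) \<union> X (Suc N))" using conn_Un Suc.prems(1) by blast
  then show ?case by (simp add: atMost_Suc Un_commute)
qed simp

text \<open>An odd set has a single vertex towards its successor, a gate that an induced path cannot
  pass twice. Only odd sets have a gate, so the order is claimed for indices
  \<open>a + 2 \<le> b\<close>: one of \<open>a\<close> and \<open>a + 1\<close> is odd.\<close>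

lemma chain_path:
  assumes X: "\<And>a. a \<le> N ==> conn (X a)" "\<And>a. a \<le> N ==> X a \<subseteq> V"
    and near: "\<And>a. a < N ==> touch (X a) (X (Suc a))"
    and far: "\<And>a b. Suc a < b ==> b \<le> N ==> \<not> touch (X a) (X b)"
    and disj: "\<And>a. a < N ==> X a \<inter> X (Suc a) = {}"
    and cut: "\<And>a x y. odd a ==> a < N ==> x \<in> X a ==> y \<in> X a ==> touch {x} (X (Suc a)) ==> touch {y} (X (Suc a)) ==> x = y"
  shows "\<exists>\<rho>. ipath \<rho> \<and> set \<rho> \<subseteq> (\<Union>a\<le>N. X a) \<and> (\<forall>a\<le>N. set \<rho> \<inter> X a \<noteq> {}) \<and>
    (\<forall>a b p p'. a + 2 \<le> b \<longrightarrow> b \<le> N \<longrightarrow> p < length \<rho> \<longrightarrow> p' < length \<rho> \<longrightarrow> \<rho> ! p \<in> X a \<longrightarrow> \<rho> ! p' \<in> X b \<longrightarrow> Suc p < p')"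
proof -
  let ?S = "\<Union>a\<le>N. X a"
  have S: "conn ?S" "?S \<subseteq> V" using conn_chain[of N X] X near by auto
  have "?S \<inter> X 0 \<noteq> {}" "?S \<inter> X N \<noteq> {}" using conn_nonempty[OF X(1)[of 0]] conn_nonempty[OF X(1)[of N]] by auto
  from exists_ipath[OF S this] have "\<exists>\<rho>. ipath \<rho> \<and> set \<rho> \<subseteq> ?S \<and> hd \<rho> \<in> X 0 \<and> last \<rho> \<in> X N" by metis
  then obtain \<rho> where \<rho>: "ipath \<rho>" "set \<rho> \<subseteq> ?S" "hd \<rho> \<in> X 0" "last \<rho> \<in> X N" by (elim exE conjE)
  have ne: "\<rho> \<noteq> []" using ipathD(1)[OF \<rho>(1)] .
  have disj': "X a \<inter> X b = {}" if "a < b" "b \<le> N" for a b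
    
  proof (cases "Suc a = b")
    case True
    then show ?thesis using disj[of a] that by simp
  next
    case False
    then show ?thesis using far[of a b] not_touch_disjoint that by simp
  qed
  have meet: "set \<rho> \<inter> X a \<noteq> {}" if "a \<le> N" for a
  proof
    assume no: "set \<rho> \<inter> X a = {}"
    have no': "v \<notin> X a" if "v \<in> set \<rho>" for v using no that by blast
    have "a \<noteq> 0" using no'[OF hd_in_set[OF ne]] \<rho>(3) by metis
    have "a \<noteq> N" using no'[OF last_in_set[OF ne]] \<rho>(4) by metis
    have "set \<rho> \<subseteq> (\<Union>b<a. X b)"
    proof (rule conn_subset_closed[OF conn_ipath[OF \<rho>(1)]])
      have "hd \<rho> \<in> (\<Union>b<a. X b)" using \<rho>(3) \<open>a \<noteq> 0\<close> by (intro UN_I[of 0]) simp_all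
      then show "set \<rho> \<inter> (\<Union>b<a. X b) \<noteq> {}" using hd_in_set[OF ne] by blast
      fix x y assume xy: "x \<in> set \<rho>" "x \<in> (\<Union>b<a. X b)" "y \<in> set \<rho>" "E x y"
      then obtain b where b: "b < a" "x \<in> X b" by blast
      have "y \<in> (\<Union>a\<le>N. X a)" using xy(3) \<rho>(2) by (rule subsetD[rotated])
      then obtain d where d: "d \<le> N" "y \<in> X d" by blast
      have "d \<noteq> a" using no'[OF xy(3)] d(2) by metis
      have "touch (X b) (X d)" using b(2) d(2) xy(4) unfolding touch_def by (intro bexI disjI2)
      then have "\<not> Suc b < d" using far[of b d] d(1) by linarith
      then have "d < a" using b(1) \<open>d \<noteq> a\<close> by linarith
      then show "y \<in> (\<Union>b<a. X b)" using d(2) by blast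
    qed
    then have "last \<rho> \<in> (\<Union>b<a. X b)" using last_in_set[OF ne] by (rule subsetD)
    then obtain b where b: "b < a" "last \<rho> \<in> X b" by (elim UN_E) simp
    then have "X b \<inter> X N = {}" using disj'[of b N] \<open>a \<le> N\<close> by simp
    then show False using b(2) \<rho>(4) by (metis IntI empty_iff)
  qed
  \<comment> \<open>Otherwise the path leaves the sets up to \<open>X c\<close> before position
    \<open>p\<close> and returns to them, and both crossings use the gate of \<open>X c\<close>, at
    two different positions.\<close>
  have init: "\<exists>b\<le>c. \<rho> ! q \<in> X b"
    if c: "odd c" "c < N" and p: "p < length \<rho>" "\<exists>b\<le>c. \<rho> ! p \<in> X b" and q: "q \<le> p" for c p q
  proof (rule ccontr)
    define L where "L = (\<Union>b\<le>c. X b)"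
    assume "\<not> ?thesis"
    then have qL: "\<rho> ! q \<notin> L" by (auto simp: L_def)
    have pL: "\<rho> ! p \<in> L" using p(2) by (auto simp: L_def)
    have "\<rho> ! 0 \<in> X 0" using \<rho>(3) ne by (simp add: hd_conv_nth)
    then have 0: "\<rho> ! 0 \<in> L" unfolding L_def by (intro UN_I[of 0]) simp_all
    have cross: "\<rho> ! i \<in> X c \<and> touch {\<rho> ! i} (X (Suc c))"
      if i: "i < length \<rho>" "j < length \<rho>" "\<rho> ! i \<in> L" "\<rho> ! j \<notin> L" "j = Suc i \<or> i = Suc j" for i j
    proof -
      have e: "E (\<rho> ! i) (\<rho> ! j)" using ipathD(4)[OF \<rho>(1) i(1,2)] i(5) by blast
      obtain a where a: "a \<le> c" "\<rho> ! i \<in> X a" using i(3) unfolding L_def by (elim UN_E) simp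
      have "\<rho> ! j \<in> (\<Union>a\<le>N. X a)" using \<rho>(2) nth_mem[OF i(2)] by (rule subsetD)
      then obtain b where b: "b \<le> N" "\<rho> ! j \<in> X b" by (elim UN_E) simp
      have "c < b" using i(4) b(2) unfolding L_def by (meson UN_I atMost_iff not_le)
      moreover have "touch (X a) (X b)" using a(2) b(2) e unfolding touch_def by (intro bexI disjI2)
      then have "\<not> Suc a < b" using far[of a b] b(1) by linarith
      ultimately have ac: "a = c" "b = Suc c" using a(1) by linarith+
      have "touch {\<rho> ! i} (X b)" using b(2) e unfolding touch_def by (intro bexI disjI2) simp_all
      then show ?thesis using a ac by simp
    qed
    define u where "u = (LEAST m. \<rho> ! m \<notin> L)"
    have u: "\<rho> ! u \<notin> L" "u \<le> q" "\<And>m. m < u ==> \<rho> ! m \<in> L"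
      unfolding u_def by (rule LeastI[of "\<lambda>m. \<rho> ! m \<notin> L", OF qL], rule Least_le[of "\<lambda>m. \<rho> ! m \<notin> L", OF qL])
        (drule not_less_Least, simp)
    have "u \<noteq> 0" using u(1) 0 by (intro notI) simp
    then obtain u' where u': "u = Suc u'" by (cases u) auto
    define v where "v = (LEAST m. q \<le> m \<and> \<rho> ! m \<in> L)"
    have v: "q \<le> v" "\<rho> ! v \<in> L" "v \<le> p" "\<And>m. m < v ==> q \<le> m ==> \<rho> ! m \<notin> L"
      using LeastI[of "\<lambda>m. q \<le> m \<and> \<rho> ! m \<in> L", OF conjI[OF q pL], folded v_def]
        Least_le[of "\<lambda>m. q \<le> m \<and> \<rho> ! m \<in> L", OF conjI[OF q pL], folded v_def]
        not_less_Least[of _ "\<lambda>m. q \<le> m \<and> \<rho> ! m \<in> L", folded v_def] by meson+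
    have "v \<noteq> q" using v(2) qL by (intro notI) simp
    then obtain v' where v': "v = Suc v'" "q \<le> v'" using v(1) by (cases v) auto
    have len: "u' < length \<rho>" "u < length \<rho>" "v < length \<rho>" "v' < length \<rho>" using u' u(2) v(3) v' p(1) q by linarith+
    have "\<rho> ! u' \<in> X c \<and> touch {\<rho> ! u'} (X (Suc c))"
      by (rule cross[OF len(1,2) _ u(1)]) (use u(3)[of u'] u' in simp_all)
    moreover have "\<rho> ! v \<in> X c \<and> touch {\<rho> ! v} (X (Suc c))"
      by (rule cross[OF len(3,4) v(2)]) (use v(4)[of v'] v' in simp_all)
    ultimately have "\<rho> ! u' = \<rho> ! v" using cut[OF c, of "\<rho> ! u'" "\<rho> ! v"] by blast
    then have "u' = v" using nth_eq_iff_index_eq[OF ipathD(2)[OF \<rho>(1)] len(1,3)] by blast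
    then show False using u(2) u' v(1) by linarith
  qed
  have order: "Suc p < p'" if ab: "a + 2 \<le> b" "b \<le> N" and p: "p < length \<rho>" "p' < length \<rho>" "\<rho> ! p \<in> X a" "\<rho> ! p' \<in> X b"
    for a b p p'
  proof -
    define c where "c = (if odd a then a else Suc a)"
    have c: "odd c" "a \<le> c" "c \<le> Suc a" by (simp_all add: c_def)
    have cN: "c < N" "c < b" using c ab by linarith+
    have "p < p'"
    proof (rule ccontr)
      assume "\<not> p < p'"
      then have "p' \<le> p" by simp
      have "\<exists>b\<le>c. \<rho> ! p \<in> X b" using p(3) c(2) by (intro exI[of _ a]) simp
      from init[OF c(1) cN(1) p(1) this \<open>p' \<le> p\<close>] obtain d where d: "d \<le> c" "\<rho> ! p' \<in> X d" by (elim exE conjE)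
      have "X d \<inter> X b = {}" by (rule disj'[OF _ ab(2)]) (use d cN in simp)
      then show False using d(2) p(4) by (metis IntI empty_iff)
    qed
    moreover have "p' \<noteq> Suc p"
    proof
      assume "p' = Suc p"
      then have "E (\<rho> ! p) (\<rho> ! p')" using ipathD(4)[OF \<rho>(1) p(1,2)] by simp
      then have "touch (X a) (X b)" using p(3,4) unfolding touch_def by (intro bexI disjI2)
      then show False using far[of a b] ab by simp
    qed
    ultimately show ?thesis by simp
  qed
  show ?thesis using \<rho>(1,2) meet order by (intro exI[of _ \<rho>] conjI allI impI) blast+
qed

end

locale hub_system = fin_graph V E for V :: "'a set" and E +
  fixes G :: "'g set" and h :: "'g => 'a set" and F :: "('g \<times> 'g) set" and Q :: "'g \<times> 'g => 'a list"
  assumes hub: "x \<in> G ==> conn (h x) \<and> h x \<subseteq> V"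
    and hub_anti: "x \<in> G ==> y \<in> G ==> x \<noteq> y ==> \<not> touch (h x) (h y)"
    and F: "(x, y) \<in> F ==> x \<in> G \<and> y \<in> G"
    and Q: "e \<in> F ==> ipath (Q e)"
    and Q_disj: "(x, y) \<in> F ==> z \<in> G ==> set (Q (x, y)) \<inter> h z = {}"
    and Q_far: "(x, y) \<in> F ==> z \<in> G ==> z \<noteq> x ==> z \<noteq> y ==> \<not> touch (set (Q (x, y))) (h z)"
    and Q_ends: "(x, y) \<in> F ==> touch {hd (Q (x, y))} (h x) \<and> touch {last (Q (x, y))} (h y)"
    and Q_last: "(x, y) \<in> F ==> v \<in> set (Q (x, y)) ==> touch {v} (h y) ==> v = last (Q (x, y))"
    and Q_anti: "e \<in> F ==> f \<in> F ==> e \<noteq> f ==> \<not> touch (set (Q e)) (set (Q f))"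
begin

definition line :: "(nat => 'g) => nat => bool" where
  "line l N \<longleftrightarrow> inj_on l {..N} \<and> l ` {..N} \<subseteq> G \<and> (\<forall>i<N. (l i, l (Suc i)) \<in> F)"

text \<open>Along a line of the grid the hubs have even and the connections odd numbers. The hubs
  that a piece belongs to are its \<open>support\<close>; pieces of any two lines touch only if one
  support contains the other.\<close>

definition piece :: "(nat => 'g) => nat => 'a set" where
  "piece l a = (if even a then h (l (a div 2)) else set (Q (l (a div 2), l (Suc (a div 2)))))"

definition support :: "(nat => 'g) => nat => 'g set" where
  "support l a = l ` {a div 2..Suc a div 2}"

lemma piece_cases:
  assumes "line l N" "a \<le> 2 * N"
  obtains (hub) x where "piece l a = h x" "support l a = {x}" "x \<in> G"
  | (link) x y where "piece l a = set (Q (x, y))" "support l a = {x, y}" "(x, y) \<in> F"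
proof (cases "even a")
  case True
  then obtain i where i: "a = 2 * i" by blast
  then show ?thesis using assms hub[of "l i"] by (auto simp: piece_def support_def line_def)
next
  case False
  then obtain i where i: "a = Suc (2 * i)" by (metis oddE Suc_eq_plus1)
  then have "{i..Suc i} = {i, Suc i}" "i < N" using assms(2) by auto
  then show ?thesis using i assms link[of "l i" "l (Suc i)"] by (auto simp: piece_def support_def line_def)
qed

lemma piece_touch_support:
  assumes "line l N" "a \<le> 2 * N" "line l' N'" "b \<le> 2 * N'" "touch (piece l a) (piece l' b)"
  shows "support l a \<subseteq> support l' b \<or> support l' b \<subseteq> support l a"
proof (rule piece_cases[OF assms(1,2)])
  fix x assume a: "piece l a = h x" "support l a = {x}" "x \<in> G"
  show ?thesis
  proof (rule piece_cases[OF assms(3,4)])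
    fix y assume "piece l' b = h y" "support l' b = {y}" "y \<in> G"
    then show ?thesis using a assms(5) hub_anti[of x y] by auto
  next
    fix y z assume b: "piece l' b = set (Q (y, z))" "support l' b = {y, z}" "(y, z) \<in> F"
    then show ?thesis using a assms(5) Q_far[OF b(3), of x] touch_sym[of "h x" "set (Q (y, z))"] by auto
  qed
next
  fix x x' assume a: "piece l a = set (Q (x, x'))" "support l a = {x, x'}" "(x, x') \<in> F"
  show ?thesis
  proof (rule piece_cases[OF assms(3,4)])
    fix y assume "piece l' b = h y" "support l' b = {y}" "y \<in> G"
    then show ?thesis using a assms(5) Q_far[OF a(3), of y] by auto
  next
    fix y z assume b: "piece l' b = set (Q (y, z))" "support l' b = {y, z}" "(y, z) \<in> F"
    then show ?thesis using a assms(5) Q_anti[OF a(3) b(3)] by auto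
  qed
qed

lemma piece_conn:
  assumes "line l N" "a \<le> 2 * N"
  shows "conn (piece l a)" "piece l a \<subseteq> V"
  by (rule piece_cases[OF assms]; use hub Q conn_ipath ipathD(3) in simp)+

lemma piece_near:
  assumes "line l N" "a < 2 * N"
  shows "touch (piece l a) (piece l (Suc a))" "piece l a \<inter> piece l (Suc a) = {}"
proof -
  have "touch (piece l a) (piece l (Suc a)) \<and> piece l a \<inter> piece l (Suc a) = {}"
  proof (cases "even a")
    case True
    then obtain i where i: "a = 2 * i" by blast
    have f: "(l i, l (Suc i)) \<in> F" using assms i by (auto simp: line_def)
    note ne = ipathD(1)[OF Q[OF f]]
    have "touch (h (l i)) (set (Q (l i, l (Suc i))))"
      using touch_mono[OF conjunct1[OF Q_ends[OF f]], of "set (Q (l i, l (Suc i)))" "h (l i)"] hd_in_set[OF ne]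
        touch_sym[of "h (l i)" "set (Q (l i, l (Suc i)))"] by simp
    then show ?thesis using i Q_disj[OF f, of "l i"] F[OF f] by (auto simp: piece_def)
  next
    case False
    then obtain i where i: "a = Suc (2 * i)" by (metis oddE Suc_eq_plus1)
    have f: "(l i, l (Suc i)) \<in> F" using assms i by (auto simp: line_def)
    note ne = ipathD(1)[OF Q[OF f]]
    have "touch (set (Q (l i, l (Suc i)))) (h (l (Suc i)))"
      using touch_mono[OF conjunct2[OF Q_ends[OF f]], of "set (Q (l i, l (Suc i)))" "h (l (Suc i))"] last_in_set[OF ne] by simp
    then show ?thesis using i Q_disj[OF f, of "l (Suc i)"] F[OF f] by (auto simp: piece_def)
  qed
  then show "touch (piece l a) (piece l (Suc a))" "piece l a \<inter> piece l (Suc a) = {}" by blast+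
qed

lemma piece_far:
  assumes "line l N" "Suc a < b" "b \<le> 2 * N"
  shows "\<not> touch (piece l a) (piece l b)"
proof
  assume "touch (piece l a) (piece l b)"
  moreover have aN: "a \<le> 2 * N" using assms by simp
  ultimately have s: "support l a \<subseteq> support l b \<or> support l b \<subseteq> support l a"
    using piece_touch_support[OF assms(1) _ assms(1,3)] by blast
  have inj: "inj_on l {..N}" using assms(1) by (simp add: line_def)
  have mem: "i \<in> I" if "l i \<in> l ` I" "i \<le> N" "I \<subseteq> {..N}" for i I
    using inj_on_image_mem_iff[OF inj _ that(3), of i] that(1,2) by simp
  have sub: "{a div 2..Suc a div 2} \<subseteq> {..N}" "{b div 2..Suc b div 2} \<subseteq> {..N}" using aN assms(3) by auto
  have in_a: "l (a div 2) \<in> support l a" using div_le_mono[of a "Suc a" 2] by (simp add: support_def)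
  have in_b: "l (Suc b div 2) \<in> support l b" using div_le_mono[of b "Suc b" 2] by (simp add: support_def)
  have "a div 2 \<in> {b div 2..Suc b div 2} \<or> Suc b div 2 \<in> {a div 2..Suc a div 2}"
    using s
  proof
    assume "support l a \<subseteq> support l b"
    then have "l (a div 2) \<in> l ` {b div 2..Suc b div 2}" using in_a unfolding support_def by blast
    then show ?thesis using mem[OF _ _ sub(2), of "a div 2"] aN by simp
  next
    assume "support l b \<subseteq> support l a"
    then have "l (Suc b div 2) \<in> l ` {a div 2..Suc a div 2}" using in_b unfolding support_def by blast
    then show ?thesis using mem[OF _ _ sub(1), of "Suc b div 2"] assms(3) by simp
  qed
  then show False using assms(2) by auto
qed

lemma line_path:
  assumes l: "line l N"
  shows "\<exists>\<rho>. ipath \<rho> \<and> set \<rho> \<subseteq> (\<Union>a\<le>2 * N. piece l a) \<and> (\<forall>a\<le>2 * N. set \<rho> \<inter> piece l a \<noteq> {}) \<and>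
    (\<forall>a b p p'. a + 2 \<le> b \<longrightarrow> b \<le> 2 * N \<longrightarrow> p < length \<rho> \<longrightarrow> p' < length \<rho> \<longrightarrow> \<rho> ! p \<in> piece l a \<longrightarrow> \<rho> ! p' \<in> piece l b \<longrightarrow> Suc p < p')"
proof (rule chain_path)
  fix a x y assume a: "odd a" "a < 2 * N" "x \<in> piece l a" "y \<in> piece l a" "touch {x} (piece l (Suc a))" "touch {y} (piece l (Suc a))"
  obtain i where i: "a = Suc (2 * i)" using a(1) by (metis oddE Suc_eq_plus1)
  have f: "(l i, l (Suc i)) \<in> F" using l a(2) i by (auto simp: line_def)
  have "x = last (Q (l i, l (Suc i)))" using Q_last[OF f, of x] a i by (simp add: piece_def)
  moreover have "y = last (Q (l i, l (Suc i)))" using Q_last[OF f, of y] a i by (simp add: piece_def)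
  ultimately show "x = y" by simp
qed (simp_all add: piece_conn[OF l] piece_near[OF l] piece_far[OF l])

lemma line_conn: "line l N ==> conn (\<Union>a\<le>2 * N. piece l a)"
  using conn_chain[of "2 * N" "piece l"] piece_conn(1) piece_near(1) by blast

end

definition grid_edges :: "nat => nat => ((nat \<times> nat) \<times> nat \<times> nat) set" where
  "grid_edges K N = {((r, j), (r, Suc j)) | r j. r \<le> K \<and> j < N} \<union> {((r, j), (Suc r, j)) | r j. r < K \<and> j \<le> N}"

text \<open>Only every second column of the grid is kept. On a row, column \<open>j\<close> touches
  at most the pieces from \<open>4 * j - 1\<close> to \<open>4 * j + 1\<close>, so pieces at
  different columns have numbers at least two apart, as the order in \<open>line_path\<close>
  requires.\<close>

lemma hub_grid_ladder:
  assumes "hub_system V E ({..K} \<times> {..2 * D}) h (grid_edges K (2 * D)) Q"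
  shows "\<exists>\<rho> C. ladder V E (Suc K) D \<rho> C"
proof -
  interpret hub_system V E "{..K} \<times> {..2 * D}" h "grid_edges K (2 * D)" Q by fact
  define row where "row r = (\<lambda>i::nat. (r, i))" for r :: nat
  define col where "col j = (\<lambda>i::nat. (i, 2 * j))" for j :: nat
  have row: "line (row r) (2 * D)" if "r \<le> K" for r
    using that unfolding line_def row_def by (auto simp: inj_on_def grid_edges_def)
  have col: "line (col j) K" if "j < D" for j
    using that unfolding line_def col_def by (auto simp: inj_on_def grid_edges_def)
  have nonempty: "a div 2 \<in> {a div 2..Suc a div 2}" for a :: nat by (simp add: div_le_mono)
  have srow: "fst z = r" if "z \<in> support (row r) a" for z r a using that by (auto simp: support_def row_def)
  have scol: "snd z = 2 * j" if "z \<in> support (col j) a" for z j a using that by (auto simp: support_def col_def)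
  have sne: "\<exists>z. z \<in> support l a" for l :: "nat => nat \<times> nat" and a using nonempty[of a] unfolding support_def by blast
  define good where "good r xs \<longleftrightarrow> ipath xs \<and> set xs \<subseteq> (\<Union>a\<le>2 * (2 * D). piece (row r) a) \<and> (\<forall>a\<le>2 * (2 * D). set xs \<inter> piece (row r) a \<noteq> {}) \<and>
    (\<forall>a b p p'. a + 2 \<le> b \<longrightarrow> b \<le> 2 * (2 * D) \<longrightarrow> p < length xs \<longrightarrow> p' < length xs \<longrightarrow> xs ! p \<in> piece (row r) a \<longrightarrow> xs ! p' \<in> piece (row r) b \<longrightarrow> Suc p < p')" for r xs
  define \<rho> where "\<rho> r = (SOME xs. good r xs)" for r
  have good: "good r (\<rho> r)" if "r \<le> K" for r
    unfolding \<rho>_def by (rule someI_ex) (use line_path[OF row[OF that]] in \<open>simp only: good_def\<close>)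
  have \<rho>: "\<And>r. r \<le> K ==> ipath (\<rho> r)" "\<And>r. r \<le> K ==> set (\<rho> r) \<subseteq> (\<Union>a\<le>2 * (2 * D). piece (row r) a)"
    "\<And>r a. r \<le> K ==> a \<le> 2 * (2 * D) ==> set (\<rho> r) \<inter> piece (row r) a \<noteq> {}"
    "\<And>r a b p p'. r \<le> K ==> a + 2 \<le> b ==> b \<le> 2 * (2 * D) ==> p < length (\<rho> r) ==> p' < length (\<rho> r) ==>
        \<rho> r ! p \<in> piece (row r) a ==> \<rho> r ! p' \<in> piece (row r) b ==> Suc p < p'"
    using good unfolding good_def by (simp, simp, simp, metis)
  define C where "C j = (\<Union>b\<le>2 * K. piece (col j) b)" for j
  have loc: "\<exists>a\<le>2 * (2 * D). a \<le> Suc (4 * j) \<and> 4 * j \<le> Suc a \<and> \<rho> r ! p \<in> piece (row r) a"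
    if r: "r \<le> K" and j: "j < D" and p: "p < length (\<rho> r)" and t: "touch (C j) {\<rho> r ! p}" for r j p
  proof -
    obtain a where a: "a \<le> 2 * (2 * D)" "\<rho> r ! p \<in> piece (row r) a" using \<rho>(2)[OF r] nth_mem[OF p] by blast
    obtain b where b: "b \<le> 2 * K" "touch (piece (col j) b) {\<rho> r ! p}" using t unfolding C_def touch_UN by blast
    have "touch (piece (col j) b) (piece (row r) a)" using touch_mono[OF b(2) subset_refl] a(2) by blast
    then have "support (col j) b \<subseteq> support (row r) a \<or> support (row r) a \<subseteq> support (col j) b"
      by (rule piece_touch_support[OF col[OF j] b(1) row[OF r] a(1)])
    then have "\<exists>z. z \<in> support (row r) a \<and> z \<in> support (col j) b" using sne by blast
    then have "2 * j \<in> {a div 2..Suc a div 2}" using scol unfolding support_def row_def by fastforce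
    then have "a \<le> Suc (4 * j)" "4 * j \<le> Suc a" by auto
    then show ?thesis using a by blast
  qed
  have "ladder V E (Suc K) D \<rho> C"
  proof
    fix r assume "r < Suc K"
    then have r: "r \<le> K" by simp
    show "ipath (\<rho> r)" by (rule \<rho>(1)[OF r])
    show "\<not> touch (set (\<rho> r)) (set (\<rho> r'))" if "r' < Suc K" "r \<noteq> r'" for r'
    proof
      have r': "r' \<le> K" using that(1) by simp
      assume "touch (set (\<rho> r)) (set (\<rho> r'))"
      then have "touch (\<Union>a\<le>2 * (2 * D). piece (row r) a) (\<Union>a\<le>2 * (2 * D). piece (row r') a)"
        by (rule touch_mono[OF _ \<rho>(2)[OF r] \<rho>(2)[OF r']])
      then obtain a b where ab: "a \<le> 2 * (2 * D)" "b \<le> 2 * (2 * D)" "touch (piece (row r) a) (piece (row r') b)"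
        unfolding touch_UN touch_UN2 by blast
      have "\<exists>z. z \<in> support (row r) a \<and> z \<in> support (row r') b"
        using piece_touch_support[OF row[OF r] ab(1) row[OF r'] ab(2,3)] sne by blast
      then show False using srow that(2) by metis
    qed
  next
    fix j assume j: "j < D"
    show "conn (C j) \<and> C j \<subseteq> V" using line_conn[OF col[OF j]] piece_conn(2)[OF col[OF j]] by (auto simp: C_def)
    show "\<not> touch (C j) (C j')" if j': "j' < D" "j \<noteq> j'" for j'
    proof
      assume "touch (C j) (C j')"
      then obtain a b where ab: "a \<le> 2 * K" "b \<le> 2 * K" "touch (piece (col j) a) (piece (col j') b)"
        unfolding C_def touch_UN touch_UN2 by blast
      have "\<exists>z. z \<in> support (col j) a \<and> z \<in> support (col j') b"
        using piece_touch_support[OF col[OF j] ab(1) col[OF j'(1)] ab(2,3)] sne by blast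
      then show False using scol that(2) by (metis nat_mult_eq_cancel_disj zero_neq_numeral)
    qed
    show "touch (C j) (set (\<rho> r))" if "r < Suc K" for r
    proof -
      have r: "r \<le> K" using that by simp
      have "piece (row r) (4 * j) = piece (col j) (2 * r)" by (simp add: piece_def row_def col_def)
      then have "piece (row r) (4 * j) \<subseteq> C j" using r unfolding C_def by (intro UN_upper[of "2 * r", THEN subset_trans[rotated]]) simp_all
      moreover have "set (\<rho> r) \<inter> piece (row r) (4 * j) \<noteq> {}" by (rule \<rho>(3)[OF r]) (use j in simp)
      ultimately show ?thesis by (intro touch_Int) blast
    qed
  next
    fix j j' r p p'
    assume a: "j < j'" "j' < D" "r < Suc K" "p < length (\<rho> r)" "p' < length (\<rho> r)" "touch (C j) {\<rho> r ! p}" "touch (C j') {\<rho> r ! p'}"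
    have r: "r \<le> K" "j < D" using a by simp_all
    obtain x where x: "x \<le> Suc (4 * j)" "\<rho> r ! p \<in> piece (row r) x" using loc[OF r a(4,6)] by blast
    obtain y where y: "y \<le> 2 * (2 * D)" "4 * j' \<le> Suc y" "\<rho> r ! p' \<in> piece (row r) y" using loc[OF r(1) a(2,5,7)] by blast
    have "x + 2 \<le> y" using x y a(1) by linarith
    then show "Suc p < p'" by (rule \<rho>(4)[OF r(1) _ y(1) a(4,5) x(2) y(3)])
  qed
  then show ?thesis by blast
qed

section \<open>Linkages between two hubs that avoid the other hubs\<close>

context fin_graph begin

definition nbrs :: "'a set => 'a set" where
  "nbrs P = {v. touch {v} P}"

text \<open>Separation is measured outside the two hubs and between their neighbourhoods, so that
  Menger's theorem gives connections disjoint from both hubs.\<close>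

definition attached :: "nat => 'i set => ('i => 'a set) => bool" where
  "attached k I P \<longleftrightarrow> (\<forall>i\<in>I. \<forall>j\<in>I. i \<noteq> j \<longrightarrow>
     (\<forall>C\<subseteq>V - P i - P j. sep (V - P i - P j) (nbrs (P i)) (nbrs (P j)) C \<longrightarrow> k \<le> card C))"

lemma ip_conn: "ip S ==> conn S"
  using conn_ipath by (auto simp: ip_def)

lemma ip_subset: "ip S ==> S \<subseteq> V"
  unfolding ip_def by (elim exE conjE) (metis ipathD(3))

text \<open>The other hubs are the columns. If too many of them touched many paths of the linkage,
  \<open>crossing_bound\<close> of these would touch the same set of paths, contrary to
  \<open>linkage_or_ladder\<close>. The \<open>Suc\<close> in the bound keeps the selected set of
  hubs nonempty.\<close>

lemma linkage_few_bad_hubs: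
  assumes nPM: "\<not> PM n" and nL: "\<And>\<rho> Q. \<not> ladder V E K D \<rho> Q"
    and I: "finite I" "\<And>i. i \<in> I ==> ip (P i)" "\<And>i j. i \<in> I ==> j \<in> I ==> i \<noteq> j ==> \<not> touch (P i) (P j)"
    and att: "attached k I P" and ij: "i \<in> I" "j \<in> I" "i \<noteq> j"
  shows "\<exists>R. linkage (V - P i - P j) (nbrs (P i)) (nbrs (P j)) k R \<and>
    card {l \<in> I - {i, j}. (2 * n + (K + n)) choose (2 * n) \<le> card {r. r < k \<and> touch (P l) (set (R r))}}
      \<le> Suc (crossing_bound n D k n) * 2 ^ k"
proof -
  define Y where "Y = V - P i - P j"
  have "\<exists>R. linkage Y (nbrs (P i)) (nbrs (P j)) k R"
    by (rule menger) (use att ij in \<open>auto simp: attached_def Y_def\<close>)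
  then obtain R0 where R0: "linkage Y (nbrs (P i)) (nbrs (P j)) k R0" by blast
  have P_sub: "P l \<subseteq> Y" if l: "l \<in> I - {i, j}" for l
  proof -
    have "P l \<subseteq> V" using I(2)[of l] l ipathD(3) by (auto simp: ip_def)
    moreover have "P l \<inter> P i = {}" by (rule not_touch_disjoint[OF I(3)]) (use l ij in auto)
    moreover have "P l \<inter> P j = {}" by (rule not_touch_disjoint[OF I(3)]) (use l ij in auto)
    ultimately show ?thesis unfolding Y_def by blast
  qed
  have eqY: "Y \<union> (\<Union>l\<in>I - {i, j}. P l) = Y" using P_sub by blast
  then have link0: "linkage (Y \<union> (\<Union>l\<in>I - {i, j}. P l)) (nbrs (P i)) (nbrs (P j)) k R0" using R0 by simp
  have fin: "finite (I - {i, j})" using I(1) by simp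
  obtain R where R: "linkage (Y \<union> (\<Union>l\<in>I - {i, j}. P l)) (nbrs (P i)) (nbrs (P j)) k R"
    and cross: "\<And>T J'. T \<subseteq> {..<k} ==> J' \<subseteq> I - {i, j} ==> (2 * n + (K + n)) choose (2 * n) \<le> card T ==>
      crossing_bound n D k n \<le> card J' ==> \<exists>r\<in>T. \<exists>l\<in>J'. \<not> touch (P l) (set (R r))"
  proof (rule linkage_or_ladder[OF fin_graph_axioms nPM nL fin _ _ link0], goal_cases)
    case (3 R)
    show ?case by (rule that[OF 3(2)]) (rule 3(3))
  qed (use I in simp_all)
  define T where "T l = {r. r < k \<and> touch (P l) (set (R r))}" for l
  define bad where "bad = {l \<in> I - {i, j}. (2 * n + (K + n)) choose (2 * n) \<le> card (T l)}"
  have "card bad \<le> Suc (crossing_bound n D k n) * 2 ^ k"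
  proof (rule ccontr)
    assume "\<not> ?thesis"
    then have c: "Suc (crossing_bound n D k n) * card (Pow {..<k}) \<le> card bad" by (simp add: card_Pow)
    have finbad: "finite bad" using I(1) by (simp add: bad_def)
    obtain y J' where y: "y \<in> Pow {..<k}" "J' \<subseteq> bad" "card J' = Suc (crossing_bound n D k n)" "\<And>l. l \<in> J' ==> T l = y"
      by (rule pigeonhole_fiber_subset[OF finbad _ _ _ c, of T]) (auto simp: T_def)
    have "J' \<noteq> {}" using y(3) by auto
    then obtain l where "l \<in> J'" by blast
    then have "(2 * n + (K + n)) choose (2 * n) \<le> card y" using y(2,4) by (auto simp: bad_def)
    moreover have "J' \<subseteq> I - {i, j}" using y(2) by (auto simp: bad_def)
    ultimately obtain r l where "r \<in> y" "l \<in> J'" "\<not> touch (P l) (set (R r))"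
      using cross[of y J'] y(1,3) by auto
    then show False using y(4)[of l] by (auto simp: T_def)
  qed
  then show ?thesis using R unfolding bad_def T_def Y_def[symmetric] eqY by blast
qed

lemma linkage_avoiding:
  assumes R: "linkage H A B k R" and Z: "finite Z" "\<And>z. z \<in> Z ==> card {r. r < k \<and> touch (P z) (set (R r))} \<le> b"
    and k: "card Z * b + k' \<le> k"
  shows "\<exists>R'. linkage {v \<in> H. \<forall>z\<in>Z. \<not> touch {v} (P z)} A B k' R'"
proof -
  define bad where "bad = (\<Union>z\<in>Z. {r. r < k \<and> touch (P z) (set (R r))})"
  have "card bad \<le> (\<Sum>z\<in>Z. card {r. r < k \<and> touch (P z) (set (R r))})" unfolding bad_def by (rule card_UN_le[OF Z(1)])
  also have "\<dots> \<le> (\<Sum>z\<in>Z. b)" by (rule sum_mono) (rule Z(2))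
  finally have "card bad \<le> card Z * b" by simp
  moreover have badk: "bad \<subseteq> {..<k}" by (auto simp: bad_def)
  ultimately have "k' \<le> card ({..<k} - bad)"
    using k card_Diff_subset[OF finite_subset[OF badk] badk] by simp
  then obtain f where f: "inj_on f {..<k'}" "f ` {..<k'} \<subseteq> {..<k} - bad"
    using card_le_inj[of "{..<k'}" "{..<k} - bad"] by auto
  have fk: "f r < k" "f r \<notin> bad" if "r < k'" for r using f(2) that by auto
  have "linkage {v \<in> H. \<forall>z\<in>Z. \<not> touch {v} (P z)} A B k' (\<lambda>r. R (f r))"
    unfolding linkage_def
  proof (intro conjI allI impI)
    fix r assume r: "r < k'"
    note L = linkageD[OF R]
    show "ipath (R (f r))" "hd (R (f r)) \<in> A" "last (R (f r)) \<in> B" using L fk(1)[OF r] by blast+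
    have "\<not> touch {v} (P z)" if vz: "v \<in> set (R (f r))" "z \<in> Z" for v z
    proof
      assume "touch {v} (P z)"
      then have "touch (set (R (f r))) (P z)" using touch_mono[of "{v}" "P z" "set (R (f r))" "P z"] vz(1) by simp
      then have "f r \<in> bad" using fk(1)[OF r] vz(2) touch_sym[of "P z"] by (auto simp: bad_def)
      then show False using fk(2)[OF r] by simp
    qed
    then show "set (R (f r)) \<subseteq> {v \<in> H. \<forall>z\<in>Z. \<not> touch {v} (P z)}" using L(2)[OF fk(1)[OF r]] by blast
  next
    fix r r' assume r: "r < k'" "r' < k'" "r \<noteq> r'"
    then have "f r \<noteq> f r'" using inj_onD[OF f(1), of r r'] by auto
    then show "set (R (f r)) \<inter> set (R (f r')) = {}" using linkageD(5)[OF R fk(1)[OF r(1)] fk(1)[OF r(2)]] by blast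
  qed
  then show ?thesis by blast
qed

end

lemma finite_grid_edges: "finite (grid_edges K N)"
  by (rule finite_subset[of _ "({..K} \<times> {..N}) \<times> ({..Suc K} \<times> {..Suc N})"]) (auto simp: grid_edges_def)

lemma grid_edges_subset: "(x, y) \<in> grid_edges K N ==> x \<in> {..K} \<times> {..N} \<and> y \<in> {..K} \<times> {..N} \<and> x \<noteq> y"
  by (auto simp: grid_edges_def)

text \<open>For each pair only few further hubs spoil the linkage, so a free set of hubs contains
  none that spoils a linkage between two others. These hubs are placed on a grid; each linkage loses
  at most \<open>K0\<close> paths to every other hub, and one anticomplete connection is chosen for
  each grid edge.\<close>

theorem hubs_ladder:
  "\<exists>M k. \<forall>(V :: 'a set) E (I :: nat set) P. ladder_free V E n (Suc K) D \<and> finite I \<and> M \<le> card I \<and> (\<forall>i\<in>I. fin_graph.ip V E (P i)) \<and>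
     (\<forall>i\<in>I. \<forall>j\<in>I. i \<noteq> j \<longrightarrow> \<not> fin_graph.touch E (P i) (P j)) \<longrightarrow> \<not> fin_graph.attached V E k I P"
proof -
  let ?G = "{..K} \<times> {..2 * D}" and ?F = "grid_edges K (2 * D)"
  define m where "m = Suc K * Suc (2 * D)"
  define K0 where "K0 = (2 * n + (Suc K + n)) choose (2 * n)"
  have cG: "card ?G = m" by (simp add: m_def)
  from anti_bridges_exist[of n "Suc K" D "card ?F", where 'e = "(nat \<times> nat) \<times> (nat \<times> nat)"]
  obtain k1 where k1: "\<forall>(V::'a set) E (F::((nat \<times> nat) \<times> (nat \<times> nat)) set) W A B. ladder_free V E n (Suc K) D \<and> linked_family V E F W A B (card ?F) k1 \<longrightarrow>
    (\<exists>Q. (\<forall>e\<in>F. fin_graph.bridge V E (W e) (A e) (B e) (Q e)) \<and>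
      (\<forall>e\<in>F. \<forall>f\<in>F. e \<noteq> f \<longrightarrow> \<not> fin_graph.touch E (set (Q e)) (set (Q f))))" by (elim exE)
  \<comment> \<open>At most \<open>K0\<close> paths are dropped for each of the other grid hubs, and
    \<open>k1\<close> paths must remain.\<close>
  define k where "k = m * K0 + k1"
  from free_subset[of 2 "Suc (crossing_bound n D k n) * 2 ^ k" m, where 'b = nat]
  obtain M where M: "\<forall>(I :: nat set) f. finite I \<and> M \<le> card I \<and>
     (\<forall>D'\<subseteq>I. card D' = 2 \<longrightarrow> finite (f D') \<and> card (f D') \<le> Suc (crossing_bound n D k n) * 2 ^ k) \<longrightarrow>
     (\<exists>J\<subseteq>I. card J = m \<and> (\<forall>D'\<subseteq>J. card D' = 2 \<longrightarrow> f D' \<inter> J \<subseteq> D'))" by (elim exE)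
  show ?thesis
  proof (rule exI[of _ M], rule exI[of _ k], intro allI impI notI, elim conjE)
    fix V :: "'a set" and E and I :: "nat set" and P
    assume lf: "ladder_free V E n (Suc K) D" and I: "finite I" "M \<le> card I" and ip: "\<forall>i\<in>I. fin_graph.ip V E (P i)"
      and anti: "\<forall>i\<in>I. \<forall>j\<in>I. i \<noteq> j \<longrightarrow> \<not> fin_graph.touch E (P i) (P j)" and att: "fin_graph.attached V E k I P"
    interpret fin_graph V E using lf by (simp add: ladder_free_def)
    have nPM: "\<not> PM n" and nL: "\<forall>\<rho> Q. \<not> ladder V E (Suc K) D \<rho> Q" using lf by (simp_all add: ladder_free_def)
    define goodR where "goodR i j R \<longleftrightarrow> linkage (V - P i - P j) (nbrs (P i)) (nbrs (P j)) k R \<and>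
      card {l \<in> I - {i, j}. K0 \<le> card {r. r < k \<and> touch (P l) (set (R r))}}
        \<le> Suc (crossing_bound n D k n) * 2 ^ k" for i j R
    have ex: "\<exists>R. goodR i j R" if "i \<in> I" "j \<in> I" "i \<noteq> j" for i j
      unfolding goodR_def K0_def
      by (rule linkage_few_bad_hubs[OF nPM _ I(1) _ _ att that]) (use nL ip anti in auto)
    define R where "R i j = (SOME R. goodR i j R)" for i j
    have R: "goodR i j (R i j)" if "i \<in> I" "j \<in> I" "i \<noteq> j" for i j
      unfolding R_def by (rule someI_ex[OF ex[OF that]])
    \<comment> \<open>A set of two hubs is read as an ordered pair by \<open>Min\<close> and
      \<open>Max\<close>. The numbering of the grid below increases along every edge, so this agrees
      with the direction of the edges.\<close>
    define bad where "bad D' = {l \<in> I - D'. K0 \<le> card {r. r < k \<and> touch (P l) (set (R (Min D') (Max D') r))}}" for D'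
    have pair: "Min {i, j} = i" "Max {i, j} = j" if "i < j" for i j :: nat using that by auto
    have "finite (bad D') \<and> card (bad D') \<le> Suc (crossing_bound n D k n) * 2 ^ k" if D': "D' \<subseteq> I" "card D' = 2" for D'
    proof -
      obtain i j where ij: "D' = {i, j}" "i < j" using D'(2) by (metis card_2_iff insert_commute linorder_neqE_nat)
      then have "goodR i j (R i j)" using R[of i j] D'(1) by simp
      then show ?thesis using I(1) by (simp add: bad_def goodR_def ij(1) pair[OF ij(2)])
    qed
    then obtain J where J: "J \<subseteq> I" "card J = m" "\<forall>D'\<subseteq>J. card D' = 2 \<longrightarrow> bad D' \<inter> J \<subseteq> D'"
      using M[rule_format, of I bad] I by blast
    have "m > 0" by (simp add: m_def)
    then have "m > 0 \<or> finite J" by simp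
    then obtain a where a: "\<And>i. i < m ==> a i \<in> J" "\<And>i j. i < j ==> j < m ==> a i < a j"
      by (rule strict_enumeration[OF J(2)]) blast
    define idx where "idx z = fst z * Suc (2 * D) + snd z" for z
    have idx_m: "idx z < m" if "z \<in> ?G" for z
    proof -
      have "fst z * Suc (2 * D) \<le> K * Suc (2 * D)" using that by (intro mult_le_mono1) auto
      then show ?thesis using that by (auto simp: idx_def m_def)
    qed
    have idx_inj: "z = z'" if zz: "z \<in> ?G" "z' \<in> ?G" "idx z = idx z'" for z z'
    proof -
      have "fst y = idx y div Suc (2 * D) \<and> snd y = idx y mod Suc (2 * D)" if "y \<in> ?G" for y
      proof -
        have "snd y < Suc (2 * D)" using that by auto
        then show ?thesis unfolding idx_def by (simp del: mult_Suc_right mult_Suc)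
      qed
      then show ?thesis using zz by (metis prod_eqI)
    qed
    define c where "c z = a (idx z)" for z
    have cJ: "c z \<in> J" if "z \<in> ?G" for z using a(1)[OF idx_m[OF that]] by (simp add: c_def)
    have cI: "c z \<in> I" if "z \<in> ?G" for z using cJ[OF that] J(1) by blast
    have c_neq: "c z \<noteq> c z'" if "z \<in> ?G" "z' \<in> ?G" "z \<noteq> z'" for z z'
      using a(2)[of "idx z" "idx z'"] a(2)[of "idx z'" "idx z"] idx_m[OF that(1)] idx_m[OF that(2)] idx_inj[OF that(1,2)] that(3)
      unfolding c_def by (metis less_irrefl linorder_neqE_nat)
    have c_less: "c x < c y" if xy: "(x, y) \<in> ?F" for x y
    proof -
      have "idx x < idx y" using xy by (auto simp: grid_edges_def idx_def)
      then show ?thesis using a(2)[OF _ idx_m] grid_edges_subset[OF xy] by (simp add: c_def)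
    qed
    define h where "h z = P (c z)" for z
    have h_anti: "\<not> touch (h z) (h z')" if "z \<in> ?G" "z' \<in> ?G" "z \<noteq> z'" for z z'
      using anti cI[OF that(1)] cI[OF that(2)] c_neq[OF that] by (simp add: h_def)
    have h_ip: "ip (h z)" if "z \<in> ?G" for z using ip cI[OF that] by (simp add: h_def)
    define W where "W e = {v \<in> V. \<forall>z\<in>?G. v \<notin> h z \<and> (touch {v} (h z) \<longrightarrow> z = fst e \<or> z = snd e)}" for e
    define A where "A e = nbrs (h (fst e))" for e :: "(nat \<times> nat) \<times> (nat \<times> nat)"
    define B where "B e = nbrs (h (snd e))" for e :: "(nat \<times> nat) \<times> (nat \<times> nat)"
    have W: "W e - A e - B e \<subseteq> W f" for e f
    proof
      fix v assume v: "v \<in> W e - A e - B e"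
      have "v \<notin> h z \<and> \<not> touch {v} (h z)" if z: "z \<in> ?G" for z
      proof -
        have "v \<notin> h z" "touch {v} (h z) ==> z = fst e \<or> z = snd e" using v z unfolding W_def by blast+
        moreover have "\<not> touch {v} (h (fst e))" "\<not> touch {v} (h (snd e))" using v unfolding A_def B_def nbrs_def by blast+
        ultimately show ?thesis by metis
      qed
      then show "v \<in> W f" using v unfolding W_def by blast
    qed
    have L: "\<exists>R. linkage (W e) (A e) (B e) k1 R" if e: "e \<in> ?F" for e
    proof -
      obtain x y where xy: "e = (x, y)" by (cases e)
      note xyF = e[unfolded xy]
      have xG: "x \<in> ?G" and yG: "y \<in> ?G" and xy': "x \<noteq> y" using grid_edges_subset[OF xyF] by blast+
      have good: "goodR (c x) (c y) (R (c x) (c y))" by (rule R[OF cI[OF xG] cI[OF yG] c_neq[OF xG yG xy']])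
      have link: "linkage (V - h x - h y) (nbrs (h x)) (nbrs (h y)) k (R (c x) (c y))"
        using good by (simp add: goodR_def h_def)
      define Z where "Z = ?G - {x, y}"
      have cZ: "card Z \<le> m" unfolding Z_def cG[symmetric] by (rule card_mono) auto
      have few: "card {r. r < k \<and> touch (h z) (set (R (c x) (c y) r))} \<le> K0" if z: "z \<in> Z" for z
      proof -
        have zG: "z \<in> ?G" "z \<noteq> x" "z \<noteq> y" using z by (auto simp: Z_def)
        have zne: "c z \<notin> {c x, c y}" using c_neq[OF zG(1) xG zG(2)] c_neq[OF zG(1) yG zG(3)] by simp
        have "card {c x, c y} = 2" using c_neq[OF xG yG xy'] by simp
        moreover have "{c x, c y} \<subseteq> J" using cJ xG yG by simp
        ultimately have "bad {c x, c y} \<inter> J \<subseteq> {c x, c y}" using J(3) by blast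
        then have "c z \<notin> bad {c x, c y}" using cJ[OF zG(1)] zne by blast
        then show ?thesis using cI[OF zG(1)] zne unfolding bad_def pair[OF c_less[OF xyF]] h_def by auto
      qed
      have "card Z * K0 + k1 \<le> k" using mult_le_mono1[OF cZ, of K0] by (simp add: k_def)
      from linkage_avoiding[OF link _ few this] have "\<exists>R'. linkage {v \<in> V - h x - h y. \<forall>z\<in>Z. \<not> touch {v} (h z)} (nbrs (h x)) (nbrs (h y)) k1 R'"
        by (simp add: Z_def)
      then obtain R' where R': "linkage {v \<in> V - h x - h y. \<forall>z\<in>Z. \<not> touch {v} (h z)} (nbrs (h x)) (nbrs (h y)) k1 R'"
        by (elim exE)
      have "{v \<in> V - h x - h y. \<forall>z\<in>Z. \<not> touch {v} (h z)} \<subseteq> W e"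
      proof
        fix v assume v: "v \<in> {v \<in> V - h x - h y. \<forall>z\<in>Z. \<not> touch {v} (h z)}"
        have "v \<notin> h z \<and> (touch {v} (h z) \<longrightarrow> z = x \<or> z = y)" if "z \<in> ?G" for z
        proof (cases "z \<in> Z")
          case True
          then have "\<not> touch {v} (h z)" using v by blast
          then show ?thesis using touch_Int[of "{v}" "h z"] by blast
        next
          case False
          then have "z = x \<or> z = y" using that by (simp add: Z_def)
          then show ?thesis using v by blast
        qed
        then show "v \<in> W e" using v by (simp add: W_def xy)
      qed
      from linkage_mono[OF R' this] have "linkage (W e) (A e) (B e) k1 R'" by (simp add: A_def B_def xy)
      then show ?thesis by blast
    qed
    have "linked_family V E ?F W A B (card ?F) k1" unfolding linked_family_def by (intro conjI ballI finite_grid_edges refl W L)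
    from k1[rule_format, OF conjI[OF lf this]] obtain Q where QQ: "(\<forall>e\<in>?F. bridge (W e) (A e) (B e) (Q e)) \<and>
      (\<forall>e\<in>?F. \<forall>f\<in>?F. e \<noteq> f \<longrightarrow> \<not> touch (set (Q e)) (set (Q f)))" by (elim exE)
    note Q = bspec[OF conjunct1[OF QQ]] conjunct2[OF QQ, rule_format]
    have "hub_system V E ?G h ?F Q"
    proof
      show "conn (h x) \<and> h x \<subseteq> V" if "x \<in> ?G" for x
        using ip_conn[OF h_ip[OF that]] ip_subset[OF h_ip[OF that]] by (rule conjI)
      show "\<not> touch (h x) (h y)" if "x \<in> ?G" "y \<in> ?G" "x \<noteq> y" for x y using h_anti[OF that] .
      show "ipath (Q e)" if "e \<in> ?F" for e using Q(1)[OF that] by (simp add: bridge_def)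
      show "\<not> touch (set (Q e)) (set (Q f))" if "e \<in> ?F" "f \<in> ?F" "e \<noteq> f" for e f using Q(2)[OF that] .
    next
      fix x y assume xy: "(x, y) \<in> ?F"
      note b = Q(1)[OF xy]
      have sW: "set (Q (x, y)) \<subseteq> W (x, y)" using b by (simp add: bridge_def)
      show "x \<in> ?G \<and> y \<in> ?G" using grid_edges_subset[OF xy] by blast
      show "touch {hd (Q (x, y))} (h x) \<and> touch {last (Q (x, y))} (h y)"
        using b by (simp add: bridge_def A_def B_def nbrs_def)
      show "set (Q (x, y)) \<inter> h z = {}" if "z \<in> ?G" for z using sW that by (auto simp: W_def)
      show "\<not> touch (set (Q (x, y))) (h z)" if z: "z \<in> ?G" "z \<noteq> x" "z \<noteq> y" for z
      proof
        assume "touch (set (Q (x, y))) (h z)"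
        then obtain v where v: "v \<in> set (Q (x, y))" "touch {v} (h z)"
          unfolding touch_iff_singleton[of "set (Q (x, y))"] by blast
        then have "v \<in> W (x, y)" using sW by blast
        then show False using v(2) z by (auto simp: W_def)
      qed
      show "v = last (Q (x, y))" if v: "v \<in> set (Q (x, y))" "touch {v} (h y)" for v
      proof -
        obtain i where i: "i < length (Q (x, y))" "v = Q (x, y) ! i" using v(1) by (auto simp: in_set_conv_nth)
        have "v \<in> B (x, y)" using v(2) by (simp add: B_def nbrs_def)
        then have "i = length (Q (x, y)) - 1" using b i by (simp add: bridge_def)
        moreover have "Q (x, y) \<noteq> []" using i(1) by auto
        ultimately show ?thesis using i(2) by (simp add: last_conv_nth)
      qed
    qed
    from hub_grid_ladder[OF this] show False using nL by blast
  qed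
qed

section \<open>Hubs in graphs without balanced separators\<close>

lemma (in fin_graph) ipath_snoc:
  assumes xs: "ipath xs" and b: "b \<in> V" "b \<notin> set xs" "\<And>i. i < length xs ==> E (xs ! i) b \<longleftrightarrow> i = length xs - 1"
  shows "ipath (xs @ [b])"
  unfolding ipath_def
proof (intro conjI allI impI)
  fix i j assume ij: "i < length (xs @ [b])" "j < length (xs @ [b])"
  show "E ((xs @ [b]) ! i) ((xs @ [b]) ! j) \<longleftrightarrow> j = Suc i \<or> i = Suc j"
    using ij ipathD(4)[OF xs, of i j] b(3)[of i] b(3)[of j] E_sym E_irrefl[of b] ipathD(1)[OF xs]
    by (cases "i < length xs"; cases "j < length xs") (auto simp: nth_append less_Suc_eq)
qed (use ipathD[OF xs] b in auto)

locale big_sides = fin_graph V E for V :: "'a set" and E +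
  fixes X :: "'a set" and \<theta> :: nat
  assumes finX: "finite X"
    and side: "S \<subseteq> V ==> card S < \<theta> ==> \<exists>D. conn D \<and> D \<subseteq> V - S \<and> card X < 2 * card (D \<inter> X)"
begin

definition big :: "'a set => bool" where
  "big D \<longleftrightarrow> conn D \<and> D \<subseteq> V \<and> card X < 2 * card (D \<inter> X)"

text \<open>The component outside \<open>U\<close> with more than half of \<open>X\<close>, or the
  empty set if there is none. It is written as a union because big sets pairwise meet, which makes
  the union connected without any choice.\<close>

definition BC :: "'a set => 'a set" where
  "BC U = \<Union>{D. big D \<and> D \<inter> U = {}}"

lemma big_Int:
  assumes "big D" "big D'"
  shows "D \<inter> D' \<noteq> {}"
proof
  assume "D \<inter> D' = {}"
  then have "card (D \<inter> X) + card (D' \<inter> X) = card ((D \<inter> X) \<union> (D' \<inter> X))"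
    using finX by (subst card_Un_disjoint) auto
  also have "\<dots> \<le> card X" by (rule card_mono[OF finX]) auto
  finally show False using assms by (simp add: big_def)
qed

lemma BC_upper: "big D ==> D \<inter> U = {} ==> D \<subseteq> BC U"
  by (auto simp: BC_def)

lemma BC_disjoint: "BC U \<inter> U = {}"
  by (auto simp: BC_def)

lemma BC_V: "BC U \<subseteq> V"
  by (auto simp: BC_def big_def)

lemma BC_mono: "U \<subseteq> U' ==> BC U' \<subseteq> BC U"
  unfolding BC_def by blast

lemma BC_big:
  assumes D: "big D" "D \<inter> U = {}"
  shows "big (BC U)"
proof -
  have "conn (\<Union>D\<in>{D. big D \<and> D \<inter> U = {}}. D)"
  proof (rule conn_UN)
    show "{D. big D \<and> D \<inter> U = {}} \<noteq> {}" using D by blast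
    show "conn D" if "D \<in> {D. big D \<and> D \<inter> U = {}}" for D using that by (simp add: big_def)
    show "touch D D'" if "D \<in> {D. big D \<and> D \<inter> U = {}}" "D' \<in> {D. big D \<and> D \<inter> U = {}}" for D D'
      by (rule touch_Int, rule big_Int) (use that in auto)
  qed
  then have "conn (BC U)" by (simp add: BC_def)
  moreover have "card (D \<inter> X) \<le> card (BC U \<inter> X)"
    using BC_upper[OF D] finX by (intro card_mono) auto
  ultimately show ?thesis using D(1) BC_V by (simp add: big_def)
qed

lemma BC_big_small:
  assumes "S \<subseteq> V" "card S < \<theta>"
  shows "big (BC S)"
proof -
  obtain D where "conn D" "D \<subseteq> V - S" "card X < 2 * card (D \<inter> X)" using side[OF assms] by blast
  then have "big D" "D \<inter> S = {}" unfolding big_def by auto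
  then show ?thesis by (rule BC_big)
qed

text \<open>Robust attachment of \<open>A\<close> to the big side. For two hubs with this property a
  small set of vertices cannot separate them, as both still touch one connected set.\<close>

definition holds :: "nat => 'a set => 'a set => bool" where
  "holds k Z A \<longleftrightarrow> (\<forall>S\<subseteq>V. card S < k \<longrightarrow> touch (BC (Z \<union> S)) A)"

text \<open>
  The path grows, as in the proof of Gyarfas that graphs without long induced paths are chi-bounded, into the big
  side left by the neighbourhood of its part so far, until that neighbourhood can no longer be cut off cheaply.
\<close>
lemma hub_exists:
  assumes Z: "Z \<subseteq> V" "card Z + k \<le> \<theta>" and k: "0 < k"
  shows "\<exists>xs S. ipath xs \<and> set xs \<subseteq> BC Z \<and> holds k Z (set xs) \<and> S \<subseteq> V \<and> card S < k \<and> \<not> touch (BC (Z \<union> S)) (set (butlast xs))"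
proof -
  \<comment> \<open>Of the whole path, only the last vertex may be adjacent to the current big side,
    so an extension into this side stays induced.\<close>
  define inv where "inv xs \<longleftrightarrow> ipath xs \<and> set xs \<subseteq> BC Z \<and> \<not> holds k Z (set (butlast xs)) \<and>
    conn (insert (last xs) (BC (Z \<union> nbrs (set (butlast xs)))))" for xs
  have avoid: "\<exists>D. big D \<and> D \<inter> (Z \<union> nbrs A) = {}" if nh: "\<not> holds k Z A" for A
  proof -
    obtain S where S: "S \<subseteq> V" "card S < k" "\<not> touch (BC (Z \<union> S)) A" using nh unfolding holds_def by blast
    have "card (Z \<union> S) < \<theta>" using card_Un_le[of Z S] S(2) Z(2) by linarith
    then have b: "big (BC (Z \<union> S))" using BC_big_small[of "Z \<union> S"] S(1) Z(1) by simp
    have "v \<notin> nbrs A" if v: "v \<in> BC (Z \<union> S)" for v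
    proof
      assume "v \<in> nbrs A"
      then have "touch {v} A" by (simp add: nbrs_def)
      then have "touch (BC (Z \<union> S)) A" using touch_mono[of "{v}" A "BC (Z \<union> S)" A] v by simp
      then show False using S(3) by simp
    qed
    moreover have "BC (Z \<union> S) \<inter> (Z \<union> S) = {}" by (rule BC_disjoint)
    ultimately have "BC (Z \<union> S) \<inter> (Z \<union> nbrs A) = {}" by blast
    then show ?thesis using b by blast
  qed
  have bigZ: "big (BC Z)" using BC_big_small[OF Z(1)] Z(2) k by simp
  then obtain v where v: "v \<in> BC Z" using conn_nonempty by (auto simp: big_def)
  have "inv [v]"
  proof -
    have "nbrs {} = {}" by (simp add: nbrs_def)
    moreover have "\<not> holds k Z {}" using k by (auto simp: holds_def intro!: exI[of _ "{}"])
    moreover have "insert v (BC Z) = BC Z" using v by blast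
    moreover have "ipath [v]" using v BC_V by (intro ipath_singleton) blast
    ultimately show ?thesis using v bigZ by (simp add: inv_def big_def)
  qed
  moreover have "length xs < Suc (card V)" if "inv xs" for xs
  proof -
    have "ipath xs" using that by (simp add: inv_def)
    then show ?thesis using distinct_card[OF ipathD(2)] card_mono[OF finite_V ipathD(3)] by (metis less_Suc_eq_le)
  qed
  \<comment> \<open>Such paths have bounded length in a finite graph. A longest one satisfies
    \<open>holds\<close>, since otherwise it could be extended.\<close>
  ultimately have "\<exists>xs. inv xs \<and> (\<forall>ys. inv ys \<longrightarrow> length ys \<le> length xs)"
    by (intro ex_has_greatest_nat[of inv "[v]" length "Suc (card V)"]) simp_all
  then obtain xs where xs: "inv xs" and max: "\<And>ys. inv ys ==> length ys \<le> length xs" by (elim exE conjE) simp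
  have ip: "ipath xs" and xsZ: "set xs \<subseteq> BC Z" and nh: "\<not> holds k Z (set (butlast xs))"
    using xs by (simp_all add: inv_def)
  note ne = ipathD(1)[OF ip]
  define C where "C = BC (Z \<union> nbrs (set (butlast xs)))"
  have C: "conn (insert (last xs) C)" using xs by (simp add: inv_def C_def)
  have "holds k Z (set xs)"
  proof (rule ccontr)
    assume nh': "\<not> holds k Z (set xs)"
    define C' where "C' = BC (Z \<union> nbrs (set xs))"
    have "set (butlast xs) \<subseteq> set xs" by (meson in_set_butlastD subsetI)
    then have "nbrs (set (butlast xs)) \<subseteq> nbrs (set xs)" using touch_mono[OF _ subset_refl] unfolding nbrs_def by blast
    then have C'C: "C' \<subseteq> C" unfolding C_def C'_def by (intro BC_mono) blast
    have bigC': "big C'" using avoid[OF nh'] BC_big unfolding C'_def by blast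
    have C'_off: "\<not> touch {v} (set xs)" if "v \<in> C'" for v
      using BC_disjoint[of "Z \<union> nbrs (set xs)"] that unfolding C'_def nbrs_def by blast
    have last_off: "last xs \<notin> C'" using C'_off[of "last xs"] last_in_set[OF ne] touch_Int[of "{last xs}" "set xs"] by blast
    have "C' \<noteq> {}" using bigC' conn_nonempty by (simp add: big_def)
    \<comment> \<open>The extension \<open>b\<close> is a neighbour of the new big side
      \<open>C'\<close> inside the old one. It touches the path, as otherwise it would belong to
      \<open>C'\<close>, and it does so only at the last vertex, as all of \<open>C\<close> is away
      from the earlier ones.\<close>
    then obtain a b where ab: "a \<in> C'" "b \<in> insert (last xs) C - C'" "E a b"
      using C C'C last_off unfolding conn_def by (metis insertI1 insertI2 subset_iff)
    have "b \<noteq> last xs"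
    proof
      assume "b = last xs"
      then have "touch {a} (set xs)" using ab(3) last_in_set[OF ne] unfolding touch_def by blast
      then show False using C'_off[OF ab(1)] by simp
    qed
    then have bC: "b \<in> C" "b \<notin> C'" using ab(2) by simp_all
    have bZ: "b \<notin> Z" "\<not> touch {b} (set (butlast xs))"
      using bC(1) BC_disjoint[of "Z \<union> nbrs (set (butlast xs))"] unfolding C_def nbrs_def by blast+
    have bV: "b \<in> V" using bC(1) BC_V by (auto simp: C_def)
    have conn_bC': "conn (insert b C')"
      by (rule conn_insert[OF _ ab(1) E_sym[OF ab(3)]]) (use bigC' in \<open>simp add: big_def\<close>)
    have tb: "touch {b} (set xs)"
    proof (rule ccontr)
      assume no: "\<not> touch {b} (set xs)"
      have "card (C' \<inter> X) \<le> card (insert b C' \<inter> X)" using finX by (intro card_mono) auto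
      then have "big (insert b C')" using conn_bC' bigC' bV by (simp add: big_def)
      moreover have "insert b C' \<inter> (Z \<union> nbrs (set xs)) = {}"
        using no bZ(1) BC_disjoint[of "Z \<union> nbrs (set xs)"] unfolding C'_def nbrs_def by blast
      ultimately have "insert b C' \<subseteq> C'" unfolding C'_def by (rule BC_upper)
      then show False using bC(2) by simp
    qed
    have set_xs: "set xs = insert (last xs) (set (butlast xs))"
      using append_butlast_last_id[OF ne] by (metis list.set(1,2) rotate1.simps(2) set_append set_rotate1)
    have b_last: "E (last xs) b" "b \<notin> set xs"
    proof -
      have "touch {b} {last xs}" using tb bZ(2) unfolding set_xs touch_def by blast
      then show "E (last xs) b" using \<open>b \<noteq> last xs\<close> E_sym by (auto simp: touch_def)
      have "b \<notin> set (butlast xs)" using bZ(2) touch_Int[of "{b}" "set (butlast xs)"] by blast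
      then show "b \<notin> set xs" using \<open>b \<noteq> last xs\<close> unfolding set_xs by simp
    qed
    have "ipath (xs @ [b])"
    proof (rule ipath_snoc[OF ip bV b_last(2)])
      fix i assume i: "i < length xs"
      show "E (xs ! i) b \<longleftrightarrow> i = length xs - 1"
      proof (cases "i = length xs - 1")
        case True
        then show ?thesis using b_last(1) ne by (simp add: last_conv_nth)
      next
        case False
        then have "xs ! i \<in> set (butlast xs)" using i by (metis length_butlast nth_butlast nth_mem linorder_neqE_nat not_less_eq Suc_pred' length_greater_0_conv ne)
        then show ?thesis using False bZ(2) E_sym unfolding touch_def by blast
      qed
    qed
    moreover have "C \<subseteq> BC Z" unfolding C_def by (rule BC_mono) blast
    then have "set (xs @ [b]) \<subseteq> BC Z" using xsZ bC(1) by auto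
    ultimately have "inv (xs @ [b])" using nh' conn_bC' by (simp add: inv_def C'_def)
    from max[OF this] show False by simp
  qed
  moreover obtain S where "S \<subseteq> V" "card S < k" "\<not> touch (BC (Z \<union> S)) (set (butlast xs))"
    using nh unfolding holds_def by blast
  ultimately show ?thesis using ip xsZ by blast
qed

text \<open>The big side left by \<open>Z \<union> C\<close> touches the first hub. It contains the
  big side left by \<open>Z' \<union> C\<close>, and so it touches the second hub too. The interior
  of a shortest path between the hubs through it is the required connected set.\<close>

lemma holds_attached:
  assumes kZ: "holds k Z (P i)" "holds k Z' (P j)" "Z \<subseteq> Z'" "Z' \<subseteq> V" "card Z' + k \<le> \<theta>"
    and ip: "ip (P i)" "ip (P j)" "\<not> touch (P i) (P j)"
    and C: "C \<subseteq> V - P i - P j" "card C < k"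
  shows "\<exists>D. conn D \<and> D \<subseteq> V - P i - P j - C \<and> D \<inter> nbrs (P i) \<noteq> {} \<and> D \<inter> nbrs (P j) \<noteq> {}"
proof -
  have CV: "C \<subseteq> V" using C(1) by blast
  define D0 where "D0 = BC (Z \<union> C)"
  have "card (Z' \<union> C) < \<theta>" using card_Un_le[of Z' C] C(2) kZ(5) by linarith
  then have b': "big (BC (Z' \<union> C))" using BC_big_small[of "Z' \<union> C"] kZ(4) CV by simp
  have sub: "BC (Z' \<union> C) \<subseteq> D0" unfolding D0_def by (rule BC_mono) (use kZ(3) in blast)
  have "BC (Z' \<union> C) \<inter> (Z \<union> C) = {}" using BC_disjoint[of "Z' \<union> C"] kZ(3) by blast
  then have bigD0: "big D0" unfolding D0_def by (rule BC_big[OF b'])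
  have t: "touch D0 (P i)" using kZ(1) CV C(2) unfolding holds_def D0_def by blast
  have "touch (BC (Z' \<union> C)) (P j)" using kZ(2) CV C(2) unfolding holds_def by blast
  then have t': "touch D0 (P j)" by (rule touch_mono) (use sub in auto)
  have "conn D0" using bigD0 by (simp add: big_def)
  note c = conn_Un[OF conn_Un[OF this ip_conn[OF ip(1)] t] ip_conn[OF ip(2)] touch_mono[OF t' Un_upper1 subset_refl]]
  have sV: "D0 \<union> P i \<union> P j \<subseteq> V" using ip_subset ip(1,2) BC_V by (simp add: D0_def)
  have "P i \<noteq> {}" "P j \<noteq> {}" using ip_conn[OF ip(1)] ip_conn[OF ip(2)] conn_nonempty by blast+
  then have "(D0 \<union> P i \<union> P j) \<inter> P i \<noteq> {}" "(D0 \<union> P i \<union> P j) \<inter> P j \<noteq> {}" by blast+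
  from exists_ipath[OF c sV this]
  have "\<exists>xs. ipath xs \<and> set xs \<subseteq> D0 \<union> P i \<union> P j \<and> hd xs \<in> P i \<and> last xs \<in> P j \<and>
    (\<forall>q<length xs. (xs ! q \<in> P i \<longrightarrow> q = 0) \<and> (xs ! q \<in> P j \<longrightarrow> q = length xs - 1))" by metis
  then obtain xs where xs: "bridge (D0 \<union> P i \<union> P j) (P i) (P j) xs" unfolding bridge_def by blast
  have ipx: "ipath xs" "hd xs \<in> P i" "last xs \<in> P j" using xs by (simp_all add: bridge_def)
  obtain x ys where 1: "xs = x # ys" using ipathD(1)[OF ipx(1)] by (cases xs) auto
  have "ys \<noteq> []"
  proof
    assume "ys = []"
    then have "x \<in> P i" "x \<in> P j" using 1 ipx by simp_all
    then show False using not_touch_disjoint[OF ip(3)] by blast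
  qed
  then obtain zs y where 2: "ys = zs @ [y]" by (cases ys rule: rev_cases) auto
  have x: "x \<in> P i" "y \<in> P j" using ipx 1 2 by simp_all
  have su: "successively E (x # zs @ [y])" using ipath_successively[OF ipx(1)] 1 2 by simp
  have "zs \<noteq> []"
  proof
    assume "zs = []"
    then have "E x y" using su by simp
    then show False using ip(3) x unfolding touch_def by blast
  qed
  then obtain u us where 3: "zs = u # us" by (cases zs) auto
  have mid: "butlast (tl xs) = zs" using 1 2 by simp
  have "E x u" using su 3 by simp
  then have hu: "hd zs \<in> nbrs (P i)" using x(1) 3 E_sym unfolding nbrs_def touch_def by auto
  have "E (last zs) y" using su \<open>zs \<noteq> []\<close> by (auto simp: successively_append_iff successively_Cons)
  then have lu: "last zs \<in> nbrs (P j)" using x(2) unfolding nbrs_def touch_def by auto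
  have "set zs \<subseteq> (D0 \<union> P i \<union> P j) - P i - P j" using bridge_interior(1)[OF xs] unfolding mid .
  moreover have "D0 \<inter> C = {}" using BC_disjoint[of "Z \<union> C"] unfolding D0_def by blast
  moreover have "D0 \<subseteq> V" unfolding D0_def by (rule BC_V)
  ultimately have "set zs \<subseteq> V - P i - P j - C" by blast
  moreover have "conn (set zs)" using bridge_interior(2)[OF xs] \<open>zs \<noteq> []\<close> ip_conn unfolding mid by simp
  moreover have "hd zs \<in> set zs" "last zs \<in> set zs" using \<open>zs \<noteq> []\<close> by simp_all
  ultimately show ?thesis using hu lu by blast
qed

text \<open>Every hub adds to \<open>Z\<close> its last vertex and fewer than \<open>k\<close>
  vertices that cut off all others of its vertices, hence the budget of \<open>k\<close> for each
  hub in \<open>\<theta>\<close>. Later hubs are then disjoint from it and touch it at most in its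
  last vertex; Ramsey's theorem removes these contacts or yields a path model.\<close>

lemma hubs_exist:
  assumes nPM: "\<not> PM n" and \<theta>: "Suc (((2 * n + M) choose (2 * n))) * k \<le> \<theta>" and k: "0 < k"
  shows "\<exists>(I :: nat set) P. finite I \<and> M \<le> card I \<and> (\<forall>i\<in>I. ip (P i)) \<and>
    (\<forall>i\<in>I. \<forall>j\<in>I. i \<noteq> j \<longrightarrow> \<not> touch (P i) (P j)) \<and> attached k I P"
proof -
  define m where "m = (2 * n + M) choose (2 * n)"
  define ok where "ok Z xs S \<longleftrightarrow> ipath xs \<and> set xs \<subseteq> BC Z \<and> holds k Z (set xs) \<and> S \<subseteq> V \<and> card S < k \<and>
    \<not> touch (BC (Z \<union> S)) (set (butlast xs))" for Z xs S
  define pick where "pick Z = (SOME xS. ok Z (fst xS) (snd xS))" for Z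
  have pick: "ok Z (fst (pick Z)) (snd (pick Z))" if "Z \<subseteq> V" "card Z + k \<le> \<theta>" for Z
    unfolding pick_def
  proof (rule someI_ex)
    show "\<exists>xS. ok Z (fst xS) (snd xS)" using hub_exists[OF that k] by (auto simp: ok_def)
  qed
  define nxt where "nxt Z = insert (last (fst (pick Z))) (Z \<union> snd (pick Z))" for Z
  define Zs where "Zs i = (nxt ^^ i) {}" for i
  define P where "P i = fst (pick (Zs i))" for i
  define S where "S i = snd (pick (Zs i))" for i
  have Zs_Suc: "Zs (Suc i) = insert (last (P i)) (Zs i \<union> S i)" for i by (simp add: Zs_def nxt_def P_def S_def)
  have Zs: "Zs i \<subseteq> V \<and> card (Zs i) \<le> i * k \<and> finite (Zs i)" if "i \<le> m" for i
    using that
  proof (induction i)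
    case 0
    then show ?case by (simp add: Zs_def)
  next
    case (Suc i)
    have "i * k \<le> m * k" using Suc.prems by (intro mult_le_mono1) simp
    then have "card (Zs i) + k \<le> \<theta>" using Suc.IH Suc.prems \<theta>[folded m_def, unfolded mult_Suc] by linarith
    then have o: "ok (Zs i) (P i) (S i)" using pick[of "Zs i"] Suc by (simp add: P_def S_def)
    have "last (P i) \<in> V" using o ipathD(1,3) last_in_set unfolding ok_def by blast
    moreover have "S i \<subseteq> V" "card (S i) < k" using o by (simp_all add: ok_def)
    moreover have "finite (S i)" using \<open>S i \<subseteq> V\<close> finite_V finite_subset by blast
    moreover have "card (insert (last (P i)) (Zs i \<union> S i)) \<le> Suc (card (Zs i) + card (S i))"
      using card_Un_le[of "Zs i" "S i"] card_insert_le_m1[of "Suc (card (Zs i) + card (S i))" "Zs i \<union> S i" "last (P i)"] by simp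
    ultimately show ?case using Suc unfolding Zs_Suc by simp
  qed
  have small: "card (Zs i) + k \<le> \<theta>" if "i < m" for i
  proof -
    have "i * k \<le> m * k" using that by (intro mult_le_mono1) simp
    then show ?thesis using Zs[of i] that \<theta>[folded m_def, unfolded mult_Suc] by linarith
  qed
  have ok: "ok (Zs i) (P i) (S i)" if "i < m" for i
    using pick[of "Zs i"] Zs[of i] small[OF that] that by (simp add: P_def S_def)
  have ipP: "ipath (P i)" if "i < m" for i using ok[OF that] by (simp add: ok_def)
  have Zs_mono: "Zs i \<subseteq> Zs j" if "i \<le> j" for i j
    using that by (induction j rule: dec_induct) (auto simp: Zs_Suc)
  have later: "last (P i) \<notin> set (P j)" "\<not> touch (set (butlast (P i))) (set (P j))" if ij: "i < j" "j < m" for i j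
  proof -
    have "Zs (Suc i) \<subseteq> Zs j" using ij by (intro Zs_mono) simp
    then have sub: "set (P j) \<subseteq> BC (Zs (Suc i))" using ok[OF ij(2)] BC_mono unfolding ok_def by blast
    show "last (P i) \<notin> set (P j)" using sub BC_disjoint[of "Zs (Suc i)"] unfolding Zs_Suc by blast
    have im: "i < m" using ij by simp
    have "BC (Zs (Suc i)) \<subseteq> BC (Zs i \<union> S i)" by (rule BC_mono) (auto simp: Zs_Suc)
    then have "set (P j) \<subseteq> BC (Zs i \<union> S i)" using sub by blast
    moreover have "\<not> touch (BC (Zs i \<union> S i)) (set (butlast (P i)))" using ok[OF im] by (simp add: ok_def)
    ultimately show "\<not> touch (set (butlast (P i))) (set (P j))"
      using touch_mono[of "set (P j)" "set (butlast (P i))" "BC (Zs i \<union> S i)" "set (butlast (P i))"]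
        touch_sym[of "set (butlast (P i))" "set (P j)"] by (simp only: subset_refl) blast
  qed
  have set_P: "set (P i) = {last (P i)} \<union> set (butlast (P i))" if "i < m" for i
    using append_butlast_last_id[OF ipathD(1)[OF ipP[OF that]]] by (metis Un_commute list.set(1,2) set_append)
  have P_disj: "set (P i) \<inter> set (P j) = {}" if ij: "i < j" "j < m" for i j
  proof -
    have "set (butlast (P i)) \<inter> set (P j) = {}" by (rule not_touch_disjoint[OF later(2)[OF ij]])
    then show ?thesis using later(1)[OF ij] set_P[of i] ij by auto
  qed
  consider J where "J \<subseteq> {..<m}" "card J = Suc (2 * n)" "pairwise (\<lambda>i j. touch (set (P i)) (set (P j))) J"
    | J where "J \<subseteq> {..<m}" "card J = Suc M" "pairwise (\<lambda>i j. \<not> touch (set (P i)) (set (P j))) J"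
    using ramsey_binomial[of "{..<m}" "2 * n" M "\<lambda>i j. touch (set (P i)) (set (P j))"] touch_sym m_def by auto
  then show ?thesis
  proof cases
    case 1
    have Jm: "i < m" if "i \<in> J" for i using 1(1) that by blast
    have "PM n"
    proof (rule PM_clique[of J n "\<lambda>i. set (P i)"])
      show "finite J" using 1(1) finite_subset by blast
      show "2 * n \<le> card J" using 1(2) by simp
      show "ip (set (P i))" if "i \<in> J" for i by (rule ip_set[OF ipP[OF Jm[OF that]]])
      show "set (P i) \<inter> set (P j) = {} \<and> touch (set (P i)) (set (P j))" if ij: "i \<in> J" "j \<in> J" "i \<noteq> j" for i j
        using pairwiseD[OF 1(3) ij] P_disj[OF _ Jm[OF ij(1)], of j] P_disj[OF _ Jm[OF ij(2)], of i] ij(3)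
        by (metis Int_commute linorder_neqE_nat)
    qed
    then show ?thesis using nPM by simp
  next
    case 2
    have Jm: "i < m" if "i \<in> J" for i using 2(1) that by blast
    have ipJ: "ip (set (P i))" if "i \<in> J" for i by (rule ip_set[OF ipP[OF Jm[OF that]]])
    have anti: "\<not> touch (set (P i)) (set (P j))" if "i \<in> J" "j \<in> J" "i \<noteq> j" for i j
      using pairwiseD[OF 2(3) that] .
    have reach: "\<exists>D. conn D \<and> D \<subseteq> V - set (P i) - set (P j) - C \<and> D \<inter> nbrs (set (P i)) \<noteq> {} \<and> D \<inter> nbrs (set (P j)) \<noteq> {}"
      if ij: "i \<in> J" "j \<in> J" "i < j" and C: "C \<subseteq> V - set (P i) - set (P j)" "card C < k" for i j C
    proof (rule holds_attached[of k "Zs i" "\<lambda>i. set (P i)" i "Zs j"])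
      show "holds k (Zs i) (set (P i))" "holds k (Zs j) (set (P j))"
        using ok[OF Jm[OF ij(1)]] ok[OF Jm[OF ij(2)]] by (simp_all add: ok_def)
      show "Zs i \<subseteq> Zs j" by (rule Zs_mono) (use ij in simp)
      show "Zs j \<subseteq> V" using Zs[of j] Jm[OF ij(2)] by simp
      show "card (Zs j) + k \<le> \<theta>" by (rule small[OF Jm[OF ij(2)]])
      show "\<not> touch (set (P i)) (set (P j))" by (rule anti) (use ij in auto)
    qed (use ipJ ij C in auto)
    have "attached k J (\<lambda>i. set (P i))"
      unfolding attached_def
    proof (intro ballI impI allI)
      fix i j C assume ij: "i \<in> J" "j \<in> J" "i \<noteq> j" and C: "C \<subseteq> V - set (P i) - set (P j)"
        and s: "sep (V - set (P i) - set (P j)) (nbrs (set (P i))) (nbrs (set (P j))) C"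
      show "k \<le> card C"
      proof (rule ccontr)
        assume "\<not> k \<le> card C"
        then have ck: "card C < k" by simp
        have "\<exists>D. conn D \<and> D \<subseteq> V - set (P i) - set (P j) - C \<and> D \<inter> nbrs (set (P i)) \<noteq> {} \<and> D \<inter> nbrs (set (P j)) \<noteq> {}"
        proof (cases "i < j")
          case True
          then show ?thesis using reach[OF ij(1,2) _ C ck] by simp
        next
          case False
          then have "j < i" using ij(3) by simp
          have "C \<subseteq> V - set (P j) - set (P i)" using C by blast
          from reach[OF ij(2,1) \<open>j < i\<close> this ck] obtain D where
            "conn D" "D \<subseteq> V - set (P j) - set (P i) - C" "D \<inter> nbrs (set (P j)) \<noteq> {}" "D \<inter> nbrs (set (P i)) \<noteq> {}"
            by (elim exE conjE)
          moreover have "V - set (P j) - set (P i) - C = V - set (P i) - set (P j) - C" by blast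
          ultimately show ?thesis by metis
        qed
        then show False using s unfolding sep_def by blast
      qed
    qed
    moreover have "finite J" using 2(1) finite_subset by blast
    ultimately show ?thesis using 2(2) ipJ anti by (intro exI[of _ J] exI[of _ "\<lambda>i. set (P i)"]) simp
  qed
qed

end

section \<open>Tree decompositions from balanced separators\<close>

text \<open>The bags of a tree decomposition, listed so that every bag comes before its parent.\<close>
inductive bag_list :: "'a set list => bool" where
  root: "bag_list [b]"
| child: "bag_list bs ==> c \<in> set bs ==> b \<inter> \<Union>(set bs) \<subseteq> c ==> bag_list (b # bs)"

text \<open>All common vertices lie in the bag \<open>a\<close> and in the root of
  \<open>cs\<close>, so this root may become a child of \<open>a\<close>.\<close>

lemma bag_list_append:
  assumes "bag_list cs" "bag_list as" "a \<in> set as" "\<Union>(set as) \<inter> \<Union>(set cs) \<subseteq> a" "\<Union>(set as) \<inter> \<Union>(set cs) \<subseteq> last cs"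
  shows "bag_list (cs @ as)"
  using assms(1,4,5)
proof induction
  case (root b)
  have "bag_list (b # as)"
    by (rule bag_list.child[OF assms(2,3)]) (use root in auto)
  then show ?case by simp
next
  case (child bs c b)
  have ne: "bs \<noteq> []" using child.hyps(2) by auto
  then have l: "last bs \<in> set bs" "last (b # bs) = last bs" by simp_all
  have "bag_list (bs @ as)"
    by (rule child.IH) (use child.prems l(2) in auto)
  moreover have "b \<inter> \<Union>(set (bs @ as)) \<subseteq> c"
  proof
    fix x assume x: "x \<in> b \<inter> \<Union>(set (bs @ as))"
    have "x \<in> \<Union>(set bs)"
    proof (cases "x \<in> \<Union>(set bs)")
      case False
      then have "x \<in> \<Union>(set as) \<inter> \<Union>(set (b # bs))" using x by auto
      then have "x \<in> last bs" using child.prems(2) l(2) by blast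
      then show ?thesis using l(1) by blast
    qed
    then show "x \<in> c" using x child.hyps(3) by blast
  qed
  ultimately show ?case using bag_list.child[of "bs @ as" c b] child.hyps(2) by simp
qed

text \<open>Reversal puts the root at index \<open>0\<close> and each parent before its children, so
  that parents become a decreasing function.\<close>

lemma bag_list_parents:
  assumes "bag_list bs"
  shows "\<exists>p. \<forall>i<length bs. 0 < i \<longrightarrow> p i < i \<and> (\<forall>j<i. rev bs ! i \<inter> rev bs ! j \<subseteq> rev bs ! p i)"
  using assms
proof induction
  case (root b)
  then show ?case by simp
next
  case (child bs c b)
  then obtain p where p: "\<And>i. i < length bs ==> 0 < i ==> p i < i \<and> (\<forall>j<i. rev bs ! i \<inter> rev bs ! j \<subseteq> rev bs ! p i)" by blast
  obtain m where m: "m < length bs" "rev bs ! m = c" using child.hyps(2) by (metis in_set_conv_nth length_rev set_rev)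
  have old: "rev (b # bs) ! i = rev bs ! i" if "i < length bs" for i using that by (simp add: nth_append)
  have new: "rev (b # bs) ! length bs = b" by (simp add: nth_append)
  show ?case
  proof (intro exI[of _ "p(length bs := m)"] allI impI)
    fix i assume i: "i < length (b # bs)" "0 < i"
    show "(p(length bs := m)) i < i \<and> (\<forall>j<i. rev (b # bs) ! i \<inter> rev (b # bs) ! j \<subseteq> rev (b # bs) ! (p(length bs := m)) i)"
    proof (cases "i = length bs")
      case True
      have "b \<inter> rev bs ! j \<subseteq> c" if "j < length bs" for j
        using child.hyps(3) nth_mem[of j "rev bs"] that by auto
      then show ?thesis using True m old new by simp
    next
      case False
      then have il: "i < length bs" using i(1) by simp
      then show ?thesis using p[OF il i(2)] False old by auto
    qed
  qed
qed

context fin_graph begin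

definition bags_of :: "'a set => nat => 'a set list => bool" where
  "bags_of W w bs \<longleftrightarrow> bag_list bs \<and> \<Union>(set bs) = W \<and> (\<forall>b\<in>set bs. card b \<le> w) \<and>
    (\<forall>u\<in>W. \<forall>v\<in>W. E u v \<longrightarrow> (\<exists>b\<in>set bs. u \<in> b \<and> v \<in> b))"

text \<open>The usual recursion, in which \<open>X\<close> must fit into the root bag. This bag
  consists of an extension \<open>X1\<close> of \<open>X\<close> and a balanced separator of it,
  with at most \<open>Suc (2 * \<theta>) + (\<theta> - 1)\<close> vertices. Each component outside
  the separator is decomposed together with the vertices that it shares with the root bag; balance
  keeps their number below \<open>2 * \<theta>\<close>.\<close>

lemma balanced_bags:
  assumes \<theta>: "0 < \<theta>"
    and bal: "\<And>X. X \<subseteq> V ==> card X = Suc (2 * \<theta>) ==>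
      \<exists>S\<subseteq>V. card S < \<theta> \<and> (\<forall>D. conn D \<longrightarrow> D \<subseteq> V - S \<longrightarrow> 2 * card (D \<inter> X) \<le> card X)"
    and W: "W \<subseteq> V" "X \<subseteq> W" "card X \<le> Suc (2 * \<theta>)"
  shows "\<exists>bs. bags_of W (3 * \<theta>) bs \<and> X \<subseteq> last bs"
  using W
proof (induction "card W" arbitrary: W X rule: less_induct)
  case less
  have finW: "finite W" using less.prems(1) finite_V finite_subset by blast
  show ?case
  proof (cases "card W \<le> Suc (2 * \<theta>)")
    case True
    then show ?thesis
      using \<theta> less.prems bag_list.root[of W] by (intro exI[of _ "[W]"]) (auto simp: bags_of_def)
  next
    case False
    have finX: "finite X" using less.prems(2) finW finite_subset by blast
    \<comment> \<open>\<open>X\<close> is padded to \<open>Suc (2 * \<theta>)\<close> elements, so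
      that no component together with the separator contains all of them and the recursion
      descends.\<close>
    have "Suc (2 * \<theta>) - card X \<le> card (W - X)"
      using False card_Diff_subset[OF finX less.prems(2)] by simp
    then obtain X0 where X0: "X0 \<subseteq> W - X" "card X0 = Suc (2 * \<theta>) - card X" by (meson obtain_subset_with_card_n)
    define X1 where "X1 = X \<union> X0"
    have X1: "X \<subseteq> X1" "X1 \<subseteq> W" using X0 less.prems(2) by (auto simp: X1_def)
    have finX1: "finite X1" using X1(2) finW finite_subset by blast
    have "card X1 = card X + card X0"
      unfolding X1_def using X0(1) finX finW finite_subset by (intro card_Un_disjoint) auto
    then have cX1: "card X1 = Suc (2 * \<theta>)" using X0(2) less.prems(3) by simp
    obtain S where S: "S \<subseteq> V" "card S < \<theta>" "\<And>D. conn D ==> D \<subseteq> V - S ==> 2 * card (D \<inter> X1) \<le> card X1"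
      using bal[of X1] X1(2) less.prems(1) cX1 by blast
    have finS: "finite S" using S(1) finite_V finite_subset by blast
    have cSW: "card (S \<inter> W) < \<theta>" using card_mono[OF finS, of "S \<inter> W"] S(2) by simp
    define B where "B = X1 \<union> (S \<inter> W)"
    have cB: "card B \<le> 3 * \<theta>" using card_Un_le[of X1 "S \<inter> W"] cX1 cSW by (simp add: B_def)
    have BW: "B \<subseteq> W" using X1(2) by (auto simp: B_def)
    define comp where "comp x = \<Union>{D. conn D \<and> D \<subseteq> W - S \<and> x \<in> D}" for x
    have comp_sub: "comp x \<subseteq> W - S" for x by (auto simp: comp_def)
    have comp_upper: "D \<subseteq> comp x" if "conn D" "D \<subseteq> W - S" "x \<in> D" for D x using that by (auto simp: comp_def)
    have comp_self: "x \<in> comp x" if "x \<in> W - S" for x using comp_upper[OF conn_singleton, of x x] that by simp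
    have comp_conn: "conn (comp x)" if "x \<in> W - S" for x
    proof -
      have "conn (\<Union>D\<in>{D. conn D \<and> D \<subseteq> W - S \<and> x \<in> D}. D)"
      proof (rule conn_UN)
        show "{D. conn D \<and> D \<subseteq> W - S \<and> x \<in> D} \<noteq> {}" using conn_singleton[of x] that by blast
        show "touch D D'" if "D \<in> {D. conn D \<and> D \<subseteq> W - S \<and> x \<in> D}" "D' \<in> {D. conn D \<and> D \<subseteq> W - S \<and> x \<in> D}" for D D'
          by (rule touch_Int) (use that in auto)
      qed simp
      then show ?thesis by (simp add: comp_def)
    qed
    have comp_closed: "z \<in> comp x" if "x \<in> W - S" "y \<in> comp x" "z \<in> W - S" "E y z" for x y z
    proof -
      have "conn (insert z (comp x))" by (rule conn_insert[OF comp_conn[OF that(1)] that(2) E_sym[OF that(4)]])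
      then have "insert z (comp x) \<subseteq> comp x"
        by (rule comp_upper) (use comp_sub comp_self that in auto)
      then show ?thesis by simp
    qed
    have comp_eq: "comp x = comp y" if "x \<in> W - S" "y \<in> W - S" "z \<in> comp x" "z \<in> comp y" for x y z
    proof -
      have "touch (comp x) (comp y)" by (rule touch_Int) (use that in blast)
      then have c: "conn (comp x \<union> comp y)" using conn_Un comp_conn that(1,2) by blast
      have s: "comp x \<union> comp y \<subseteq> W - S" using comp_sub by blast
      have "comp x \<union> comp y \<subseteq> comp x" by (rule comp_upper[OF c s]) (use comp_self that(1) in blast)
      moreover have "comp x \<union> comp y \<subseteq> comp y" by (rule comp_upper[OF c s]) (use comp_self that(2) in blast)
      ultimately show ?thesis by blast
    qed
    have part: "\<exists>bs. bags_of (comp x \<union> (S \<inter> W)) (3 * \<theta>) bs \<and> (comp x \<inter> X1) \<union> (S \<inter> W) \<subseteq> last bs"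
      if x: "x \<in> W - S" for x
    proof -
      have "comp x \<subseteq> V - S" using comp_sub[of x] less.prems(1) by blast
      then have "2 * card (comp x \<inter> X1) \<le> Suc (2 * \<theta>)" using S(3)[OF comp_conn[OF x]] cX1 by simp
      then have half: "card (comp x \<inter> X1) \<le> \<theta>" by presburger
      then have c: "card ((comp x \<inter> X1) \<union> (S \<inter> W)) < 2 * \<theta>"
        using card_Un_le[of "comp x \<inter> X1" "S \<inter> W"] cSW by simp
      have sub: "comp x \<union> (S \<inter> W) \<subseteq> W" using comp_sub[of x] by blast
      have "\<not> X1 \<subseteq> comp x \<union> (S \<inter> W)"
      proof
        assume "X1 \<subseteq> comp x \<union> (S \<inter> W)"
        then have "X1 \<subseteq> (comp x \<inter> X1) \<union> (S \<inter> W)" by blast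
        moreover have "finite ((comp x \<inter> X1) \<union> (S \<inter> W))" using finX1 finS by blast
        ultimately have "card X1 < 2 * \<theta>" using card_mono[of "(comp x \<inter> X1) \<union> (S \<inter> W)" X1] c by linarith
        then show False using cX1 by simp
      qed
      then have "comp x \<union> (S \<inter> W) \<subset> W" using sub X1(2) by blast
      then have lt: "card (comp x \<union> (S \<inter> W)) < card W" by (rule psubset_card_mono[OF finW])
      show ?thesis by (rule less.hyps[OF lt]) (use sub less.prems(1) c in auto)
    qed
    have glue: "\<exists>bs. bag_list bs \<and> last bs = B \<and> \<Union>(set bs) = B \<union> \<Union>\<D> \<and> (\<forall>b\<in>set bs. card b \<le> 3 * \<theta>) \<and>
        (\<forall>D\<in>\<D>. \<forall>u\<in>D \<union> (S \<inter> W). \<forall>v\<in>D \<union> (S \<inter> W). E u v \<longrightarrow> (\<exists>b\<in>set bs. u \<in> b \<and> v \<in> b))"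
      if "finite \<D>" "\<D> \<subseteq> comp ` (W - S)" for \<D>
      using that
    proof (induction \<D>)
      case empty
      then show ?case using bag_list.root[of B] cB by (intro exI[of _ "[B]"]) simp
    next
      case (insert D \<D>)
      obtain as where as: "bag_list as" "last as = B" "\<Union>(set as) = B \<union> \<Union>\<D>" "\<forall>b\<in>set as. card b \<le> 3 * \<theta>"
        "\<forall>D\<in>\<D>. \<forall>u\<in>D \<union> (S \<inter> W). \<forall>v\<in>D \<union> (S \<inter> W). E u v \<longrightarrow> (\<exists>b\<in>set as. u \<in> b \<and> v \<in> b)"
        using insert.IH insert.prems by (elim meta_impE) (auto simp del: UN_simps)
      obtain x where x: "x \<in> W - S" "D = comp x" using insert.prems by blast
      from part[OF x(1)] obtain cs where cs: "bag_list cs" "(D \<inter> X1) \<union> (S \<inter> W) \<subseteq> last cs" "\<Union>(set cs) = D \<union> (S \<inter> W)"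
        "\<forall>b\<in>set cs. card b \<le> 3 * \<theta>" "\<forall>u\<in>D \<union> (S \<inter> W). \<forall>v\<in>D \<union> (S \<inter> W). E u v \<longrightarrow> (\<exists>b\<in>set cs. u \<in> b \<and> v \<in> b)"
        unfolding x(2) bags_of_def by (elim exE conjE)
      have ne: "as \<noteq> []" using as(1) by (cases rule: bag_list.cases) auto
      have disj: "D \<inter> D' = {}" if D': "D' \<in> \<D>" for D'
      proof (rule ccontr)
        assume "D \<inter> D' \<noteq> {}"
        then obtain z where z: "z \<in> D" "z \<in> D'" by blast
        have "D' \<in> comp ` (W - S)" using insert.prems D' by blast
        then obtain y where y: "y \<in> W - S" "D' = comp y" by blast
        have "D = D'" using comp_eq[OF x(1) y(1)] z x(2) y(2) by simp
        then show False using insert.hyps(2) D' by simp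
      qed
      have DS: "D \<inter> S = {}" using comp_sub[of x] x(2) by blast
      have i: "\<Union>(set as) \<inter> \<Union>(set cs) \<subseteq> (D \<inter> X1) \<union> (S \<inter> W)"
      proof
        fix z assume z: "z \<in> \<Union>(set as) \<inter> \<Union>(set cs)"
        show "z \<in> (D \<inter> X1) \<union> (S \<inter> W)"
        proof (cases "z \<in> S \<inter> W")
          case False
          then have zD: "z \<in> D" using z cs(3) by blast
          then have "z \<notin> \<Union>\<D>" using disj by blast
          then have "z \<in> B" using z as(3) by blast
          then have "z \<in> X1" using False unfolding B_def by blast
          then show ?thesis using zD by simp
        qed simp
      qed
      have "last as \<in> set as" using ne by simp
      then have "bag_list (cs @ as)"
        by (rule bag_list_append[OF cs(1) as(1)]) (use i cs(2) as(2) in \<open>auto simp: B_def\<close>)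
      moreover have "\<Union>(set (cs @ as)) = B \<union> \<Union>(insert D \<D>)" using as(3) cs(3) by (auto simp: B_def)
      moreover have "last (cs @ as) = B" using ne as(2) by simp
      moreover have "\<forall>b\<in>set (cs @ as). card b \<le> 3 * \<theta>" using as(4) cs(4) by auto
      moreover have "\<forall>D'\<in>insert D \<D>. \<forall>u\<in>D' \<union> (S \<inter> W). \<forall>v\<in>D' \<union> (S \<inter> W). E u v \<longrightarrow> (\<exists>b\<in>set (cs @ as). u \<in> b \<and> v \<in> b)"
      proof (intro ballI impI)
        fix D' u v assume a: "D' \<in> insert D \<D>" "u \<in> D' \<union> (S \<inter> W)" "v \<in> D' \<union> (S \<inter> W)" "E u v"
        show "\<exists>b\<in>set (cs @ as). u \<in> b \<and> v \<in> b"
        proof (cases "D' = D")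
          case True
          then obtain b where "b \<in> set cs" "u \<in> b" "v \<in> b" using cs(5) a by (simp only:) blast
          then show ?thesis by (intro bexI[of _ b]) simp_all
        next
          case False
          then have "D' \<in> \<D>" using a(1) by simp
          then obtain b where "b \<in> set as" "u \<in> b" "v \<in> b" using as(5) a(2-4) by blast
          then show ?thesis by (intro bexI[of _ b]) simp_all
        qed
      qed
      ultimately show ?case by blast
    qed
    obtain bs where bs: "bag_list bs" "last bs = B" "\<Union>(set bs) = B \<union> \<Union>(comp ` (W - S))" "\<forall>b\<in>set bs. card b \<le> 3 * \<theta>"
      "\<forall>D\<in>comp ` (W - S). \<forall>u\<in>D \<union> (S \<inter> W). \<forall>v\<in>D \<union> (S \<inter> W). E u v \<longrightarrow> (\<exists>b\<in>set bs. u \<in> b \<and> v \<in> b)"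
      using glue[of "comp ` (W - S)"] finW by blast
    have "\<Union>(comp ` (W - S)) = W - S" using comp_sub comp_self by blast
    then have U: "\<Union>(set bs) = W" using bs(3) BW by (auto simp: B_def)
    have ne: "bs \<noteq> []" using bs(1) by (cases rule: bag_list.cases) auto
    have edge: "\<exists>b\<in>set bs. u \<in> b \<and> v \<in> b" if uv: "u \<in> W" "v \<in> W" "E u v" "u \<notin> S" for u v
    proof -
      have u: "u \<in> W - S" using uv by simp
      have "v \<in> comp u \<union> (S \<inter> W)"
        using comp_closed[OF u comp_self[OF u] _ uv(3)] uv(2) by blast
      moreover have "u \<in> comp u \<union> (S \<inter> W)" using comp_self[OF u] by simp
      ultimately show ?thesis using bs(5) u uv(3) by blast
    qed
    have "\<exists>b\<in>set bs. u \<in> b \<and> v \<in> b" if uv: "u \<in> W" "v \<in> W" "E u v" for u v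
    proof (cases "u \<in> S")
      case uS: True
      show ?thesis
      proof (cases "v \<in> S")
        case True
        then have "u \<in> B" "v \<in> B" using uS uv by (simp_all add: B_def)
        moreover have "B \<in> set bs" using ne bs(2) last_in_set by metis
        ultimately show ?thesis by blast
      next
        case False
        show ?thesis using edge[OF uv(2,1) E_sym[OF uv(3)] False] by blast
      qed
    next
      case False
      show ?thesis by (rule edge[OF uv False])
    qed
    moreover have "X \<subseteq> last bs" using X1(1) bs(2) by (auto simp: B_def)
    ultimately show ?thesis using bs(1,4) U by (intro exI[of _ bs]) (simp add: bags_of_def)
  qed
qed

end

section \<open>Trees from parent functions\<close>

definition parent_tree :: "(nat => nat) => nat => nat pair_pre_digraph" where
  "parent_tree p N = \<lparr> pverts = {..<N}, parcs = {(i, p i) | i. 0 < i \<and> i < N} \<union> {(p i, i) | i. 0 < i \<and> i < N} \<rparr>"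

lemma parent_tree_simps [simp]:
  "pverts (parent_tree p N) = {..<N}"
  "(x, y) \<in> parcs (parent_tree p N) \<longleftrightarrow> (0 < x \<and> x < N \<and> y = p x) \<or> (0 < y \<and> y < N \<and> x = p y)"
  by (auto simp: parent_tree_def)

text \<open>Every element reaches \<open>r\<close> by passing to parents inside \<open>A\<close>.
  This serves both for the whole tree and for the set of bags that contain a given vertex.\<close>

lemma parent_tree_connected:
  assumes p: "\<And>i. 0 < i ==> i < N ==> p i < i" and A: "A \<subseteq> {..<N}" "r \<in> A"
    and up: "\<And>i. i \<in> A ==> i \<noteq> r ==> 0 < i \<and> p i \<in> A"
  shows "Digraph_Component.connected (with_proj (parent_tree p N) \<restriction> A)"
proof -
  let ?T = "with_proj (parent_tree p N) \<restriction> A"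
  let ?M = "mk_symmetric ?T"
  have adj: "(i, p i) \<in> parcs ?M" "(p i, i) \<in> parcs ?M" if "i \<in> A" "i \<noteq> r" for i
  proof -
    have a: "(i, p i) \<in> arcs ?T" using up[OF that] that A by (auto simp: induce_subgraph_def)
    have "tail ?T = fst" "head ?T = snd" by (simp_all add: induce_subgraph_def)
    then show "(i, p i) \<in> parcs ?M" "(p i, i) \<in> parcs ?M" unfolding parcs_mk_symmetric by (intro UN_I[OF a], simp)+
  qed
  have V: "verts (with_proj ?M) = A" by simp
  have to_root: "(i, r) \<in> rtrancl_on A (parcs ?M) \<and> (r, i) \<in> rtrancl_on A (parcs ?M)" if "i \<in> A" for i
    using that
  proof (induction i rule: less_induct)
    case (less i)
    show ?case
    proof (cases "i = r")
      case False
      have pi: "0 < i" "p i \<in> A" using up[OF less.prems False] by blast+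
      have "p i < i" using p pi(1) less.prems A(1) by auto
      note IH = less.IH[OF this pi(2)]
      have "(i, p i) \<in> rtrancl_on A (parcs ?M)" "(p i, i) \<in> rtrancl_on A (parcs ?M)"
        using rtrancl_on_into_rtrancl_on[OF rtrancl_on_refl adj(1)[OF less.prems False]]
          rtrancl_on_into_rtrancl_on[OF rtrancl_on_refl adj(2)[OF less.prems False]] less.prems pi(2) by simp_all
      then show ?thesis using IH rtrancl_on_trans by metis
    qed (use less.prems in simp)
  qed
  show ?thesis
    unfolding Digraph_Component.connected_def
  proof (rule strongly_connectedI)
    show "verts (with_proj ?M) \<noteq> {}" using A(2) by auto
    show "u \<rightarrow>\<^sup>*\<^bsub>with_proj ?M\<^esub> v" if "u \<in> verts (with_proj ?M)" "v \<in> verts (with_proj ?M)" for u v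
    proof -
      have "(u, r) \<in> rtrancl_on A (parcs ?M)" "(r, v) \<in> rtrancl_on A (parcs ?M)"
        using to_root[of u] to_root[of v] that unfolding V by blast+
      then have "(u, v) \<in> rtrancl_on A (parcs ?M)" by (rule rtrancl_on_trans)
      then show ?thesis unfolding reachable_def V with_proj_simps(3) .
    qed
  qed
qed

lemma pcas_nth: "pcas u c v ==> k < length c ==> snd (c ! k) = (if Suc k < length c then fst (c ! Suc k) else v)"
proof (induction c arbitrary: u k)
  case (Cons e c)
  then show ?case by (cases k; cases c) auto
qed simp

lemma pcas_verts: "pcas u c v ==> pawalk_verts u c = map fst c @ [v]"
  by (induction c arbitrary: u) auto

text \<open>The largest vertex of a cycle has two distinct neighbours on it. Both are smaller, so
  both would be its parent.\<close>

lemma parent_tree_tree: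
  assumes p: "\<And>i. 0 < i ==> i < N ==> p i < i" and N: "0 < N"
  shows "undirected_tree (parent_tree p N)"
  unfolding undirected_tree_def
proof (intro conjI notI)
  let ?T = "parent_tree p N"
  have pN: "p i < N" if "0 < i" "i < N" for i using p[OF that] that by simp
  show pg: "pair_graph ?T"
  proof
    show "finite (parcs ?T)"
      by (rule finite_subset[of _ "{..<N} \<times> {..<N}"]) (use pN in auto)
    show "symmetric (with_proj ?T)" unfolding symmetric_def sym_def by auto
    show "fst e \<in> pverts ?T" "snd e \<in> pverts ?T" "fst e \<noteq> snd e" if e: "e \<in> parcs ?T" for e
    proof -
      obtain i where "0 < i" "i < N" "e = (i, p i) \<or> e = (p i, i)" using e by (cases e) auto
      then show "fst e \<in> pverts ?T" "snd e \<in> pverts ?T" "fst e \<noteq> snd e" using p[of i] by auto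
    qed
  qed simp
  have "with_proj ?T = with_proj ?T \<restriction> {..<N}"
    using pN by (intro pre_digraph.equality) (auto simp: induce_subgraph_def with_proj_def)
  moreover have "Digraph_Component.connected (with_proj ?T \<restriction> {..<N})"
    by (rule parent_tree_connected[of N p "{..<N}" 0]) (use p pN N in auto)
  ultimately show "Digraph_Component.connected (with_proj ?T)" by simp
  assume "\<exists>c. pre_digraph.cycle (with_proj ?T) c \<and> 3 \<le> length c"
  then obtain c where cyc: "pre_digraph.cycle (with_proj ?T) c" and len: "3 \<le> length c" by blast
  obtain u where cas: "pcas u c u" and arcs: "set c \<subseteq> parcs ?T" and dist: "distinct (tl (pawalk_verts u c))"
    using cyc by (auto simp: pre_digraph.cycle_def pre_digraph.awalk_def cas_with_proj_eq awalk_verts_with_proj_eq)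
  let ?L = "length c"
  obtain e es where c: "c = e # es" using len by (cases c) auto
  define x where "x k = fst (c ! k)" for k
  have "fst e = u" using cas c by simp
  have L0: "0 \<in> {..<?L}" using c by simp
  have "distinct (tl (map fst c @ [u]))" using dist by (simp only: pcas_verts[OF cas])
  then have "distinct (map fst c)" using \<open>fst e = u\<close> by (auto simp: c)
  then have inj: "i = j" if "x i = x j" "i < ?L" "j < ?L" for i j
    using that nth_eq_iff_index_eq[of "map fst c" i j] by (simp add: x_def)
  have x0: "x 0 = u" using \<open>fst e = u\<close> c by (simp add: x_def)
  have nxt: "c ! k = (x k, x (if Suc k < ?L then Suc k else 0))" if "k < ?L" for k
    using pcas_nth[OF cas that] x0 by (intro prod_eqI) (auto simp: x_def)
  have arc: "(x k, x (if Suc k < ?L then Suc k else 0)) \<in> parcs ?T" if "k < ?L" for k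
    using nth_mem[OF that] arcs nxt[OF that] by auto
  have "finite (x ` {..<?L})" "x ` {..<?L} \<noteq> {}" using L0 by blast+
  from Max_in[OF this] obtain k where k: "k < ?L" "x k = Max (x ` {..<?L})" by auto
  have max: "x j \<le> x k" if "j < ?L" for j using that unfolding k(2) by (intro Max_ge) auto
  have parent: "y = p (x k)" if "y \<in> x ` {..<?L}" "(x k, y) \<in> parcs ?T \<or> (y, x k) \<in> parcs ?T" for y
    using that p[of y] max by (auto simp: not_less[symmetric])
  define a where "a = (if Suc k < ?L then Suc k else 0)"
  define b where "b = (if k = 0 then ?L - 1 else k - 1)"
  have ab: "a < ?L" "b < ?L" "a \<noteq> b" using k(1) len by (auto simp: a_def b_def)
  have "x a = p (x k)" using arc[OF k(1)] ab(1) by (intro parent) (auto simp: a_def)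
  moreover have "(if Suc b < ?L then Suc b else 0) = k" using k(1) len by (auto simp: b_def)
  then have "x b = p (x k)" using arc[OF ab(2)] ab(2) by (intro parent) auto
  ultimately show False using inj[of a b] ab by simp
qed

lemma treewidth_le:
  assumes bs: "bag_list bs" "\<Union>(set bs) = verts G" "\<And>b. b \<in> set bs ==> card b \<le> w"
    and edge: "\<And>u v. u \<rightarrow>\<^bsub>G\<^esub> v ==> \<exists>b\<in>set bs. u \<in> b \<and> v \<in> b"
  shows "treewidth G \<le> w"
proof -
  let ?N = "length bs"
  define \<beta> where "\<beta> i = rev bs ! i" for i
  obtain p where p: "\<And>i. i < ?N ==> 0 < i ==> p i < i \<and> (\<forall>j<i. \<beta> i \<inter> \<beta> j \<subseteq> \<beta> (p i))"
    using bag_list_parents[OF bs(1)] unfolding \<beta>_def by blast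
  have p': "p i < i" if "0 < i" "i < ?N" for i using p that by blast
  have N: "0 < ?N" using bs(1) by (cases rule: bag_list.cases) auto
  have bags: "\<exists>i<?N. \<beta> i = b" if "b \<in> set bs" for b
    using that by (metis \<beta>_def in_set_conv_nth length_rev set_rev)
  have bag_mem: "\<beta> i \<in> set bs" if "i < ?N" for i using nth_mem[of i "rev bs"] that by (simp add: \<beta>_def)
  let ?T = "parent_tree p ?N"
  have "tree_decomposition ?T \<beta> G"
    unfolding tree_decomposition_def
  proof (intro conjI ballI allI impI)
    show "undirected_tree ?T" by (rule parent_tree_tree[OF p' N])
    show "(\<Union>x\<in>pverts ?T. \<beta> x) = verts G"
    proof
      show "(\<Union>x\<in>pverts ?T. \<beta> x) \<subseteq> verts G" unfolding bs(2)[symmetric] using bag_mem by auto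
      show "verts G \<subseteq> (\<Union>x\<in>pverts ?T. \<beta> x)" unfolding bs(2)[symmetric] using bags by fastforce
    qed
    fix u v assume "u \<rightarrow>\<^bsub>G\<^esub> v"
    then obtain b where b: "b \<in> set bs" "u \<in> b" "v \<in> b" using edge by blast
    then obtain i where "i < ?N" "\<beta> i = b" using bags by blast
    then show "\<exists>x\<in>pverts ?T. u \<in> \<beta> x \<and> v \<in> \<beta> x" using b by auto
  next
    fix v assume "v \<in> verts G"
    then obtain b where b: "b \<in> set bs" "v \<in> b" using bs(2) by blast
    obtain i0 where i0: "i0 < ?N" "v \<in> \<beta> i0" using bags[OF b(1)] b(2) by blast
    define A where "A = {x \<in> pverts ?T. v \<in> \<beta> x}"
    \<comment> \<open>The first bag with \<open>v\<close> is the root of the bags with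
      \<open>v\<close>: a later one meets it in \<open>v\<close>, so the parent of the later one
      contains \<open>v\<close> as well.\<close>
    define r where "r = (LEAST i. v \<in> \<beta> i)"
    have r: "v \<in> \<beta> r" "\<And>i. v \<in> \<beta> i ==> r \<le> i" using LeastI[of "\<lambda>i. v \<in> \<beta> i" i0] Least_le[of "\<lambda>i. v \<in> \<beta> i"] i0(2) by (auto simp: r_def)
    have "Digraph_Component.connected (with_proj ?T \<restriction> A)"
    proof (rule parent_tree_connected[OF p'])
      show "A \<subseteq> {..<?N}" by (auto simp: A_def)
      show "r \<in> A" using r i0 le_less_trans by (auto simp: A_def)
      show "0 < i \<and> p i \<in> A" if i: "i \<in> A" "i \<noteq> r" for i
      proof -
        have i': "i < ?N" "v \<in> \<beta> i" using i(1) by (auto simp: A_def)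
        then have "r < i" using r(2)[of i] i(2) by simp
        then have "p i < i" "\<beta> i \<inter> \<beta> r \<subseteq> \<beta> (p i)" using p[OF i'(1)] by auto
        then show ?thesis using \<open>r < i\<close> i' r(1) by (auto simp: A_def)
      qed
    qed
    then show "Digraph_Component.connected (with_proj ?T \<restriction> {x \<in> pverts ?T. v \<in> \<beta> x})" by (simp add: A_def)
  qed
  then have "treewidth G \<le> decomposition_width ?T \<beta>" unfolding treewidth_def by (intro Least_le) blast
  also have "decomposition_width ?T \<beta> \<le> Max ((\<lambda>x. card (\<beta> x)) ` {..<?N})" by (simp add: decomposition_width_def)
  also have "\<dots> \<le> w"
    by (rule Max.boundedI) (use N bag_mem bs(3) in auto)
  finally show ?thesis .
qed

text \<open>If every set had a balanced separator of fewer than \<open>\<theta>\<close> vertices,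
  \<open>balanced_bags\<close> would give a tree decomposition with bags of size at most
  \<open>3 * \<theta>\<close>.\<close>

lemma big_sides_exist:
  assumes g: "fin_graph (verts G) (\<lambda>u v. u \<rightarrow>\<^bsub>G\<^esub> v)" and \<theta>: "0 < \<theta>" "3 * \<theta> < treewidth G"
  shows "\<exists>X. big_sides (verts G) (\<lambda>u v. u \<rightarrow>\<^bsub>G\<^esub> v) X \<theta>"
proof (rule ccontr)
  assume none: "\<not> ?thesis"
  interpret fin_graph "verts G" "\<lambda>u v. u \<rightarrow>\<^bsub>G\<^esub> v" by (rule g)
  have bal: "\<exists>S\<subseteq>verts G. card S < \<theta> \<and> (\<forall>D. conn D \<longrightarrow> D \<subseteq> verts G - S \<longrightarrow> 2 * card (D \<inter> X) \<le> card X)"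
    if X: "X \<subseteq> verts G" for X
  proof (rule ccontr)
    assume no: "\<not> ?thesis"
    have "big_sides (verts G) (\<lambda>u v. u \<rightarrow>\<^bsub>G\<^esub> v) X \<theta>"
    proof
      show "finite X" using X finite_V finite_subset by blast
      show "\<exists>D. conn D \<and> D \<subseteq> verts G - S \<and> card X < 2 * card (D \<inter> X)" if "S \<subseteq> verts G" "card S < \<theta>" for S
        using no that by (meson not_le)
    qed
    then show False using none by blast
  qed
  have "\<exists>bs. bags_of (verts G) (3 * \<theta>) bs \<and> {} \<subseteq> last bs"
    by (rule balanced_bags[OF \<theta>(1) bal]) simp_all
  then obtain bs where bs: "bag_list bs" "\<Union>(set bs) = verts G" "\<forall>b\<in>set bs. card b \<le> 3 * \<theta>"
    "\<forall>u\<in>verts G. \<forall>v\<in>verts G. u \<rightarrow>\<^bsub>G\<^esub> v \<longrightarrow> (\<exists>b\<in>set bs. u \<in> b \<and> v \<in> b)"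
    unfolding bags_of_def by (elim exE conjE)
  have "treewidth G \<le> 3 * \<theta>"
  proof (rule treewidth_le[OF bs(1,2)])
    show "\<exists>b\<in>set bs. u \<in> b \<and> v \<in> b" if "u \<rightarrow>\<^bsub>G\<^esub> v" for u v
      using bs(4) that E_in_V[of u v] E_in_V[of v u] E_sym[of u v] by blast
  qed (use bs(3) in blast)
  then show False using \<theta>(2) by simp
qed

section \<open>Clean graphs\<close>

lemma (in graph) ends_induce: "arcs_ends (G \<restriction> X) = {(u, v). u \<rightarrow>\<^bsub>G\<^esub> v \<and> u \<in> X \<and> v \<in> X}"
  by (auto simp: induce_subgraph_def arcs_ends_conv)

lemma (in graph) graph_induce:
  assumes "X \<subseteq> verts G"
  shows "graph (G \<restriction> X)"
proof
  show "symmetric (G \<restriction> X)"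
    using arcs_ends_symmetric[OF sym_arcs] unfolding symmetric_def ends_induce sym_def by blast
  show "finite (verts (G \<restriction> X))" using finite_subset[OF assms finite_verts] by simp
  show "finite (arcs (G \<restriction> X))" using finite_arcs by (simp add: induce_subgraph_def)
  show "e1 = e2" if "e1 \<in> arcs (G \<restriction> X)" "e2 \<in> arcs (G \<restriction> X)" "arc_to_ends (G \<restriction> X) e1 = arc_to_ends (G \<restriction> X) e2" for e1 e2
    by (rule no_multi_arcs) (use that in \<open>auto simp: induce_subgraph_def arc_to_ends_def\<close>)
qed (use no_loops in \<open>auto simp: induce_subgraph_def\<close>)

sublocale graph \<subseteq> fin_graph "verts G" "\<lambda>u v. u \<rightarrow>\<^bsub>G\<^esub> v"
proof
  show "v \<rightarrow>\<^bsub>G\<^esub> u" if "u \<rightarrow>\<^bsub>G\<^esub> v" for u v using arcs_ends_symmetric[OF sym_arcs that] .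
  show "u \<in> verts G" if "u \<rightarrow>\<^bsub>G\<^esub> v" for u v using that by (auto simp: arcs_ends_conv)
  show "\<not> u \<rightarrow>\<^bsub>G\<^esub> u" for u using no_loops by (auto simp: arcs_ends_conv)
qed simp

context graph begin

lemma induced_induce_induce:
  assumes "X \<subseteq> U" "U \<subseteq> verts G"
  shows "induced_subgraph (G \<restriction> X) (G \<restriction> U)"
proof -
  interpret U: graph "G \<restriction> U" by (rule graph_induce[OF assms(2)])
  have "(G \<restriction> U) \<restriction> X = G \<restriction> X" using assms(1) by (auto simp: induce_subgraph_def)
  then show ?thesis using U.induced_induce[of X] assms(1) by simp
qed

lemma induce_all: "G \<restriction> verts G = G"
  by (intro pre_digraph.equality) (auto simp: induce_subgraph_def)

lemma vwalk_arcs_zip: "vwalk_arcs xs = zip xs (tl xs)"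
  by (induction xs rule: vwalk_arcs.induct) simp_all

lemma set_vwalk_arcs: "set (vwalk_arcs xs) = {(xs ! i, xs ! Suc i) | i. Suc i < length xs}"
  unfolding vwalk_arcs_zip set_zip by (rule Collect_cong) (auto simp: nth_tl less_diff_conv)

lemma path_in_induce:
  assumes "ip X" "X \<subseteq> U" "U \<subseteq> verts G"
  shows "path_in (G \<restriction> U) (G \<restriction> X)"
proof -
  obtain xs where xs: "ipath xs" "set xs = X" using assms(1) by (auto simp: ip_def)
  have "u \<rightarrow>\<^bsub>G\<^esub> v \<and> u \<in> X \<and> v \<in> X \<longleftrightarrow> (u, v) \<in> set (vwalk_arcs xs) \<union> (set (vwalk_arcs xs))\<inverse>" for u v
  proof
    assume "u \<rightarrow>\<^bsub>G\<^esub> v \<and> u \<in> X \<and> v \<in> X"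
    then obtain i j where "u = xs ! i" "v = xs ! j" "i < length xs" "j < length xs" "xs ! i \<rightarrow>\<^bsub>G\<^esub> xs ! j"
      unfolding xs(2)[symmetric] in_set_conv_nth by blast
    then show "(u, v) \<in> set (vwalk_arcs xs) \<union> (set (vwalk_arcs xs))\<inverse>"
      using ipathD(4)[OF xs(1)] unfolding set_vwalk_arcs by blast
  next
    assume "(u, v) \<in> set (vwalk_arcs xs) \<union> (set (vwalk_arcs xs))\<inverse>"
    then obtain i where "Suc i < length xs" "(u, v) = (xs ! i, xs ! Suc i) \<or> (v, u) = (xs ! i, xs ! Suc i)"
      unfolding set_vwalk_arcs by blast
    then show "u \<rightarrow>\<^bsub>G\<^esub> v \<and> u \<in> X \<and> v \<in> X"
      using ipathD(4)[OF xs(1), of i "Suc i"] E_sym xs(2) nth_mem[of i xs] nth_mem[of "Suc i" xs] by auto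
  qed
  then have "arcs_ends (G \<restriction> X) = set (vwalk_arcs xs) \<union> (set (vwalk_arcs xs))\<inverse>" unfolding ends_induce by auto
  moreover from this have "vpath xs (G \<restriction> X)"
    using xs ipathD(1,2)[OF xs(1)] by (simp add: vpath_def vwalk_def)
  ultimately have "is_path (G \<restriction> X)"
    unfolding is_path_def using xs(2) graph_induce[of X] assms by auto
  then show ?thesis using induced_induce_induce assms by (simp add: path_in_def)
qed

lemma polypath_induce:
  assumes I: "finite I" "card I = w" "\<And>i. i \<in> I ==> ip (P i)" "\<And>i. i \<in> I ==> P i \<subseteq> U" "U \<subseteq> verts G"
    and disj: "\<And>i j. i \<in> I ==> j \<in> I ==> i \<noteq> j ==> P i \<inter> P j = {}"
  shows "inj_on (\<lambda>i. G \<restriction> P i) I" "polypath w (G \<restriction> U) ((\<lambda>i. G \<restriction> P i) ` I)"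
proof -
  show inj: "inj_on (\<lambda>i. G \<restriction> P i) I"
  proof (rule inj_onI, rule ccontr)
    fix i j assume ij: "i \<in> I" "j \<in> I" "G \<restriction> P i = G \<restriction> P j" "i \<noteq> j"
    then have "P i = P j" by (metis induce_subgraph_verts)
    then show False using disj[OF ij(1,2,4)] conn_nonempty[OF ip_conn[OF I(3)[OF ij(1)]]] by simp
  qed
  show "polypath w (G \<restriction> U) ((\<lambda>i. G \<restriction> P i) ` I)"
    unfolding polypath_def
  proof (intro conjI ballI)
    show "card ((\<lambda>i. G \<restriction> P i) ` I) = w" using inj I(2) by (simp add: card_image)
    show "pairwise (\<lambda>W W'. verts W \<inter> verts W' = {}) ((\<lambda>i. G \<restriction> P i) ` I)"
    proof (rule pairwise_imageI)
      show "verts (G \<restriction> P i) \<inter> verts (G \<restriction> P j) = {}" if "i \<in> I" "j \<in> I" "i \<noteq> j" for i j using disj[OF that] by simp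
    qed
    fix W assume "W \<in> (\<lambda>i. G \<restriction> P i) ` I"
    then obtain i where "i \<in> I" "W = G \<restriction> P i" by blast
    then show "path_in (G \<restriction> U) W" using path_in_induce[OF I(3) I(4) I(5)] by simp
  qed (use I in simp)
qed

text \<open>Arcs of \<open>G\<close> are abstract objects, so an isomorphism has to choose one for
  every pair in \<open>W\<close>. The absence of parallel arcs ensures that the chosen arcs are all
  arcs of the induced subgraph.\<close>

lemma induces_iso:
  assumes W: "wf_digraph (with_proj W)" and ind: "induces W"
  shows "\<exists>X\<subseteq>verts G. digraph_iso (with_proj W) (G \<restriction> X)"
proof -
  obtain f where f: "inj_on f (pverts W)" "f ` pverts W \<subseteq> verts G"
    "\<And>x y. x \<in> pverts W ==> y \<in> pverts W ==> f x \<rightarrow>\<^bsub>G\<^esub> f y \<longleftrightarrow> (x, y) \<in> parcs W"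
    using ind unfolding induces_def by blast
  have wf: "fst a \<in> pverts W \<and> snd a \<in> pverts W" if "a \<in> parcs W" for a
    using wf_digraph.wellformed[OF W] that by simp
  define h where "h a = (SOME e. e \<in> arcs G \<and> tail G e = f (fst a) \<and> head G e = f (snd a))" for a
  have h: "h a \<in> arcs G \<and> tail G (h a) = f (fst a) \<and> head G (h a) = f (snd a)" if "a \<in> parcs W" for a
  proof -
    have "f (fst a) \<rightarrow>\<^bsub>G\<^esub> f (snd a)" using f(3)[of "fst a" "snd a"] wf[OF that] that by simp
    then have "\<exists>e. e \<in> arcs G \<and> tail G e = f (fst a) \<and> head G e = f (snd a)" by (auto simp: arcs_ends_conv)
    then show ?thesis unfolding h_def by (rule someI_ex)
  qed
  define hom where "hom = \<lparr>iso_verts = f, iso_arcs = h, iso_head = head G, iso_tail = tail G\<rparr>"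
  have "inj_on h (parcs W)"
  proof (rule inj_onI)
    fix a b assume ab: "a \<in> parcs W" "b \<in> parcs W" "h a = h b"
    then have "f (fst a) = f (fst b)" "f (snd a) = f (snd b)" using h[OF ab(1)] h[OF ab(2)] by simp_all
    then show "a = b" using inj_onD[OF f(1)] wf[OF ab(1)] wf[OF ab(2)] by (metis prod_eqI)
  qed
  then have "pre_digraph.digraph_isomorphism (with_proj W) hom"
    using W f(1) h by (simp add: pre_digraph.digraph_isomorphism_def hom_def)
  moreover have "arcs (G \<restriction> (f ` pverts W)) = h ` parcs W"
  proof (intro equalityI subsetI)
    fix e assume "e \<in> arcs (G \<restriction> (f ` pverts W))"
    then obtain x y where e: "e \<in> arcs G" "x \<in> pverts W" "tail G e = f x" "y \<in> pverts W" "head G e = f y"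
      by (auto simp: induce_subgraph_def)
    then have "f x \<rightarrow>\<^bsub>G\<^esub> f y" by (auto simp: arcs_ends_conv intro!: image_eqI[of _ _ e])
    then have a: "(x, y) \<in> parcs W" using f(3) e by blast
    have "e = h (x, y)" by (rule no_multi_arcs) (use h[OF a] e in \<open>auto simp: arc_to_ends_def\<close>)
    then show "e \<in> h ` parcs W" using a by blast
  next
    fix e assume "e \<in> h ` parcs W"
    then obtain a where "a \<in> parcs W" "e = h a" by blast
    then show "e \<in> arcs (G \<restriction> (f ` pverts W))" using h[of a] wf[of a] by (simp add: induce_subgraph_def)
  qed
  then have "G \<restriction> (f ` pverts W) = app_iso hom (with_proj W)"
    by (intro pre_digraph.equality) (simp_all add: hom_def app_iso_def induce_subgraph_def)
  ultimately show ?thesis using f(2) unfolding digraph_iso_def by blast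
qed

lemma clean_no_obstruction: "clean t G ==> X \<subseteq> verts G ==> \<not> basic_obstruction t (G \<restriction> X)"
  unfolding clean_def using induced_induce by blast

lemma clean_not_wall_like:
  assumes "clean t G"
  shows "\<not> wall_like t"
proof
  assume "wall_like t"
  then obtain W where W: "subdivision_pair (wall t) W" "induces W \<or> induces (line_graph W)" unfolding wall_like_def by blast
  interpret W: pair_bidirected_digraph W by (rule bidirected_digraphI_subdivision[OF W(1)])
  have 1: "wf_digraph (with_proj W)" by unfold_locales
  have 2: "wf_digraph (with_proj (line_graph W))"
    by unfold_locales (auto simp: line_graph_def Let_def)
  have "\<exists>X\<subseteq>verts G. basic_obstruction t (G \<restriction> X)"
    using W(2) induces_iso[OF 1] induces_iso[OF 2] W(1) unfolding basic_obstruction_def by blast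
  then show False using clean_no_obstruction[OF assms] by blast
qed

text \<open>For \<open>t = 0\<close> the null graph is a K_{0,0} and hence an obstruction in every
  graph.\<close>

lemma clean_pos:
  assumes "clean t G"
  shows "0 < t"
proof (rule ccontr)
  assume "\<not> 0 < t"
  then have "K\<^bsub>t,t\<^esub> (G \<restriction> {})"
    using graph_induce[of "{}"] unfolding complete_bipartite_digraph_def ends_induce by (auto intro!: exI[of _ "{}"])
  then show False using clean_no_obstruction[OF assms, of "{}"] by (simp add: basic_obstruction_def)
qed

end

lemma choose_le_power: "(m + i) choose i \<le> Suc m ^ i"
proof (induction i)
  case (Suc i)
  have "Suc i * ((m + Suc i) choose Suc i) = Suc (m + i) * ((m + i) choose i)"
    using Suc_times_binomial[of i "m + i"] by simp
  also have "\<dots> \<le> (Suc i * Suc m) * Suc m ^ i" using Suc by (intro mult_le_mono) simp_all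
  finally have "Suc i * ((m + Suc i) choose Suc i) \<le> Suc i * Suc m ^ Suc i" by (simp only: power_Suc mult.assoc)
  then show ?case by (simp only: Suc_mult_le_cancel1)
qed simp

context graph begin

text \<open>Cliques on \<open>t + 1\<close> vertices are excluded, and with \<open>t = Suc m\<close>
  the Ramsey bound is \<open>(t + m) choose t \<le> t ^ t\<close>. So each side contains a stable
  set of size \<open>t\<close>, and two such sets induce a K_{t,t}.\<close>

lemma clean_no_biclique:
  assumes cl: "clean t G" and XY: "X \<subseteq> verts G" "Y \<subseteq> verts G" "X \<inter> Y = {}" "t ^ t \<le> card X" "t ^ t \<le> card Y"
    and adj: "\<And>x y. x \<in> X ==> y \<in> Y ==> x \<rightarrow>\<^bsub>G\<^esub> y"
  shows False
proof -
  obtain m where m: "t = Suc m" using clean_pos[OF cl] by (cases t) auto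
  have "(t + m) choose t \<le> t ^ t" using choose_le_power[of m t] by (simp add: m add.commute)
  have stable: "\<exists>J\<subseteq>Z. card J = t \<and> pairwise (\<lambda>x y. \<not> x \<rightarrow>\<^bsub>G\<^esub> y) J" if Z: "Z \<subseteq> verts G" "t ^ t \<le> card Z" for Z
  proof (rule ccontr)
    assume no: "\<not> ?thesis"
    have "finite Z" using Z(1) finite_verts finite_subset by blast
    have "(\<exists>J\<subseteq>Z. card J = Suc t \<and> pairwise (\<lambda>x y. x \<rightarrow>\<^bsub>G\<^esub> y) J) \<or>
        (\<exists>J\<subseteq>Z. card J = Suc m \<and> pairwise (\<lambda>x y. \<not> x \<rightarrow>\<^bsub>G\<^esub> y) J)"
      by (rule ramsey_binomial[OF \<open>finite Z\<close> le_trans[OF \<open>(t + m) choose t \<le> t ^ t\<close> Z(2)]]) (rule E_sym)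
    then have "\<exists>J\<subseteq>Z. card J = Suc t \<and> pairwise (\<lambda>x y. x \<rightarrow>\<^bsub>G\<^esub> y) J" using no unfolding m[symmetric] by (elim disjE) simp_all
    then obtain J where J: "J \<subseteq> Z" "card J = Suc t" "pairwise (\<lambda>x y. x \<rightarrow>\<^bsub>G\<^esub> y) J" by (elim exE conjE)
    have "arcs_ends (G \<restriction> J) = {(u, v). (u, v) \<in> J \<times> J \<and> u \<noteq> v}"
      using J(3) E_irrefl unfolding ends_induce pairwise_def by blast
    then have "K\<^bsub>t + 1\<^esub> (G \<restriction> J)" using graph_induce[of J] J Z(1) by (simp add: complete_digraph_def)
    then show False using clean_no_obstruction[OF cl, of J] J(1) Z(1) by (auto simp: basic_obstruction_def)
  qed
  obtain X' Y' where X': "X' \<subseteq> X" "card X' = t" "pairwise (\<lambda>x y. \<not> x \<rightarrow>\<^bsub>G\<^esub> y) X'"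
    and Y': "Y' \<subseteq> Y" "card Y' = t" "pairwise (\<lambda>x y. \<not> x \<rightarrow>\<^bsub>G\<^esub> y) Y'"
    using stable[OF XY(1,4)] stable[OF XY(2,5)] by blast
  have "arcs_ends (G \<restriction> (X' \<union> Y')) = X' \<times> Y' \<union> Y' \<times> X'"
  proof (intro equalityI subrelI)
    fix u v assume "(u, v) \<in> arcs_ends (G \<restriction> (X' \<union> Y'))"
    then have uv: "u \<rightarrow>\<^bsub>G\<^esub> v" "u \<in> X' \<union> Y'" "v \<in> X' \<union> Y'" unfolding ends_induce by blast+
    then have "u \<noteq> v" using E_irrefl by blast
    then have "\<not> (u \<in> X' \<and> v \<in> X')" "\<not> (u \<in> Y' \<and> v \<in> Y')" using pairwiseD[OF X'(3)] pairwiseD[OF Y'(3)] uv(1) by blast+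
    then show "(u, v) \<in> X' \<times> Y' \<union> Y' \<times> X'" using uv by blast
  next
    fix u v assume "(u, v) \<in> X' \<times> Y' \<union> Y' \<times> X'"
    then show "(u, v) \<in> arcs_ends (G \<restriction> (X' \<union> Y'))" using adj E_sym X'(1) Y'(1) unfolding ends_induce by blast
  qed
  moreover have "X' \<inter> Y' = {}" "X' \<union> Y' \<subseteq> verts G" using X'(1) Y'(1) XY by blast+
  ultimately have "K\<^bsub>t,t\<^esub> (G \<restriction> (X' \<union> Y'))"
    using graph_induce[of "X' \<union> Y'"] X'(2) Y'(2) unfolding complete_bipartite_digraph_def induce_subgraph_verts by blast
  then show False using clean_no_obstruction[OF cl \<open>X' \<union> Y' \<subseteq> verts G\<close>] by (simp add: basic_obstruction_def)
qed

text \<open>The origin of the looseness constant. Fewer than \<open>l\<close> of the paths have no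
  vertex with \<open>t ^ t\<close> neighbours in \<open>S\<close>, as they would form a meager
  cluster. Of the more than \<open>t ^ t * s ^ (t ^ t)\<close> others, \<open>t ^ t\<close> have
  vertices adjacent to the same \<open>t ^ t\<close> elements of \<open>S\<close>, which is a
  biclique.\<close>

lemma no_cluster:
  fixes I :: "'i set"
  assumes cl: "clean t G" and a: "\<not> (\<exists>S \<L>. cluster s l G S \<L> \<and> meager (t ^ t) G S \<L>)"
    and S: "S \<subseteq> verts G" "card S = s" and I: "finite I" "card I = l + t ^ t * s ^ (t ^ t)" "\<And>i. i \<in> I ==> ip (P i)"
    and disj: "\<And>i j. i \<in> I ==> j \<in> I ==> i \<noteq> j ==> P i \<inter> P j = {}" "\<And>i. i \<in> I ==> P i \<inter> S = {}"
    and adj: "\<And>x i. x \<in> S ==> i \<in> I ==> \<exists>u\<in>P i. x \<rightarrow>\<^bsub>G\<^esub> u"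
  shows False
proof -
  define q where "q = t ^ t"
  define bad where "bad = {i \<in> I. \<exists>v\<in>P i. q \<le> card {x \<in> S. v \<rightarrow>\<^bsub>G\<^esub> x}}"
  have finS: "finite S" using S(1) finite_verts finite_subset by blast
  have PV: "P i \<subseteq> verts G" if "i \<in> I" for i by (rule ip_subset[OF I(3)[OF that]])
  have "\<not> l \<le> card (I - bad)"
  proof
    assume "l \<le> card (I - bad)"
    then obtain L where L: "L \<subseteq> I - bad" "card L = l" by (meson obtain_subset_with_card_n)
    have LI: "i \<in> I" if "i \<in> L" for i using L(1) that by blast
    let ?L = "(\<lambda>i. G \<restriction> P i) ` L"
    have "polypath l (G \<restriction> (verts G - S)) ?L"
    proof (rule polypath_induce(2))
      show "finite L" using L(1) I(1) finite_subset by blast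
      show "P i \<subseteq> verts G - S" if "i \<in> L" for i using PV[OF LI[OF that]] disj(2)[OF LI[OF that]] by blast
    qed (use L(2) I(3) disj(1) LI in auto)
    moreover have "\<exists>u\<in>verts W. x \<rightarrow>\<^bsub>G\<^esub> u" if xW: "x \<in> S" "W \<in> ?L" for x W
    proof -
      obtain i where "i \<in> L" "W = G \<restriction> P i" using xW(2) by blast
      then show ?thesis using adj[OF xW(1) LI] by simp
    qed
    ultimately have "cluster s l G S ?L" using S unfolding cluster_def by blast
    moreover have "meager q G S ?L"
      unfolding meager_def
    proof
      fix v assume "v \<in> (\<Union>W\<in>?L. verts W)"
      then obtain i where "i \<in> L" "v \<in> P i" by auto
      then have "i \<in> I" "i \<notin> bad" "v \<in> P i" using L(1) by blast+
      then have "\<not> q \<le> card {x \<in> S. v \<rightarrow>\<^bsub>G\<^esub> x}" unfolding bad_def by blast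
      then show "card {x \<in> S. v \<rightarrow>\<^bsub>G\<^esub> x} < q" by simp
    qed
    ultimately show False using a unfolding q_def by blast
  qed
  moreover have "card (I - bad) = card I - card bad" "card bad \<le> card I"
    using I(1) by (auto simp: bad_def intro!: card_Diff_subset card_mono)
  ultimately have cbad: "q * s ^ q < card bad" using I(2) unfolding q_def by linarith
  define F where "F = {T. T \<subseteq> S \<and> card T = q}"
  have "\<exists>T v. T \<in> F \<and> v \<in> P i \<and> (\<forall>x\<in>T. v \<rightarrow>\<^bsub>G\<^esub> x)" if i: "i \<in> bad" for i
  proof -
    obtain v where v: "v \<in> P i" "q \<le> card {x \<in> S. v \<rightarrow>\<^bsub>G\<^esub> x}" using i by (auto simp: bad_def)
    obtain T where "T \<subseteq> {x \<in> S. v \<rightarrow>\<^bsub>G\<^esub> x}" "card T = q" using obtain_subset_with_card_n[OF v(2)] by metis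
    then have "T \<in> F" "\<forall>x\<in>T. v \<rightarrow>\<^bsub>G\<^esub> x" unfolding F_def by blast+
    then show ?thesis using v(1) by blast
  qed
  then obtain T v where Tv: "\<And>i. i \<in> bad ==> T i \<in> F \<and> v i \<in> P i \<and> (\<forall>x\<in>T i. v i \<rightarrow>\<^bsub>G\<^esub> x)" by metis
  have "card F \<le> s ^ q"
    using n_subsets[OF finS, of q] S(2) binomial_le_pow[of q s] binomial_eq_0[of s q] by (cases "q \<le> s") (simp_all add: F_def)
  then have "q * card F \<le> q * s ^ q" by (rule mult_le_mono2)
  then have c: "q * card F \<le> card bad" using cbad by linarith
  have fin: "finite bad" "finite F" using I(1) finS by (simp_all add: bad_def F_def)
  have "bad \<noteq> {}" using cbad by auto
  then have "F \<noteq> {}" using Tv by blast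
  then obtain T0 J where J: "T0 \<in> F" "J \<subseteq> bad" "card J = q" "\<And>i. i \<in> J ==> T i = T0"
    by (rule pigeonhole_fiber_subset[OF fin _ _ c, of T]) (use Tv in auto)
  have JI: "i \<in> I" if "i \<in> J" for i using J(2) that by (auto simp: bad_def)
  have vJ: "v i \<in> P i" "\<And>x. x \<in> T0 ==> v i \<rightarrow>\<^bsub>G\<^esub> x" if "i \<in> J" for i using Tv[of i] J(2) J(4)[OF that] that by auto
  have "inj_on v J"
  proof (rule inj_onI, rule ccontr)
    fix i j assume ij: "i \<in> J" "j \<in> J" "v i = v j" "i \<noteq> j"
    then show False using disj(1)[OF JI JI ij(4)] vJ(1)[OF ij(1)] vJ(1)[OF ij(2)] by auto
  qed
  then have cv: "card (v ` J) = q" using J(3) by (simp add: card_image)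
  have T0: "T0 \<subseteq> S" "card T0 = q" using J(1) by (simp_all add: F_def)
  show False
  proof (rule clean_no_biclique[OF cl, of "v ` J" T0])
    show "v ` J \<subseteq> verts G" using vJ(1) PV JI by blast
    show "T0 \<subseteq> verts G" using T0(1) S(1) by blast
    show "v ` J \<inter> T0 = {}" using disj(2) JI vJ(1) T0(1) by blast
    show "x \<rightarrow>\<^bsub>G\<^esub> y" if "x \<in> v ` J" "y \<in> T0" for x y using vJ(2) that by blast
  qed (use cv T0(2) q_def in auto)
qed

end

definition cluster_or_polypath :: "nat => nat => nat => nat => ('a, 'b) pre_digraph => bool" where
  "cluster_or_polypath l s t w G \<longleftrightarrow> (\<exists>S \<L>. cluster s l G S \<L> \<and> meager (t ^ t) G S \<L>) \<or>
     (\<exists>\<W>. polypath (2 * w) G \<W> \<and> fancy w G \<W> \<and> loose (l + t ^ t * s ^ (t ^ t)) G \<W>)"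

text \<open>Each selected index keeps one of its two paths, which side being decided only after the
  selection. So conflicts are counted for all choices: for a \<open>d\<close>-set of indices and one
  of its \<open>2 ^ d\<close> choices of paths, \<open>no_cluster\<close> bounds by \<open>s\<close>
  the further indices with a vertex attached to all chosen paths. A free set has no conflicts; half
  of its indices keep the paths \<open>A\<close>, the others the paths \<open>B\<close>, which makes
  the family fancy.\<close>

lemma path_model_cluster_or_polypath:
  "\<exists>N. \<forall>G :: ('a, 'b) pre_digraph. graph G \<and> clean t G \<and> fin_graph.PM (verts G) (\<lambda>u v. u \<rightarrow>\<^bsub>G\<^esub> v) N \<longrightarrow>
     cluster_or_polypath l s t w G"
proof -
  define d where "d = l + t ^ t * s ^ (t ^ t)"
  from free_subset[of d "2 ^ d * s" "2 * w", where 'b = nat]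
  obtain N where N: "\<forall>(I :: nat set) f. finite I \<and> N \<le> card I \<and>
     (\<forall>D\<subseteq>I. card D = d \<longrightarrow> finite (f D) \<and> card (f D) \<le> 2 ^ d * s) \<longrightarrow>
     (\<exists>J\<subseteq>I. card J = 2 * w \<and> (\<forall>D\<subseteq>J. card D = d \<longrightarrow> f D \<inter> J \<subseteq> D))" by (elim exE)
  show ?thesis
  proof (rule exI[of _ N], intro allI impI, elim conjE, unfold cluster_or_polypath_def, subst disj_commute, rule disjCI)
    fix G :: "('a, 'b) pre_digraph"
    assume g: "graph G" and cl: "clean t G" and pm: "fin_graph.PM (verts G) (\<lambda>u v. u \<rightarrow>\<^bsub>G\<^esub> v) N"
      and a: "\<not> (\<exists>S \<L>. cluster s l G S \<L> \<and> meager (t ^ t) G S \<L>)"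
    interpret graph G by (rule g)
    obtain A B where AB: "\<forall>i<N. ip (A i) \<and> ip (B i)" "\<forall>i<N. \<forall>j<N. i \<noteq> j \<longrightarrow> A i \<inter> A j = {} \<and> B i \<inter> B j = {}"
      "\<forall>i<N. \<forall>j<N. A i \<inter> B j = {} \<and> touch (A i) (B j)" using pm unfolding PM_def by (elim exE conjE)
    define P where "P i b = (if b then A i else B i)" for i and b :: bool
    have P_ip: "ip (P i b)" if "i < N" for i b using AB(1) that by (simp add: P_def)
    have P_disj: "P i b \<inter> P j c = {}" if "i < N" "j < N" "i \<noteq> j" for i j b c
      using AB(2,3) that by (simp add: P_def Int_commute)
    define R where "R D c = {i \<in> {..<N} - D. \<exists>b. \<exists>v\<in>P i b. \<forall>k\<in>D. \<exists>u\<in>P k (c k). v \<rightarrow>\<^bsub>G\<^esub> u}" for D c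
    \<comment> \<open>The subset \<open>D'\<close> encodes a choice: its members contribute their
      paths \<open>A\<close>, the rest of \<open>D\<close> the paths \<open>B\<close>.\<close>
    define f where "f D = (\<Union>D'\<in>Pow D. R D (\<lambda>k. k \<in> D'))" for D
    have few: "card (R D c) \<le> s" if D: "D \<subseteq> {..<N}" "card D = d" for D c
    proof (rule ccontr)
      assume "\<not> ?thesis"
      then have "s \<le> card (R D c)" by simp
      then obtain I where I: "I \<subseteq> R D c" "card I = s" by (meson obtain_subset_with_card_n)
      have "\<exists>v b. v \<in> P i b \<and> (\<forall>k\<in>D. \<exists>u\<in>P k (c k). v \<rightarrow>\<^bsub>G\<^esub> u)" if "i \<in> I" for i using I(1) that unfolding R_def by blast
      then obtain v b where v: "\<And>i. i \<in> I ==> v i \<in> P i (b i) \<and> (\<forall>k\<in>D. \<exists>u\<in>P k (c k). v i \<rightarrow>\<^bsub>G\<^esub> u)" by metis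
      have IN: "i < N" "i \<notin> D" if "i \<in> I" for i using I(1) that unfolding R_def by blast+
      have "inj_on v I"
      proof (rule inj_onI, rule ccontr)
        fix i j assume ij: "i \<in> I" "j \<in> I" "v i = v j" "i \<noteq> j"
        then show False using P_disj[of i j "b i" "b j"] IN(1) v[OF ij(1)] v[OF ij(2)] by auto
      qed
      then have cS: "card (v ` I) = s" using I(2) by (simp add: card_image)
      show False
      proof (rule no_cluster[OF cl a, of "v ` I" D "\<lambda>k. P k (c k)"])
        show "v ` I \<subseteq> verts G" using v IN(1) ip_subset[OF P_ip] by blast
        show "finite D" using D(1) finite_subset by blast
        show "ip (P k (c k))" if "k \<in> D" for k using P_ip D(1) that by blast
        show "P k (c k) \<inter> P k' (c k') = {}" if "k \<in> D" "k' \<in> D" "k \<noteq> k'" for k k' by (rule P_disj) (use D(1) that in auto)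
        show "P k (c k) \<inter> v ` I = {}" if k: "k \<in> D" for k
        proof (rule ccontr)
          assume "P k (c k) \<inter> v ` I \<noteq> {}"
          then obtain i where i: "i \<in> I" "v i \<in> P k (c k)" by blast
          have "P i (b i) \<inter> P k (c k) = {}" by (rule P_disj) (use IN[OF i(1)] k D(1) in auto)
          then show False using v[OF i(1)] i(2) by blast
        qed
      qed (use cS D(2) v d_def in auto)
    qed
    have "finite (f D) \<and> card (f D) \<le> 2 ^ d * s" if D: "D \<subseteq> {..<N}" "card D = d" for D
    proof
      have finD: "finite D" using D(1) finite_subset by blast
      then show "finite (f D)" by (simp add: f_def R_def)
      have "card (f D) \<le> (\<Sum>D'\<in>Pow D. card (R D (\<lambda>k. k \<in> D')))" unfolding f_def using finD by (intro card_UN_le) simp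
      also have "\<dots> \<le> (\<Sum>D'\<in>Pow D. s)" by (rule sum_mono) (rule few[OF D])
      finally show "card (f D) \<le> 2 ^ d * s" using finD D(2) by (simp add: card_Pow)
    qed
    then obtain J where J: "J \<subseteq> {..<N}" "card J = 2 * w" "\<forall>D\<subseteq>J. card D = d \<longrightarrow> f D \<inter> J \<subseteq> D"
      using N[rule_format, of "{..<N}" f] by auto
    have finJ: "finite J" using J(1) finite_subset by blast
    have "w \<le> card J" using J(2) by simp
    then obtain J1 where J1: "J1 \<subseteq> J" "card J1 = w" by (meson obtain_subset_with_card_n)
    have cJ2: "card (J - J1) = w" using J(2) J1 finJ by (simp add: card_Diff_subset finite_subset)
    define X where "X i = P i (i \<in> J1)" for i
    have JN: "i < N" if "i \<in> J" for i using J(1) that by blast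
    have X_disj: "X i \<inter> X j = {}" if "i \<in> J" "j \<in> J" "i \<noteq> j" for i j unfolding X_def by (rule P_disj[OF JN JN]) (use that in auto)
    let ?W = "(\<lambda>i. G \<restriction> X i) ` J"
    have X_ip: "ip (X i)" if "i \<in> J" for i unfolding X_def by (rule P_ip[OF JN[OF that]])
    note poly = polypath_induce[OF finJ J(2) X_ip ip_subset[OF X_ip] subset_refl X_disj]
    have p: "polypath (2 * w) G ?W" using poly(2) by (simp add: induce_all)
    have "fancy w G ?W"
      unfolding fancy_def
    proof (intro exI[of _ "(\<lambda>i. G \<restriction> X i) ` J1"] conjI ballI)
      show "(\<lambda>i. G \<restriction> X i) ` J1 \<subseteq> ?W" using J1(1) by blast
      show "card ((\<lambda>i. G \<restriction> X i) ` J1) = w" using card_image[OF inj_on_subset[OF poly(1) J1(1)]] J1(2) by simp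
      fix W' W assume "W' \<in> (\<lambda>i. G \<restriction> X i) ` J1" "W \<in> ?W - (\<lambda>i. G \<restriction> X i) ` J1"
      then obtain i j where ij: "i \<in> J1" "W' = G \<restriction> X i" "j \<in> J" "j \<notin> J1" "W = G \<restriction> X j" by blast
      have iJ: "i \<in> J" using ij(1) J1(1) by blast
      have "X i = A i" "X j = B j" using ij by (simp_all add: X_def P_def)
      then have t: "touch (X i) (X j)" "X i \<inter> X j = {}" using AB(3) JN[OF iJ] JN[OF ij(3)] by simp_all
      then obtain u v where uv: "u \<in> X i" "v \<in> X j" "u = v \<or> u \<rightarrow>\<^bsub>G\<^esub> v" unfolding touch_def by blast
      then have "u \<noteq> v" using t(2) by blast
      then show "\<exists>u\<in>verts W'. \<exists>v\<in>verts W. u \<rightarrow>\<^bsub>G\<^esub> v" using uv ij(2,5) by auto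
    qed
    moreover have "loose d G ?W"
      unfolding loose_def
    proof (intro ballI)
      fix W v assume W: "W \<in> ?W" and v: "v \<in> verts W"
      obtain i where i: "i \<in> J" "W = G \<restriction> X i" using W by blast
      define C where "C = {j \<in> J - {i}. \<exists>u\<in>X j. v \<rightarrow>\<^bsub>G\<^esub> u}"
      have finC: "finite C" using finJ by (simp add: C_def)
      have "{W' \<in> ?W - {W}. \<exists>u\<in>verts W'. v \<rightarrow>\<^bsub>G\<^esub> u} \<subseteq> (\<lambda>j. G \<restriction> X j) ` C"
      proof
        fix W' assume W': "W' \<in> {W' \<in> ?W - {W}. \<exists>u\<in>verts W'. v \<rightarrow>\<^bsub>G\<^esub> u}"
        then obtain j where j: "j \<in> J" "W' = G \<restriction> X j" by blast
        then have "j \<in> C" using W' i(2) by (auto simp: C_def)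
        then show "W' \<in> (\<lambda>j. G \<restriction> X j) ` C" using j(2) by blast
      qed
      then have le: "card {W' \<in> ?W - {W}. \<exists>u\<in>verts W'. v \<rightarrow>\<^bsub>G\<^esub> u} \<le> card C"
        using card_mono[OF finite_imageI[OF finC]] card_image_le[OF finC] le_trans by blast
      have "card C < d"
      proof (rule ccontr)
        assume "\<not> card C < d"
        then have "d \<le> card C" by simp
        then obtain D where D: "D \<subseteq> C" "card D = d" by (meson obtain_subset_with_card_n)
        have DJ: "D \<subseteq> J" "i \<notin> D" using D(1) by (auto simp: C_def)
        have "\<exists>u\<in>P k (k \<in> D \<inter> J1). v \<rightarrow>\<^bsub>G\<^esub> u" if "k \<in> D" for k
          using D(1) that unfolding C_def X_def by auto
        moreover have "v \<in> P i (i \<in> J1)" using v i(2) by (simp add: X_def)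
        ultimately have "i \<in> R D (\<lambda>k. k \<in> D \<inter> J1)" using JN[OF i(1)] DJ(2) unfolding R_def by blast
        then have "i \<in> f D" unfolding f_def by (intro UN_I[of "D \<inter> J1"]) auto
        then show False using J(3) DJ D(2) i(1) by blast
      qed
      then show "card {W' \<in> ?W - {W}. \<exists>u\<in>verts W'. v \<rightarrow>\<^bsub>G\<^esub> u} < d" using le by simp
    qed
    ultimately show "\<exists>\<W>. polypath (2 * w) G \<W> \<and> fancy w G \<W> \<and> loose (l + t ^ t * s ^ (t ^ t)) G \<W>"
      using p unfolding d_def by blast
  qed
qed

text \<open>Grids of hubs give ladders with \<open>Suc K\<close> rows, whereas walls are obtained
  from \<open>K\<close> rows.\<close>

lemma ladder_fewer_rows:
  assumes "ladder V E (Suc K) D \<rho> Q"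
  shows "ladder V E K D \<rho> Q"
proof -
  interpret ladder V E "Suc K" D \<rho> Q by fact
  have "Suc p < p'" if "j < j'" "j' < D" "r < K" "p < length (\<rho> r)" "p' < length (\<rho> r)"
    "touch (Q j) {\<rho> r ! p}" "touch (Q j') {\<rho> r ! p'}" for j j' r p p'
    by (rule Q_ordered[of j j' r]) (use that in simp_all)
  then show ?thesis
    by unfold_locales (simp_all add: rows rows_anti Q_conn Q_anti Q_touch)
qed

theorem theorem5p1:
  shows "\<forall>(c::nat) (l::nat) (s::nat) (t::nat) (w::nat). \<exists>\<gamma>::nat. \<forall>G :: ('a,'b) pre_digraph.
    graph G \<and> clean t G \<and> treewidth G > \<gamma> \<longrightarrow>
      (\<exists>S \<L>. cluster s l G S \<L> \<and> meager (t ^ t) G S \<L>) \<or>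
      (\<exists>\<W>. polypath (2 * w) G \<W> \<and> fancy w G \<W> \<and> loose (l + t ^ t * s ^ (t ^ t)) G \<W>)"
proof (intro allI)
  fix c l s t w :: nat
  from path_model_cluster_or_polypath[of t l s w] obtain n where
    n: "\<forall>G :: ('a, 'b) pre_digraph. graph G \<and> clean t G \<and> fin_graph.PM (verts G) (\<lambda>u v. u \<rightarrow>\<^bsub>G\<^esub> v) n \<longrightarrow>
      cluster_or_polypath l s t w G" by (elim exE)
  from ladder_wall_like[of n t] obtain K D where
    KD: "\<forall>(V :: 'a set) E \<rho> Q. ladder V E K D \<rho> Q \<and> \<not> fin_graph.PM V E n \<longrightarrow> fin_graph.wall_like V E t" by (elim exE)
  from hubs_ladder[of n K D] obtain M k where
    Mk: "\<forall>(V :: 'a set) E (I :: nat set) P. ladder_free V E n (Suc K) D \<and> finite I \<and> M \<le> card I \<and> (\<forall>i\<in>I. fin_graph.ip V E (P i)) \<and>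
     (\<forall>i\<in>I. \<forall>j\<in>I. i \<noteq> j \<longrightarrow> \<not> fin_graph.touch E (P i) (P j)) \<longrightarrow> \<not> fin_graph.attached V E k I P" by (elim exE)
  \<comment> \<open>The budget of \<open>hubs_exist\<close>, with \<open>Suc k\<close> in place of
    \<open>k\<close> to make it positive; the attachment obtained is stronger than the one needed.
    The threshold for the treewidth is \<open>3 * \<theta>\<close>, the size of the bags in
    \<open>balanced_bags\<close>.\<close>
  define \<theta> where "\<theta> = Suc ((2 * n + M) choose (2 * n)) * Suc k"
  have "cluster_or_polypath l s t w G" if g: "graph G" and cl: "clean t G" and tw: "treewidth G > 3 * \<theta>"
    for G :: "('a,'b) pre_digraph"
  proof -
    interpret graph G by (rule g)
    let ?E = "\<lambda>u v. u \<rightarrow>\<^bsub>G\<^esub> v"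
    have "PM n"
    proof (rule ccontr)
      assume nPM: "\<not> PM n"
      then have lf: "ladder_free (verts G) ?E n (Suc K) D"
        using KD clean_not_wall_like[OF cl] ladder_fewer_rows fin_graph_axioms unfolding ladder_free_def by metis
      obtain X where "big_sides (verts G) ?E X \<theta>"
        using big_sides_exist[OF fin_graph_axioms _ tw] by (auto simp: \<theta>_def)
      then interpret big_sides "verts G" ?E X \<theta> .
      obtain I :: "nat set" and P where I: "finite I" "M \<le> card I" "\<forall>i\<in>I. ip (P i)"
        "\<forall>i\<in>I. \<forall>j\<in>I. i \<noteq> j \<longrightarrow> \<not> touch (P i) (P j)" "attached (Suc k) I P"
        using hubs_exist[OF nPM, of M "Suc k"] by (auto simp: \<theta>_def)
      have "attached k I P" using I(5) unfolding attached_def by (meson Suc_leD)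
      then show False using Mk[rule_format, of "verts G" ?E I P] lf I(1-4) by blast
    qed
    then show ?thesis using n g cl by blast
  qed
  then show "\<exists>\<gamma>. \<forall>G :: ('a,'b) pre_digraph. graph G \<and> clean t G \<and> treewidth G > \<gamma> \<longrightarrow>
      (\<exists>S \<L>. cluster s l G S \<L> \<and> meager (t ^ t) G S \<L>) \<or>
      (\<exists>\<W>. polypath (2 * w) G \<W> \<and> fancy w G \<W> \<and> loose (l + t ^ t * s ^ (t ^ t)) G \<W>)"
    unfolding cluster_or_polypath_def by blast
qed

end
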